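(* Let $\pi:\mathbb{L}\to M$ be a bundle of Lie algebras with fiber $\mathfrak{k}$, where $\mathfrak{k}$ is perfect or centerfree. Then for every $x\in M$ every $x$-derivation of $\mathbb{L}$ is a differential operator of order at most $1$, and the triple $(\mathcal{D}(\mathbb{L}),\overline{p},M)$ admits a vector bundle structure such that $\operatorname{Der}(\Gamma(\mathbb{L}))$ is naturally identified with $\Gamma(\mathcal{D}(\mathbb{L}))$. In addition, there exists a short exact sequence of vector bundles over $M$ $$0\longrightarrow \operatorname{Der}(\mathbb{L})\overset{i}{\longrightarrow}\mathcal{D}(\mathbb{L})\overset{\sigma}{\longrightarrow}TM\otimes\operatorname{Cent}(\mathbb{L})\longrightarrow 0 .$$
   Context: All vector spaces and linear maps are over $\mathbb{K}\in\{\mathbb{R},\mathbb{C}\}$ (the tensor product with $TM$ is over $\mathbb{R}$). A manifold is smooth, finite-dimensional over $\mathbb{R}$, Hausdorff, paracompact and connected. A Lie algebra $\mathfrak{g}$ is perfect if $[\mathfrak{g},\mathfrak{g}]=\mathfrak{g}$, and centerfree if its center is $0$. $\operatorname{Der}(\mathfrak{g})$ is the Lie algebra of derivations of $\mathfrak{g}$, and the centroid is $\operatorname{Cent}(\mathfrak{g})=\{f\in\operatorname{End}(\mathfrak{g}): f[x,y]=[x,f(y)]\ \forall x,y\in\mathfrak{g}\}$. Let $\mathfrak{k}$ be a finite-dimensional Lie algebra over $\mathbb{K}$. A bundle of Lie algebras $\pi:\mathbb{L}\to M$ with fiber $\mathfrak{k}$ is a smooth vector bundle with fiber $\mathfrak{k}$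 over a manifold $M$ together with a bundle atlas whose transition maps take values in $\operatorname{Aut}(\mathfrak{k})$; each fiber $\mathbb{L}_x$ carries the Lie bracket for which bundle charts restrict to Lie algebra isomorphisms $\mathbb{L}_x\to\mathfrak{k}$. $\Gamma(\mathbb{L})$ is the Lie algebra of smooth sections with pointwise bracket. $\operatorname{Der}(\mathbb{L})$ and $\operatorname{Cent}(\mathbb{L})$ are the smooth subbundles of $\operatorname{Hom}(\mathbb{L},\mathbb{L})$ (fibers $\operatorname{End}(\mathbb{L}_x)$) with fibers $\operatorname{Der}(\mathbb{L}_x)$ and $\operatorname{Cent}(\mathbb{L}_x)$. For $x\in M$, an $x$-derivation of $\mathbb{L}$ is a linear map $\delta:\Gamma(\mathbb{L})\to\mathbb{L}_x$ with $\delta[X,Y]=[\delta(X),Y_x]+[X_x,\delta(Y)]$ for all $X,Y\in\Gamma(\mathbb{L})$. $\mathcal{D}_x(\mathbb{L})$ is the vector space of $x$-derivations, $\mathcal{D}(\mathbb{L})=\bigcup_{x\in M}\mathcal{D}_x(\mathbb{L})$ (disjoint union), and $\overline{p}:\mathcal{D}(\mathbb{L})\to M$ maps $\mathcal{D}_x(\mathbb{L})$ to $x$. The map $i:\operatorname{Der}(\mathbb{L})\to\mathcal{D}(\mathbb{L})$ sends $D\in\operatorname{Der}(\mathbb{L}_x)$ to the $x$-derivation $X\mapsto D(X_x)$. That an $x$-derivation is a differential operator of order at most $1$ means that in a bundle chart and a chart of $M$ around $x$ its value on $X$ is a linear expression in the value at $x$ and the first partial derivatives at $x$ of the local form of $X$.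 The natural identification of $\operatorname{Der}(\Gamma(\mathbb{L}))$ with $\Gamma(\mathcal{D}(\mathbb{L}))$ is the linear isomorphism sending $D$ to the section $x\mapsto \operatorname{ev}_x\circ D$, where $\operatorname{ev}_x(X)=X_x$. *)

theory Defs
  imports "HOL-Analysis.Analysis"
begin

section \<open>Scalars and model spaces\<close>

text \<open>The field of scalars is the real or the complex field: a real algebra that is a field and is
  either \<open>\<real>\<close> itself or \<open>\<real> + \<real>i\<close> with \<open>i\<^sup>2 = -1\<close>.\<close>

class real_or_complex = real_field +
  assumes real_or_complex:
    "(\<forall>z. \<exists>a. z = a *\<^sub>R 1) \<or>
     (\<exists>i. i * i = - 1 \<and> (\<forall>z. \<exists>a b. z = a *\<^sub>R 1 + b *\<^sub>R i))"

instance real :: real_or_complex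
  by standard simp

instance complex :: real_or_complex
proof
  have "z = Re z *\<^sub>R 1 + Im z *\<^sub>R \<i>" for z
    by (simp add: complex_eq_iff)
  then show "(\<forall>z :: complex. \<exists>a. z = a *\<^sub>R 1) \<or>
     (\<exists>i :: complex. i * i = - 1 \<and> (\<forall>z. \<exists>a b. z = a *\<^sub>R 1 + b *\<^sub>R i))"
    using i_squared by blast
qed

text \<open>Charts of a manifold take values in a finite-dimensional real inner product space. In contrast
  to \<^class>\<open>euclidean_space\<close>, dimension \<open>0\<close> is allowed.\<close>

class fin_dim_inner = real_inner +
  assumes finite_spanning_set: "\<exists>B. finite B \<and> (\<forall>x. \<exists>c. x = (\<Sum>b\<in>B. c b *\<^sub>R b))"

instance real :: fin_dim_inner
proof
  have "\<exists>c. x = (\<Sum>b\<in>{1}. c b *\<^sub>R b)" for x :: real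
    by (rule exI[of _ "\<lambda>_. x"]) simp
  then show "\<exists>B :: real set. finite B \<and> (\<forall>x. \<exists>c. x = (\<Sum>b\<in>B. c b *\<^sub>R b))"
    by blast
qed


section \<open>Smooth functions and manifolds\<close>

primrec k_times_differentiable_on ::
    "nat \<Rightarrow> 'a set \<Rightarrow> ('a::real_normed_vector \<Rightarrow> 'b::real_normed_vector) \<Rightarrow> bool" where
  "k_times_differentiable_on 0 S f \<longleftrightarrow> continuous_on S f"
| "k_times_differentiable_on (Suc k) S f \<longleftrightarrow>
     (\<forall>x\<in>S. f differentiable (at x)) \<and>
     (\<forall>v. k_times_differentiable_on k S (\<lambda>x. frechet_derivative f (at x) v))"

text \<open>Only used for open sets \<open>S\<close> in a finite-dimensional space.\<close>

definition smooth_on :: "'a set \<Rightarrow> ('a::real_normed_vector \<Rightarrow> 'b::real_normed_vector) \<Rightarrow> bool" where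
  "smooth_on S f \<longleftrightarrow> (\<forall>k. k_times_differentiable_on k S f)"

type_synonym ('m, 'a) atlas = "('m set \<times> ('m \<Rightarrow> 'a)) set"

definition smooth_atlas :: "('m::topological_space, 'a::fin_dim_inner) atlas \<Rightarrow> bool" where
  "smooth_atlas A \<longleftrightarrow>
     (\<forall>(U, \<phi>)\<in>A. open U \<and> open (\<phi> ` U) \<and> homeomorphism U (\<phi> ` U) \<phi> (inv_into U \<phi>)) \<and>
     \<Union> (fst ` A) = UNIV \<and>
     (\<forall>(U, \<phi>)\<in>A. \<forall>(U', \<phi>')\<in>A. smooth_on (\<phi> ` (U \<inter> U')) (\<phi>' \<circ> inv_into U \<phi>))"

definition paracompact_type :: "'m::topological_space itself \<Rightarrow> bool" where
  "paracompact_type _ \<longleftrightarrow>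
     (\<forall>\<C> :: 'm set set. (\<forall>C\<in>\<C>. open C) \<and> \<Union> \<C> = UNIV \<longrightarrow>
        (\<exists>\<D>. (\<forall>D\<in>\<D>. open D \<and> (\<exists>C\<in>\<C>. D \<subseteq> C)) \<and> \<Union> \<D> = UNIV \<and>
             locally_finite_in euclidean \<D>))"

text \<open>The manifold is the type \<open>'m\<close>; the Hausdorff property is its class \<^class>\<open>t2_space\<close>.\<close>

definition smooth_manifold :: "('m::t2_space, 'a::fin_dim_inner) atlas \<Rightarrow> bool" where
  "smooth_manifold A \<longleftrightarrow>
     smooth_atlas A \<and> connected (UNIV :: 'm set) \<and> paracompact_type TYPE('m)"

definition smooth_fun ::
    "('m::t2_space, 'a::fin_dim_inner) atlas \<Rightarrow> 'm set \<Rightarrow> ('m \<Rightarrow> real) \<Rightarrow> bool" where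
  "smooth_fun A W f \<longleftrightarrow> (\<forall>(U, \<phi>)\<in>A. smooth_on (\<phi> ` (U \<inter> W)) (f \<circ> inv_into U \<phi>))"


section \<open>Vector spaces with explicit carrier\<close>

text \<open>The fibers of a bundle are vector spaces that vary with the base point, so they are
  represented as records. Spaces of maps consist of functions that are \<^const>\<open>extensional\<close> on their
  domain.\<close>

record ('k, 'v) vspace =
  car :: "'v set"
  vadd :: "'v \<Rightarrow> 'v \<Rightarrow> 'v"
  vzero :: 'v
  vscale :: "'k \<Rightarrow> 'v \<Rightarrow> 'v"

definition is_vspace :: "('k::field, 'v) vspace \<Rightarrow> bool" where
  "is_vspace V \<longleftrightarrow>
     vzero V \<in> car V \<and>
     (\<forall>u\<in>car V. \<forall>v\<in>car V. vadd V u v \<in> car V) \<and>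
     (\<forall>c. \<forall>v\<in>car V. vscale V c v \<in> car V) \<and>
     (\<forall>u\<in>car V. \<forall>v\<in>car V. \<forall>w\<in>car V. vadd V (vadd V u v) w = vadd V u (vadd V v w)) \<and>
     (\<forall>u\<in>car V. \<forall>v\<in>car V. vadd V u v = vadd V v u) \<and>
     (\<forall>v\<in>car V. vadd V (vzero V) v = v) \<and>
     (\<forall>v\<in>car V. \<exists>w\<in>car V. vadd V v w = vzero V) \<and>
     (\<forall>c. \<forall>u\<in>car V. \<forall>v\<in>car V. vscale V c (vadd V u v) = vadd V (vscale V c u) (vscale V c v)) \<and>
     (\<forall>c d. \<forall>v\<in>car V. vscale V (c + d) v = vadd V (vscale V c v) (vscale V d v)) \<and>
     (\<forall>c d. \<forall>v\<in>car V. vscale V (c * d) v = vscale V c (vscale V d v)) \<and>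
     (\<forall>v\<in>car V. vscale V 1 v = v)"

definition lin_map :: "('k, 'v) vspace \<Rightarrow> ('k, 'w) vspace \<Rightarrow> ('v \<Rightarrow> 'w) \<Rightarrow> bool" where
  "lin_map V W f \<longleftrightarrow>
     f \<in> car V \<rightarrow> car W \<and>
     (\<forall>u\<in>car V. \<forall>v\<in>car V. f (vadd V u v) = vadd W (f u) (f v)) \<and>
     (\<forall>c. \<forall>v\<in>car V. f (vscale V c v) = vscale W c (f v))"

definition lin_iso :: "('k, 'v) vspace \<Rightarrow> ('k, 'w) vspace \<Rightarrow> ('v \<Rightarrow> 'w) \<Rightarrow> bool" where
  "lin_iso V W f \<longleftrightarrow> lin_map V W f \<and> bij_betw f (car V) (car W)"

definition type_vspace :: "('k \<Rightarrow> 'v \<Rightarrow> 'v) \<Rightarrow> ('k, 'v::ab_group_add) vspace" where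
  "type_vspace scl = \<lparr>car = UNIV, vadd = (+), vzero = 0, vscale = scl\<rparr>"

definition coord_space :: "nat \<Rightarrow> ('k::field, nat \<Rightarrow> 'k) vspace" where
  "coord_space n =
     \<lparr>car = {v. \<forall>i\<ge>n. v i = 0}, vadd = (\<lambda>u v i. u i + v i), vzero = (\<lambda>i. 0),
      vscale = (\<lambda>c v i. c * v i)\<rparr>"

definition fin_dim_vspace :: "('k::field, 'v) vspace \<Rightarrow> bool" where
  "fin_dim_vspace V \<longleftrightarrow> is_vspace V \<and> (\<exists>n f. lin_iso V (coord_space n) f)"

definition maps_vspace :: "'s set \<Rightarrow> ('k, 'v) vspace \<Rightarrow> ('s \<Rightarrow> 'v) set \<Rightarrow> ('k, 's \<Rightarrow> 'v) vspace" where
  "maps_vspace S V F =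
     \<lparr>car = extensional S \<inter> F,
      vadd = (\<lambda>f g. \<lambda>s\<in>S. vadd V (f s) (g s)),
      vzero = (\<lambda>s\<in>S. vzero V),
      vscale = (\<lambda>c f. \<lambda>s\<in>S. vscale V c (f s))\<rparr>"

definition real_dual :: "('k::real_or_complex, 'v) vspace \<Rightarrow> ('v \<Rightarrow> real) set" where
  "real_dual V = {l \<in> extensional (car V).
     (\<forall>u\<in>car V. \<forall>v\<in>car V. l (vadd V u v) = l u + l v) \<and>
     (\<forall>r. \<forall>v\<in>car V. l (vscale V (of_real r) v) = r * l v)}"

text \<open>For a real space \<open>V\<close> and a space \<open>W\<close> over the scalar field, \<open>V \<otimes>\<^sub>\<real> W\<close> embeds into the
  maps from the dual of \<open>V\<close> to \<open>W\<close> by \<open>v \<otimes> w \<mapsto> (l \<mapsto> l(v) w)\<close>; it is realized as the image of this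
  embedding, that is, as the set of finite sums of pure tensors.\<close>

definition pure_tensor ::
    "(real, 'v) vspace \<Rightarrow> ('k::real_or_complex, 'w) vspace \<Rightarrow> 'v \<Rightarrow> 'w \<Rightarrow> ('v \<Rightarrow> real) \<Rightarrow> 'w" where
  "pure_tensor V W v w = (\<lambda>l\<in>real_dual V. vscale W (of_real (l v)) w)"

inductive_set tensors ::
    "(real, 'v) vspace \<Rightarrow> ('k::real_or_complex, 'w) vspace \<Rightarrow> (('v \<Rightarrow> real) \<Rightarrow> 'w) set"
  for V :: "(real, 'v) vspace" and W :: "('k::real_or_complex, 'w) vspace" where
  pure: "v \<in> car V \<Longrightarrow> w \<in> car W \<Longrightarrow> pure_tensor V W v w \<in> tensors V W"
| add: "s \<in> tensors V W \<Longrightarrow> t \<in> tensors V W \<Longrightarrow>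
    (\<lambda>l\<in>real_dual V. vadd W (s l) (t l)) \<in> tensors V W"

definition tensor_prod ::
    "(real, 'v) vspace \<Rightarrow> ('k::real_or_complex, 'w) vspace \<Rightarrow> ('k, ('v \<Rightarrow> real) \<Rightarrow> 'w) vspace" where
  "tensor_prod V W = maps_vspace (real_dual V) W (tensors V W)"

text \<open>\<open>f \<otimes> g\<close> for \<open>f : V \<rightarrow> V'\<close> and \<open>g : W \<rightarrow> W'\<close>.\<close>

definition tensor_map ::
    "(real, 'v) vspace \<Rightarrow> (real, 'v1) vspace \<Rightarrow> ('v \<Rightarrow> 'v1) \<Rightarrow> ('w \<Rightarrow> 'w1) \<Rightarrow>
     (('v \<Rightarrow> real) \<Rightarrow> 'w) \<Rightarrow> (('v1 \<Rightarrow> real) \<Rightarrow> 'w1)" where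
  "tensor_map V V' f g t = (\<lambda>l\<in>real_dual V'. g (t (\<lambda>v\<in>car V. l (f v))))"


section \<open>Smooth vector bundles\<close>

text \<open>A map into a finite-dimensional vector space \<open>V\<close> is smooth if its composition with every
  real-linear functional is (equivalently, if its real components are).\<close>

definition smooth_vec_fun ::
    "('m::t2_space, 'a::fin_dim_inner) atlas \<Rightarrow> 'm set \<Rightarrow> ('k::real_or_complex, 'v) vspace \<Rightarrow>
     ('m \<Rightarrow> 'v) \<Rightarrow> bool" where
  "smooth_vec_fun A W V g \<longleftrightarrow>
     (\<forall>x\<in>W. g x \<in> car V) \<and> (\<forall>l\<in>real_dual V. smooth_fun A W (\<lambda>x. l (g x)))"

text \<open>A bundle is given by its typical fiber, its family of fibers (the total space being the
  disjoint union of the \<open>fib E x\<close>) and a set of local trivializations \<open>(U, \<psi>)\<close>, where \<open>\<psi> x\<close> maps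
  the fiber at \<open>x \<in> U\<close> to the typical fiber. The trivializations determine the topology and the
  smooth structure of the total space.\<close>

record ('k, 'm, 'e, 'f) vbundle =
  model :: "('k, 'f) vspace"
  fib :: "'m \<Rightarrow> ('k, 'e) vspace"
  triv :: "('m set \<times> ('m \<Rightarrow> 'e \<Rightarrow> 'f)) set"

text \<open>Smoothness of a fiberwise linear map over the identity of the base. In local trivializations
  it is \<open>(x, v) \<mapsto> H(x) v\<close> with \<open>H(x)\<close> linear, which is smooth iff \<open>x \<mapsto> H(x) v\<close> is for each \<open>v\<close>.\<close>

definition smooth_bundle_map ::
    "('m::t2_space, 'a::fin_dim_inner) atlas \<Rightarrow> ('k::real_or_complex, 'm, 'e, 'f) vbundle \<Rightarrow>
     ('k, 'm, 'e1, 'f1) vbundle \<Rightarrow> ('m \<Rightarrow> 'e \<Rightarrow> 'e1) \<Rightarrow> bool" where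
  "smooth_bundle_map A E E' h \<longleftrightarrow>
     (\<forall>x. lin_map (fib E x) (fib E' x) (h x)) \<and>
     (\<forall>(U, \<psi>)\<in>triv E. \<forall>(U', \<psi>')\<in>triv E'. \<forall>v\<in>car (model E).
        smooth_vec_fun A (U \<inter> U') (model E')
          (\<lambda>x. \<psi>' x (h x (inv_into (car (fib E x)) (\<psi> x) v))))"

text \<open>The last condition says that the transition maps are smooth.\<close>

definition vector_bundle ::
    "('m::t2_space, 'a::fin_dim_inner) atlas \<Rightarrow> ('k::real_or_complex, 'm, 'e, 'f) vbundle \<Rightarrow> bool" where
  "vector_bundle A E \<longleftrightarrow>
     fin_dim_vspace (model E) \<and>
     (\<forall>x. is_vspace (fib E x)) \<and>
     (\<forall>(U, \<psi>)\<in>triv E. open U \<and> (\<forall>x\<in>U. lin_iso (fib E x) (model E) (\<psi> x))) \<and>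
     \<Union> (fst ` triv E) = UNIV \<and>
     smooth_bundle_map A E E (\<lambda>x v. v)"

definition sections ::
    "('m::t2_space, 'a::fin_dim_inner) atlas \<Rightarrow> ('k::real_or_complex, 'm, 'e, 'f) vbundle \<Rightarrow>
     ('k, 'm \<Rightarrow> 'e) vspace" where
  "sections A E =
     \<lparr>car = {X. (\<forall>x. X x \<in> car (fib E x)) \<and>
                (\<forall>(U, \<psi>)\<in>triv E. smooth_vec_fun A U (model E) (\<lambda>x. \<psi> x (X x)))},
      vadd = (\<lambda>X Y x. vadd (fib E x) (X x) (Y x)),
      vzero = (\<lambda>x. vzero (fib E x)),
      vscale = (\<lambda>c X x. vscale (fib E x) c (X x))\<rparr>"

definition short_exact_sequence ::
    "('m::t2_space, 'a::fin_dim_inner) atlas \<Rightarrow> ('k::real_or_complex, 'm, 'e1, 'f1) vbundle \<Rightarrow>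
     ('k, 'm, 'e2, 'f2) vbundle \<Rightarrow> ('k, 'm, 'e3, 'f3) vbundle \<Rightarrow>
     ('m \<Rightarrow> 'e1 \<Rightarrow> 'e2) \<Rightarrow> ('m \<Rightarrow> 'e2 \<Rightarrow> 'e3) \<Rightarrow> bool" where
  "short_exact_sequence A E1 E2 E3 i s \<longleftrightarrow>
     vector_bundle A E1 \<and> vector_bundle A E2 \<and> vector_bundle A E3 \<and>
     smooth_bundle_map A E1 E2 i \<and> smooth_bundle_map A E2 E3 s \<and>
     (\<forall>x. inj_on (i x) (car (fib E1 x)) \<and>
          i x ` car (fib E1 x) = {d \<in> car (fib E2 x). s x d = vzero (fib E3 x)} \<and>
          s x ` car (fib E2 x) = car (fib E3 x))"

text \<open>Tangent vectors at \<open>x\<close> are the derivations at \<open>x\<close> of the algebra of smooth functions. The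
  trivialization of the tangent bundle given by a chart \<open>(U, \<phi>)\<close> sends the derivation
  \<open>coord_derivation A U \<phi> x a\<close>, the directional derivative along \<open>a\<close> in the chart, to \<open>a\<close>.\<close>

definition smooth_functions :: "('m::t2_space, 'a::fin_dim_inner) atlas \<Rightarrow> ('m \<Rightarrow> real) set" where
  "smooth_functions A = {f. smooth_fun A UNIV f}"

definition tangent_space ::
    "('m::t2_space, 'a::fin_dim_inner) atlas \<Rightarrow> 'm \<Rightarrow> (real, ('m \<Rightarrow> real) \<Rightarrow> real) vspace" where
  "tangent_space A x = maps_vspace (smooth_functions A) (type_vspace (*\<^sub>R))
     {v. (\<forall>f\<in>smooth_functions A. \<forall>g\<in>smooth_functions A. v (\<lambda>y. f y + g y) = v f + v g) \<and>
         (\<forall>r. \<forall>f\<in>smooth_functions A. v (\<lambda>y. r * f y) = r * v f) \<and>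
         (\<forall>f\<in>smooth_functions A. \<forall>g\<in>smooth_functions A.
            v (\<lambda>y. f y * g y) = v f * g x + f x * v g)}"

definition coord_derivation ::
    "('m::t2_space, 'a::fin_dim_inner) atlas \<Rightarrow> 'm set \<Rightarrow> ('m \<Rightarrow> 'a) \<Rightarrow> 'm \<Rightarrow> 'a \<Rightarrow>
     ('m \<Rightarrow> real) \<Rightarrow> real" where
  "coord_derivation A U \<phi> x a =
     (\<lambda>f\<in>smooth_functions A. frechet_derivative (f \<circ> inv_into U \<phi>) (at (\<phi> x)) a)"

definition tangent_bundle ::
    "('m::t2_space, 'a::fin_dim_inner) atlas \<Rightarrow> (real, 'm, ('m \<Rightarrow> real) \<Rightarrow> real, 'a) vbundle" where
  "tangent_bundle A =
     \<lparr>model = type_vspace (*\<^sub>R), fib = tangent_space A,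
      triv = (\<lambda>(U, \<phi>). (U, \<lambda>x. inv_into UNIV (coord_derivation A U \<phi> x))) ` A\<rparr>"

definition tensor_bundle ::
    "(real, 'm, 'e, 'f) vbundle \<Rightarrow> ('k::real_or_complex, 'm, 'e1, 'f1) vbundle \<Rightarrow>
     ('k, 'm, ('e \<Rightarrow> real) \<Rightarrow> 'e1, ('f \<Rightarrow> real) \<Rightarrow> 'f1) vbundle" where
  "tensor_bundle E F =
     \<lparr>model = tensor_prod (model E) (model F),
      fib = (\<lambda>x. tensor_prod (fib E x) (fib F x)),
      triv = {(U \<inter> U', \<lambda>x. tensor_map (fib E x) (model E) (\<psi> x) (\<psi>' x)) | U \<psi> U' \<psi>'.
                (U, \<psi>) \<in> triv E \<and> (U', \<psi>') \<in> triv F}\<rparr>"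


section \<open>Lie algebras and bundles of Lie algebras\<close>

locale lie_algebra = vector_space scl
  for scl :: "'k::field \<Rightarrow> 'g::ab_group_add \<Rightarrow> 'g" +
  fixes bracket :: "'g \<Rightarrow> 'g \<Rightarrow> 'g"
  assumes bracket_add_left: "bracket (x + y) z = bracket x z + bracket y z"
    and bracket_add_right: "bracket x (y + z) = bracket x y + bracket x z"
    and bracket_scale_left: "bracket (scl c x) y = scl c (bracket x y)"
    and bracket_scale_right: "bracket x (scl c y) = scl c (bracket x y)"
    and bracket_self: "bracket x x = 0"
    and jacobi: "bracket x (bracket y z) + bracket y (bracket z x) + bracket z (bracket x y) = 0"
begin

definition perfect :: bool where
  "perfect \<longleftrightarrow> span {bracket x y | x y. True} = UNIV"

definition centerfree :: bool where
  "centerfree \<longleftrightarrow> {z. \<forall>x. bracket z x = 0} = {0}"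

end

definition derivations ::
    "('k, 'v) vspace \<Rightarrow> ('v \<Rightarrow> 'v \<Rightarrow> 'v) \<Rightarrow> ('k, 'v \<Rightarrow> 'v) vspace" where
  "derivations V br = maps_vspace (car V) V
     {D. lin_map V V D \<and>
         (\<forall>u\<in>car V. \<forall>v\<in>car V. D (br u v) = vadd V (br (D u) v) (br u (D v)))}"

definition centroid ::
    "('k, 'v) vspace \<Rightarrow> ('v \<Rightarrow> 'v \<Rightarrow> 'v) \<Rightarrow> ('k, 'v \<Rightarrow> 'v) vspace" where
  "centroid V br = maps_vspace (car V) V
     {f. lin_map V V f \<and> (\<forall>u\<in>car V. \<forall>v\<in>car V. f (br u v) = br u (f v))}"

text \<open>Bundles of Lie algebras with fiber \<open>\<kk>\<close>, where \<open>\<kk>\<close> is the type \<open>'g\<close> with operations \<open>scl\<close>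
  and \<open>brk\<close>, and \<open>brL x\<close> is the bracket of the fiber at \<open>x\<close>. Since all trivializations are fiberwise
  Lie algebra isomorphisms, the transition maps take values in the automorphisms of \<open>\<kk>\<close>.\<close>

definition lie_algebra_bundle ::
    "('m::t2_space, 'a::fin_dim_inner) atlas \<Rightarrow> ('k::real_or_complex \<Rightarrow> 'g \<Rightarrow> 'g) \<Rightarrow>
     ('g \<Rightarrow> 'g \<Rightarrow> 'g) \<Rightarrow> ('k, 'm, 'e, 'g::ab_group_add) vbundle \<Rightarrow> ('m \<Rightarrow> 'e \<Rightarrow> 'e \<Rightarrow> 'e) \<Rightarrow> bool" where
  "lie_algebra_bundle A scl brk L brL \<longleftrightarrow>
     vector_bundle A L \<and> model L = type_vspace scl \<and>
     (\<forall>x. \<forall>u\<in>car (fib L x). \<forall>v\<in>car (fib L x). brL x u v \<in> car (fib L x)) \<and>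
     (\<forall>(U, \<psi>)\<in>triv L. \<forall>x\<in>U. \<forall>u\<in>car (fib L x). \<forall>v\<in>car (fib L x).
        \<psi> x (brL x u v) = brk (\<psi> x u) (\<psi> x v))"

definition section_bracket ::
    "('m \<Rightarrow> 'e \<Rightarrow> 'e \<Rightarrow> 'e) \<Rightarrow> ('m \<Rightarrow> 'e) \<Rightarrow> ('m \<Rightarrow> 'e) \<Rightarrow> 'm \<Rightarrow> 'e" where
  "section_bracket brL X Y = (\<lambda>x. brL x (X x) (Y x))"

definition conj_map ::
    "('k, 'v) vspace \<Rightarrow> ('k, 'w) vspace \<Rightarrow> ('v \<Rightarrow> 'w) \<Rightarrow> ('v \<Rightarrow> 'v) \<Rightarrow> 'w \<Rightarrow> 'w" where
  "conj_map V W \<psi> D = (\<lambda>w\<in>car W. \<psi> (D (inv_into (car V) \<psi> w)))"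

definition conj_triv ::
    "('k, 'm, 'e, 'f) vbundle \<Rightarrow> ('m set \<times> ('m \<Rightarrow> ('e \<Rightarrow> 'e) \<Rightarrow> 'f \<Rightarrow> 'f)) set" where
  "conj_triv L = (\<lambda>(U, \<psi>). (U, \<lambda>x. conj_map (fib L x) (model L) (\<psi> x))) ` triv L"

text \<open>The trivializations of \<open>Hom(L, L)\<close> are the conjugations by those of \<open>L\<close>. They map the fibers
  of the subbundles \<open>Der(L)\<close> and \<open>Cent(L)\<close> onto \<open>Der(\<kk>)\<close> and \<open>Cent(\<kk>)\<close>.\<close>

definition Der_bundle ::
    "('g \<Rightarrow> 'g \<Rightarrow> 'g) \<Rightarrow> ('k, 'm, 'e, 'g) vbundle \<Rightarrow> ('m \<Rightarrow> 'e \<Rightarrow> 'e \<Rightarrow> 'e) \<Rightarrow>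
     ('k, 'm, 'e \<Rightarrow> 'e, 'g \<Rightarrow> 'g) vbundle" where
  "Der_bundle brk L brL =
     \<lparr>model = derivations (model L) brk, fib = (\<lambda>x. derivations (fib L x) (brL x)),
      triv = conj_triv L\<rparr>"

definition Cent_bundle ::
    "('g \<Rightarrow> 'g \<Rightarrow> 'g) \<Rightarrow> ('k, 'm, 'e, 'g) vbundle \<Rightarrow> ('m \<Rightarrow> 'e \<Rightarrow> 'e \<Rightarrow> 'e) \<Rightarrow>
     ('k, 'm, 'e \<Rightarrow> 'e, 'g \<Rightarrow> 'g) vbundle" where
  "Cent_bundle brk L brL =
     \<lparr>model = centroid (model L) brk, fib = (\<lambda>x. centroid (fib L x) (brL x)),
      triv = conj_triv L\<rparr>"


section \<open>Derivations at a point\<close>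

definition x_derivations ::
    "('m::t2_space, 'a::fin_dim_inner) atlas \<Rightarrow> ('k::real_or_complex, 'm, 'e, 'f) vbundle \<Rightarrow>
     ('m \<Rightarrow> 'e \<Rightarrow> 'e \<Rightarrow> 'e) \<Rightarrow> 'm \<Rightarrow> ('k, ('m \<Rightarrow> 'e) \<Rightarrow> 'e) vspace" where
  "x_derivations A L brL x = maps_vspace (car (sections A L)) (fib L x)
     {\<delta>. lin_map (sections A L) (fib L x) \<delta> \<and>
         (\<forall>X\<in>car (sections A L). \<forall>Y\<in>car (sections A L).
            \<delta> (section_bracket brL X Y) =
              vadd (fib L x) (brL x (\<delta> X) (Y x)) (brL x (X x) (\<delta> Y)))}"

definition der_inclusion ::
    "('m::t2_space, 'a::fin_dim_inner) atlas \<Rightarrow> ('k::real_or_complex, 'm, 'e, 'f) vbundle \<Rightarrow>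
     'm \<Rightarrow> ('e \<Rightarrow> 'e) \<Rightarrow> ('m \<Rightarrow> 'e) \<Rightarrow> 'e" where
  "der_inclusion A L x D = (\<lambda>X\<in>car (sections A L). D (X x))"

definition eval_derivation ::
    "('m::t2_space, 'a::fin_dim_inner) atlas \<Rightarrow> ('k::real_or_complex, 'm, 'e, 'f) vbundle \<Rightarrow>
     (('m \<Rightarrow> 'e) \<Rightarrow> 'm \<Rightarrow> 'e) \<Rightarrow> 'm \<Rightarrow> ('m \<Rightarrow> 'e) \<Rightarrow> 'e" where
  "eval_derivation A L D x = (\<lambda>X\<in>car (sections A L). D X x)"

text \<open>The derivative at \<open>p\<close> in direction \<open>a\<close> of a map into a finite-dimensional vector space \<open>V\<close>,
  which carries no norm here and is tested by real-linear functionals.\<close>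

definition partial_derivative ::
    "('k::real_or_complex, 'v) vspace \<Rightarrow> ('a::real_normed_vector \<Rightarrow> 'v) \<Rightarrow> 'a \<Rightarrow> 'a \<Rightarrow> 'v" where
  "partial_derivative V g p a =
     (THE w. w \<in> car V \<and>
        (\<forall>l\<in>real_dual V. ((\<lambda>t. l (g (p + t *\<^sub>R a))) has_real_derivative l w) (at 0)))"

definition local_form ::
    "'m set \<Rightarrow> ('m \<Rightarrow> 'a) \<Rightarrow> ('m \<Rightarrow> 'e \<Rightarrow> 'f) \<Rightarrow> ('m \<Rightarrow> 'e) \<Rightarrow> 'a \<Rightarrow> 'f" where
  "local_form U \<phi> \<psi> X p = \<psi> (inv_into U \<phi> p) (X (inv_into U \<phi> p))"

text \<open>In every chart \<open>(U, \<phi>)\<close> of the manifold and every bundle chart \<open>(U', \<psi>)\<close> around \<open>x\<close>, and for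
  every basis \<open>C\<close> of the model space of the manifold (partial derivatives being taken in the
  directions \<open>c \<in> C\<close>), the value \<open>\<psi>\<^sub>x(\<delta>(X))\<close> is linear in the value and the first partial derivatives
  of the local form of \<open>X\<close> at \<open>\<phi>(x)\<close>.\<close>

definition order_at_most_one ::
    "('m::t2_space, 'a::fin_dim_inner) atlas \<Rightarrow> ('k::real_or_complex \<Rightarrow> 'g \<Rightarrow> 'g) \<Rightarrow>
     ('k, 'm, 'e, 'g::ab_group_add) vbundle \<Rightarrow> 'm \<Rightarrow> (('m \<Rightarrow> 'e) \<Rightarrow> 'e) \<Rightarrow> bool" where
  "order_at_most_one A scl L x \<delta> \<longleftrightarrow>
     (\<forall>(U, \<phi>)\<in>A. \<forall>(U', \<psi>)\<in>triv L. \<forall>C :: 'a set.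
        x \<in> U \<inter> U' \<and> finite C \<and> independent C \<and> span C = UNIV \<longrightarrow>
        (\<exists>a b. Vector_Spaces.linear scl scl a \<and>
               (\<forall>c\<in>C. Vector_Spaces.linear scl scl (b c)) \<and>
               (\<forall>X\<in>car (sections A L).
                  \<psi> x (\<delta> X) =
                    a (local_form U \<phi> \<psi> X (\<phi> x)) +
                    (\<Sum>c\<in>C. b c (partial_derivative (model L) (local_form U \<phi> \<psi> X) (\<phi> x) c)))))"

end

theory Submission
  imports Defs
begin

text \<open>If \<open>f\<close> and \<open>g\<close> vanish at \<open>x\<close>, then an \<open>x\<close>-derivation \<open>\<delta>\<close> kills \<open>f g X\<close>: for \<open>X = [Y, Z]\<close> because
  \<open>f g X = [f Y, g Z]\<close>, and for centerfree fibers because \<open>[f g X, Y] = [f X, g Y]\<close> shows that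
  \<open>\<delta>(f g X)\<close> is central. So \<open>\<delta>\<close> is local and, by Hadamard's lemma, of first order; in charts its
  coefficients are a derivation of \<open>\<kk>\<close> and, for each coordinate, an element of the centroid.
  These coefficients trivialize the bundle of derivations, and \<open>(df, X\<^sub>x) \<mapsto> \<delta>(f X)\<close> for \<open>f(x) = 0\<close>
  recovers the centroid part.

  For perfect fibers every section has to be a finite sum of brackets, although there need not be a
  finite atlas. Finitely many sections that span every fiber are found by successive perturbations
  over a compact exhaustion; the parameters to be avoided form a Lipschitz image of a set of
  smaller dimension. The brackets of these sections span every fiber as well, every section is a
  combination of them with smooth coefficients, and \<open>f [Y, Z] = [f Y, Z]\<close>.\<close>

section \<open>Functionals on vector spaces with explicit carrier\<close>

text \<open>An x-derivation respects finite sums only and is not known to be local at the start, so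
  no partition of unity can be pushed through it. This is why sections over perfect fibers must be
  finite sums of brackets globally. Once products of two functions vanishing at \<open>x\<close> are
  killed, locality is cheap: a section vanishing near \<open>x\<close> equals \<open>g * g\<close>
  times itself for a cutoff \<open>g\<close> with \<open>g x = 0\<close>. The dimension count behind
  the perturbations: a family fails to span at \<open>z\<close> iff a nonzero functional kills it
  there. Divided by its largest coordinate, this functional lies in a unit cube of dimension r, the
  real dimension of the fiber; together with \<open>z\<close> it ranges over a box of dimension n +
  r, with n the dimension of the manifold. Hence n + r + 1 sections for each basis direction are
  enough, and boundedness of the box lets a counting argument replace measure theory. The fibers
  carry no norm, topology or sum operator. Vectors are therefore compared, combined and
  differentiated through functionals, and a minimal separating family of functionals plays the role
  of a basis.\<close>

definition functional :: "('k::field, 'v) vspace \<Rightarrow> ('v \<Rightarrow> 'k) \<Rightarrow> bool" where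
  "functional V f \<longleftrightarrow>
     (\<forall>u\<in>car V. \<forall>v\<in>car V. f (vadd V u v) = f u + f v) \<and>
     (\<forall>c. \<forall>v\<in>car V. f (vscale V c v) = c * f v)"

text \<open>The codomain is left open, since the same notion serves \<K>-valued and real-valued
  functionals.\<close>

definition separating :: "('k, 'v) vspace \<Rightarrow> ('v \<Rightarrow> 'b) set \<Rightarrow> bool" where
  "separating V F \<longleftrightarrow> (\<forall>u\<in>car V. \<forall>v\<in>car V. (\<forall>f\<in>F. f u = f v) \<longrightarrow> u = v)"

lemma is_vspaceD:
  assumes "is_vspace V"
  shows "vzero V \<in> car V"
    "u \<in> car V ==> v \<in> car V ==> vadd V u v \<in> car V"
    "v \<in> car V ==> vscale V c v \<in> car V"
    "u \<in> car V ==> v \<in> car V ==> w \<in> car V ==> vadd V (vadd V u v) w = vadd V u (vadd V v w)"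
    "u \<in> car V ==> v \<in> car V ==> vadd V u v = vadd V v u"
    "v \<in> car V ==> vadd V (vzero V) v = v"
    "v \<in> car V ==> \<exists>w\<in>car V. vadd V v w = vzero V"
    "u \<in> car V ==> v \<in> car V ==> vscale V c (vadd V u v) = vadd V (vscale V c u) (vscale V c v)"
    "v \<in> car V ==> vscale V (c + d) v = vadd V (vscale V c v) (vscale V d v)"
    "v \<in> car V ==> vscale V (c * d) v = vscale V c (vscale V d v)"
    "v \<in> car V ==> vscale V 1 v = v"
proof -
  note a0 = assms[unfolded is_vspace_def]
  note a1 = a0[THEN conjunct2]
  note a2 = a1[THEN conjunct2]
  note a3 = a2[THEN conjunct2]
  note a4 = a3[THEN conjunct2]
  note a5 = a4[THEN conjunct2]
  note a6 = a5[THEN conjunct2]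
  note a7 = a6[THEN conjunct2]
  note a8 = a7[THEN conjunct2]
  note a9 = a8[THEN conjunct2]
  note a10 = a9[THEN conjunct2]
  show "vzero V \<in> car V" by (rule a0[THEN conjunct1, rule_format])
  show "vadd V u v \<in> car V" if "u \<in> car V" "v \<in> car V" by (rule a1[THEN conjunct1, rule_format]) (fact that)+
  show "vscale V c v \<in> car V" if "v \<in> car V" by (rule a2[THEN conjunct1, rule_format]) (fact that)+
  show "vadd V (vadd V u v) w = vadd V u (vadd V v w)" if "u \<in> car V" "v \<in> car V" "w \<in> car V" by (rule a3[THEN conjunct1, rule_format]) (fact that)+
  show "vadd V u v = vadd V v u" if "u \<in> car V" "v \<in> car V" by (rule a4[THEN conjunct1, rule_format]) (fact that)+
  show "vadd V (vzero V) v = v" if "v \<in> car V" by (rule a5[THEN conjunct1, rule_format]) (fact that)+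
  show "\<exists>w\<in>car V. vadd V v w = vzero V" if "v \<in> car V" by (rule a6[THEN conjunct1, rule_format]) (fact that)+
  show "vscale V c (vadd V u v) = vadd V (vscale V c u) (vscale V c v)" if "u \<in> car V" "v \<in> car V" by (rule a7[THEN conjunct1, rule_format]) (fact that)+
  show "vscale V (c + d) v = vadd V (vscale V c v) (vscale V d v)" if "v \<in> car V" by (rule a8[THEN conjunct1, rule_format]) (fact that)+
  show "vscale V (c * d) v = vscale V c (vscale V d v)" if "v \<in> car V" by (rule a9[THEN conjunct1, rule_format]) (fact that)+
  show "vscale V 1 v = v" if "v \<in> car V" by (rule a10[rule_format]) (fact that)+
qed

lemma vscale_0:
  assumes V: "is_vspace V" and v: "v \<in> car V"
  shows "vscale V 0 v = vzero V"
proof -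
  let ?z = "vscale V 0 v"
  have z: "?z \<in> car V" by (rule is_vspaceD(3)[OF V v])
  have zz: "vadd V ?z ?z = ?z" using is_vspaceD(9)[OF V v, of 0 0] by simp
  obtain w where w: "w \<in> car V" "vadd V ?z w = vzero V" using is_vspaceD(7)[OF V z] by blast
  have "vadd V ?z (vadd V ?z w) = vadd V ?z w"
    using is_vspaceD(4)[OF V z z w(1)] zz by simp
  then have "vadd V ?z (vzero V) = vzero V" using w(2) by simp
  then show ?thesis
    using is_vspaceD(5,6)[OF V] is_vspaceD(1)[OF V] z by metis
qed

lemma functional_zero:
  assumes V: "is_vspace V" and f: "functional V f"
  shows "f (vzero V) = 0"
proof -
  have "f (vscale V 0 (vzero V)) = 0 * f (vzero V)"
    using f is_vspaceD(1)[OF V] unfolding functional_def by blast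
  then show ?thesis using vscale_0[OF V is_vspaceD(1)[OF V]] by simp
qed

text \<open>Stands in for a finite sum of vectors of a record: the sum is described by its values
  under functionals, and later uses need nothing else about it.\<close>

lemma ex_linear_combination:
  assumes V: "is_vspace V" and "finite I" and e: "\<And>i. i \<in> I ==> e i \<in> car V"
  shows "\<exists>w\<in>car V. \<forall>l. functional V l \<longrightarrow> l w = (\<Sum>i\<in>I. c i * l (e i))"
  using \<open>finite I\<close> e
proof (induction I rule: finite_induct)
  case empty
  then show ?case using functional_zero[OF V] is_vspaceD(1)[OF V] by auto
next
  case (insert i I)
  then obtain w where w: "w \<in> car V" "\<forall>l. functional V l \<longrightarrow> l w = (\<Sum>i\<in>I. c i * l (e i))"
    by auto
  have "vscale V (c i) (e i) \<in> car V" using insert is_vspaceD(3)[OF V] by auto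
  then have "vadd V (vscale V (c i) (e i)) w \<in> car V" using is_vspaceD(2)[OF V] w by auto
  moreover have "l (vadd V (vscale V (c i) (e i)) w) = (\<Sum>i\<in>insert i I. c i * l (e i))"
    if "functional V l" for l
    using that insert w \<open>vscale V (c i) (e i) \<in> car V\<close> unfolding functional_def by auto
  ultimately show ?case by blast
qed

text \<open>A minimal separating subfamily has a dual basis: a vector that only \<open>f\<close> distinguishes from
  another one shows that \<open>f\<close> cannot be omitted.\<close>

lemma ex_dual_basis:
  assumes V: "is_vspace V" and fin: "finite F" and func: "\<And>f. f \<in> F ==> functional V f"
    and sep: "separating V F"
  obtains G e where "G \<subseteq> F" "separating V G" "\<And>g. g \<in> G ==> e g \<in> car V"
    "\<And>f g. f \<in> G ==> g \<in> G ==> f (e g) = (if f = g then 1 else 0)"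
    "\<And>l v. functional V l ==> v \<in> car V ==> l v = (\<Sum>g\<in>G. g v * l (e g))"
proof -
  have "\<exists>G. (G \<subseteq> F \<and> separating V G) \<and> (\<forall>H. H \<subseteq> F \<and> separating V H \<longrightarrow> card G \<le> card H)"
    using ex_has_least_nat[of "\<lambda>G. G \<subseteq> F \<and> separating V G" F card] sep by auto
  then obtain G where G: "G \<subseteq> F" "separating V G"
    and min: "\<And>H. H \<subseteq> F ==> separating V H ==> card G \<le> card H" by blast
  have finG: "finite G" using G fin finite_subset by blast
  have fG: "functional V g" if "g \<in> G" for g using that G func by blast
  have "\<exists>w\<in>car V. \<forall>f\<in>G. f w = (if f = g then 1 else 0)" if g: "g \<in> G" for g
  proof -
    have "\<not> separating V (G - {g})"
    proof
      assume "separating V (G - {g})"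
      then have "card G \<le> card (G - {g})" using min[of "G - {g}"] G by blast
      then show False using g finG by (meson card_Diff1_less leD)
    qed
    then obtain u v where uv: "u \<in> car V" "v \<in> car V" "\<forall>f\<in>G - {g}. f u = f v" "u \<noteq> v"
      unfolding separating_def by blast
    then have ne: "g u \<noteq> g v" using G(2) unfolding separating_def by blast
    define d where "d = g u - g v"
    have d: "d \<noteq> 0" using ne by (simp add: d_def)
    \<comment> \<open>The difference of \<open>u\<close> and \<open>v\<close> divided by
      \<open>g u - g v\<close>: the other members of \<open>G\<close> do not distinguish
      \<open>u\<close> from \<open>v\<close>, so they vanish on it.\<close>
    let ?w = "vadd V (vscale V (1 / d) u) (vscale V (- 1 / d) v)"
    have "f ?w = (f u - f v) / d" if "f \<in> G" for f
    proof -
      have "vscale V (1 / d) u \<in> car V" "vscale V (- 1 / d) v \<in> car V"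
        using uv is_vspaceD(3)[OF V] by auto
      then have "f ?w = 1 / d * f u + (- 1 / d) * f v"
        using fG[OF that] uv unfolding functional_def by metis
      then show ?thesis by (simp add: diff_divide_distrib)
    qed
    note fw = this
    have "f ?w = (if f = g then 1 else 0)" if f: "f \<in> G" for f
    proof (cases "f = g")
      case True
      then show ?thesis using fw[OF f] d by (simp only: d_def divide_self simp_thms if_True)
    next
      case False
      then have "f u - f v = 0" using uv(3) f by simp
      then show ?thesis using fw[OF f] False by (simp only: div_0 simp_thms if_False)
    qed
    then have "\<forall>f\<in>G. f ?w = (if f = g then 1 else 0)" by blast
    moreover have "?w \<in> car V" using uv is_vspaceD(2,3)[OF V] by blast
    ultimately show ?thesis by blast
  qed
  then have "\<forall>g\<in>G. \<exists>w. w \<in> car V \<and> (\<forall>f\<in>G. f w = (if f = g then 1 else 0))" by blast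
  then obtain e where "\<forall>g\<in>G. e g \<in> car V \<and> (\<forall>f\<in>G. f (e g) = (if f = g then 1 else 0))"
    by (rule bchoice[THEN exE])
  then have e: "\<And>g. g \<in> G ==> e g \<in> car V"
    "\<And>f g. f \<in> G ==> g \<in> G ==> f (e g) = (if f = g then 1 else 0)"
    by simp_all
  have "l v = (\<Sum>g\<in>G. g v * l (e g))" if l: "functional V l" and v: "v \<in> car V" for l v
  proof -
    obtain w where w: "w \<in> car V" "\<forall>l. functional V l \<longrightarrow> l w = (\<Sum>g\<in>G. g v * l (e g))"
      using ex_linear_combination[OF V finG, of e "\<lambda>g. g v", OF e(1), simplified] by blast
    \<comment> \<open>The combination with the coordinates of \<open>v\<close> agrees with
      \<open>v\<close> on \<open>G\<close>. As \<open>G\<close> is separating, it is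
      \<open>v\<close> itself, and the expansion holds for every functional.\<close>
    have "f w = f v" if "f \<in> G" for f
    proof -
      have "f w = (\<Sum>g\<in>G. g v * f (e g))" using w(2) fG[OF that] by simp
      also have "\<dots> = (\<Sum>g\<in>G. if g = f then g v else 0)"
        by (intro sum.cong refl) (simp add: e(2)[OF that])
      finally show ?thesis using that finG by simp
    qed
    then have "w = v" using G(2) w(1) v unfolding separating_def by blast
    then show ?thesis using w(2) l by simp
  qed
  then show ?thesis using that[OF G e] by blast
qed

section \<open>Finite dimension from separating families\<close>

lemma is_vspace_coord_space: "is_vspace (coord_space n)"
proof -
  have "\<exists>w. (\<forall>i\<ge>n. w i = 0) \<and> (\<lambda>i. v i + w i) = (\<lambda>i. 0)" if "\<forall>i\<ge>n. v i = 0" for v :: "nat \<Rightarrow> 'a"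
    using that by (intro exI[of _ "\<lambda>i. - v i"]) auto
  then show ?thesis
    unfolding is_vspace_def coord_space_def by (auto simp: algebra_simps)
qed

text \<open>A minimal separating subfamily serves as the coordinate map; its dual basis makes this
  map surjective onto \<open>coord_space\<close>.\<close>

lemma fin_dim_vspaceI:
  assumes V: "is_vspace V" and fin: "finite F" and func: "\<And>f. f \<in> F ==> functional V f"
    and sep: "separating V F"
  shows "fin_dim_vspace V"
proof -
  obtain G e where G: "G \<subseteq> F" "separating V G" "\<And>g. g \<in> G ==> e g \<in> car V"
    "\<And>f g. f \<in> G ==> g \<in> G ==> f (e g) = (if f = g then 1 else 0)"
    by (rule ex_dual_basis[OF assms]) (assumption | (rule that; assumption))+
  have "finite G" using G fin finite_subset by blast
  then obtain h and n :: nat where h: "bij_betw h {..<n} G"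
    using ex_bij_betw_nat_finite[of G] that[unfolded lessThan_atLeast0] by blast
  have hG: "h i \<in> G" if "i < n" for i using h that bij_betwE by blast
  have fh: "functional V (h i)" if "i < n" for i using hG[OF that] G func by blast
  define f where "f v = (\<lambda>i. if i < n then h i v else 0)" for v
  have "lin_map V (coord_space n) f"
    using fh unfolding lin_map_def f_def coord_space_def functional_def by fastforce
  moreover have "inj_on f (car V)"
  proof (rule inj_onI)
    fix u v assume uv: "u \<in> car V" "v \<in> car V" "f u = f v"
    have "g u = g v" if g: "g \<in> G" for g
    proof -
      obtain i where "i < n" "g = h i" using g bij_betw_imp_surj_on[OF h] by blast
      then show ?thesis using uv(3) unfolding f_def by metis
    qed
    then show "u = v" using G(2) uv unfolding separating_def by blast
  qed
  moreover have "f ` car V = car (coord_space n)"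
  proof
    show "f ` car V \<subseteq> car (coord_space n)" unfolding f_def coord_space_def by auto
    show "car (coord_space n) \<subseteq> f ` car V"
    proof
      fix c assume "c \<in> car (coord_space n :: ('a, nat \<Rightarrow> 'a) vspace)"
      then have c: "c i = 0" if "i \<ge> n" for i using that by (simp add: coord_space_def)
      have eh: "e (h i) \<in> car V" if "i \<in> {..<n}" for i using that hG G(3) by auto
      obtain w where w: "w \<in> car V"
          "\<forall>l. functional V l \<longrightarrow> l w = (\<Sum>i<n. c i * l (e (h i)))"
        using ex_linear_combination[OF V finite_lessThan, of n "\<lambda>i. e (h i)" c, OF eh] by blast
      have "h j w = c j" if "j < n" for j
      proof -
        have "h j w = (\<Sum>i<n. c i * h j (e (h i)))" using w(2) fh[OF that] by simp
        also have "\<dots> = (\<Sum>i<n. if i = j then c i else 0)"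
        proof (rule sum.cong)
          fix i assume "i \<in> {..<n}"
          then show "c i * h j (e (h i)) = (if i = j then c i else 0)"
            using G(4)[OF hG[OF that] hG, of i] h that
            by (auto simp: bij_betw_def inj_on_def)
        qed simp
        finally show ?thesis using that by simp
      qed
      then have "f w = c" using c unfolding f_def by auto
      then show "c \<in> f ` car V" using w(1) by blast
    qed
  qed
  ultimately show ?thesis
    using V unfolding fin_dim_vspace_def lin_iso_def bij_betw_def by blast
qed

section \<open>Linear maps and isomorphisms between carriers\<close>

lemma lin_mapD:
  assumes "lin_map V W f"
  shows "v \<in> car V ==> f v \<in> car W"
    "u \<in> car V ==> v \<in> car V ==> f (vadd V u v) = vadd W (f u) (f v)"
    "v \<in> car V ==> f (vscale V c v) = vscale W c (f v)"
  using assms unfolding lin_map_def by auto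

lemma lin_map_zero:
  assumes "is_vspace V" "is_vspace W" "lin_map V W f"
  shows "f (vzero V) = vzero W"
  using lin_mapD(3)[OF assms(3) is_vspaceD(1)[OF assms(1)], of 0]
    vscale_0[OF assms(1) is_vspaceD(1)[OF assms(1)]]
    vscale_0[OF assms(2) lin_mapD(1)[OF assms(3) is_vspaceD(1)[OF assms(1)]]] by simp

lemma lin_map_comp: "lin_map V W f ==> lin_map W Z g ==> lin_map V Z (\<lambda>v. g (f v))"
  unfolding lin_map_def by (auto simp: Pi_iff)

lemma lin_isoD:
  assumes "lin_iso V W f"
  shows "lin_map V W f" "v \<in> car V ==> f v \<in> car W" "w \<in> car W ==> inv_into (car V) f w \<in> car V"
    "v \<in> car V ==> inv_into (car V) f (f v) = v" "w \<in> car W ==> f (inv_into (car V) f w) = w"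
    "u \<in> car V ==> v \<in> car V ==> f u = f v \<longleftrightarrow> u = v" "f ` car V = car W" "inj_on f (car V)"
  using assms inv_into_into[of w f "car V"] unfolding lin_iso_def
  by (auto simp: lin_mapD bij_betw_inv_into_left bij_betw_inv_into_right bij_betw_def inj_on_eq_iff)

lemma lin_iso_inv:
  assumes "is_vspace V" "lin_iso V W f"
  shows "lin_iso W V (inv_into (car V) f)"
  unfolding lin_iso_def lin_map_def
proof (intro conjI ballI allI funcsetI)
  note D = lin_isoD[OF assms(2)] lin_mapD[OF lin_isoD(1)[OF assms(2)]] is_vspaceD[OF assms(1)]
  show "inv_into (car V) f w \<in> car V" if "w \<in> car W" for w using D that by blast
  show "bij_betw (inv_into (car V) f) (car W) (car V)"
    using assms(2) bij_betw_inv_into unfolding lin_iso_def by blast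
  show "inv_into (car V) f (vadd W u v) = vadd V (inv_into (car V) f u) (inv_into (car V) f v)"
    if "u \<in> car W" "v \<in> car W" for u v
    by (metis D(3-5) D(10) D(13) that)
  show "inv_into (car V) f (vscale W c v) = vscale V c (inv_into (car V) f v)"
    if "v \<in> car W" for c v
    by (metis D(3-5) D(11) D(14) that)
qed

lemma lin_iso_comp: "lin_iso V W f ==> lin_iso W Z g ==> lin_iso V Z (\<lambda>v. g (f v))"
  unfolding lin_iso_def using lin_map_comp[of V W f Z g] bij_betw_trans[of f "car V" "car W" g "car Z"]
  by (simp add: comp_def)

text \<open>Restriction of scalars, which lets the dual basis construction over \<K> produce real
  bases as well.\<close>

definition real_vspace :: "('k::real_or_complex, 'v) vspace \<Rightarrow> (real, 'v) vspace" where
  "real_vspace V =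
     \<lparr>car = car V, vadd = vadd V, vzero = vzero V, vscale = (\<lambda>r. vscale V (of_real r))\<rparr>"

lemma is_vspace_real_vspace: "is_vspace V ==> is_vspace (real_vspace V)"
  unfolding real_vspace_def is_vspace_def by (auto simp: of_real_add of_real_mult)

text \<open>Drops the extensionality built into \<open>real_dual\<close>, so that composites such as
  \<open>\<lambda>v. l (f v)\<close> qualify as they stand; \<open>restrict_real_dual\<close> leads
  back.\<close>

definition real_functional :: "('k::real_or_complex, 'v) vspace \<Rightarrow> ('v \<Rightarrow> real) \<Rightarrow> bool" where
  "real_functional V l \<longleftrightarrow> functional (real_vspace V) l"

lemma real_functional_iff:
  "real_functional V l \<longleftrightarrow>
     (\<forall>u\<in>car V. \<forall>v\<in>car V. l (vadd V u v) = l u + l v) \<and>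
     (\<forall>r. \<forall>v\<in>car V. l (vscale V (of_real r) v) = r * l v)"
  unfolding real_functional_def functional_def real_vspace_def by simp

lemma real_dual_iff: "l \<in> real_dual V \<longleftrightarrow> l \<in> extensional (car V) \<and> real_functional V l"
  unfolding real_dual_def real_functional_iff by auto

lemma restrict_real_dual:
  assumes "is_vspace V" "real_functional V l"
  shows "restrict l (car V) \<in> real_dual V"
  using assms is_vspaceD(2,3)[OF assms(1)] unfolding real_dual_iff real_functional_iff by auto

lemma real_functional_comp:
  "lin_map V W f ==> real_functional W l ==> real_functional V (\<lambda>v. l (f v))"
  unfolding lin_map_def real_functional_iff by (auto simp: Pi_iff)

text \<open>For \<open>\<K> = \<real>\<close> the imaginary part is \<open>0\<close>.\<close>

lemma ex_real_imaginary_parts: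
  "\<exists>(re :: 'k::real_or_complex \<Rightarrow> real) im. (\<forall>z w. re (z + w) = re z + re w \<and> im (z + w) = im z + im w) \<and>
    (\<forall>r z. re (of_real r * z) = r * re z \<and> im (of_real r * z) = r * im z) \<and>
    (\<forall>z w. re z = re w \<and> im z = im w \<longrightarrow> z = w)"
proof (cases "\<forall>z :: 'k. \<exists>a. z = a *\<^sub>R 1")
  case True
  then obtain re where re: "\<And>z :: 'k. z = re z *\<^sub>R 1" by metis
  have 1: "a = re z" if "z = a *\<^sub>R 1" for a z using re[of z] that by (metis scaleR_right_imp_eq zero_neq_one)
  have "re (z + w) = re z + re w" for z w
    by (rule 1[symmetric]) (metis re scaleR_left_distrib)
  moreover have "re (of_real r * z) = r * re z" for r z
    by (rule 1[symmetric]) (metis re of_real_def mult_scaleR_left mult_1 scaleR_scaleR)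
  moreover have "z = w" if "re z = re w" for z w using re[of z] re[of w] that by simp
  ultimately show ?thesis by (intro exI[of _ re] exI[of _ "\<lambda>_. 0"]) auto
next
  case False
  then obtain i :: 'k where i: "i * i = - 1" "\<forall>z. \<exists>a b. z = a *\<^sub>R 1 + b *\<^sub>R i"
    using real_or_complex by blast
  then obtain re im where ri: "\<And>z :: 'k. z = re z *\<^sub>R 1 + im z *\<^sub>R i" by metis
  \<comment> \<open>A square root of -1 is no real multiple of 1. This makes 1 and \<open>i\<close>
    linearly independent over the reals and the two parts well defined.\<close>
  have inot: "i \<noteq> a *\<^sub>R 1" for a
  proof
    assume "i = a *\<^sub>R 1"
    then have "(a * a) *\<^sub>R (1 :: 'k) = (- 1) *\<^sub>R 1" using i(1) by simp
    then have "a * a = - 1" by (metis scaleR_right_imp_eq zero_neq_one)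
    then show False using zero_le_square[of a] by linarith
  qed
  have u0: "c = 0 \<and> d = 0" if "c *\<^sub>R 1 + d *\<^sub>R i = 0" for c d
  proof -
    have "d = 0"
    proof (rule ccontr)
      assume d: "d \<noteq> 0"
      have "d *\<^sub>R i = (- c) *\<^sub>R 1" using that by (simp add: eq_neg_iff_add_eq_0 add.commute)
      then have "(1 / d) *\<^sub>R (d *\<^sub>R i) = (1 / d) *\<^sub>R ((- c) *\<^sub>R 1)" by simp
      then have "i = (- c / d) *\<^sub>R 1" using d by (simp add: divide_inverse mult.commute)
      then show False using inot by blast
    qed
    then show ?thesis using that by simp
  qed
  have uniq: "a = re z \<and> b = im z" if "z = a *\<^sub>R 1 + b *\<^sub>R i" for a b z
  proof -
    have "(a - re z) *\<^sub>R 1 + (b - im z) *\<^sub>R i = (a *\<^sub>R 1 + b *\<^sub>R i) - (re z *\<^sub>R 1 + im z *\<^sub>R i)"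
      by (simp add: algebra_simps)
    also have "\<dots> = 0" using that ri[of z] by simp
    finally show ?thesis using u0[of "a - re z" "b - im z"] by simp
  qed
  have "re z + re w = re (z + w) \<and> im z + im w = im (z + w)" for z w
    by (rule uniq) (subst ri[of z], subst ri[of w], simp add: algebra_simps)
  moreover have "r * re z = re (of_real r * z) \<and> r * im z = im (of_real r * z)" for r z
    by (rule uniq) (subst ri[of z], simp add: algebra_simps of_real_def)
  moreover have "z = w" if "re z = re w" "im z = im w" for z w using ri[of z] ri[of w] that by simp
  ultimately show ?thesis by (intro exI[of _ re] exI[of _ im]) auto
qed

text \<open>The real and imaginary parts of the \<K>-coordinates separate points.\<close>

lemma ex_finite_separating_real_functionals:
  assumes "fin_dim_vspace V"
  obtains F where "finite F" "separating V F" "\<And>f. f \<in> F ==> real_functional V f"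
proof -
  obtain n f where f: "lin_iso V (coord_space n) f" using assms unfolding fin_dim_vspace_def by blast
  obtain re im :: "'a \<Rightarrow> real" where ri: "\<forall>z w. re (z + w) = re z + re w \<and> im (z + w) = im z + im w"
    "\<forall>r z. re (of_real r * z) = r * re z \<and> im (of_real r * z) = r * im z"
    "\<forall>z w. re z = re w \<and> im z = im w \<longrightarrow> z = w"
    using ex_real_imaginary_parts by blast
  define F where "F = (\<lambda>i v. re (f v i)) ` {..<n} \<union> (\<lambda>i v. im (f v i)) ` {..<n}"
  have "finite F" unfolding F_def by auto
  moreover have "separating V F"
    unfolding separating_def
  proof (intro ballI impI)
    fix u v assume uv: "u \<in> car V" "v \<in> car V" and *: "\<forall>l\<in>F. l u = l v"
    have "f u i = f v i" for i
    proof (cases "i < n")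
      case True
      then have "(\<lambda>v. re (f v i)) \<in> F" "(\<lambda>v. im (f v i)) \<in> F" unfolding F_def by auto
      then have "re (f u i) = re (f v i)" "im (f u i) = im (f v i)" using * by (auto dest: bspec)
      then show ?thesis using ri(3) by simp
    next
      case False
      then show ?thesis
        using lin_isoD(2)[OF f uv(1)] lin_isoD(2)[OF f uv(2)] by (simp add: coord_space_def)
    qed
    then show "u = v" using lin_isoD(6)[OF f uv] by auto
  qed
  moreover have "real_functional V l" if "l \<in> F" for l
    using that lin_mapD[OF lin_isoD(1)[OF f]] ri
    unfolding F_def real_functional_iff by (auto simp: coord_space_def)
  ultimately show ?thesis using that by blast
qed

lemma real_dual_basis_of_separating:
  assumes V: "is_vspace V" and "finite F" "separating V F" "\<And>f. f \<in> F ==> real_functional V f"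
  obtains G e where "G \<subseteq> F" "separating V G" "\<And>g. g \<in> G ==> e g \<in> car V"
    "\<And>f g. f \<in> G ==> g \<in> G ==> f (e g) = (if f = g then 1 else 0)"
    "\<And>l v. real_functional V l ==> v \<in> car V ==> l v = (\<Sum>g\<in>G. g v * l (e g))"
proof -
  have sep: "separating (real_vspace V) G = separating V G" for G :: "('b \<Rightarrow> real) set"
    unfolding separating_def real_vspace_def by simp
  have car: "car (real_vspace V) = car V" by (simp add: real_vspace_def)
  show ?thesis
    by (rule ex_dual_basis[OF is_vspace_real_vspace[OF V] assms(2), unfolded sep car,
          OF assms(4)[unfolded real_functional_def] assms(3)])
      (assumption | (rule that[unfolded real_functional_def]; assumption))+
qed

text \<open>The functionals are restricted to the carrier so that they belong to
  \<open>real_dual\<close>, the set by which smoothness is tested; numbers as indices avoid summing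
  over a set of functions.\<close>

lemma ex_real_basis:
  assumes V: "fin_dim_vspace V"
  obtains r :: nat and \<epsilon> e where "\<And>i. i < r ==> \<epsilon> i \<in> real_dual V" "\<And>i. i < r ==> e i \<in> car V"
    "\<And>i j. i < r ==> j < r ==> \<epsilon> i (e j) = (if i = j then 1 else 0)"
    "\<And>l v. real_functional V l ==> v \<in> car V ==> l v = (\<Sum>i<r. \<epsilon> i v * l (e i))"
    "separating V (\<epsilon> ` {..<r})"
proof -
  have vs: "is_vspace V" using V unfolding fin_dim_vspace_def by blast
  obtain F where F: "finite F" "separating V F" "\<And>f. f \<in> F ==> real_functional V f"
    by (rule ex_finite_separating_real_functionals[OF V]) (assumption | (rule that; assumption))+
  obtain G e where G: "G \<subseteq> F" "separating V G" "\<And>g. g \<in> G ==> e g \<in> car V"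
    "\<And>f g. f \<in> G ==> g \<in> G ==> f (e g) = (if f = g then 1 else 0)"
    "\<And>l v. real_functional V l ==> v \<in> car V ==> l v = (\<Sum>g\<in>G. g v * l (e g))"
    by (rule real_dual_basis_of_separating[OF vs F]) (assumption | (rule that; assumption))+
  have "finite G" using G F finite_subset by blast
  then obtain h and n :: nat where h: "bij_betw h {..<n} G"
    using ex_bij_betw_nat_finite[of G] that[unfolded lessThan_atLeast0] by blast
  have hG: "h i \<in> G" if "i < n" for i using h that bij_betwE by blast
  let ?\<epsilon> = "\<lambda>i. restrict (h i) (car V)"
  show ?thesis
  proof (rule that[of n ?\<epsilon> "\<lambda>i. e (h i)"])
    show "?\<epsilon> i \<in> real_dual V" if "i < n" for i
      using restrict_real_dual[OF vs] F(3) G(1) hG[OF that] by blast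
    show "e (h i) \<in> car V" if "i < n" for i using G(3) hG that by blast
    then show "?\<epsilon> i (e (h j)) = (if i = j then 1 else 0)" if "i < n" "j < n" for i j
      using G(4)[OF hG hG, OF that] h that by (auto simp: bij_betw_def inj_on_def)
    show "l v = (\<Sum>i<n. ?\<epsilon> i v * l (e (h i)))" if "real_functional V l" "v \<in> car V" for l v
    proof -
      have "l v = (\<Sum>g\<in>G. g v * l (e g))" using G(5) that by blast
      also have "\<dots> = (\<Sum>i<n. h i v * l (e (h i)))"
        by (rule sum.reindex_bij_betw[OF h, symmetric])
      finally show ?thesis using that by simp
    qed
    show "separating V (?\<epsilon> ` {..<n})"
      unfolding separating_def
    proof (intro ballI impI)
      fix u v assume uv: "u \<in> car V" "v \<in> car V" "\<forall>f\<in>?\<epsilon> ` {..<n}. f u = f v"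
      then have "\<forall>f\<in>G. f u = f v" using h unfolding bij_betw_def by auto
      then show "u = v" using G(2) uv unfolding separating_def by blast
    qed
  qed
qed

lemma real_dual_eqI:
  assumes "fin_dim_vspace V" "u \<in> car V" "v \<in> car V" "\<And>l. l \<in> real_dual V ==> l u = l v"
  shows "u = v"
proof -
  obtain r :: nat and \<epsilon> where "\<And>i. i < r ==> \<epsilon> i \<in> real_dual V" "separating V (\<epsilon> ` {..<r})"
    by (rule ex_real_basis[OF assms(1)]) (assumption | (rule that; assumption))+
  then show ?thesis using assms unfolding separating_def by auto
qed

lemma lin_iso_fin_dim:
  assumes V: "is_vspace V" and W: "fin_dim_vspace W" and f: "lin_iso V W f"
  shows "fin_dim_vspace V"
proof -
  obtain n g where "lin_iso W (coord_space n) g" using W unfolding fin_dim_vspace_def by blast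
  then have "lin_iso V (coord_space n) (\<lambda>v. g (f v))" by (rule lin_iso_comp[OF f])
  then show ?thesis using V unfolding fin_dim_vspace_def by blast
qed

subsection \<open>Spaces of maps\<close>

text \<open>The closure properties that make \<open>maps_vspace S V F\<close> a vector space. They
  concern extensional members of \<open>F\<close> only, because \<open>F\<close> is usually a
  condition such as linearity that ignores values outside \<open>S\<close>.\<close>

definition map_subspace :: "'s set \<Rightarrow> ('k::field, 'v) vspace \<Rightarrow> ('s \<Rightarrow> 'v) set \<Rightarrow> bool" where
  "map_subspace S V F \<longleftrightarrow> is_vspace V \<and> extensional S \<inter> F \<subseteq> S \<rightarrow> car V \<and>
     (\<lambda>s\<in>S. vzero V) \<in> F \<and>
     (\<forall>f\<in>extensional S \<inter> F. \<forall>g\<in>extensional S \<inter> F. (\<lambda>s\<in>S. vadd V (f s) (g s)) \<in> F) \<and>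
     (\<forall>c. \<forall>f\<in>extensional S \<inter> F. (\<lambda>s\<in>S. vscale V c (f s)) \<in> F)"

lemma maps_vspace_simps:
  "car (maps_vspace S V F) = extensional S \<inter> F"
  "vadd (maps_vspace S V F) f g = (\<lambda>s\<in>S. vadd V (f s) (g s))"
  "vzero (maps_vspace S V F) = (\<lambda>s\<in>S. vzero V)"
  "vscale (maps_vspace S V F) c f = (\<lambda>s\<in>S. vscale V c (f s))"
  by (simp_all add: maps_vspace_def)

lemma map_subspaceD:
  assumes "map_subspace S V F"
  shows "f \<in> extensional S ==> f \<in> F ==> s \<in> S ==> f s \<in> car V" "is_vspace V"
  using assms unfolding map_subspace_def by auto

lemma is_vspace_maps:
  assumes F: "map_subspace S V F"
  shows "is_vspace (maps_vspace S V F)"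
proof -
  have V: "is_vspace V" using F by (simp add: map_subspace_def)
  note D = is_vspaceD[OF V]
  have val: "f s \<in> car V" if "f \<in> extensional S" "f \<in> F" "s \<in> S" for f s
    using F that unfolding map_subspace_def by (auto simp: Pi_iff)
  have "\<exists>g\<in>extensional S \<inter> F. (\<lambda>s\<in>S. vadd V (f s) (g s)) = (\<lambda>s\<in>S. vzero V)"
    if f: "f \<in> extensional S" "f \<in> F" for f
  proof
    show "(\<lambda>s\<in>S. vscale V (- 1) (f s)) \<in> extensional S \<inter> F"
      using F f unfolding map_subspace_def by auto
    have "vadd V (f s) (vscale V (- 1) (f s)) = vzero V" if s: "s \<in> S" for s
    proof -
      have "vadd V (f s) (vscale V (- 1) (f s)) = vadd V (vscale V 1 (f s)) (vscale V (- 1) (f s))"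
        using D(11) val f s by simp
      also have "\<dots> = vscale V (1 + - 1) (f s)" using D(9)[OF val[OF f s]] by metis
      finally show ?thesis using vscale_0[OF V val[OF f s]] by simp
    qed
    then show "(\<lambda>s\<in>S. vadd V (f s) ((\<lambda>s\<in>S. vscale V (- 1) (f s)) s)) = (\<lambda>s\<in>S. vzero V)"
      by (intro restrict_ext) simp
  qed
  moreover have "(\<lambda>s\<in>S. vadd V (vzero V) (f s)) = f" "(\<lambda>s\<in>S. vscale V 1 (f s)) = f"
    if "f \<in> extensional S" "f \<in> F" for f
    using that by (auto intro!: extensionalityI[of _ S] simp: D(6,11)[OF val])
  ultimately show ?thesis
    using F unfolding is_vspace_def maps_vspace_simps map_subspace_def
    by (auto intro!: restrict_ext simp: val D(4,8,9,10) ) (auto simp: val D(5) cong: restrict_cong)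
qed

lemma maps_functional:
  assumes "functional V l" "map_subspace S V F" "s \<in> S"
  shows "functional (maps_vspace S V F) (\<lambda>f. l (f s))"
  using assms(1,3) map_subspaceD(1)[OF assms(2)] unfolding functional_def maps_vspace_simps by simp

lemma maps_real_functional:
  assumes "real_functional V l" "map_subspace S V F" "s \<in> S"
  shows "real_functional (maps_vspace S V F) (\<lambda>f. l (f s))"
  using assms(1,3) map_subspaceD(1)[OF assms(2)] unfolding real_functional_iff maps_vspace_simps by simp

lemma fin_dim_coordinates:
  assumes "fin_dim_vspace V"
  obtains F where "finite F" "separating V F" "\<And>f. f \<in> F ==> functional V f"
proof -
  obtain n f where f: "lin_iso V (coord_space n) f" using assms unfolding fin_dim_vspace_def by blast
  have "separating V ((\<lambda>i v. f v i) ` {..<n})"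
    unfolding separating_def
  proof (intro ballI impI)
    fix u v assume uv: "u \<in> car V" "v \<in> car V" and *: "\<forall>l\<in>(\<lambda>i v. f v i) ` {..<n}. l u = l v"
    have "f u i = f v i" for i
      using * lin_isoD(2)[OF f uv(1)] lin_isoD(2)[OF f uv(2)]
      by (cases "i < n") (auto simp: coord_space_def)
    then show "u = v" using lin_isoD(6)[OF f uv] by auto
  qed
  moreover have "functional V l" if "l \<in> (\<lambda>i v. f v i) ` {..<n}" for l
    using that lin_mapD[OF lin_isoD(1)[OF f]] unfolding functional_def by (auto simp: coord_space_def)
  ultimately show ?thesis using that by blast
qed

text \<open>Evaluation at the points of \<open>T\<close> followed by coordinates of \<open>V\<close>
  separates the maps. \<open>T\<close> will be a basis for spaces of endomorphisms, a dual basis for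
  tensors and the index set for families of coefficients.\<close>

lemma fin_dim_maps:
  assumes F: "map_subspace S V F" and V: "fin_dim_vspace V" and T: "finite T" "T \<subseteq> S"
    and det: "\<And>f g. f \<in> extensional S \<inter> F ==> g \<in> extensional S \<inter> F ==> (\<And>s. s \<in> T ==> f s = g s) ==> f = g"
  shows "fin_dim_vspace (maps_vspace S V F)"
proof -
  obtain K where K: "finite K" "separating V K" "\<And>f. f \<in> K ==> functional V f"
    by (rule fin_dim_coordinates[OF V]) (assumption | (rule that; assumption))+
  show ?thesis
  proof (rule fin_dim_vspaceI[OF is_vspace_maps[OF F]])
    let ?G = "(\<lambda>(l, s) f. l (f s)) ` (K \<times> T)"
    show "finite ?G" using K T by auto
    show "functional (maps_vspace S V F) g" if "g \<in> ?G" for g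
      using that K(3) T(2) F maps_functional by fastforce
    show "separating (maps_vspace S V F) ?G"
      unfolding separating_def maps_vspace_simps
    proof (intro ballI impI)
      fix f g assume fg: "f \<in> extensional S \<inter> F" "g \<in> extensional S \<inter> F" and *: "\<forall>h\<in>?G. h f = h g"
      show "f = g"
      proof (rule det[OF fg])
        fix s assume s: "s \<in> T"
        have "f s \<in> car V" "g s \<in> car V" using fg F s T unfolding map_subspace_def by (auto simp: Pi_iff)
        moreover have "\<forall>l\<in>K. l (f s) = l (g s)" using * s by auto
        ultimately show "f s = g s" using K(2) unfolding separating_def by blast
      qed
    qed
  qed
qed

section \<open>Finite-dimensional inner product spaces\<close>

lemma ex_orthonormal_basis:
  "\<exists>B :: 'a::fin_dim_inner set. finite B \<and>
     (\<forall>b\<in>B. \<forall>c\<in>B. b \<bullet> c = (if b = c then 1 else 0)) \<and> (\<forall>x. (\<Sum>b\<in>B. (x \<bullet> b) *\<^sub>R b) = x)"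
proof -
  obtain S :: "'a set" where S: "finite S" "\<forall>x. \<exists>c. x = (\<Sum>b\<in>S. c b *\<^sub>R b)"
    using finite_spanning_set by blast
  have "x \<in> span S" for x
  proof -
    obtain c where "x = (\<Sum>b\<in>S. c b *\<^sub>R b)" using S(2) by blast
    then show ?thesis by (simp add: span_sum span_scale span_base)
  qed
  then have spS: "span S = UNIV" by blast
  obtain C :: "'a set" where C: "finite C" "span C = UNIV" "pairwise orthogonal C"
    using basis_orthogonal[OF S(1)] unfolding spS by blast
  \<comment> \<open>The orthogonal family may contain 0, which has to be dropped before
    normalizing.\<close>
  define B where "B = (\<lambda>c. (1 / norm c) *\<^sub>R c) ` (C - {0})"
  have fB: "finite B" unfolding B_def using C by simp
  have on: "b \<bullet> c = (if b = c then 1 else 0)" if bc: "b \<in> B" "c \<in> B" for b c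
  proof -
    obtain b' c' where b': "b' \<in> C" "b' \<noteq> 0" "b = (1 / norm b') *\<^sub>R b'"
      and c': "c' \<in> C" "c' \<noteq> 0" "c = (1 / norm c') *\<^sub>R c'"
      using bc unfolding B_def by blast
    show ?thesis
    proof (cases "b' = c'")
      case True
      then have "b = c" using b' c' by simp
      moreover have "b \<bullet> b = 1" using b' by (simp add: dot_square_norm power2_eq_square)
      ultimately show ?thesis by simp
    next
      case False
      then have "b' \<bullet> c' = 0" using C(3) b' c' unfolding pairwise_def orthogonal_def by blast
      then have "b \<bullet> c = 0" using b' c' by simp
      moreover have "b \<bullet> b = 1" using b' by (simp add: dot_square_norm power2_eq_square)
      ultimately show ?thesis by auto
    qed
  qed
  have "(\<Sum>b\<in>B. (x \<bullet> b) *\<^sub>R b) = x" for x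
  proof -
    \<comment> \<open>What remains after projection is orthogonal to \<open>C\<close>, hence to the
      whole space and to itself.\<close>
    define y where "y = x - (\<Sum>b\<in>B. (x \<bullet> b) *\<^sub>R b)"
    have yB: "y \<bullet> b = 0" if b: "b \<in> B" for b
    proof -
      have "(\<Sum>c\<in>B. (x \<bullet> c) *\<^sub>R c) \<bullet> b = (\<Sum>c\<in>B. (x \<bullet> c) * (c \<bullet> b))"
        by (simp add: inner_sum_left)
      also have "\<dots> = (\<Sum>c\<in>B. if c = b then x \<bullet> c else 0)"
        by (intro sum.cong refl) (simp add: on b)
      also have "\<dots> = x \<bullet> b" using fB b by simp
      finally show ?thesis by (simp add: y_def inner_diff_left)
    qed
    have "C \<subseteq> {z. y \<bullet> z = 0}"
    proof
      fix c assume c: "c \<in> C"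
      show "c \<in> {z. y \<bullet> z = 0}"
      proof (cases "c = 0")
        case False
        then have "(1 / norm c) *\<^sub>R c \<in> B" unfolding B_def using c by blast
        then have "y \<bullet> ((1 / norm c) *\<^sub>R c) = 0" by (rule yB)
        then show ?thesis using False by simp
      qed simp
    qed
    then have "span C \<subseteq> {z. y \<bullet> z = 0}" by (rule span_minimal[OF _ subspace_hyperplane])
    then have "y \<bullet> y = 0" using C(2) by blast
    then show ?thesis by (simp add: y_def)
  qed
  then show ?thesis using fB on by blast
qed

text \<open>One choice for the whole development, so that coefficients in different charts share
  their index set. It is empty in dimension 0.\<close>

definition onb :: "'a::fin_dim_inner set" where
  "onb = (SOME B. finite B \<and> (\<forall>b\<in>B. \<forall>c\<in>B. b \<bullet> c = (if b = c then 1 else 0)) \<and>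
     (\<forall>x. (\<Sum>b\<in>B. (x \<bullet> b) *\<^sub>R b) = x))"

lemma onb:
  "finite (onb :: 'a::fin_dim_inner set)"
  "b \<in> onb ==> c \<in> onb ==> (b :: 'a) \<bullet> c = (if b = c then 1 else 0)"
  "(\<Sum>b\<in>onb. (x \<bullet> b) *\<^sub>R b) = (x :: 'a)"
proof -
  have "finite (onb :: 'a set) \<and> (\<forall>b\<in>onb. \<forall>c\<in>onb. (b :: 'a) \<bullet> c = (if b = c then 1 else 0)) \<and>
      (\<forall>x :: 'a. (\<Sum>b\<in>onb. (x \<bullet> b) *\<^sub>R b) = x)"
    unfolding onb_def by (rule someI_ex[OF ex_orthonormal_basis])
  then show "finite (onb :: 'a set)" "(\<Sum>b\<in>onb. (x \<bullet> b) *\<^sub>R b) = (x :: 'a)"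
    "b \<in> onb ==> c \<in> onb ==> (b :: 'a) \<bullet> c = (if b = c then 1 else 0)"
    by simp_all
qed

lemma linear_onb:
  fixes x :: "'a::fin_dim_inner"
  assumes "linear l"
  shows "l x = (\<Sum>b\<in>onb. (x \<bullet> b) *\<^sub>R l b)"
proof -
  have "l x = l (\<Sum>b\<in>onb. (x \<bullet> b) *\<^sub>R b)" by (simp add: onb(3))
  then show ?thesis using assms by (simp add: linear_sum linear_scale)
qed

text \<open>Makes closed balls in the chart space compact. Coordinates with respect to
  \<open>onb\<close> reduce the claim to bounded real sequences.\<close>

instance fin_dim_inner \<subseteq> heine_borel
proof
  fix f :: "nat \<Rightarrow> 'a"
  assume f: "bounded (range f)"
  let ?u = "\<lambda>e. \<Sum>b\<in>onb. e b *\<^sub>R b :: 'a"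
  have 1: "?u e \<bullet> k = e k" if "k \<in> onb" for e k
  proof -
    have "?u e \<bullet> k = (\<Sum>b\<in>onb. if b = k then e b else 0)"
      unfolding inner_sum_left by (intro sum.cong refl) (simp add: onb(2) that)
    then show ?thesis using that by (simp add: onb(1))
  qed
  have "\<forall>d\<subseteq>(onb :: 'a set). \<exists>l::'a. \<exists>r::nat \<Rightarrow> nat. strict_mono r \<and>
    (\<forall>e>0. eventually (\<lambda>n. \<forall>i\<in>d. dist (f (r n) \<bullet> i) (l \<bullet> i) < e) sequentially)"
  proof (rule compact_lemma_general[where unproj = ?u and proj = "(\<bullet>)"])
    show "bounded ((\<lambda>x. x \<bullet> k) ` range f)" for k
      using f by (rule bounded_linear_image) (rule bounded_linear_inner_left)
  qed (auto simp: onb 1)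
  then obtain l :: 'a and r :: "nat \<Rightarrow> nat" where r: "strict_mono r"
    and l: "\<forall>e>0. eventually (\<lambda>n. \<forall>i\<in>onb. dist (f (r n) \<bullet> i) (l \<bullet> i) < e) sequentially"
    by blast
  have "(\<lambda>n. f (r n) \<bullet> i) \<longlonglongrightarrow> l \<bullet> i" if "i \<in> onb" for i
    unfolding tendsto_iff using l that by (auto elim!: eventually_mono)
  then have "(\<lambda>n. \<Sum>i\<in>onb. (f (r n) \<bullet> i) *\<^sub>R i) \<longlonglongrightarrow> (\<Sum>i\<in>onb. (l \<bullet> i) *\<^sub>R i)"
    by (intro tendsto_sum tendsto_scaleR tendsto_const)
  then have "(f \<circ> r) \<longlonglongrightarrow> l" unfolding onb(3) comp_def .
  then show "\<exists>l r. strict_mono r \<and> (f \<circ> r) \<longlonglongrightarrow> l" using r by blast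
qed

instance fin_dim_inner \<subseteq> banach ..

section \<open>Calculus of smooth functions\<close>

lemma k_times_cong:
  assumes "open S" "\<And>x. x \<in> S ==> f x = g x" "k_times_differentiable_on k S f"
  shows "k_times_differentiable_on k S g"
  using assms(2,3)
proof (induction k arbitrary: f g)
  case 0
  then show ?case using continuous_on_cong[of S S f g] by simp
next
  case (Suc k)
  have d: "f differentiable (at x)" if "x \<in> S" for x
    using Suc.prems(2) that by simp
  have "g differentiable (at x)" if "x \<in> S" for x
    using has_derivative_transform_within_open[OF d[OF that, unfolded frechet_derivative_works] assms(1) that Suc.prems(1)]
    unfolding differentiable_def by blast
  moreover have "k_times_differentiable_on k S (\<lambda>x. frechet_derivative g (at x) v)" for v
  proof (rule Suc.IH)
    show "k_times_differentiable_on k S (\<lambda>x. frechet_derivative f (at x) v)" using Suc.prems(2) by simp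
    show "frechet_derivative f (at x) v = frechet_derivative g (at x) v" if "x \<in> S" for x
      using frechet_derivative_transform_within_open[OF d[OF that] assms(1) that Suc.prems(1)] by simp
  qed
  ultimately show ?case by simp
qed

text \<open>Lets the derivative be supplied by a formula instead of
  \<open>frechet_derivative\<close>, which is how each rule of differentiation enters the inductions
  below.\<close>

lemma k_times_SucI:
  assumes "open S" and f': "\<And>x. x \<in> S ==> (f has_derivative f' x) (at x)"
    and "\<And>v. k_times_differentiable_on k S (\<lambda>x. f' x v)"
  shows "k_times_differentiable_on (Suc k) S f"
proof -
  have "frechet_derivative f (at x) = f' x" if "x \<in> S" for x
    using frechet_derivative_at[OF f'[OF that]] by simp
  then have "k_times_differentiable_on k S (\<lambda>x. frechet_derivative f (at x) v)" for v
    by (intro k_times_cong[OF assms(1) _ assms(3)[of v]]) simp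
  moreover have "f differentiable (at x)" if "x \<in> S" for x
    using f'[OF that] unfolding differentiable_def by blast
  ultimately show ?thesis by simp
qed

lemma k_times_SucD:
  assumes "k_times_differentiable_on (Suc k) S f"
  shows "x \<in> S ==> (f has_derivative frechet_derivative f (at x)) (at x)"
    "k_times_differentiable_on k S (\<lambda>x. frechet_derivative f (at x) v)"
  using assms by (auto simp: frechet_derivative_works)

lemma k_times_continuous: "k_times_differentiable_on k S f ==> continuous_on S f"
  by (cases k) (auto intro!: continuous_at_imp_continuous_on differentiable_imp_continuous_within)

lemma k_times_pred: "k_times_differentiable_on (Suc k) S f ==> k_times_differentiable_on k S f"
proof (induction k arbitrary: f)
  case 0
  then show ?case using k_times_continuous[of "Suc 0" S f] by simp
next
  case (Suc k)
  have "k_times_differentiable_on k S (\<lambda>x. frechet_derivative f (at x) v)" for v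
    using Suc.IH[OF k_times_SucD(2)[OF Suc.prems]] .
  then show ?case using Suc.prems by simp
qed

lemma k_times_subset:
  "T \<subseteq> S ==> k_times_differentiable_on k S f ==> k_times_differentiable_on k T f"
  by (induction k arbitrary: f) (auto intro: continuous_on_subset)

lemma k_times_local:
  assumes "\<And>x. x \<in> S ==> \<exists>T. open T \<and> x \<in> T \<and> k_times_differentiable_on k (T \<inter> S) f"
    and "open S"
  shows "k_times_differentiable_on k S f"
  using assms(1)
proof (induction k arbitrary: f)
  case 0
  have "continuous (at x) f" if x: "x \<in> S" for x
  proof -
    obtain T where "open T" "x \<in> T" "continuous_on (T \<inter> S) f" using 0[OF x] by auto
    then show ?thesis
      using x assms(2) by (metis IntI continuous_on_eq_continuous_at open_Int)
  qed
  then show ?case by (simp add: continuous_at_imp_continuous_on)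
next
  case (Suc k)
  have "f differentiable (at x)" if x: "x \<in> S" for x
  proof -
    obtain T where "x \<in> T" "k_times_differentiable_on (Suc k) (T \<inter> S) f" using Suc.prems[OF x] by blast
    then show ?thesis using x by simp
  qed
  moreover have "k_times_differentiable_on k S (\<lambda>x. frechet_derivative f (at x) v)" for v
  proof (rule Suc.IH)
    fix x assume "x \<in> S"
    from Suc.prems[OF this]
    show "\<exists>T. open T \<and> x \<in> T \<and>
        k_times_differentiable_on k (T \<inter> S) (\<lambda>x. frechet_derivative f (at x) v)" by auto
  qed
  ultimately show ?case by simp
qed

lemma k_times_const: "open S ==> k_times_differentiable_on k S (\<lambda>x. c)"
proof (induction k arbitrary: c)
  case (Suc k)
  show ?case by (rule k_times_SucI[where f' = "\<lambda>x v. 0"]) (use Suc in auto)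
qed simp

lemma k_times_add:
  assumes "open S"
  shows "k_times_differentiable_on k S f ==> k_times_differentiable_on k S g ==>
    k_times_differentiable_on k S (\<lambda>x. f x + g x)"
proof (induction k arbitrary: f g)
  case (Suc k)
  note f = k_times_SucD[OF Suc.prems(1)] and g = k_times_SucD[OF Suc.prems(2)]
  show ?case
    by (rule k_times_SucI[OF assms has_derivative_add[OF f(1) g(1)]]) (use Suc.IH[OF f(2) g(2)] assms in auto)
qed (auto intro: continuous_on_add)

lemma k_times_bounded_linear:
  assumes "open S" and l: "bounded_linear l"
  shows "k_times_differentiable_on k S f ==> k_times_differentiable_on k S (\<lambda>x. l (f x))"
proof (induction k arbitrary: f)
  case 0
  then show ?case using bounded_linear.continuous_on[OF l] by simp
next
  case (Suc k)
  note f = k_times_SucD[OF Suc.prems(1)]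
  show ?case
    by (rule k_times_SucI[OF assms(1) bounded_linear.has_derivative[OF l f(1)]])
      (use Suc.IH[OF f(2)] assms in auto)
qed

lemma k_times_ident: "open S ==> k_times_differentiable_on k S (\<lambda>x. x)"
proof (induction k)
  case (Suc k)
  show ?case
    by (rule k_times_SucI[where f' = "\<lambda>x v. v"]) (use Suc k_times_const in auto)
qed simp

lemma k_times_mult:
  fixes f g :: "'a::real_normed_vector \<Rightarrow> real"
  assumes "open S"
  shows "k_times_differentiable_on k S f ==> k_times_differentiable_on k S g ==>
    k_times_differentiable_on k S (\<lambda>x. f x * g x)"
proof (induction k arbitrary: f g)
  case (Suc k)
  note f = k_times_SucD[OF Suc.prems(1)] and g = k_times_SucD[OF Suc.prems(2)]
  have "k_times_differentiable_on k S (\<lambda>x. f x * frechet_derivative g (at x) v +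
      frechet_derivative f (at x) v * g x)" for v
    by (intro k_times_add Suc.IH assms k_times_pred[OF Suc.prems(1)] k_times_pred[OF Suc.prems(2)] f(2) g(2))
  then show ?case
    by (intro k_times_SucI[OF assms has_derivative_mult[OF f(1) g(1)]])
qed (auto intro: continuous_on_mult)

lemma k_times_sum:
  assumes "open S" "\<And>i. i \<in> I ==> k_times_differentiable_on k S (f i)"
  shows "k_times_differentiable_on k S (\<lambda>x. \<Sum>i\<in>I. f i x)"
  using assms(2)
  by (induction I rule: infinite_finite_induct) (auto intro: k_times_add k_times_const assms(1))

text \<open>Expanding the chain rule in \<open>onb\<close> turns the derivative into a sum of
  products of real functions, each of which is a composite of lower order or a component of the
  derivative of \<open>g\<close>. The induction therefore varies \<open>f\<close> and keeps
  \<open>g\<close> fixed.\<close>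

lemma k_times_compose:
  fixes g :: "'a::real_normed_vector \<Rightarrow> 'b::fin_dim_inner" and f :: "'b \<Rightarrow> real"
  assumes "open S" "open T" "g ` S \<subseteq> T"
  shows "k_times_differentiable_on k T f ==> k_times_differentiable_on k S g ==>
    k_times_differentiable_on k S (\<lambda>x. f (g x))"
proof (induction k arbitrary: f)
  case 0
  then show ?case using assms(3) by (auto intro: continuous_on_compose2)
next
  case (Suc k)
  note f = k_times_SucD[OF Suc.prems(1)] and g = k_times_SucD[OF Suc.prems(2)]
  have lin: "linear (frechet_derivative f (at (g x)))" if "x \<in> S" for x
    using f(1)[of "g x"] that assms(3) has_derivative_linear by blast
  have "k_times_differentiable_on k S (\<lambda>x. \<Sum>b\<in>onb. (frechet_derivative g (at x) v \<bullet> b) *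
      frechet_derivative f (at (g x)) b)" for v
    by (intro k_times_sum k_times_mult assms(1) Suc.IH f(2) k_times_pred[OF Suc.prems(2)]
        k_times_bounded_linear[OF assms(1) bounded_linear_inner_left] g(2))
  then have "k_times_differentiable_on k S (\<lambda>x. frechet_derivative f (at (g x)) (frechet_derivative g (at x) v))" for v
    by (rule k_times_cong[OF assms(1), rotated]) (simp add: linear_onb[OF lin, symmetric] linear_onb[OF lin])
  then show ?case
    by (intro k_times_SucI[OF assms(1) has_derivative_compose[OF g(1) f(1)]]) (use assms in auto)
qed

section \<open>Closure properties of smooth functions\<close>

lemma smooth_onI: "(\<And>k. k_times_differentiable_on k S f) ==> smooth_on S f"
  by (simp add: smooth_on_def)

lemma smooth_onD: "smooth_on S f ==> k_times_differentiable_on k S f"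
  by (simp add: smooth_on_def)

lemma smooth_on_has_derivative:
  "smooth_on S f ==> x \<in> S ==> (f has_derivative frechet_derivative f (at x)) (at x)"
  using k_times_SucD(1)[OF smooth_onD] .

lemma smooth_on_frechet_derivative:
  "smooth_on S f ==> smooth_on S (\<lambda>x. frechet_derivative f (at x) v)"
  by (rule smooth_onI) (rule k_times_SucD(2)[OF smooth_onD])

lemma smooth_on_continuous: "smooth_on S f ==> continuous_on S f"
  by (rule k_times_continuous[OF smooth_onD])

lemma smooth_on_cong: "open S ==> (\<And>x. x \<in> S ==> f x = g x) ==> smooth_on S f ==> smooth_on S g"
  by (rule smooth_onI) (rule k_times_cong[OF _ _ smooth_onD])

lemma smooth_on_subset: "smooth_on S f ==> T \<subseteq> S ==> smooth_on T f"
  by (rule smooth_onI) (rule k_times_subset[OF _ smooth_onD])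

lemma smooth_on_local:
  assumes "\<And>x. x \<in> S ==> \<exists>T. open T \<and> x \<in> T \<and> smooth_on (T \<inter> S) f" "open S"
  shows "smooth_on S f"
proof (rule smooth_onI, rule k_times_local[OF _ assms(2)])
  fix k x assume "x \<in> S"
  from assms(1)[OF this] obtain T where "open T" "x \<in> T" "smooth_on (T \<inter> S) f" by blast
  then show "\<exists>T. open T \<and> x \<in> T \<and> k_times_differentiable_on k (T \<inter> S) f"
    using smooth_onD[of "T \<inter> S" f k] by blast
qed

lemma smooth_on_const: "open S ==> smooth_on S (\<lambda>x. c)"
  by (rule smooth_onI) (intro k_times_const)

lemma smooth_on_add: "open S ==> smooth_on S f ==> smooth_on S g ==> smooth_on S (\<lambda>x. f x + g x)"
  by (rule smooth_onI) (intro k_times_add smooth_onD)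

lemma smooth_on_mult:
  fixes f g :: "'a::real_normed_vector \<Rightarrow> real"
  shows "open S ==> smooth_on S f ==> smooth_on S g ==> smooth_on S (\<lambda>x. f x * g x)"
  by (rule smooth_onI) (intro k_times_mult smooth_onD)

lemma smooth_on_sum:
  "open S ==> (\<And>i. i \<in> I ==> smooth_on S (f i)) ==> smooth_on S (\<lambda>x. \<Sum>i\<in>I. f i x)"
  by (rule smooth_onI) (intro k_times_sum smooth_onD)

lemma smooth_on_bounded_linear:
  "open S ==> bounded_linear l ==> smooth_on S f ==> smooth_on S (\<lambda>x. l (f x))"
  by (rule smooth_onI) (rule k_times_bounded_linear[OF _ _ smooth_onD])

lemma smooth_on_ident: "open S ==> smooth_on S (\<lambda>x. x)"
  by (rule smooth_onI) (intro k_times_ident)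

lemma smooth_on_compose:
  fixes g :: "'a::real_normed_vector \<Rightarrow> 'b::fin_dim_inner" and f :: "'b \<Rightarrow> real"
  shows "open S ==> open T ==> g ` S \<subseteq> T ==> smooth_on T f ==> smooth_on S g ==>
    smooth_on S (\<lambda>x. f (g x))"
  by (rule smooth_onI) (rule k_times_compose[OF _ _ _ smooth_onD smooth_onD])

lemma frechet_derivative_onb:
  assumes "smooth_on S f" "x \<in> S"
  shows "frechet_derivative f (at x) v = (\<Sum>b\<in>onb. (v \<bullet> b) *\<^sub>R frechet_derivative f (at x) b)"
  by (rule linear_onb) (rule has_derivative_linear[OF smooth_on_has_derivative[OF assms]])

text \<open>The derivative is a constant times the square of the function itself, so the induction
  hypothesis covers it.\<close>

lemma smooth_on_inverse_real: "smooth_on {x :: real. x \<noteq> 0} inverse"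
proof (rule smooth_onI)
  have o: "open {x :: real. x \<noteq> 0}" by (simp add: open_Collect_neq)
  show "k_times_differentiable_on k {x :: real. x \<noteq> 0} inverse" for k
  proof (induction k)
    case 0
    then show ?case by (auto intro!: continuous_intros)
  next
    case (Suc k)
    have "k_times_differentiable_on k {x :: real. x \<noteq> 0} (\<lambda>x. - v * (inverse x * inverse x))" for v
      by (intro k_times_mult k_times_const o Suc)
    then have "k_times_differentiable_on k {x :: real. x \<noteq> 0} (\<lambda>x. - (inverse x * v * inverse x))" for v
      by (rule k_times_cong[OF o, rotated]) simp
    then show ?case by (intro k_times_SucI[OF o has_derivative_inverse'] o) auto
  qed
qed

lemma smooth_on_divide:
  fixes f g :: "'a::real_normed_vector \<Rightarrow> real"
  assumes "open S" "smooth_on S f" "smooth_on S g" "\<And>x. x \<in> S ==> g x \<noteq> 0"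
  shows "smooth_on S (\<lambda>x. f x / g x)"
  unfolding divide_inverse
  by (intro smooth_on_mult assms smooth_on_compose[OF _ _ _ smooth_on_inverse_real])
    (use assms in \<open>auto simp: open_Collect_neq\<close>)

subsection \<open>Bump functions\<close>

text \<open>The family with the parameter \<open>n\<close> is closed under differentiation up to
  linear combinations, so smoothness follows by induction for all members at once.\<close>

definition flat :: "nat \<Rightarrow> real \<Rightarrow> real" where
  "flat n t = (if t > 0 then inverse t ^ n * exp (- inverse t) else 0)"

text \<open>With s = 1 / t this is the fact that the exponential of s outgrows every power of
  s.\<close>

lemma flat_at_right: "(flat n \<longlongrightarrow> 0) (at_right 0)"
proof -
  have "((\<lambda>t. inverse t ^ n / exp (inverse t)) \<longlongrightarrow> 0) (at_right (0::real))"
    by (rule filterlim_compose[OF tendsto_power_div_exp_0 filterlim_inverse_at_top_right])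
  then show ?thesis
    by (rule filterlim_mono_eventually[OF _ order.refl order.refl])
      (auto simp: flat_def exp_minus divide_inverse eventually_at intro!: exI[of _ 1])
qed

lemma DERIV_flat: "(flat n has_real_derivative (flat (n + 2) t - real n * flat (n + 1) t)) (at t)"
proof -
  consider "t > 0" | "t < 0" | "t = 0" by linarith
  then show ?thesis
  proof cases
    case 1
    have i: "(inverse has_real_derivative - (inverse t ^ Suc (Suc 0))) (at t)"
      using 1 by (intro DERIV_inverse) auto
    have e: "((\<lambda>t. exp (- inverse t)) has_real_derivative exp (- inverse t) * - (- (inverse t ^ Suc (Suc 0)))) (at t)"
      by (rule DERIV_chain2[OF DERIV_exp DERIV_minus[OF i]])
    have "((\<lambda>t. inverse t ^ n * exp (- inverse t)) has_real_derivative
        (flat (n + 2) t - real n * flat (n + 1) t)) (at t)"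
      by (rule DERIV_cong[OF DERIV_mult[OF DERIV_power[OF i, of n] e]])
        (use 1 in \<open>cases n; simp add: flat_def algebra_simps\<close>)
    then show ?thesis
      by (rule DERIV_cong_ev[OF refl _ refl, THEN iffD1, rotated])
        (use 1 eventually_nhds_in_open[of "{0<..}" t] in \<open>auto simp: flat_def elim!: eventually_mono\<close>)
  next
    case 2
    have "((\<lambda>t. 0) has_real_derivative (flat (n + 2) t - real n * flat (n + 1) t)) (at t)"
      using 2 by (simp add: flat_def)
    then show ?thesis
      by (rule DERIV_cong_ev[OF refl _ refl, THEN iffD1, rotated])
        (use 2 eventually_nhds_in_open[of "{..<0}" t] in \<open>auto simp: flat_def elim!: eventually_mono\<close>)
  next
    case 3
    \<comment> \<open>On the right the difference quotient at 0 is the next member of the family, on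
      the left it is 0.\<close>
    have "((\<lambda>h. flat n h / h) \<longlongrightarrow> 0) (at 0)"
    proof (rule filterlim_split_at)
      have "\<forall>\<^sub>F h in at_left 0. flat n h / h = 0"
        by (auto simp: flat_def eventually_at intro!: exI[of _ 1])
      then show "((\<lambda>h. flat n h / h) \<longlongrightarrow> 0) (at_left 0)"
        by (rule tendsto_eventually)
      have "\<forall>\<^sub>F h in at_right 0. flat (Suc n) h = flat n h / h"
        by (auto simp: flat_def eventually_at divide_inverse mult_ac intro!: exI[of _ 1])
      then show "((\<lambda>h. flat n h / h) \<longlongrightarrow> 0) (at_right 0)"
        by (rule tendsto_cong[THEN iffD1, OF _ flat_at_right])
    qed
    then show ?thesis unfolding DERIV_def using 3 by (simp add: flat_def)
  qed
qed

lemma smooth_on_flat: "smooth_on UNIV (flat n)"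
proof (rule smooth_onI)
  show "k_times_differentiable_on k UNIV (flat n)" for k
  proof (induction k arbitrary: n)
    case 0
    show ?case using DERIV_flat by (auto intro!: continuous_at_imp_continuous_on DERIV_isCont)
  next
    case (Suc k)
    have "k_times_differentiable_on k UNIV (\<lambda>t. flat (n + 2) t * v + (- real n * v) * flat (n + 1) t)" for v
      by (intro k_times_add k_times_mult k_times_const Suc open_UNIV)
    then have "k_times_differentiable_on k UNIV (\<lambda>t. (flat (n + 2) t - real n * flat (n + 1) t) * v)" for v
      by (rule k_times_cong[OF open_UNIV, rotated]) (simp add: algebra_simps)
    then show ?case
      by (intro k_times_SucI[where f' = "\<lambda>t v. (flat (n + 2) t - real n * flat (n + 1) t) * v"] open_UNIV)
        (simp_all add: has_field_derivative_imp_has_derivative[OF DERIV_flat[of n], simplified])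
  qed
qed

lemma ex_bump_function:
  fixes p :: "'a::fin_dim_inner"
  assumes r: "r > 0"
  shows "\<exists>\<beta> :: 'a \<Rightarrow> real. smooth_on UNIV \<beta> \<and> (\<forall>x\<in>cball p r. \<beta> x = 1) \<and> (\<forall>x. x \<notin> ball p (2 * r) \<longrightarrow> \<beta> x = 0)"
proof -
  \<comment> \<open>Scaled so that \<open>q\<close> is 1 on the sphere of radius \<open>r\<close>
    and 0 on the sphere of radius \<open>2 * r\<close>.\<close>
  define q where "q x = (4 * r\<^sup>2 - (x - p) \<bullet> (x - p)) / (3 * r\<^sup>2)" for x
  \<comment> \<open>The squared distance is written in coordinates because the product rule is
    available for real functions.\<close>
  have "(x - p) \<bullet> (x - p) = (\<Sum>b\<in>onb. ((x - p) \<bullet> b) * ((x - p) \<bullet> b))" for x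
  proof -
    have "(x - p) \<bullet> (x - p) = (x - p) \<bullet> (\<Sum>b\<in>onb. ((x - p) \<bullet> b) *\<^sub>R b)" by (simp only: onb(3))
    then show ?thesis by (simp only: inner_sum_right inner_scaleR_right)
  qed
  then have q: "q x = (4 * r\<^sup>2 + (- 1) * (\<Sum>b\<in>onb. ((x + - p) \<bullet> b) * ((x + - p) \<bullet> b))) / (3 * r\<^sup>2)" for x
    unfolding q_def by (simp only: ) simp
  have sq: "smooth_on UNIV q"
    unfolding q using r
    by (intro smooth_on_divide smooth_on_add smooth_on_mult smooth_on_sum smooth_on_const open_UNIV
        smooth_on_bounded_linear[OF _ bounded_linear_inner_left] smooth_on_ident) auto
  \<comment> \<open>The usual smooth step: 0 for \<open>t \<le> 0\<close>, 1 for
    \<open>t \<ge> 1\<close>. The denominator is positive because \<open>t\<close> and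
    \<open>1 - t\<close> are not both at most 0.\<close>
  define s where "s t = flat 0 t / (flat 0 t + flat 0 (1 + (- 1) * t))" for t
  have pos: "flat 0 t + flat 0 (1 + (- 1) * t) \<noteq> 0" for t
  proof -
    have "flat 0 t \<ge> 0" "flat 0 (1 + (- 1) * t) \<ge> 0" "flat 0 t > 0 \<or> flat 0 (1 + (- 1) * t) > 0"
      by (auto simp: flat_def)
    then show ?thesis by linarith
  qed
  have ss: "smooth_on UNIV s"
    unfolding s_def
    by (intro smooth_on_divide smooth_on_add smooth_on_flat open_UNIV pos
        smooth_on_compose[OF _ open_UNIV _ smooth_on_flat] smooth_on_mult smooth_on_const smooth_on_ident) auto
  have "s (q x) = 1" if "x \<in> cball p r" for x
  proof -
    have "norm (x - p) \<le> r" using that by (simp add: dist_norm norm_minus_commute)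
    then have "(x - p) \<bullet> (x - p) \<le> r\<^sup>2" by (simp add: dot_square_norm power_mono)
    then have "q x \<ge> 1" using r by (simp add: q_def field_simps)
    then show ?thesis using pos[of "q x"] by (auto simp: s_def flat_def)
  qed
  moreover have "s (q x) = 0" if "x \<notin> ball p (2 * r)" for x
  proof -
    have "norm (x - p) \<ge> 2 * r" using that by (simp add: dist_norm norm_minus_commute)
    then have "(norm (x - p))\<^sup>2 \<ge> (2 * r)\<^sup>2" using r by (intro power_mono) auto
    then have "(x - p) \<bullet> (x - p) \<ge> 4 * r\<^sup>2" by (simp add: dot_square_norm power_mult_distrib)
    then have "q x \<le> 0" using r by (simp add: q_def field_simps)
    then show ?thesis by (simp add: s_def flat_def)
  qed
  moreover have "smooth_on UNIV (\<lambda>x. s (q x))"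
    by (rule smooth_on_compose[OF open_UNIV open_UNIV _ ss sq]) simp
  ultimately show ?thesis by (intro exI[of _ "\<lambda>x. s (q x)"]) auto
qed

subsection \<open>Hadamard's lemma\<close>

lemma ball_segment:
  fixes p :: "'a::real_normed_vector"
  assumes "x \<in> ball p r" "0 \<le> t" "t \<le> 1"
  shows "p + t *\<^sub>R (x - p) \<in> ball p r"
proof -
  have "norm (t *\<^sub>R (x - p)) \<le> 1 * norm (x - p)"
    unfolding norm_scaleR using assms by (intro mult_right_mono) auto
  then show ?thesis using assms(1) by (simp add: dist_norm norm_minus_commute)
qed

text \<open>Each differentiation with respect to \<open>x\<close> produces a factor \<open>t\<close>
  inside the integral. Carrying the power \<open>t ^ j\<close> closes the induction.\<close>

lemma k_times_segment_integral:
  fixes p :: "'a::fin_dim_inner" and u :: "'a \<Rightarrow> real"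
  shows "k_times_differentiable_on k (ball p r) u ==>
    k_times_differentiable_on k (ball p r) (\<lambda>x. integral (cbox 0 1) (\<lambda>t. t ^ j * u (p + t *\<^sub>R (x - p))))"
proof (induction k arbitrary: u j)
  case 0
  have "continuous_on (ball p r \<times> cbox 0 1) (\<lambda>z. u (p + snd z *\<^sub>R (fst z - p)))"
    by (rule continuous_on_compose2[OF 0[simplified]])
      (auto intro!: continuous_intros simp del: mem_ball simp: ball_segment)
  then have "continuous_on (ball p r \<times> cbox 0 1) (\<lambda>(x, t). t ^ j * u (p + t *\<^sub>R (x - p)))"
    by (auto intro!: continuous_intros simp: split_beta)
  then show ?case unfolding k_times_differentiable_on.simps by (rule integral_continuous_on_param)
next
  case (Suc k)
  let ?S = "ball p r"
  define q where "q x t = p + t *\<^sub>R (x - p)" for x :: 'a and t :: real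
  note D = k_times_SucD[OF Suc.prems]
  have qS: "q x t \<in> ?S" if "x \<in> ?S" "t \<in> cbox 0 1" for x t
    using that ball_segment unfolding q_def by auto
  have cont: "continuous_on (?S \<times> cbox 0 1) (\<lambda>z. w (q (fst z) (snd z)))" if "continuous_on ?S w" for w :: "'a \<Rightarrow> real"
    by (rule continuous_on_compose2[OF that])
      (auto intro!: continuous_intros simp: q_def simp del: mem_ball simp: ball_segment)
  define u' where "u' b x = frechet_derivative u (at x) b" for x b
  \<comment> \<open>The derivative in operator form, built from \<open>blinfun_inner_left\<close>:
    differentiation under the integral sign asks for a jointly continuous operator-valued
    derivative.\<close>
  define F where "F x t = (\<Sum>b\<in>onb. (t ^ Suc j * u' b (q x t)) *\<^sub>R blinfun_inner_left b)" for x t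
  have Fv: "blinfun_apply (F x t) v = t ^ Suc j * u' v (q x t)" if "x \<in> ?S" "t \<in> cbox 0 1" for x t v
  proof -
    have "u' v (q x t) = (\<Sum>b\<in>onb. (v \<bullet> b) *\<^sub>R u' b (q x t))"
      unfolding u'_def by (rule linear_onb) (rule has_derivative_linear[OF D(1)[OF qS[OF that]]])
    then show ?thesis
      by (simp add: F_def blinfun.sum_left blinfun.scaleR_left sum_distrib_left mult_ac)
  qed
  have contF: "continuous_on (?S \<times> cbox 0 1) (\<lambda>(x, t). F x t)"
    unfolding F_def split_beta
    by (intro continuous_on_sum continuous_on_scaleR continuous_on_mult continuous_intros
        cont k_times_continuous[OF D(2)[folded u'_def]])
  have der: "((\<lambda>x. t ^ j * u (q x t)) has_derivative blinfun_apply (F x t)) (at x within ?S)"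
    if xt: "x \<in> ?S" "t \<in> cbox 0 1" for x t
  proof -
    have "((\<lambda>x. q x t) has_derivative (\<lambda>v. t *\<^sub>R v)) (at x)"
      unfolding q_def by (auto intro!: derivative_eq_intros)
    then have "((\<lambda>x. u (q x t)) has_derivative (\<lambda>v. frechet_derivative u (at (q x t)) (t *\<^sub>R v))) (at x)"
      by (rule has_derivative_compose[where f = "\<lambda>x. q x t" and g = u, OF _ D(1)[OF qS[OF xt]]])
    then have "((\<lambda>x. t ^ j * u (q x t)) has_derivative
        (\<lambda>v. t ^ j * frechet_derivative u (at (q x t)) (t *\<^sub>R v))) (at x)"
      by (rule has_derivative_mult_right)
    moreover have "t ^ j * frechet_derivative u (at (q x t)) (t *\<^sub>R v) = blinfun_apply (F x t) v" for v
      using linear_scale[OF has_derivative_linear[OF D(1)[OF qS[OF xt]]]]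
      by (simp add: Fv[OF xt] u'_def)
    ultimately show ?thesis using has_derivative_at_withinI by simp
  qed
  have int: "(\<lambda>t. t ^ j * u (q x t)) integrable_on cbox 0 1" if x: "x \<in> ?S" for x
  proof (rule integrable_continuous)
    have "continuous_on (cbox 0 1) (\<lambda>t. u (q x t))"
      by (rule continuous_on_compose2[OF cont[OF k_times_continuous[OF Suc.prems]], of _ "\<lambda>t. (x, t)", simplified])
        (use x in \<open>auto intro!: continuous_intros\<close>)
    then show "continuous_on (cbox 0 1) (\<lambda>t. t ^ j * u (q x t))" by (intro continuous_intros)
  qed
  have intF: "F x integrable_on cbox 0 1" if x: "x \<in> ?S" for x
    by (rule integrable_continuous, rule continuous_on_compose2[OF contF, of _ "\<lambda>t. (x, t)", simplified])
      (use x in \<open>auto intro!: continuous_intros\<close>)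
  show ?case
  proof (rule k_times_SucI)
    fix x assume x: "x \<in> ?S"
    have "((\<lambda>x. integral (cbox 0 1) (\<lambda>t. t ^ j * u (q x t))) has_derivative
        blinfun_apply (integral (cbox 0 1) (F x))) (at x within ?S)"
      by (rule leibniz_rule[OF der int contF x convex_ball])
    then show "((\<lambda>x. integral (cbox 0 1) (\<lambda>t. t ^ j * u (p + t *\<^sub>R (x - p)))) has_derivative
        blinfun_apply (integral (cbox 0 1) (F x))) (at x)"
      unfolding q_def at_within_open[OF x open_ball] .
  next
    fix v
    have "k_times_differentiable_on k ?S (\<lambda>x. integral (cbox 0 1) (\<lambda>t. t ^ Suc j * u' v (p + t *\<^sub>R (x - p))))"
      by (rule Suc.IH[OF D(2)[folded u'_def]])
    then show "k_times_differentiable_on k ?S (\<lambda>x. blinfun_apply (integral (cbox 0 1) (F x)) v)"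
    proof (rule k_times_cong[OF open_ball, rotated])
      fix x assume x: "x \<in> ?S"
      show "integral (cbox 0 1) (\<lambda>t. t ^ Suc j * u' v (p + t *\<^sub>R (x - p))) =
          blinfun_apply (integral (cbox 0 1) (F x)) v"
        unfolding blinfun_apply_integral[OF intF[OF x]]
        by (rule Henstock_Kurzweil_Integration.integral_cong) (simp only: Fv[OF x] q_def)
    qed
  qed auto
qed

text \<open>The fundamental theorem of calculus along the segment from \<open>p\<close> to
  \<open>x\<close>. The cofactor of each coordinate is the average of a partial derivative over the
  segment, which at \<open>p\<close> is that partial derivative.\<close>

lemma Hadamard:
  fixes p :: "'a::fin_dim_inner" and f :: "'a \<Rightarrow> real"
  assumes f: "smooth_on (ball p r) f" and r: "r > 0"
  obtains g where "\<And>b. smooth_on (ball p r) (g b)" "\<And>b. g b p = frechet_derivative f (at p) b"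
    "\<And>x. x \<in> ball p r ==> f x = f p + (\<Sum>b\<in>onb. ((x - p) \<bullet> b) * g b x)"
proof
  define f' where "f' b x = frechet_derivative f (at x) b" for b x
  define g where "g b x = integral (cbox 0 1) (\<lambda>t. t ^ 0 * f' b (p + t *\<^sub>R (x - p)))" for b x
  show "smooth_on (ball p r) (g b)" for b
    unfolding g_def f'_def
    by (rule smooth_onI, rule k_times_segment_integral, rule smooth_onD)
      (rule smooth_on_frechet_derivative[OF f])
  show "g b p = frechet_derivative f (at p) b" for b by (simp add: g_def f'_def)
  fix x assume x: "x \<in> ball p r"
  let ?q = "\<lambda>t. p + t *\<^sub>R (x - p)"
  have qS: "?q t \<in> ball p r" if "t \<in> {0..1}" for t using ball_segment[OF x] that by auto
  have int: "(\<lambda>t. f' b (?q t)) integrable_on {0..1}" for b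
    by (intro integrable_continuous_interval
        continuous_on_compose2[OF smooth_on_continuous[OF smooth_on_frechet_derivative[OF f]], folded f'_def])
      (auto intro!: continuous_intros simp del: mem_ball simp: qS)
  have "((\<lambda>t. frechet_derivative f (at (?q t)) (x - p)) has_integral (f (?q 1) - f (?q 0))) {0..1}"
  proof (rule fundamental_theorem_of_calculus)
    fix t :: real assume t: "t \<in> {0..1}"
    have "((\<lambda>t. f (?q t)) has_derivative (\<lambda>s. frechet_derivative f (at (?q t)) (s *\<^sub>R (x - p)))) (at t)"
      by (rule has_derivative_compose[where f = ?q and g = f, OF _ smooth_on_has_derivative[OF f qS[OF t]]])
        (auto intro!: derivative_eq_intros)
    then show "((\<lambda>t. f (?q t)) has_vector_derivative frechet_derivative f (at (?q t)) (x - p)) (at t within {0..1})"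
      using linear_scale[OF has_derivative_linear[OF smooth_on_has_derivative[OF f qS[OF t]]]]
      unfolding has_vector_derivative_def by (simp add: has_derivative_at_withinI)
  qed simp
  then have "f x - f p = integral {0..1} (\<lambda>t. frechet_derivative f (at (?q t)) (x - p))"
    by (simp add: integral_unique)
  also have "\<dots> = integral {0..1} (\<lambda>t. \<Sum>b\<in>onb. ((x - p) \<bullet> b) * f' b (?q t))"
    by (rule Henstock_Kurzweil_Integration.integral_cong)
      (use frechet_derivative_onb[OF f qS, of _ "x - p"] in \<open>simp add: f'_def\<close>)
  also have "\<dots> = (\<Sum>b\<in>onb. integral {0..1} (\<lambda>t. ((x - p) \<bullet> b) * f' b (?q t)))"
    by (rule integral_sum[OF onb(1)]) (intro integrable_on_mult_right int)
  also have "\<dots> = (\<Sum>b\<in>onb. ((x - p) \<bullet> b) * g b x)"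
    by (simp add: g_def)
  finally show "f x = f p + (\<Sum>b\<in>onb. ((x - p) \<bullet> b) * g b x)" by simp
qed

text \<open>On a compact ball the partial derivatives are bounded, and convexity allows the mean
  value inequality.\<close>

lemma smooth_on_Lipschitz:
  fixes p :: "'a::fin_dim_inner" and f :: "'a \<Rightarrow> real"
  assumes f: "smooth_on S f" and S: "cball p r \<subseteq> S"
  shows "\<exists>\<Lambda>\<ge>0. (\<forall>x\<in>cball p r. \<bar>f x\<bar> \<le> \<Lambda>) \<and> (\<forall>x\<in>cball p r. \<forall>y\<in>cball p r. \<bar>f x - f y\<bar> \<le> \<Lambda> * norm (x - y))"
proof -
  have bdd: "\<exists>M. \<forall>x\<in>cball p r. \<bar>g x\<bar> \<le> M" if "smooth_on S g" for g :: "'a \<Rightarrow> real"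
  proof -
    have "compact (g ` cball p r)"
      by (intro compact_continuous_image compact_cball continuous_on_subset[OF smooth_on_continuous[OF that] S])
    then have "bounded (g ` cball p r)" by (rule compact_imp_bounded)
    then show ?thesis unfolding bounded_iff by auto
  qed
  obtain M0 where M0: "\<forall>x\<in>cball p r. \<bar>f x\<bar> \<le> M0" using bdd[OF f] by blast
  have "\<forall>b. \<exists>M. \<forall>x\<in>cball p r. \<bar>frechet_derivative f (at x) b\<bar> \<le> M"
    using bdd[OF smooth_on_frechet_derivative[OF f]] by blast
  then obtain M where M: "\<And>b x. x \<in> cball p r ==> \<bar>frechet_derivative f (at x) b\<bar> \<le> M b" by metis
  let ?\<Lambda> = "\<Sum>b\<in>onb. \<bar>M b\<bar>"
  have lip: "norm (f x - f y) \<le> ?\<Lambda> * norm (x - y)" if xy: "x \<in> cball p r" "y \<in> cball p r" for x y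
  proof (rule differentiable_bound[OF convex_cball _ _ xy])
    show "(f has_derivative frechet_derivative f (at x)) (at x within cball p r)" if "x \<in> cball p r" for x
      using smooth_on_has_derivative[OF f] that S by (blast intro: has_derivative_at_withinI)
    show "onorm (frechet_derivative f (at x)) \<le> ?\<Lambda>" if x: "x \<in> cball p r" for x
    proof (rule onorm_bound)
      show "0 \<le> ?\<Lambda>" by (simp add: sum_nonneg)
      fix v
      have xS: "x \<in> S" using x S by blast
      have "norm (frechet_derivative f (at x) v) \<le> (\<Sum>b\<in>onb. norm ((v \<bullet> b) *\<^sub>R frechet_derivative f (at x) b))"
        by (subst frechet_derivative_onb[OF f xS]) (rule norm_sum)
      also have "\<dots> \<le> (\<Sum>b\<in>onb. norm v * \<bar>M b\<bar>)"
      proof (rule sum_mono)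
        fix b :: 'a assume b: "b \<in> onb"
        have "norm b = 1" using onb(2)[OF b b] by (simp add: norm_eq_sqrt_inner)
        then have "\<bar>v \<bullet> b\<bar> \<le> norm v" using Cauchy_Schwarz_ineq2[of v b] by simp
        then show "norm ((v \<bullet> b) *\<^sub>R frechet_derivative f (at x) b) \<le> norm v * \<bar>M b\<bar>"
          using M[OF x, of b] by (auto simp: abs_mult intro!: mult_mono)
      qed
      finally show "norm (frechet_derivative f (at x) v) \<le> ?\<Lambda> * norm v"
        by (simp add: sum_distrib_left mult.commute)
    qed
  qed
  have "0 \<le> ?\<Lambda>" by (simp add: sum_nonneg)
  show ?thesis
  \<comment> \<open>Adding the bound for the values gives one constant for both estimates.\<close>
  proof (intro exI[of _ "?\<Lambda> + \<bar>M0\<bar>"] conjI ballI)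
    show "0 \<le> ?\<Lambda> + \<bar>M0\<bar>" using \<open>0 \<le> ?\<Lambda>\<close> by simp
    show "\<bar>f x\<bar> \<le> ?\<Lambda> + \<bar>M0\<bar>" if "x \<in> cball p r" for x using bspec[OF M0 that] \<open>0 \<le> ?\<Lambda>\<close> by linarith
    show "\<bar>f x - f y\<bar> \<le> (?\<Lambda> + \<bar>M0\<bar>) * norm (x - y)" if "x \<in> cball p r" "y \<in> cball p r" for x y
    proof -
      have "?\<Lambda> * norm (x - y) \<le> (?\<Lambda> + \<bar>M0\<bar>) * norm (x - y)" by (intro mult_right_mono) auto
      then show ?thesis using lip[OF that] by simp
    qed
  qed
qed

subsection \<open>Lipschitz maps do not raise the dimension\<close>

text \<open>Points of a fine grid in the target that are hit by points of one cell of a grid in the source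
  are equal, but the grid in the target has more points than the one in the source has cells.\<close>

lemma Lipschitz_image_avoids:
  fixes P :: "('d \<Rightarrow> real) set" and g :: "'q \<Rightarrow> ('d \<Rightarrow> real) \<Rightarrow> real"
  assumes fin: "finite D" "finite Q" and less: "card D < card Q"
    and B: "\<And>p d. p \<in> P ==> d \<in> D ==> \<bar>p d\<bar> \<le> B"
    and lip: "\<And>p p' \<epsilon> i. p \<in> P ==> p' \<in> P ==> i \<in> Q ==> \<epsilon> > 0 ==> (\<And>d. d \<in> D ==> \<bar>p d - p' d\<bar> \<le> \<epsilon>) ==>
      \<bar>g i p - g i p'\<bar> \<le> \<Lambda> * \<epsilon>"
    and \<eta>: "\<eta> > 0"
  shows "\<exists>\<tau>. (\<forall>i\<in>Q. 0 \<le> \<tau> i \<and> \<tau> i < \<eta>) \<and> (\<forall>p\<in>P. \<exists>i\<in>Q. g i p \<noteq> \<tau> i)"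
proof (rule ccontr)
  assume neg: "\<not> ?thesis"
  define \<Lambda>' where "\<Lambda>' = \<bar>\<Lambda>\<bar> + 1"
  have \<Lambda>': "\<Lambda>' > 0" "\<Lambda> < \<Lambda>'" by (auto simp: \<Lambda>'_def)
  define B' where "B' = \<bar>B\<bar>"
  \<comment> \<open>Independent of \<open>M\<close>, yet large enough for
    \<open>2 * m + 2 \<le> \<kappa> * M\<close>, where \<open>2 * m + 2\<close> counts the cells
    along one coordinate axis of the source.\<close>
  define \<kappa> where "\<kappa> = nat \<lceil>4 * \<Lambda>' * B' / \<eta>\<rceil> + 4"
  \<comment> \<open>The least number exceeding \<open>\<kappa> ^ card D\<close>. The target grid
    then has at least \<open>M * M ^ card D\<close> points, more than the at most
    \<open>\<kappa> ^ card D * M ^ card D\<close> cells of the source.\<close>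
  define M where "M = \<kappa> ^ card D + 1"
  have M: "M > 0" by (simp add: M_def)
  \<comment> \<open>The size of a cell: points of one cell have images at distance at most
    \<open>\<Lambda>' * \<epsilon> = \<eta> / (2 * M)\<close>, half the mesh of the target
    grid.\<close>
  define \<epsilon> where "\<epsilon> = \<eta> / (2 * \<Lambda>' * M)"
  have \<epsilon>: "\<epsilon> > 0" using \<eta> \<Lambda>' M by (simp add: \<epsilon>_def)
  define m where "m = nat \<lceil>B' / \<epsilon>\<rceil>"
  let ?T = "Q \<rightarrow>\<^sub>E {..<M}"
  have "\<forall>t\<in>?T. \<exists>p\<in>P. \<forall>i\<in>Q. g i p = \<eta> * real (t i) / M"
  proof
    fix t assume t: "t \<in> ?T"
    have "0 \<le> \<eta> * real (t i) / M \<and> \<eta> * real (t i) / M < \<eta>" if "i \<in> Q" for i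
    proof -
      have "t i < M" using t that by auto
      then have "\<eta> * real (t i) < \<eta> * M" using \<eta> by simp
      then show ?thesis using \<eta> M by (simp add: field_simps)
    qed
    then show "\<exists>p\<in>P. \<forall>i\<in>Q. g i p = \<eta> * real (t i) / M"
      using neg by (auto dest!: spec[of _ "\<lambda>i. \<eta> * real (t i) / M"])
  qed
  then obtain p where p: "\<And>t. t \<in> ?T ==> p t \<in> P" "\<And>t i. t \<in> ?T ==> i \<in> Q ==> g i (p t) = \<eta> * real (t i) / M"
    by metis
  define c where "c t = (\<lambda>d\<in>D. \<lfloor>p t d / \<epsilon>\<rfloor>)" for t
  have "c ` ?T \<subseteq> D \<rightarrow>\<^sub>E {- int m - 1..int m}"
  proof
    fix y assume "y \<in> c ` ?T"
    then obtain t where t: "t \<in> ?T" "y = c t" by blast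
    have "\<lfloor>p t d / \<epsilon>\<rfloor> \<in> {- int m - 1..int m}" if d: "d \<in> D" for d
    proof -
      have "\<bar>p t d\<bar> \<le> B'" using B[OF p(1)[OF t(1)] d] by (simp add: B'_def)
      then have "\<bar>p t d / \<epsilon>\<bar> \<le> B' / \<epsilon>" using \<epsilon> by (simp add: abs_divide divide_right_mono)
      also have "\<dots> \<le> m" unfolding m_def by linarith
      finally have "p t d / \<epsilon> \<le> m" "- real m \<le> p t d / \<epsilon>" by linarith+
      then show ?thesis unfolding atLeastAtMost_iff by linarith
    qed
    then show "y \<in> D \<rightarrow>\<^sub>E {- int m - 1..int m}" unfolding t(2) c_def by auto
  qed
  moreover have "inj_on c ?T"
  proof (rule inj_onI)
    fix t t' assume t: "t \<in> ?T" "t' \<in> ?T" "c t = c t'"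
    have cell: "\<bar>p t d - p t' d\<bar> \<le> \<epsilon>" if "d \<in> D" for d
    proof -
      have "\<lfloor>p t d / \<epsilon>\<rfloor> = \<lfloor>p t' d / \<epsilon>\<rfloor>" using fun_cong[OF t(3), of d] that by (simp add: c_def)
      then have "\<bar>p t d / \<epsilon> - p t' d / \<epsilon>\<bar> \<le> 1" by linarith
      then have "\<bar>(p t d - p t' d) / \<epsilon>\<bar> \<le> 1" by (simp add: diff_divide_distrib)
      then show ?thesis using \<epsilon> by (simp add: abs_divide)
    qed
    have "t i = t' i" if i: "i \<in> Q" for i
    proof -
      have "\<bar>\<eta> * real (t i) / M - \<eta> * real (t' i) / M\<bar> \<le> \<Lambda> * \<epsilon>"
        using lip[OF p(1)[OF t(1)] p(1)[OF t(2)] i \<epsilon> cell] p(2)[OF t(1) i] p(2)[OF t(2) i] by simp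
      also have "\<dots> \<le> \<Lambda>' * \<epsilon>" using \<Lambda>' \<epsilon> by (intro mult_right_mono) auto
      also have "\<dots> = \<eta> / (2 * M)" using \<Lambda>' by (simp add: \<epsilon>_def)
      finally have "\<bar>\<eta> / M * (real (t i) - real (t' i))\<bar> \<le> \<eta> / M * (1 / 2)" by (simp add: algebra_simps)
      then have "\<eta> / M * \<bar>real (t i) - real (t' i)\<bar> \<le> \<eta> / M * (1 / 2)" using \<eta> by (simp add: abs_mult)
      moreover have "\<eta> / M > 0" using \<eta> M by simp
      ultimately have "\<bar>real (t i) - real (t' i)\<bar> \<le> 1 / 2" by (simp only: mult_le_cancel_left_pos)
      then show ?thesis by linarith
    qed
    then show "t = t'" using t(1,2) by (intro PiE_ext) auto
  qed
  moreover have "finite (D \<rightarrow>\<^sub>E {- int m - 1..int m})" using fin by (intro finite_PiE) auto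
  ultimately have "card ?T \<le> card (D \<rightarrow>\<^sub>E {- int m - 1..int m})" by (meson card_inj_on_le)
  moreover have c: "card {- int m - 1..int m} = 2 * m + 2"
    by (simp only: card_atLeastAtMost_int)
  ultimately have le: "M ^ card Q \<le> (2 * m + 2) ^ card D"
    using fin by (simp add: card_PiE c del: card_atLeastAtMost_int)
  have "real (2 * m + 2) \<le> real (\<kappa> * M)"
  proof -
    have "real m \<le> B' / \<epsilon> + 1" unfolding m_def using \<epsilon> by (simp add: B'_def)
    also have "B' / \<epsilon> = 2 * \<Lambda>' * B' / \<eta> * M" using \<eta> \<Lambda>' M by (simp add: \<epsilon>_def field_simps)
    finally have 1: "real (2 * m + 2) \<le> 4 * \<Lambda>' * B' / \<eta> * M + 4" by simp
    have "4 * \<Lambda>' * B' / \<eta> \<le> real (nat \<lceil>4 * \<Lambda>' * B' / \<eta>\<rceil>)" by linarith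
    then have 2: "4 * \<Lambda>' * B' / \<eta> * M \<le> real (nat \<lceil>4 * \<Lambda>' * B' / \<eta>\<rceil>) * M"
      by (intro mult_right_mono) auto
    have 3: "4 * 1 \<le> 4 * real M" using M by (intro mult_left_mono) auto
    have "real (\<kappa> * M) = real (nat \<lceil>4 * \<Lambda>' * B' / \<eta>\<rceil>) * M + 4 * real M"
      unfolding \<kappa>_def by (simp add: algebra_simps)
    then show ?thesis using 1 2 3 by linarith
  qed
  then have "2 * m + 2 \<le> \<kappa> * M" by (simp only: of_nat_le_iff)
  then have "(2 * m + 2) ^ card D \<le> \<kappa> ^ card D * M ^ card D"
    by (metis power_mono power_mult_distrib zero_le)
  then have "M ^ card Q \<le> \<kappa> ^ card D * M ^ card D" using le by simp
  moreover have "M ^ Suc (card D) \<le> M ^ card Q" using less M by (intro power_increasing) auto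
  ultimately have "M * M ^ card D \<le> \<kappa> ^ card D * M ^ card D" unfolding power_Suc by (rule le_trans[rotated])
  then have "M \<le> \<kappa> ^ card D" using M by (simp only: mult_le_cancel2) simp
  then show False by (simp add: M_def)
qed

section \<open>Smooth functions on a manifold\<close>

locale atlas =
  fixes A :: "('m::t2_space, 'a::fin_dim_inner) atlas"
  assumes smooth_atlas: "smooth_atlas A"
begin

lemma chart:
  assumes "(U, \<phi>) \<in> A"
  shows "open U" "open (\<phi> ` U)" "continuous_on U \<phi>" "continuous_on (\<phi> ` U) (inv_into U \<phi>)"
    "inj_on \<phi> U" "x \<in> U ==> inv_into U \<phi> (\<phi> x) = x"
proof -
  have 1: "open U \<and> open (\<phi> ` U) \<and> homeomorphism U (\<phi> ` U) \<phi> (inv_into U \<phi>)"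
    using smooth_atlas assms unfolding smooth_atlas_def by auto
  then show "open U" "open (\<phi> ` U)" "continuous_on U \<phi>" "continuous_on (\<phi> ` U) (inv_into U \<phi>)"
    unfolding homeomorphism_def by auto
  have "\<forall>x\<in>U. inv_into U \<phi> (\<phi> x) = x" using 1 unfolding homeomorphism_def by auto
  then show "inj_on \<phi> U" "x \<in> U ==> inv_into U \<phi> (\<phi> x) = x"
    by (auto intro: inj_on_inverseI)
qed

lemma ex_chart:
  obtains U \<phi> where "(U, \<phi>) \<in> A" "x \<in> U"
proof -
  have "x \<in> \<Union> (fst ` A)" using smooth_atlas unfolding smooth_atlas_def by auto
  then show ?thesis using that by auto
qed

lemma transition_smooth:
  assumes "(U, \<phi>) \<in> A" "(U', \<phi>') \<in> A"
  shows "smooth_on (\<phi> ` (U \<inter> U')) (\<lambda>y. \<phi>' (inv_into U \<phi> y))"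
proof -
  have "\<forall>c\<in>A. \<forall>c'\<in>A. smooth_on (snd c ` (fst c \<inter> fst c')) (snd c' \<circ> inv_into (fst c) (snd c))"
    using smooth_atlas unfolding smooth_atlas_def by (auto simp: split_beta)
  from bspec[OF bspec[OF this assms(1)] assms(2)] show ?thesis by (simp add: comp_def)
qed

lemma open_chart_image:
  assumes c: "(U, \<phi>) \<in> A" and "open W"
  shows "open (\<phi> ` (U \<inter> W))"
proof -
  have "\<phi> ` (U \<inter> W) = \<phi> ` U \<inter> inv_into U \<phi> -` W"
    using chart(6)[OF c] by auto
  then show ?thesis using continuous_open_preimage[OF chart(4)[OF c] chart(2)[OF c] \<open>open W\<close>] by simp
qed

lemma smooth_funD:
  "(U, \<phi>) \<in> A ==> smooth_fun A W f ==> smooth_on (\<phi> ` (U \<inter> W)) (\<lambda>y. f (inv_into U \<phi> y))"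
  unfolding smooth_fun_def comp_def by auto

lemma smooth_funI:
  "(\<And>U \<phi>. (U, \<phi>) \<in> A ==> smooth_on (\<phi> ` (U \<inter> W)) (\<lambda>y. f (inv_into U \<phi> y))) ==> smooth_fun A W f"
  unfolding smooth_fun_def comp_def by auto

lemma smooth_fun_subset: "smooth_fun A W f ==> V \<subseteq> W ==> smooth_fun A V f"
  by (rule smooth_funI, rule smooth_on_subset[OF smooth_funD]) auto

lemma smooth_fun_cong:
  assumes W: "open W" and eq: "\<And>x. x \<in> W ==> f x = g x" and f: "smooth_fun A W f"
  shows "smooth_fun A W g"
proof (rule smooth_funI)
  fix U \<phi> assume c: "(U, \<phi>) \<in> A"
  show "smooth_on (\<phi> ` (U \<inter> W)) (\<lambda>y. g (inv_into U \<phi> y))"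
    by (rule smooth_on_cong[OF open_chart_image[OF c W] _ smooth_funD[OF c f]])
      (auto simp: chart(6)[OF c] eq)
qed

lemma smooth_fun_local:
  assumes W: "open W" and "\<And>x. x \<in> W ==> \<exists>N. open N \<and> x \<in> N \<and> smooth_fun A (N \<inter> W) f"
  shows "smooth_fun A W f"
proof (rule smooth_funI, rule smooth_on_local)
  fix U \<phi> assume c: "(U, \<phi>) \<in> A"
  show "open (\<phi> ` (U \<inter> W))" by (rule open_chart_image[OF c W])
  fix y assume "y \<in> \<phi> ` (U \<inter> W)"
  then obtain x where x: "x \<in> U" "x \<in> W" "y = \<phi> x" by auto
  obtain N where N: "open N" "x \<in> N" "smooth_fun A (N \<inter> W) f" using assms(2)[OF x(2)] by blast
  have "\<phi> ` (U \<inter> N) \<inter> \<phi> ` (U \<inter> W) = \<phi> ` (U \<inter> (N \<inter> W))"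
    using inj_on_image_Int[OF chart(5)[OF c], of "U \<inter> N" "U \<inter> W"] by (simp add: Int_ac)
  then have "smooth_on (\<phi> ` (U \<inter> N) \<inter> \<phi> ` (U \<inter> W)) (\<lambda>y. f (inv_into U \<phi> y))"
    using smooth_funD[OF c N(3)] by simp
  then show "\<exists>T. open T \<and> y \<in> T \<and> smooth_on (T \<inter> \<phi> ` (U \<inter> W)) (\<lambda>y. f (inv_into U \<phi> y))"
    using open_chart_image[OF c N(1)] x N(2) by blast
qed

text \<open>One chart suffices, since the transition maps into the others are smooth.\<close>

lemma smooth_fun_chartI:
  assumes c: "(U, \<phi>) \<in> A" and W: "open W" "W \<subseteq> U" and h: "smooth_on (\<phi> ` W) h"
  shows "smooth_fun A W (\<lambda>x. h (\<phi> x))"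
proof (rule smooth_funI)
  fix U' \<phi>' assume c': "(U', \<phi>') \<in> A"
  show "smooth_on (\<phi>' ` (U' \<inter> W)) (\<lambda>y. h (\<phi> (inv_into U' \<phi>' y)))"
  proof (rule smooth_on_compose[OF _ _ _ h])
    show "open (\<phi>' ` (U' \<inter> W))" by (rule open_chart_image[OF c' W(1)])
    show "open (\<phi> ` W)" using open_chart_image[OF c W(1)] W(2) by (simp add: Int_absorb1)
    show "(\<lambda>y. \<phi> (inv_into U' \<phi>' y)) ` \<phi>' ` (U' \<inter> W) \<subseteq> \<phi> ` W"
      using chart(6)[OF c'] by auto
    show "smooth_on (\<phi>' ` (U' \<inter> W)) (\<lambda>y. \<phi> (inv_into U' \<phi>' y))"
      by (rule smooth_on_subset[OF transition_smooth[OF c' c]]) (use W in auto)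
  qed
qed

lemma smooth_fun_const: "open W ==> smooth_fun A W (\<lambda>x. c)"
  by (rule smooth_funI) (rule smooth_on_const[OF open_chart_image])

lemma smooth_fun_add: "open W ==> smooth_fun A W f ==> smooth_fun A W g ==> smooth_fun A W (\<lambda>x. f x + g x)"
  by (rule smooth_funI) (rule smooth_on_add[OF open_chart_image smooth_funD smooth_funD])

lemma smooth_fun_mult: "open W ==> smooth_fun A W f ==> smooth_fun A W g ==> smooth_fun A W (\<lambda>x. f x * g x)"
  by (rule smooth_funI) (rule smooth_on_mult[OF open_chart_image smooth_funD smooth_funD])

lemma smooth_fun_diff:
  assumes "open W" "smooth_fun A W f" "smooth_fun A W g"
  shows "smooth_fun A W (\<lambda>x. f x - g x)"
  using smooth_fun_add[OF assms(1,2) smooth_fun_mult[OF assms(1) smooth_fun_const[OF assms(1), of "- 1"] assms(3)]]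
  by simp

lemma smooth_fun_sum:
  "open W ==> (\<And>i. i \<in> I ==> smooth_fun A W (f i)) ==> smooth_fun A W (\<lambda>x. \<Sum>i\<in>I. f i x)"
  by (rule smooth_funI) (rule smooth_on_sum[OF open_chart_image smooth_funD])

lemma smooth_fun_divide:
  assumes "open W" "smooth_fun A W f" "smooth_fun A W g" "\<And>x. x \<in> W ==> g x \<noteq> 0"
  shows "smooth_fun A W (\<lambda>x. f x / g x)"
proof (rule smooth_funI)
  fix U \<phi> assume c: "(U, \<phi>) \<in> A"
  show "smooth_on (\<phi> ` (U \<inter> W)) (\<lambda>y. f (inv_into U \<phi> y) / g (inv_into U \<phi> y))"
    by (rule smooth_on_divide[OF open_chart_image[OF c assms(1)] smooth_funD[OF c assms(2)] smooth_funD[OF c assms(3)]])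
      (use assms(4) chart(6)[OF c] in auto)
qed

lemma smooth_fun_coordinate:
  assumes "(U, \<phi>) \<in> A" "open W" "W \<subseteq> U"
  shows "smooth_fun A W (\<lambda>x. \<phi> x \<bullet> b)"
  using open_chart_image[OF assms(1,2)] assms(3)
  by (intro smooth_fun_chartI[OF assms, where h = "\<lambda>y. y \<bullet> b"]
      smooth_on_bounded_linear[OF _ bounded_linear_inner_left] smooth_on_ident) (simp_all add: Int_absorb1)

section \<open>Derivatives of functions in a chart\<close>

definition chart_deriv :: "'m set \<Rightarrow> ('m \<Rightarrow> 'a) \<Rightarrow> ('m \<Rightarrow> real) \<Rightarrow> 'm \<Rightarrow> 'a \<Rightarrow> real" where
  "chart_deriv U \<phi> f x v = frechet_derivative (\<lambda>y. f (inv_into U \<phi> y)) (at (\<phi> x)) v"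

lemma smooth_fun_has_derivative:
  assumes c: "(U, \<phi>) \<in> A" and "open W" "smooth_fun A W f" "x \<in> U \<inter> W"
  shows "((\<lambda>y. f (inv_into U \<phi> y)) has_derivative chart_deriv U \<phi> f x) (at (\<phi> x))"
  unfolding chart_deriv_def[abs_def]
  using smooth_on_has_derivative[OF smooth_funD[OF c assms(3)], of "\<phi> x"] assms(4) by simp

lemma chart_deriv_eqI:
  "((\<lambda>y. f (inv_into U \<phi> y)) has_derivative D) (at (\<phi> x)) ==> chart_deriv U \<phi> f x = D"
  unfolding chart_deriv_def[abs_def] by (drule frechet_derivative_at) simp

lemma smooth_fun_chart_deriv:
  assumes c: "(U, \<phi>) \<in> A" and W: "open W" "W \<subseteq> U" and f: "smooth_fun A W f"
  shows "smooth_fun A W (\<lambda>x. chart_deriv U \<phi> f x v)"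
proof -
  have "U \<inter> W = W" using W by blast
  then show ?thesis
    unfolding chart_deriv_def
    by (intro smooth_fun_chartI[OF c W] smooth_on_frechet_derivative)
      (use smooth_funD[OF c f] in simp)
qed

lemma chart_deriv_linear:
  assumes "(U, \<phi>) \<in> A" "open W" "smooth_fun A W f" "x \<in> U \<inter> W"
  shows "linear (chart_deriv U \<phi> f x)"
  by (rule has_derivative_linear[OF smooth_fun_has_derivative[OF assms]])

lemma chart_deriv_cong:
  assumes c: "(U, \<phi>) \<in> A" and W: "open W" "smooth_fun A W f" and x: "x \<in> U \<inter> W"
    and eq: "\<And>y. y \<in> W ==> f y = g y"
  shows "chart_deriv U \<phi> g x = chart_deriv U \<phi> f x"
proof (rule chart_deriv_eqI, rule has_derivative_transform_within_open)
  show "((\<lambda>y. f (inv_into U \<phi> y)) has_derivative chart_deriv U \<phi> f x) (at (\<phi> x))"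
    by (rule smooth_fun_has_derivative[OF c W x])
  show "open (\<phi> ` (U \<inter> W))" by (rule open_chart_image[OF c W(1)])
  show "\<phi> x \<in> \<phi> ` (U \<inter> W)" using x by blast
  show "f (inv_into U \<phi> y) = g (inv_into U \<phi> y)" if "y \<in> \<phi> ` (U \<inter> W)" for y
    using that eq chart(6)[OF c] by auto
qed

lemma chart_deriv_const: "chart_deriv U \<phi> (\<lambda>y. r) x = (\<lambda>v. 0)"
  by (rule chart_deriv_eqI) simp

lemma chart_deriv_add:
  assumes "(U, \<phi>) \<in> A" "open W" "smooth_fun A W f" "smooth_fun A W g" "x \<in> U \<inter> W"
  shows "chart_deriv U \<phi> (\<lambda>y. f y + g y) x v = chart_deriv U \<phi> f x v + chart_deriv U \<phi> g x v"
  using chart_deriv_eqI[OF has_derivative_add[OF smooth_fun_has_derivative[OF assms(1-3,5)]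
        smooth_fun_has_derivative[OF assms(1,2,4,5)]]] by simp

lemma chart_deriv_mult:
  assumes "(U, \<phi>) \<in> A" "open W" "smooth_fun A W f" "smooth_fun A W g" "x \<in> U \<inter> W"
  shows "chart_deriv U \<phi> (\<lambda>y. f y * g y) x v = f x * chart_deriv U \<phi> g x v + chart_deriv U \<phi> f x v * g x"
  using chart_deriv_eqI[OF has_derivative_mult[OF smooth_fun_has_derivative[OF assms(1-3,5)]
        smooth_fun_has_derivative[OF assms(1,2,4,5)]]] assms(5) chart(6)[OF assms(1)] by simp

lemma chart_deriv_sum:
  assumes "(U, \<phi>) \<in> A" "open W" "\<And>i. i \<in> I ==> smooth_fun A W (f i)" "x \<in> U \<inter> W"
  shows "chart_deriv U \<phi> (\<lambda>y. \<Sum>i\<in>I. f i y) x v = (\<Sum>i\<in>I. chart_deriv U \<phi> (f i) x v)"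
proof -
  have "((\<lambda>y. \<Sum>i\<in>I. f i (inv_into U \<phi> y)) has_derivative (\<lambda>v. \<Sum>i\<in>I. chart_deriv U \<phi> (f i) x v)) (at (\<phi> x))"
    by (rule has_derivative_sum) (rule smooth_fun_has_derivative[OF assms(1,2) assms(3) assms(4)])
  from chart_deriv_eqI[OF this] show ?thesis by simp
qed

lemma chart_deriv_coordinate:
  assumes c: "(U, \<phi>) \<in> A" and x: "x \<in> U"
  shows "chart_deriv U \<phi> (\<lambda>y. (\<phi> y - p) \<bullet> b) x v = v \<bullet> b"
proof -
  have "((\<lambda>y. (y - p) \<bullet> b) has_derivative (\<lambda>v. v \<bullet> b)) (at (\<phi> x))"
    by (auto intro!: derivative_eq_intros)
  then have "((\<lambda>y. (\<phi> (inv_into U \<phi> y) - p) \<bullet> b) has_derivative (\<lambda>v. v \<bullet> b)) (at (\<phi> x))"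
    by (rule has_derivative_transform_within_open[OF _ chart(2)[OF c]])
      (use x chart(6)[OF c] in auto)
  from chart_deriv_eqI[OF this] show ?thesis by simp
qed

section \<open>Chart balls, bump functions and extension of local functions\<close>

lemma ex_chart_ball:
  assumes c: "(U, \<phi>) \<in> A" and x: "x \<in> U" "x \<in> N" and N: "open N"
  obtains r where "r > 0" "cball (\<phi> x) (2 * r) \<subseteq> \<phi> ` (U \<inter> N)"
proof -
  obtain e where "e > 0" "cball (\<phi> x) e \<subseteq> \<phi> ` (U \<inter> N)"
    using bspec[OF open_contains_cball[THEN iffD1, OF open_chart_image[OF c N]], of "\<phi> x"] x by blast
  \<comment> \<open>Half of the available radius: a bump function can then be 1 on the ball of
    radius \<open>r\<close> and 0 off the ball of radius \<open>2 * r\<close>.\<close>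
  then show ?thesis using that[of "e / 2"] by auto
qed

lemma chart_ball:
  assumes c: "(U, \<phi>) \<in> A" and sub: "cball (\<phi> x) r \<subseteq> \<phi> ` (U \<inter> N)"
  shows "compact (inv_into U \<phi> ` cball (\<phi> x) r)" "closed (inv_into U \<phi> ` cball (\<phi> x) r)"
    "open (inv_into U \<phi> ` ball (\<phi> x) r)" "inv_into U \<phi> ` cball (\<phi> x) r \<subseteq> U \<inter> N"
    "y \<in> U ==> y \<in> inv_into U \<phi> ` cball (\<phi> x) r \<longleftrightarrow> \<phi> y \<in> cball (\<phi> x) r"
    "y \<in> U ==> y \<in> inv_into U \<phi> ` ball (\<phi> x) r \<longleftrightarrow> \<phi> y \<in> ball (\<phi> x) r"
    "x \<in> U ==> r > 0 ==> x \<in> inv_into U \<phi> ` ball (\<phi> x) r"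
proof -
  have subU: "cball (\<phi> x) r \<subseteq> \<phi> ` U" using sub by blast
  show co: "compact (inv_into U \<phi> ` cball (\<phi> x) r)"
    by (intro compact_continuous_image continuous_on_subset[OF chart(4)[OF c] subU] compact_cball)
  \<comment> \<open>Uses that the manifold is Hausdorff: the chart ball is closed in all of it, not
    only in \<open>U\<close>, so extension by 0 is safe.\<close>
  then show "closed (inv_into U \<phi> ` cball (\<phi> x) r)" by (rule compact_imp_closed)
  show "inv_into U \<phi> ` cball (\<phi> x) r \<subseteq> U \<inter> N"
  proof
    fix y assume "y \<in> inv_into U \<phi> ` cball (\<phi> x) r"
    then obtain z where "z \<in> U \<inter> N" "y = inv_into U \<phi> (\<phi> z)" using sub by blast
    then show "y \<in> U \<inter> N" using chart(6)[OF c] by simp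
  qed
  have eq: "y \<in> inv_into U \<phi> ` S \<longleftrightarrow> \<phi> y \<in> S" if "S \<subseteq> \<phi> ` U" "y \<in> U" for S y
  proof
    assume "\<phi> y \<in> S"
    then show "y \<in> inv_into U \<phi> ` S" using chart(6)[OF c that(2)] by (metis image_eqI)
  next
    assume "y \<in> inv_into U \<phi> ` S"
    then obtain z where "z \<in> S" "y = inv_into U \<phi> z" by blast
    then show "\<phi> y \<in> S" using that(1) by (metis f_inv_into_f subsetD)
  qed
  show "y \<in> U ==> y \<in> inv_into U \<phi> ` cball (\<phi> x) r \<longleftrightarrow> \<phi> y \<in> cball (\<phi> x) r"
    by (rule eq[OF subU])
  have subU': "ball (\<phi> x) r \<subseteq> \<phi> ` U" using subU ball_subset_cball by blast
  show *: "y \<in> U ==> y \<in> inv_into U \<phi> ` ball (\<phi> x) r \<longleftrightarrow> \<phi> y \<in> ball (\<phi> x) r" for y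
    by (rule eq[OF subU'])
  show "x \<in> U ==> r > 0 ==> x \<in> inv_into U \<phi> ` ball (\<phi> x) r" using * by simp
  have "inv_into U \<phi> ` ball (\<phi> x) r = U \<inter> \<phi> -` ball (\<phi> x) r"
  proof -
    have "inv_into U \<phi> ` ball (\<phi> x) r \<subseteq> U"
      using subU' by (auto intro: inv_into_into simp del: mem_ball)
    then show ?thesis using * by blast
  qed
  then show "open (inv_into U \<phi> ` ball (\<phi> x) r)"
    using continuous_open_preimage[OF chart(3)[OF c] chart(1)[OF c] open_ball] by simp
qed

lemma chart_bump:
  assumes c: "(U, \<phi>) \<in> A" and r: "r > 0" and sub: "cball (\<phi> x) (2 * r) \<subseteq> \<phi> ` (U \<inter> N)"
  obtains \<beta> where "smooth_fun A UNIV \<beta>" "\<And>y. y \<in> inv_into U \<phi> ` cball (\<phi> x) r ==> \<beta> y = 1"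
    "\<And>y. y \<notin> inv_into U \<phi> ` cball (\<phi> x) (2 * r) ==> \<beta> y = 0"
proof -
  obtain b :: "'a \<Rightarrow> real" where b: "smooth_on UNIV b" "\<forall>y\<in>cball (\<phi> x) r. b y = 1"
    "\<forall>y. y \<notin> ball (\<phi> x) (2 * r) \<longrightarrow> b y = 0"
    using ex_bump_function[OF r, of "\<phi> x"] by blast
  let ?C = "inv_into U \<phi> ` cball (\<phi> x) (2 * r)"
  define \<beta> where "\<beta> y = (if y \<in> U then b (\<phi> y) else 0)" for y
  have sub': "cball (\<phi> x) r \<subseteq> \<phi> ` (U \<inter> N)" using sub r by (auto simp: subset_iff)
  have off: "\<beta> y = 0" if "y \<notin> ?C" for y
    using that chart_ball(5)[OF c sub, of y] b(3) unfolding \<beta>_def by auto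
  show ?thesis
  proof (rule that[OF _ _ off])
    show "\<beta> y = 1" if y: "y \<in> inv_into U \<phi> ` cball (\<phi> x) r" for y
    proof -
      have yU: "y \<in> U" using chart_ball(4)[OF c sub'] y by blast
      have "\<phi> y \<in> cball (\<phi> x) r" using chart_ball(5)[OF c sub' yU] y by blast
      then show ?thesis using b(2) yU by (simp add: \<beta>_def)
    qed
    show "smooth_fun A UNIV \<beta>"
    proof (rule smooth_fun_local[OF open_UNIV])
      fix y :: 'm
      show "\<exists>N. open N \<and> y \<in> N \<and> smooth_fun A (N \<inter> UNIV) \<beta>"
      proof (cases "y \<in> U")
        case True
        have "smooth_fun A U (\<lambda>y. b (\<phi> y))"
          by (rule smooth_fun_chartI[OF c chart(1)[OF c] order.refl smooth_on_subset[OF b(1)]]) simp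
        then have "smooth_fun A U \<beta>"
          by (rule smooth_fun_cong[OF chart(1)[OF c], rotated]) (simp add: \<beta>_def)
        then show ?thesis using True chart(1)[OF c] by auto
      next
        case False
        have op: "open (- ?C)" using chart_ball(2)[OF c sub] by (rule open_Compl)
        have "smooth_fun A (- ?C) \<beta>"
          by (rule smooth_fun_cong[OF op _ smooth_fun_const[OF op, of 0]]) (simp add: off)
        moreover have "y \<in> - ?C" using False chart_ball(4)[OF c sub] by blast
        ultimately show ?thesis using op by auto
      qed
    qed
  qed
qed

lemma ex_bump:
  assumes N: "open N" "x \<in> N"
  obtains \<beta> V C where "smooth_fun A UNIV \<beta>" "open V" "x \<in> V" "V \<subseteq> C" "closed C" "C \<subseteq> N"
    "\<And>y. y \<in> V ==> \<beta> y = 1" "\<And>y. y \<notin> C ==> \<beta> y = 0"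
proof -
  obtain U \<phi> where c: "(U, \<phi>) \<in> A" "x \<in> U" by (rule ex_chart)
  obtain r where r: "r > 0" and sub: "cball (\<phi> x) (2 * r) \<subseteq> \<phi> ` (U \<inter> N)"
    by (rule ex_chart_ball[OF c N(2,1)])
  have sub': "cball (\<phi> x) r \<subseteq> \<phi> ` (U \<inter> N)" using sub r by (auto simp: subset_iff)
  obtain \<beta> where \<beta>: "smooth_fun A UNIV \<beta>" "\<And>y. y \<in> inv_into U \<phi> ` cball (\<phi> x) r ==> \<beta> y = 1"
    "\<And>y. y \<notin> inv_into U \<phi> ` cball (\<phi> x) (2 * r) ==> \<beta> y = 0"
    by (rule chart_bump[OF c(1) r sub]) (rule that; assumption)
  show ?thesis
  proof (rule that[of \<beta> "inv_into U \<phi> ` ball (\<phi> x) r" "inv_into U \<phi> ` cball (\<phi> x) (2 * r)"])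
    show "inv_into U \<phi> ` ball (\<phi> x) r \<subseteq> inv_into U \<phi> ` cball (\<phi> x) (2 * r)"
      using r by (intro image_mono) auto
    show "\<beta> y = 1" if "y \<in> inv_into U \<phi> ` ball (\<phi> x) r" for y using \<beta>(2) that by auto
  qed (use \<beta> chart_ball[OF c(1) sub] chart_ball(3,7)[OF c(1) sub'] c(2) r in auto)
qed

text \<open>The open sets \<open>N\<close> and \<open>- C\<close> cover the manifold, and on each of
  them the function is given by a smooth expression.\<close>

lemma smooth_fun_extend_zero:
  assumes \<beta>: "smooth_fun A UNIV \<beta>" "\<And>y. y \<notin> C ==> \<beta> y = 0" and C: "closed C" "C \<subseteq> N"
    and N: "open N" and f: "smooth_fun A N f"
  shows "smooth_fun A UNIV (\<lambda>y. if y \<in> N then \<beta> y * f y else 0)"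
proof (rule smooth_fun_local[OF open_UNIV])
  fix y :: 'm
  show "\<exists>W. open W \<and> y \<in> W \<and> smooth_fun A (W \<inter> UNIV) (\<lambda>y. if y \<in> N then \<beta> y * f y else 0)"
  proof (cases "y \<in> N")
    case True
    have "smooth_fun A N (\<lambda>y. if y \<in> N then \<beta> y * f y else 0)"
      by (rule smooth_fun_cong[OF N _ smooth_fun_mult[OF N smooth_fun_subset[OF \<beta>(1)] f]]) auto
    then show ?thesis using True N by auto
  next
    case False
    have op: "open (- C)" using C(1) by (rule open_Compl)
    have "smooth_fun A (- C) (\<lambda>y. if y \<in> N then \<beta> y * f y else 0)"
      by (rule smooth_fun_cong[OF op _ smooth_fun_const[OF op, of 0]]) (simp add: \<beta>(2))
    then show ?thesis using False op C(2) by auto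
  qed
qed

lemma smooth_fun_extend:
  assumes N: "open N" "x \<in> N" and f: "smooth_fun A N f"
  obtains F V where "smooth_fun A UNIV F" "open V" "x \<in> V" "V \<subseteq> N" "\<And>y. y \<in> V ==> F y = f y"
proof -
  obtain \<beta> V C where \<beta>: "smooth_fun A UNIV \<beta>" "open V" "x \<in> V" "V \<subseteq> C" "closed C" "C \<subseteq> N"
    "\<And>y. y \<in> V ==> \<beta> y = 1" "\<And>y. y \<notin> C ==> \<beta> y = 0"
    by (rule ex_bump[OF N]) (rule that; assumption)
  show ?thesis
  proof (rule that[of "\<lambda>y. if y \<in> N then \<beta> y * f y else 0" V])
    show "smooth_fun A UNIV (\<lambda>y. if y \<in> N then \<beta> y * f y else 0)"
      by (rule smooth_fun_extend_zero[OF \<beta>(1,8,5,6) N(1) f])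
  qed (use \<beta> in auto)
qed

text \<open>For localization: whatever vanishes on \<open>N\<close> is unchanged by multiplication
  with \<open>g\<close>, although \<open>g\<close> vanishes at \<open>x\<close>.\<close>

lemma ex_cutoff:
  assumes N: "open N" "x \<in> N"
  obtains g where "smooth_fun A UNIV g" "g x = 0" "\<And>y. y \<notin> N ==> g y = 1"
proof -
  obtain \<beta> V C where \<beta>: "smooth_fun A UNIV \<beta>" "open V" "x \<in> V" "V \<subseteq> C" "closed C" "C \<subseteq> N"
    "\<And>y. y \<in> V ==> \<beta> y = 1" "\<And>y. y \<notin> C ==> \<beta> y = 0"
    by (rule ex_bump[OF N]) (rule that; assumption)
  show ?thesis
    by (rule that[of "\<lambda>y. 1 - \<beta> y"])
      (use \<beta> smooth_fun_diff[OF open_UNIV smooth_fun_const[OF open_UNIV] \<beta>(1)] in auto)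
qed

text \<open>Derivations act on global functions only, so the coordinates centered at
  \<open>x\<close> are extended beyond the chart and stay correct near \<open>x\<close>.\<close>

lemma ex_global_coordinates:
  assumes c: "(U, \<phi>) \<in> A" and x: "x \<in> U"
  obtains y V where "\<And>b. smooth_fun A UNIV (y b)" "open V" "x \<in> V" "V \<subseteq> U"
    "\<And>b z. z \<in> V ==> y b z = (\<phi> z - \<phi> x) \<bullet> b"
proof -
  obtain \<beta> V C where \<beta>: "smooth_fun A UNIV \<beta>" "open V" "x \<in> V" "V \<subseteq> C" "closed C" "C \<subseteq> U"
    "\<And>y. y \<in> V ==> \<beta> y = 1" "\<And>y. y \<notin> C ==> \<beta> y = 0"
    by (rule ex_bump[OF chart(1)[OF c] x]) (rule that; assumption)
  have 1: "smooth_fun A U (\<lambda>z. (\<phi> z - \<phi> x) \<bullet> b)" for b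
    unfolding inner_diff_left
    by (intro smooth_fun_diff smooth_fun_coordinate[OF c] smooth_fun_const chart(1)[OF c] order.refl)
  have "smooth_fun A UNIV (\<lambda>z. if z \<in> U then \<beta> z * ((\<phi> z - \<phi> x) \<bullet> b) else 0)" for b
    by (rule smooth_fun_extend_zero[OF \<beta>(1) _ \<beta>(5,6) chart(1)[OF c] 1]) (rule \<beta>(8))
  then show ?thesis
    by (rule that[of "\<lambda>b z. if z \<in> U then \<beta> z * ((\<phi> z - \<phi> x) \<bullet> b) else 0" V])
      (use \<beta>(2-7) in auto)
qed

text \<open>A linear functional on the smooth functions that kills products of two functions vanishing
  at \<open>x\<close> is a differential operator of order at most one at \<open>x\<close>, by Hadamard's lemma.\<close>

lemma first_order_functional:
  fixes \<theta> :: "('m \<Rightarrow> real) \<Rightarrow> real"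
  assumes add: "\<And>f g. smooth_fun A UNIV f ==> smooth_fun A UNIV g ==> \<theta> (\<lambda>y. f y + g y) = \<theta> f + \<theta> g"
    and scale: "\<And>r f. smooth_fun A UNIV f ==> \<theta> (\<lambda>y. r * f y) = r * \<theta> f"
    and vanish: "\<And>f g. smooth_fun A UNIV f ==> smooth_fun A UNIV g ==> f x = 0 ==> g x = 0 ==>
      \<theta> (\<lambda>y. f y * g y) = 0"
    and c: "(U, \<phi>) \<in> A" "x \<in> U"
    and y: "\<And>b. smooth_fun A UNIV (y b)" "open V" "x \<in> V" "V \<subseteq> U"
      "\<And>b z. z \<in> V ==> y b z = (\<phi> z - \<phi> x) \<bullet> b"
    and f: "smooth_fun A UNIV f"
  shows "\<theta> f = f x * \<theta> (\<lambda>_. 1) + (\<Sum>b\<in>onb. chart_deriv U \<phi> f x b * \<theta> (y b))"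
proof -
  have const: "smooth_fun A UNIV (\<lambda>_. r)" for r by (rule smooth_fun_const[OF open_UNIV])
  have zero: "\<theta> (\<lambda>_. 0) = 0" using scale[OF const, of 0 0] by simp
  \<comment> \<open>\<open>h\<close> equals \<open>h * g\<close> for a cutoff \<open>g\<close>, a
    product of two functions vanishing at \<open>x\<close>.\<close>
  have local: "\<theta> h = 0" if h: "smooth_fun A UNIV h" and N: "open N" "x \<in> N" "\<And>y. y \<in> N ==> h y = 0" for h N
  proof -
    obtain g where g: "smooth_fun A UNIV g" "g x = 0" "\<And>y. y \<notin> N ==> g y = 1"
      by (rule ex_cutoff[OF N(1,2)]) (rule that; assumption)
    have "h = (\<lambda>y. h y * g y)"
    proof
      fix y show "h y = h y * g y" using N(3) g(3) by (cases "y \<in> N") auto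
    qed
    then show ?thesis using vanish[OF h g(1) N(3)[OF N(2)] g(2)] by simp
  qed
  have sum: "smooth_fun A UNIV (\<lambda>y. \<Sum>i\<in>I. F i y) \<and> \<theta> (\<lambda>y. \<Sum>i\<in>I. F i y) = (\<Sum>i\<in>I. \<theta> (F i))"
    if "\<And>i. i \<in> I ==> smooth_fun A UNIV (F i)" "finite I" for F and I :: "'a set"
    using that(2,1)
  proof (induction I rule: finite_induct)
    case empty
    then show ?case using zero const by simp
  next
    case (insert i I)
    then show ?case using add smooth_fun_add[OF open_UNIV] by simp
  qed
  obtain r where r: "r > 0" and sub: "cball (\<phi> x) (2 * r) \<subseteq> \<phi> ` (U \<inter> V)"
    by (rule ex_chart_ball[OF c y(3,2)])
  have sub': "cball (\<phi> x) r \<subseteq> \<phi> ` (U \<inter> V)" using sub r by (auto simp: subset_iff)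
  let ?B = "inv_into U \<phi> ` ball (\<phi> x) r"
  have BU: "?B \<subseteq> U \<inter> V" using chart_ball(4)[OF c(1) sub'] by (auto simp: subset_iff)
  have oB: "open ?B" by (rule chart_ball(3)[OF c(1) sub'])
  have xB: "x \<in> ?B" by (rule chart_ball(7)[OF c(1) sub' c(2) r])
  have ballU: "ball (\<phi> x) r \<subseteq> \<phi> ` (U \<inter> UNIV)" using sub' ball_subset_cball by blast
  obtain g where g: "\<And>b. smooth_on (ball (\<phi> x) r) (g b)"
    "\<And>b. g b (\<phi> x) = frechet_derivative (\<lambda>y. f (inv_into U \<phi> y)) (at (\<phi> x)) b"
    "\<And>z. z \<in> ball (\<phi> x) r ==> f (inv_into U \<phi> z) =
      f (inv_into U \<phi> (\<phi> x)) + (\<Sum>b\<in>onb. ((z - \<phi> x) \<bullet> b) * g b z)"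
    by (rule Hadamard[OF smooth_on_subset[OF smooth_funD[OF c(1) f] ballU] r]) (rule that; assumption)
  have imB: "\<phi> ` ?B \<subseteq> ball (\<phi> x) r"
    using chart_ball(6)[OF c(1) sub'] BU by blast
  have gB: "smooth_fun A ?B (\<lambda>z. g b (\<phi> z))" for b
    by (rule smooth_fun_chartI[OF c(1) oB _ smooth_on_subset[OF g(1) imB]]) (use BU in blast)
  obtain \<beta> V' C where \<beta>: "smooth_fun A UNIV \<beta>" "open V'" "x \<in> V'" "V' \<subseteq> C" "closed C" "C \<subseteq> ?B"
    "\<And>y. y \<in> V' ==> \<beta> y = 1" "\<And>y. y \<notin> C ==> \<beta> y = 0"
    by (rule ex_bump[OF oB xB]) (rule that; assumption)
  define G where "G b z = (if z \<in> ?B then \<beta> z * g b (\<phi> z) else 0)" for b z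
  have G: "smooth_fun A UNIV (G b)" for b
    unfolding G_def[abs_def] by (rule smooth_fun_extend_zero[OF \<beta>(1,8,5,6) oB gB])
  have GV: "G b z = g b (\<phi> z)" if "z \<in> V'" for b z
    using that \<beta>(4,6,7) unfolding G_def by auto
  have Gx: "G b x = chart_deriv U \<phi> f x b" for b
    unfolding GV[OF \<beta>(3)] chart_deriv_def by (rule g(2))
  have yx: "y b x = 0" for b using y(5)[OF y(3)] by simp
  \<comment> \<open>Replacing \<open>G b\<close> by its value at \<open>x\<close> changes the
    product by \<open>y b * (G b - G b x)\<close>, and both of these factors vanish at
    \<open>x\<close>.\<close>
  have yG: "\<theta> (\<lambda>z. y b z * G b z) = G b x * \<theta> (y b)" for b
  proof -
    have d: "smooth_fun A UNIV (\<lambda>z. G b z - G b x)" by (rule smooth_fun_diff[OF open_UNIV G const])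
    have "\<theta> (\<lambda>z. y b z * (G b z - G b x) + G b x * y b z) =
        \<theta> (\<lambda>z. y b z * (G b z - G b x)) + \<theta> (\<lambda>z. G b x * y b z)"
      by (rule add[OF smooth_fun_mult[OF open_UNIV y(1) d] smooth_fun_mult[OF open_UNIV const y(1)]])
    moreover have "(\<lambda>z. y b z * (G b z - G b x) + G b x * y b z) = (\<lambda>z. y b z * G b z)"
      by (simp add: algebra_simps)
    moreover have "\<theta> (\<lambda>z. y b z * (G b z - G b x)) = 0" by (rule vanish[OF y(1) d yx]) simp
    ultimately show ?thesis using scale[OF y(1)] by simp
  qed
  define S where "S z = (\<Sum>b\<in>onb. y b z * G b z)" for z
  have S: "smooth_fun A UNIV S" "\<theta> S = (\<Sum>b\<in>onb. G b x * \<theta> (y b))"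
    using sum[OF smooth_fun_mult[OF open_UNIV y(1) G] onb(1), of "\<lambda>b. b" "\<lambda>b. b"] yG
    unfolding S_def[abs_def] by simp_all
  \<comment> \<open>The remainder in Hadamard's formula. It vanishes only near \<open>x\<close>,
    since the cofactors had to be cut off; locality disposes of it.\<close>
  define h where "h z = f z - (f x * 1 + S z)" for z
  have sm: "smooth_fun A UNIV (\<lambda>z. f x * 1 + S z)" by (rule smooth_fun_add[OF open_UNIV const S(1)])
  have hs: "smooth_fun A UNIV h" unfolding h_def[abs_def] by (rule smooth_fun_diff[OF open_UNIV f sm])
  have "h z = 0" if z: "z \<in> V' \<inter> ?B" for z
  proof -
    have zU: "z \<in> U" "z \<in> V" using z BU by auto
    have "\<phi> z \<in> ball (\<phi> x) r" using imB z by blast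
    from g(3)[OF this] have "f z = f x + (\<Sum>b\<in>onb. ((\<phi> z - \<phi> x) \<bullet> b) * g b (\<phi> z))"
      by (simp add: chart(6)[OF c(1)] zU c(2))
    then show ?thesis unfolding h_def S_def using z by (simp add: y(5)[OF zU(2)] GV)
  qed
  then have "\<theta> h = 0" by (intro local[OF hs, of "V' \<inter> ?B"]) (use \<beta>(2,3) oB xB in auto)
  have "\<theta> f = \<theta> (\<lambda>z. h z + (f x * 1 + S z))" by (simp add: h_def)
  also have "\<dots> = \<theta> h + \<theta> (\<lambda>z. f x * 1 + S z)" by (rule add[OF hs sm])
  also have "\<theta> (\<lambda>z. f x * 1 + S z) = \<theta> (\<lambda>_. f x * 1) + \<theta> S"
    by (rule add[OF _ S(1)]) (rule const)
  also have "\<theta> (\<lambda>_. f x * 1) = f x * \<theta> (\<lambda>_. 1)" by (rule scale[OF const])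
  finally show ?thesis using \<open>\<theta> h = 0\<close> S(2) Gx by simp
qed

end

section \<open>Smooth maps into vector spaces\<close>

context atlas
begin

text \<open>Every real functional is a combination of members of \<open>F\<close> with constant
  coefficients, so these finitely many tests are enough.\<close>

lemma smooth_vec_fun_separating:
  assumes V: "is_vspace V" and F: "finite F" "separating V F" "\<And>f. f \<in> F ==> real_functional V f"
    and W: "open W" and g: "\<And>x. x \<in> W ==> g x \<in> car V"
    and s: "\<And>f. f \<in> F ==> smooth_fun A W (\<lambda>x. f (g x))"
  shows "smooth_vec_fun A W V g"
proof -
  obtain G e where G: "G \<subseteq> F" "separating V G" "\<And>h. h \<in> G ==> e h \<in> car V"
    "\<And>f h. f \<in> G ==> h \<in> G ==> f (e h) = (if f = h then 1 else 0)"
    "\<And>l v. real_functional V l ==> v \<in> car V ==> l v = (\<Sum>h\<in>G. h v * l (e h))"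
    by (rule real_dual_basis_of_separating[OF V F]) (assumption | (rule that; assumption))+
  have "smooth_fun A W (\<lambda>x. l (g x))" if l: "l \<in> real_dual V" for l
  proof (rule smooth_fun_cong[OF W])
    show "smooth_fun A W (\<lambda>x. \<Sum>h\<in>G. h (g x) * l (e h))"
      using G(1) by (intro smooth_fun_sum smooth_fun_mult smooth_fun_const W s) auto
    show "(\<Sum>h\<in>G. h (g x) * l (e h)) = l (g x)" if "x \<in> W" for x
      using G(5)[OF _ g[OF that], of l] l unfolding real_dual_iff by simp
  qed
  then show ?thesis unfolding smooth_vec_fun_def using g by blast
qed

lemma smooth_vec_fun_car: "smooth_vec_fun A W V g ==> x \<in> W ==> g x \<in> car V"
  unfolding smooth_vec_fun_def by blast

lemma smooth_vec_fun_functional: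
  assumes V: "is_vspace V" and W: "open W" and g: "smooth_vec_fun A W V g" and l: "real_functional V l"
  shows "smooth_fun A W (\<lambda>x. l (g x))"
proof (rule smooth_fun_cong[OF W])
  show "smooth_fun A W (\<lambda>x. restrict l (car V) (g x))"
    using g restrict_real_dual[OF V l] unfolding smooth_vec_fun_def by blast
qed (use smooth_vec_fun_car[OF g] in simp)

lemma smooth_vec_funI:
  "(\<And>x. x \<in> W ==> g x \<in> car V) ==> (\<And>l. real_functional V l ==> smooth_fun A W (\<lambda>x. l (g x))) ==>
    smooth_vec_fun A W V g"
  unfolding smooth_vec_fun_def by (auto simp: real_dual_iff)

lemma smooth_vec_fun_cong:
  assumes "open W" "\<And>x. x \<in> W ==> f x = g x" "smooth_vec_fun A W V f"
  shows "smooth_vec_fun A W V g"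
  unfolding smooth_vec_fun_def
proof (intro conjI ballI)
  show "g x \<in> car V" if "x \<in> W" for x using smooth_vec_fun_car[OF assms(3) that] assms(2)[OF that] by simp
  fix l assume "l \<in> real_dual V"
  then have "smooth_fun A W (\<lambda>x. l (f x))" using assms(3) unfolding smooth_vec_fun_def by blast
  then show "smooth_fun A W (\<lambda>x. l (g x))" by (rule smooth_fun_cong[OF assms(1), rotated]) (simp add: assms(2))
qed

lemma smooth_vec_fun_subset: "smooth_vec_fun A W V g ==> N \<subseteq> W ==> smooth_vec_fun A N V g"
  unfolding smooth_vec_fun_def using smooth_fun_subset by blast

lemma smooth_vec_fun_local:
  assumes "open W" "\<And>x. x \<in> W ==> \<exists>N. open N \<and> x \<in> N \<and> smooth_vec_fun A (N \<inter> W) V f"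
  shows "smooth_vec_fun A W V f"
  unfolding smooth_vec_fun_def
proof (intro conjI ballI)
  show "f x \<in> car V" if x: "x \<in> W" for x
    using assms(2)[OF x] x unfolding smooth_vec_fun_def by blast
  fix l assume l: "l \<in> real_dual V"
  show "smooth_fun A W (\<lambda>x. l (f x))"
  proof (rule smooth_fun_local[OF assms(1)])
    fix x assume "x \<in> W"
    from assms(2)[OF this] l show "\<exists>N. open N \<and> x \<in> N \<and> smooth_fun A (N \<inter> W) (\<lambda>x. l (f x))"
      unfolding smooth_vec_fun_def by blast
  qed
qed

lemma smooth_vec_fun_const: "open W ==> v \<in> car V ==> smooth_vec_fun A W V (\<lambda>x. v)"
  unfolding smooth_vec_fun_def by (simp add: smooth_fun_const)

lemma smooth_vec_fun_lin_map:
  assumes "is_vspace V" "open N" "smooth_vec_fun A N V g" "lin_map V W T"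
  shows "smooth_vec_fun A N W (\<lambda>x. T (g x))"
  by (rule smooth_vec_funI)
    (use lin_mapD(1)[OF assms(4) smooth_vec_fun_car[OF assms(3)]]
        smooth_vec_fun_functional[OF assms(1-3) real_functional_comp[OF assms(4)]] in auto)

text \<open>Expanding \<open>g x\<close> in a real basis of \<open>V\<close> leaves smooth
  coefficients times the values of \<open>H x\<close> at constant vectors.\<close>

lemma smooth_vec_fun_apply:
  assumes V: "fin_dim_vspace V" and N: "open N" and H: "\<And>x. x \<in> N ==> lin_map V W (H x)"
    and W: "is_vspace W" and Hs: "\<And>v. v \<in> car V ==> smooth_vec_fun A N W (\<lambda>x. H x v)"
    and g: "smooth_vec_fun A N V g"
  shows "smooth_vec_fun A N W (\<lambda>x. H x (g x))"
proof (rule smooth_vec_funI)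
  show "H x (g x) \<in> car W" if "x \<in> N" for x
    using lin_mapD(1)[OF H[OF that] smooth_vec_fun_car[OF g that]] .
  fix l assume l: "real_functional W l"
  have vs: "is_vspace V" using V unfolding fin_dim_vspace_def by blast
  obtain r :: nat and \<epsilon> e where e: "\<And>i. i < r ==> \<epsilon> i \<in> real_dual V" "\<And>i. i < r ==> e i \<in> car V"
    "\<And>i j. i < r ==> j < r ==> \<epsilon> i (e j) = (if i = j then 1 else 0)"
    "\<And>l v. real_functional V l ==> v \<in> car V ==> l v = (\<Sum>i<r. \<epsilon> i v * l (e i))"
    "separating V (\<epsilon> ` {..<r})"
    by (rule ex_real_basis[OF V]) (rule that; assumption)
  show "smooth_fun A N (\<lambda>x. l (H x (g x)))"
  proof (rule smooth_fun_cong[OF N])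
    have "smooth_fun A N (\<lambda>x. \<epsilon> i (g x))" if "i < r" for i
      using g e(1)[OF that] unfolding smooth_vec_fun_def by blast
    moreover have "smooth_fun A N (\<lambda>x. l (H x (e i)))" if "i < r" for i
      by (rule smooth_vec_fun_functional[OF W N Hs[OF e(2)[OF that]] l])
    ultimately show "smooth_fun A N (\<lambda>x. \<Sum>i<r. \<epsilon> i (g x) * l (H x (e i)))"
      by (intro smooth_fun_sum smooth_fun_mult N) auto
    show "(\<Sum>i<r. \<epsilon> i (g x) * l (H x (e i))) = l (H x (g x))" if x: "x \<in> N" for x
      using e(4)[OF real_functional_comp[OF H[OF x] l] smooth_vec_fun_car[OF g x]] by simp
  qed
qed

lemma smooth_vec_fun_eval:
  assumes "map_subspace S V F" "open N" "smooth_vec_fun A N (maps_vspace S V F) g" "s \<in> S"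
  shows "smooth_vec_fun A N V (\<lambda>x. g x s)"
proof (rule smooth_vec_funI)
  show "g x s \<in> car V" if "x \<in> N" for x
    using smooth_vec_fun_car[OF assms(3) that] map_subspaceD(1)[OF assms(1) _ _ assms(4)]
    by (simp add: maps_vspace_simps)
  show "smooth_fun A N (\<lambda>x. l (g x s))" if "real_functional V l" for l
    by (rule smooth_vec_fun_functional[OF is_vspace_maps[OF assms(1)] assms(2,3)
          maps_real_functional[OF that assms(1,4)]])
qed

text \<open>Evaluations at the determining set \<open>T\<close>, followed by separating functionals
  of \<open>V\<close>, form a finite separating family on the space of maps.\<close>

lemma smooth_vec_fun_maps:
  assumes F: "map_subspace S V F" and V: "fin_dim_vspace V" and T: "finite T" "T \<subseteq> S"
    and det: "\<And>f g. f \<in> extensional S \<inter> F ==> g \<in> extensional S \<inter> F ==> (\<And>s. s \<in> T ==> f s = g s) ==> f = g"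
    and N: "open N" and g: "\<And>x. x \<in> N ==> g x \<in> extensional S \<inter> F"
    and s: "\<And>s. s \<in> T ==> smooth_vec_fun A N V (\<lambda>x. g x s)"
  shows "smooth_vec_fun A N (maps_vspace S V F) g"
proof -
  have vs: "is_vspace V" using V unfolding fin_dim_vspace_def by blast
  obtain K where K: "finite K" "separating V K" "\<And>f. f \<in> K ==> real_functional V f"
    by (rule ex_finite_separating_real_functionals[OF V]) (rule that; assumption)
  let ?G = "(\<lambda>(l, s) f. l (f s)) ` (K \<times> T)"
  show ?thesis
  proof (rule smooth_vec_fun_separating[OF is_vspace_maps[OF F], where F = ?G])
    show "finite ?G" using K T by auto
    show "real_functional (maps_vspace S V F) h" if "h \<in> ?G" for h
      using that K(3) T(2) maps_real_functional[OF _ F] by auto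
    show "separating (maps_vspace S V F) ?G"
      unfolding separating_def maps_vspace_simps
    proof (intro ballI impI)
      fix f h assume fh: "f \<in> extensional S \<inter> F" "h \<in> extensional S \<inter> F" and *: "\<forall>k\<in>?G. k f = k h"
      show "f = h"
      proof (rule det[OF fh])
        fix s assume s: "s \<in> T"
        have "f s \<in> car V" "h s \<in> car V" using fh s T(2) map_subspaceD(1)[OF F] by auto
        moreover have "\<forall>l\<in>K. l (f s) = l (h s)" using * s by auto
        ultimately show "f s = h s" using K(2) unfolding separating_def by blast
      qed
    qed
    show "smooth_fun A N (\<lambda>x. h (g x))" if h: "h \<in> ?G" for h
    proof -
      obtain l s' where ls: "l \<in> K" "s' \<in> T" "h = (\<lambda>f. l (f s'))" using h by auto
      show ?thesis unfolding ls(3)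
        by (rule smooth_vec_fun_functional[OF vs N s[OF ls(2)] K(3)[OF ls(1)]])
    qed
  qed (use N g in \<open>auto simp: maps_vspace_simps\<close>)
qed

subsection \<open>Vector bundles\<close>

lemma vector_bundleD:
  assumes "vector_bundle A E"
  shows "fin_dim_vspace (model E)" "is_vspace (model E)" "is_vspace (fib E x)"
    "(U, \<psi>) \<in> triv E ==> open U" "(U, \<psi>) \<in> triv E ==> x \<in> U ==> lin_iso (fib E x) (model E) (\<psi> x)"
    "(U, \<psi>) \<in> triv E ==> (U', \<psi>') \<in> triv E ==> v \<in> car (model E) ==>
       smooth_vec_fun A (U \<inter> U') (model E) (\<lambda>x. \<psi>' x (inv_into (car (fib E x)) (\<psi> x) v))"
  using assms unfolding vector_bundle_def fin_dim_vspace_def smooth_bundle_map_def by fast+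

lemma ex_triv:
  assumes "vector_bundle A E"
  obtains U \<psi> where "(U, \<psi>) \<in> triv E" "x \<in> U"
proof -
  have "x \<in> \<Union> (fst ` triv E)" using assms unfolding vector_bundle_def by auto
  then show ?thesis using that by auto
qed

lemma vector_bundleI:
  assumes "fin_dim_vspace (model E)" "\<And>x. is_vspace (fib E x)"
    "\<And>U \<psi>. (U, \<psi>) \<in> triv E ==> open U"
    "\<And>U \<psi> x. (U, \<psi>) \<in> triv E ==> x \<in> U ==> lin_iso (fib E x) (model E) (\<psi> x)"
    "\<And>x. \<exists>U \<psi>. (U, \<psi>) \<in> triv E \<and> x \<in> U"
    "\<And>U \<psi> U' \<psi>' v. (U, \<psi>) \<in> triv E ==> (U', \<psi>') \<in> triv E ==> v \<in> car (model E) ==>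
       smooth_vec_fun A (U \<inter> U') (model E) (\<lambda>x. \<psi>' x (inv_into (car (fib E x)) (\<psi> x) v))"
  shows "vector_bundle A E"
proof -
  have "\<Union> (fst ` triv E) = UNIV" using assms(5) by force
  moreover have "lin_map (fib E x) (fib E x) (\<lambda>v. v)" for x unfolding lin_map_def by auto
  moreover have "\<forall>(U, \<psi>)\<in>triv E. open U \<and> (\<forall>x\<in>U. lin_iso (fib E x) (model E) (\<psi> x))"
    by (clarify, intro conjI ballI) (rule assms(3,4); assumption)+
  moreover have "\<forall>(U, \<psi>)\<in>triv E. \<forall>(U', \<psi>')\<in>triv E. \<forall>v\<in>car (model E).
      smooth_vec_fun A (U \<inter> U') (model E) (\<lambda>x. \<psi>' x (inv_into (car (fib E x)) (\<psi> x) v))"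
    by clarify (rule assms(6))
  ultimately show ?thesis
    unfolding vector_bundle_def smooth_bundle_map_def using assms(1,2) by simp
qed

lemma transition_lin_iso:
  assumes E: "vector_bundle A E" and t: "(U, \<psi>) \<in> triv E" "(U', \<psi>') \<in> triv E" and x: "x \<in> U" "x \<in> U'"
  shows "lin_iso (model E) (model E) (\<lambda>v. \<psi>' x (inv_into (car (fib E x)) (\<psi> x) v))"
  using lin_iso_comp[OF lin_iso_inv[OF vector_bundleD(3)[OF E] vector_bundleD(5)[OF E t(1) x(1)]]
      vector_bundleD(5)[OF E t(2) x(2)]] .

lemma triv_change:
  assumes E: "vector_bundle A E" and t: "(U, \<psi>) \<in> triv E" "(U', \<psi>') \<in> triv E"
    and N: "open N" "N \<subseteq> U \<inter> U'" and s: "\<And>x. x \<in> N ==> s x \<in> car (fib E x)"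
    and sm: "smooth_vec_fun A N (model E) (\<lambda>x. \<psi> x (s x))"
  shows "smooth_vec_fun A N (model E) (\<lambda>x. \<psi>' x (s x))"
proof (rule smooth_vec_fun_cong[OF N(1)])
  show "smooth_vec_fun A N (model E) (\<lambda>x. \<psi>' x (inv_into (car (fib E x)) (\<psi> x) (\<psi> x (s x))))"
  proof (rule smooth_vec_fun_apply[OF vector_bundleD(1)[OF E] N(1) _ vector_bundleD(2)[OF E] _ sm,
        where H = "\<lambda>x v. \<psi>' x (inv_into (car (fib E x)) (\<psi> x) v)"])
    show "lin_map (model E) (model E) (\<lambda>v. \<psi>' x (inv_into (car (fib E x)) (\<psi> x) v))" if "x \<in> N" for x
      by (rule lin_isoD(1)[OF transition_lin_iso[OF E t]]) (use that N in auto)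
    show "smooth_vec_fun A N (model E) (\<lambda>x. \<psi>' x (inv_into (car (fib E x)) (\<psi> x) v))"
      if "v \<in> car (model E)" for v
      by (rule smooth_vec_fun_subset[OF vector_bundleD(6)[OF E t that] N(2)])
  qed
  show "\<psi>' x (inv_into (car (fib E x)) (\<psi> x) (\<psi> x (s x))) = \<psi>' x (s x)" if "x \<in> N" for x
  proof -
    have "x \<in> U" using that N by blast
    then show ?thesis using lin_isoD(4)[OF vector_bundleD(5)[OF E t(1)] s[OF that]] by simp
  qed
qed

end

subsection \<open>Endomorphisms\<close>

lemma endomorphism_eqI:
  assumes V: "fin_dim_vspace V" and e: "\<And>i. i < r ==> e i \<in> car V"
    "\<And>l v. real_functional V l ==> v \<in> car V ==> l v = (\<Sum>i<r. \<epsilon> i v * l (e i))"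
    and f: "lin_map V W f" "f \<in> extensional (car V)" and g: "lin_map V W g" "g \<in> extensional (car V)"
    and W: "fin_dim_vspace W"
    and eq: "\<And>s. s \<in> e ` {..<r::nat} ==> f s = g s"
  shows "f = g"
proof (rule extensionalityI[OF f(2) g(2)])
  fix v assume v: "v \<in> car V"
  show "f v = g v"
  proof (rule real_dual_eqI[OF W lin_mapD(1)[OF f(1) v] lin_mapD(1)[OF g(1) v]])
    fix l assume "l \<in> real_dual W"
    then have l: "real_functional W l" by (simp add: real_dual_iff)
    show "l (f v) = l (g v)"
      using e(2)[OF real_functional_comp[OF f(1) l] v] e(2)[OF real_functional_comp[OF g(1) l] v] eq
      by simp
  qed
qed

lemma conj_map_ext: "conj_map V W \<psi> D \<in> extensional (car W)"
  unfolding conj_map_def by simp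

text \<open>Conjugation by the inverse isomorphism is inverse to conjugation. The second claim
  spells the inverse out, because transition maps are stated through
  \<open>inv_into\<close>.\<close>

lemma lin_iso_conj_map:
  assumes V: "is_vspace V" and \<psi>: "lin_iso V W \<psi>"
    and F: "map_subspace (car V) V F" and F': "map_subspace (car W) W F'"
    and 1: "\<And>D. D \<in> extensional (car V) ==> D \<in> F ==> conj_map V W \<psi> D \<in> F'"
    and 2: "\<And>D. D \<in> extensional (car W) ==> D \<in> F' ==> conj_map W V (inv_into (car V) \<psi>) D \<in> F"
  shows "lin_iso (maps_vspace (car V) V F) (maps_vspace (car W) W F') (conj_map V W \<psi>)"
    "D' \<in> car (maps_vspace (car W) W F') ==>
      inv_into (car (maps_vspace (car V) V F)) (conj_map V W \<psi>) D' = (\<lambda>v\<in>car V. inv_into (car V) \<psi> (D' (\<psi> v)))"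
proof -
  note \<psi>D = lin_isoD[OF \<psi>]
  have inv2: "inv_into (car W) (inv_into (car V) \<psi>) v = \<psi> v" if "v \<in> car V" for v
    using lin_isoD(4)[OF lin_iso_inv[OF V \<psi>] \<psi>D(2)[OF that]] \<psi>D(4)[OF that] by simp
  have bak: "conj_map W V (inv_into (car V) \<psi>) D = (\<lambda>v\<in>car V. inv_into (car V) \<psi> (D (\<psi> v)))" for D
    unfolding conj_map_def using inv2 by (intro restrict_ext) simp
  have FD: "D v \<in> car V" if "D \<in> extensional (car V)" "D \<in> F" "v \<in> car V" for D v
    using map_subspaceD(1)[OF F that] .
  have F'D: "D v \<in> car W" if "D \<in> extensional (car W)" "D \<in> F'" "v \<in> car W" for D v
    using map_subspaceD(1)[OF F' that] .
  have l: "conj_map W V (inv_into (car V) \<psi>) (conj_map V W \<psi> D) = D"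
    if "D \<in> extensional (car V)" "D \<in> F" for D
    unfolding bak by (rule extensionalityI[of _ "car V"]) (use that FD in \<open>auto simp: conj_map_def \<psi>D(2,4)\<close>)
  have r: "conj_map V W \<psi> (conj_map W V (inv_into (car V) \<psi>) D) = D"
    if "D \<in> extensional (car W)" "D \<in> F'" for D
    unfolding bak by (rule extensionalityI[of _ "car W"]) (use that F'D in \<open>auto simp: conj_map_def \<psi>D(3,5)\<close>)
  have bij: "bij_betw (conj_map V W \<psi>) (extensional (car V) \<inter> F) (extensional (car W) \<inter> F')"
    by (rule bij_betw_byWitness[where f' = "conj_map W V (inv_into (car V) \<psi>)"])
      (use l r 1 2 conj_map_ext in auto)
  have "conj_map V W \<psi> (\<lambda>s\<in>car V. vadd V (D s) (D' s)) = (\<lambda>s\<in>car W. vadd W (conj_map V W \<psi> D s) (conj_map V W \<psi> D' s))"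
    if "D \<in> extensional (car V)" "D \<in> F" "D' \<in> extensional (car V)" "D' \<in> F" for D D'
    unfolding conj_map_def
    by (intro restrict_ext) (use that FD \<psi>D(3) lin_mapD(2)[OF \<psi>D(1)] in simp)
  moreover have "conj_map V W \<psi> (\<lambda>s\<in>car V. vscale V c (D s)) = (\<lambda>s\<in>car W. vscale W c (conj_map V W \<psi> D s))"
    if "D \<in> extensional (car V)" "D \<in> F" for D c
    unfolding conj_map_def
    by (intro restrict_ext) (use that FD \<psi>D(3) lin_mapD(3)[OF \<psi>D(1)] in simp)
  ultimately show "lin_iso (maps_vspace (car V) V F) (maps_vspace (car W) W F') (conj_map V W \<psi>)"
    using bij 1 conj_map_ext unfolding lin_iso_def lin_map_def maps_vspace_simps by auto
  show "inv_into (car (maps_vspace (car V) V F)) (conj_map V W \<psi>) D' = (\<lambda>v\<in>car V. inv_into (car V) \<psi> (D' (\<psi> v)))"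
    if D': "D' \<in> car (maps_vspace (car W) W F')" for D'
  proof -
    have D'': "D' \<in> extensional (car W)" "D' \<in> F'" using D' by (auto simp: maps_vspace_simps)
    have "inv_into (extensional (car V) \<inter> F) (conj_map V W \<psi>) D' = conj_map W V (inv_into (car V) \<psi>) D'"
      by (rule inv_into_f_eq) (use bij r[OF D''] 2[OF D''] conj_map_ext in \<open>auto simp: bij_betw_def\<close>)
    then show ?thesis unfolding maps_vspace_simps bak .
  qed
qed

context atlas
begin

text \<open>The transition map conjugates a constant \<open>D\<close> by the transition map of
  \<open>L\<close>. On a basis vector this is a transition map, then \<open>D\<close>, then a
  transition map back, and each of the three preserves smoothness.\<close>

lemma conj_vector_bundle:
  assumes L: "vector_bundle A L"
    and F: "\<And>x. map_subspace (car (fib L x)) (fib L x) (F x)"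
    and G: "map_subspace (car (model L)) (model L) G" "\<And>D. D \<in> G ==> lin_map (model L) (model L) D"
    and 1: "\<And>U \<psi> x D. (U, \<psi>) \<in> triv L ==> x \<in> U ==> D \<in> extensional (car (fib L x)) ==> D \<in> F x ==>
      conj_map (fib L x) (model L) (\<psi> x) D \<in> G"
    and 2: "\<And>U \<psi> x D. (U, \<psi>) \<in> triv L ==> x \<in> U ==> D \<in> extensional (car (model L)) ==> D \<in> G ==>
      conj_map (model L) (fib L x) (inv_into (car (fib L x)) (\<psi> x)) D \<in> F x"
    and E: "model E = maps_vspace (car (model L)) (model L) G"
      "\<And>x. fib E x = maps_vspace (car (fib L x)) (fib L x) (F x)" "triv E = conj_triv L"
  shows "vector_bundle A E"
proof -
  note LD = vector_bundleD[OF L]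
  obtain r :: nat and \<epsilon> e where e: "\<And>i. i < r ==> \<epsilon> i \<in> real_dual (model L)" "\<And>i. i < r ==> e i \<in> car (model L)"
    "\<And>i j. i < r ==> j < r ==> \<epsilon> i (e j) = (if i = j then 1 else 0)"
    "\<And>l v. real_functional (model L) l ==> v \<in> car (model L) ==> l v = (\<Sum>i<r. \<epsilon> i v * l (e i))"
    "separating (model L) (\<epsilon> ` {..<r})"
    by (rule ex_real_basis[OF LD(1)]) (rule that; assumption)
  have T: "finite (e ` {..<r})" "e ` {..<r} \<subseteq> car (model L)" using e(2) by auto
  have det: "f = g" if "f \<in> extensional (car (model L)) \<inter> G" "g \<in> extensional (car (model L)) \<inter> G"
    "\<And>s. s \<in> e ` {..<r} ==> f s = g s" for f g
    by (rule endomorphism_eqI[OF LD(1) e(2,4) _ _ _ _ LD(1) that(3)]) (use that G(2) in auto)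
  have iso: "lin_iso (fib E x) (model E) (conj_map (fib L x) (model L) (\<psi> x))"
    "D \<in> car (model E) ==> inv_into (car (fib E x)) (conj_map (fib L x) (model L) (\<psi> x)) D =
      (\<lambda>v\<in>car (fib L x). inv_into (car (fib L x)) (\<psi> x) (D (\<psi> x v)))"
    if t: "(U, \<psi>) \<in> triv L" "x \<in> U" for U \<psi> x D
    unfolding E(1,2)
    by (rule lin_iso_conj_map[OF LD(3) LD(5)[OF t] F G(1) 1[OF t] 2[OF t]]; assumption)+
  show ?thesis
  proof (rule vector_bundleI)
    show "fin_dim_vspace (model E)" unfolding E(1) by (rule fin_dim_maps[OF G(1) LD(1) T det])
    show "is_vspace (fib E x)" for x unfolding E(2) by (rule is_vspace_maps[OF F])
    show "open U" if "(U, \<psi>) \<in> triv E" for U \<psi> using that LD(4) unfolding E(3) conj_triv_def by auto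
    show "lin_iso (fib E x) (model E) (\<psi> x)" if t: "(U, \<psi>) \<in> triv E" "x \<in> U" for U \<psi> x
    proof -
      obtain \<psi>0 where 0: "(U, \<psi>0) \<in> triv L" "\<psi> = (\<lambda>x. conj_map (fib L x) (model L) (\<psi>0 x))"
        using t(1) unfolding E(3) conj_triv_def by auto
      show ?thesis unfolding 0(2) by (rule iso(1)[OF 0(1) t(2)])
    qed
    show "\<exists>U \<psi>. (U, \<psi>) \<in> triv E \<and> x \<in> U" for x
    proof -
      obtain U \<psi> where "(U, \<psi>) \<in> triv L" "x \<in> U" by (rule ex_triv[OF L])
      then show ?thesis unfolding E(3) conj_triv_def by force
    qed
    fix U \<psi> U' \<psi>' D assume t: "(U, \<psi>) \<in> triv E" "(U', \<psi>') \<in> triv E" and D: "D \<in> car (model E)"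
    obtain \<psi>0 where 0: "(U, \<psi>0) \<in> triv L" "\<psi> = (\<lambda>x. conj_map (fib L x) (model L) (\<psi>0 x))"
      using t(1) unfolding E(3) conj_triv_def by auto
    obtain \<psi>1 where 1: "(U', \<psi>1) \<in> triv L" "\<psi>' = (\<lambda>x. conj_map (fib L x) (model L) (\<psi>1 x))"
      using t(2) unfolding E(3) conj_triv_def by auto
    have D': "D \<in> extensional (car (model L))" "D \<in> G" using D by (auto simp: E(1) maps_vspace_simps)
    have linD: "lin_map (model L) (model L) D" by (rule G(2)[OF D'(2)])
    let ?N = "U \<inter> U'"
    have N: "open ?N" using LD(4)[OF 0(1)] LD(4)[OF 1(1)] by auto
    let ?c = "\<lambda>x. \<psi>' x (inv_into (car (fib E x)) (\<psi> x) D)"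
    have val: "?c x v = \<psi>1 x (inv_into (car (fib L x)) (\<psi>0 x) (D (\<psi>0 x (inv_into (car (fib L x)) (\<psi>1 x) v))))"
      if x: "x \<in> ?N" and v: "v \<in> car (model L)" for x v
    proof -
      have xU: "x \<in> U" "x \<in> U'" using x by auto
      have "inv_into (car (fib E x)) (\<psi> x) D =
          (\<lambda>v\<in>car (fib L x). inv_into (car (fib L x)) (\<psi>0 x) (D (\<psi>0 x v)))"
        unfolding 0(2) by (rule iso(2)[OF 0(1) xU(1) D])
      moreover have "inv_into (car (fib L x)) (\<psi>1 x) v \<in> car (fib L x)"
        by (rule lin_isoD(3)[OF LD(5)[OF 1(1) xU(2)] v])
      ultimately show ?thesis unfolding 1(2) conj_map_def using v by simp
    qed
    have carE: "?c x \<in> extensional (car (model L)) \<inter> G" if x: "x \<in> ?N" for x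
    proof -
      have xU: "x \<in> U" "x \<in> U'" using x by auto
      have i0: "lin_iso (fib E x) (model E) (\<psi> x)" unfolding 0(2) by (rule iso(1)[OF 0(1) xU(1)])
      have i1: "lin_iso (fib E x) (model E) (\<psi>' x)" unfolding 1(2) by (rule iso(1)[OF 1(1) xU(2)])
      show ?thesis using lin_isoD(2)[OF i1 lin_isoD(3)[OF i0 D]] by (simp add: E(1) maps_vspace_simps)
    qed
    show "smooth_vec_fun A ?N (model E) ?c"
      unfolding E(1)
    proof (rule smooth_vec_fun_maps[OF G(1) LD(1) T det N carE])
      fix s assume "s \<in> e ` {..<r}"
      then have s: "s \<in> car (model L)" using T(2) by blast
      have "smooth_vec_fun A ?N (model L) (\<lambda>x. \<psi>0 x (inv_into (car (fib L x)) (\<psi>1 x) s))"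
        using LD(6)[OF 1(1) 0(1) s] by (simp add: Int_commute)
      then have a: "smooth_vec_fun A ?N (model L) (\<lambda>x. D (\<psi>0 x (inv_into (car (fib L x)) (\<psi>1 x) s)))"
        by (rule smooth_vec_fun_lin_map[OF LD(2) N _ linD])
      have "smooth_vec_fun A ?N (model L)
          (\<lambda>x. \<psi>1 x (inv_into (car (fib L x)) (\<psi>0 x) (D (\<psi>0 x (inv_into (car (fib L x)) (\<psi>1 x) s)))))"
        by (rule smooth_vec_fun_apply[OF LD(1) N _ LD(2) _ a,
              where H = "\<lambda>x v. \<psi>1 x (inv_into (car (fib L x)) (\<psi>0 x) v)"])
          (use lin_isoD(1)[OF transition_lin_iso[OF L 0(1) 1(1)]] LD(6)[OF 0(1) 1(1)] in auto)
      then show "smooth_vec_fun A ?N (model L) (\<lambda>x. ?c x s)"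
        by (rule smooth_vec_fun_cong[OF N, rotated]) (simp only: val s)
    qed
  qed
qed

end

subsection \<open>Tensor products\<close>

lemma vscale_zero:
  assumes "is_vspace V"
  shows "vscale V c (vzero V) = vzero V"
  using is_vspaceD(10)[OF assms is_vspaceD(1)[OF assms], of c 0] vscale_0[OF assms is_vspaceD(1)[OF assms]]
  by simp

lemma vscale_commute: "is_vspace V ==> v \<in> car V ==> vscale V c (vscale V d v) = vscale V d (vscale V c v)"
  using is_vspaceD(10)[of V v c d] is_vspaceD(10)[of V v d c] by (simp add: mult.commute)

lemma real_functional_scale: "real_functional V l ==> v \<in> car V ==> l (vscale V (of_real r) v) = r * l v"
  unfolding real_functional_iff by blast

lemma real_functional_add: "real_functional V l ==> u \<in> car V ==> v \<in> car V ==> l (vadd V u v) = l u + l v"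
  unfolding real_functional_iff by blast

lemma real_dual_comp:
  assumes "is_vspace V" "lin_map V W f" "l \<in> real_dual W"
  shows "(\<lambda>v\<in>car V. l (f v)) \<in> real_dual V"
  using restrict_real_dual[OF assms(1) real_functional_comp[OF assms(2)]] assms(3) by (simp add: real_dual_iff)

lemma tensors_ext: "t \<in> tensors V W ==> t \<in> extensional (real_dual V)"
  by (induction rule: tensors.induct) (auto simp: pure_tensor_def extensional_def)

lemma tensors_car:
  assumes "is_vspace W" "t \<in> tensors V W" "l \<in> real_dual V"
  shows "t l \<in> car W"
  using assms(2)
proof (induction rule: tensors.induct)
  case (pure v w)
  then show ?case using assms(1,3) is_vspaceD(3) by (simp add: pure_tensor_def)
next
  case (add s t)
  then show ?case using assms(1,3) is_vspaceD(2) by simp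
qed

text \<open>Sums are built into \<open>tensors\<close>; a scalar factor is absorbed by the second
  component of a pure tensor, and zero is itself a pure tensor.\<close>

lemma map_subspace_tensors:
  fixes V :: "(real, 'v) vspace" and W :: "('k::real_or_complex, 'w) vspace"
  assumes V: "is_vspace V" and W: "is_vspace W"
  shows "map_subspace (real_dual V) W (tensors V W)"
proof -
  have "(\<lambda>l\<in>real_dual V. vzero W) = pure_tensor V W (vzero V) (vzero W)"
    unfolding pure_tensor_def by (intro restrict_ext) (simp add: vscale_zero[OF W])
  then have zero: "(\<lambda>l\<in>real_dual V. vzero W) \<in> tensors V W"
    using tensors.pure is_vspaceD(1)[OF V] is_vspaceD(1)[OF W] by metis
  have scale: "(\<lambda>l\<in>real_dual V. vscale W c (t l)) \<in> tensors V W" if "t \<in> tensors V W" for c t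
    using that
  proof (induction rule: tensors.induct)
    case (pure v w)
    have "(\<lambda>l\<in>real_dual V. vscale W c (pure_tensor V W v w l)) = pure_tensor V W v (vscale W c w)"
      unfolding pure_tensor_def
      by (intro restrict_ext) (simp add: vscale_commute[OF W pure(2), of c])
    then show ?case using tensors.pure[OF pure(1) is_vspaceD(3)[OF W pure(2)], of c] by simp
  next
    case (add s t)
    have eq: "(\<lambda>l\<in>real_dual V. vscale W c ((\<lambda>l\<in>real_dual V. vadd W (s l) (t l)) l)) =
      (\<lambda>l\<in>real_dual V. vadd W ((\<lambda>l\<in>real_dual V. vscale W c (s l)) l) ((\<lambda>l\<in>real_dual V. vscale W c (t l)) l))"
      by (intro restrict_ext) (simp add: is_vspaceD(8)[OF W tensors_car[OF W add(1)] tensors_car[OF W add(2)]])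
    show ?case unfolding eq by (rule tensors.add[OF add(3,4)])
  qed
  show ?thesis
    unfolding map_subspace_def
    using zero scale tensors.add W tensors_car[OF W] by auto
qed

text \<open>A tensor is linear in the functional to which it is applied, so its values on a dual
  basis determine it.\<close>

lemma tensor_expand:
  fixes V :: "(real, 'v) vspace" and W :: "('k::real_or_complex, 'w) vspace"
  assumes W: "is_vspace W" and t: "t \<in> tensors V W" and l: "l \<in> real_dual V" and h: "real_functional W h"
    and e: "\<And>i. i < r ==> \<epsilon> i \<in> real_dual V" "\<And>v. v \<in> car V ==> l v = (\<Sum>i<(r::nat). \<epsilon> i v * l (e i))"
  shows "h (t l) = (\<Sum>i<r. l (e i) * h (t (\<epsilon> i)))"
  using t
proof (induction rule: tensors.induct)
  case (pure v w)
  have "h (pure_tensor V W v w k) = k v * h w" if "k \<in> real_dual V" for k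
    using that real_functional_scale[OF h pure(2)] by (simp add: pure_tensor_def)
  then show ?case using l e pure(1) by (simp add: sum_distrib_left mult_ac)
next
  case (add s t)
  have "h ((\<lambda>l\<in>real_dual V. vadd W (s l) (t l)) k) = h (s k) + h (t k)" if "k \<in> real_dual V" for k
    using that real_functional_add[OF h tensors_car[OF W add(1) that] tensors_car[OF W add(2) that]] by simp
  then show ?case using l e(1) add(3,4) by (simp add: sum.distrib distrib_left)
qed

lemma tensor_eqI:
  fixes V :: "(real, 'v) vspace" and W :: "('k::real_or_complex, 'w) vspace"
  assumes W: "fin_dim_vspace W" and st: "s \<in> tensors V W" "t \<in> tensors V W"
    and e: "\<And>i. i < r ==> \<epsilon> i \<in> real_dual V"
      "\<And>l v. real_functional V l ==> v \<in> car V ==> l v = (\<Sum>i<(r::nat). \<epsilon> i v * l (e i))"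
    and eq: "\<And>k. k \<in> \<epsilon> ` {..<r} ==> s k = t k"
  shows "s = t"
proof (rule extensionalityI[OF tensors_ext[OF st(1)] tensors_ext[OF st(2)]])
  fix l assume l: "l \<in> real_dual V"
  have vs: "is_vspace W" using W unfolding fin_dim_vspace_def by blast
  show "s l = t l"
  proof (rule real_dual_eqI[OF W tensors_car[OF vs st(1) l] tensors_car[OF vs st(2) l]])
    fix h assume "h \<in> real_dual W"
    then have h: "real_functional W h" by (simp add: real_dual_iff)
    have l': "real_functional V l" using l by (simp add: real_dual_iff)
    show "h (s l) = h (t l)"
      using tensor_expand[OF vs st(1) l h e(1) e(2)[OF l']] tensor_expand[OF vs st(2) l h e(1) e(2)[OF l']] eq
      by simp
  qed
qed

lemma fin_dim_tensor_prod:
  fixes V :: "(real, 'v) vspace" and W :: "('k::real_or_complex, 'w) vspace"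
  assumes V: "fin_dim_vspace V" and W: "fin_dim_vspace W"
  shows "fin_dim_vspace (tensor_prod V W)"
proof -
  have vs: "is_vspace V" "is_vspace W" using V W unfolding fin_dim_vspace_def by blast+
  obtain r :: nat and \<epsilon> e where e: "\<And>i. i < r ==> \<epsilon> i \<in> real_dual V" "\<And>i. i < r ==> e i \<in> car V"
    "\<And>i j. i < r ==> j < r ==> \<epsilon> i (e j) = (if i = j then 1 else 0)"
    "\<And>l v. real_functional V l ==> v \<in> car V ==> l v = (\<Sum>i<r. \<epsilon> i v * l (e i))"
    "separating V (\<epsilon> ` {..<r})"
    by (rule ex_real_basis[OF V]) (rule that; assumption)
  show ?thesis
    unfolding tensor_prod_def
  proof (rule fin_dim_maps[OF map_subspace_tensors[OF vs] W, where T = "\<epsilon> ` {..<r}"])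
    show "f = g" if fg: "f \<in> extensional (real_dual V) \<inter> tensors V W" "g \<in> extensional (real_dual V) \<inter> tensors V W"
      and eq: "\<And>s. s \<in> \<epsilon> ` {..<r} ==> f s = g s" for f g
      by (rule tensor_eqI[OF W _ _ e(1,4) eq]) (use fg in auto)
  qed (use e(1) in auto)
qed

text \<open>The sum of the pure tensors of \<open>v i\<close> and \<open>w i\<close>, again
  described by its values under functionals.\<close>

lemma ex_tensor_sum:
  fixes V :: "(real, 'v) vspace" and W :: "('k::real_or_complex, 'w) vspace"
  assumes V: "is_vspace V" and W: "is_vspace W" and "finite I"
    and "\<And>i. i \<in> I ==> v i \<in> car V" "\<And>i. i \<in> I ==> w i \<in> car W"
  shows "\<exists>t\<in>tensors V W. \<forall>l\<in>real_dual V. \<forall>h. real_functional W h \<longrightarrow> h (t l) = (\<Sum>i\<in>I. l (v i) * h (w i))"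
  using assms(3-5)
proof (induction I rule: finite_induct)
  case empty
  have "h (vzero W) = 0" if "real_functional W h" for h
    using functional_zero[OF is_vspace_real_vspace[OF W] that[unfolded real_functional_def]]
    by (simp add: real_vspace_def)
  then show ?case using map_subspace_tensors[OF V W] unfolding map_subspace_def
    by (intro bexI[of _ "\<lambda>l\<in>real_dual V. vzero W"]) auto
next
  case (insert i I)
  then obtain t where t: "t \<in> tensors V W"
    "\<forall>l\<in>real_dual V. \<forall>h. real_functional W h \<longrightarrow> h (t l) = (\<Sum>i\<in>I. l (v i) * h (w i))" by auto
  let ?p = "pure_tensor V W (v i) (w i)"
  have p: "?p \<in> tensors V W" using insert by (intro tensors.pure) auto
  have "h (vadd W (?p l) (t l)) = (\<Sum>i\<in>insert i I. l (v i) * h (w i))"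
    if l: "l \<in> real_dual V" and h: "real_functional W h" for l h
  proof -
    have "h (?p l) = l (v i) * h (w i)"
      using l real_functional_scale[OF h] insert.prems(2) by (simp add: pure_tensor_def)
    then show ?thesis
      using real_functional_add[OF h tensors_car[OF W p l] tensors_car[OF W t(1) l]] t(2) l h insert.hyps
      by simp
  qed
  then show ?case using tensors.add[OF p t(1)] by (intro bexI[OF _ tensors.add[OF p t(1)]]) auto
qed

lemma tensor_map_tensors:
  fixes V :: "(real, 'v) vspace" and W :: "('k::real_or_complex, 'w) vspace"
  assumes V: "is_vspace V" and W: "is_vspace W" and f: "lin_map V V' f" and g: "lin_map W W' g"
    and t: "t \<in> tensors V W"
  shows "tensor_map V V' f g t \<in> tensors V' W'"
  using t
proof (induction rule: tensors.induct)
  case (pure v w)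
  have "tensor_map V V' f g (pure_tensor V W v w) = pure_tensor V' W' (f v) (g w)"
    unfolding tensor_map_def pure_tensor_def
    by (intro restrict_ext) (use real_dual_comp[OF V f] pure lin_mapD(3)[OF g pure(2)] in simp)
  then show ?case using tensors.pure[OF lin_mapD(1)[OF f pure(1)] lin_mapD(1)[OF g pure(2)]] by simp
next
  case (add s t)
  have eq: "tensor_map V V' f g (\<lambda>l\<in>real_dual V. vadd W (s l) (t l)) =
      (\<lambda>l\<in>real_dual V'. vadd W' (tensor_map V V' f g s l) (tensor_map V V' f g t l))"
    unfolding tensor_map_def
    by (intro restrict_ext)
      (use real_dual_comp[OF V f] tensors_car[OF W add(1)] tensors_car[OF W add(2)] lin_mapD(2)[OF g] in simp)
  show ?case unfolding eq by (rule tensors.add[OF add(3,4)])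
qed

text \<open>The inverse is the tensor product of the inverses: the pullbacks of functionals along
  \<open>f\<close> and along its inverse cancel.\<close>

lemma lin_iso_tensor_map:
  fixes V :: "(real, 'v) vspace" and W :: "('k::real_or_complex, 'w) vspace"
  assumes V: "is_vspace V" "is_vspace V'" and W: "is_vspace W" "is_vspace W'"
    and f: "lin_iso V V' f" and g: "lin_iso W W' g"
  shows "lin_iso (tensor_prod V W) (tensor_prod V' W') (tensor_map V V' f g)"
    "t' \<in> car (tensor_prod V' W') ==> inv_into (car (tensor_prod V W)) (tensor_map V V' f g) t' =
      tensor_map V' V (inv_into (car V) f) (inv_into (car W) g) t'"
proof -
  note fD = lin_isoD[OF f] and gD = lin_isoD[OF g]
  let ?f' = "inv_into (car V) f" and ?g' = "inv_into (car W) g"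
  note f'D = lin_isoD[OF lin_iso_inv[OF V(1) f]] and g'D = lin_isoD[OF lin_iso_inv[OF W(1) g]]
  have car: "car (tensor_prod V W) = tensors V W" "car (tensor_prod V' W') = tensors V' W'"
    using tensors_ext unfolding tensor_prod_def maps_vspace_simps by blast+
  have l: "tensor_map V' V ?f' ?g' (tensor_map V V' f g t) = t" if t: "t \<in> tensors V W" for t
  proof (rule extensionalityI[OF _ tensors_ext[OF t]])
    show "tensor_map V' V ?f' ?g' (tensor_map V V' f g t) \<in> extensional (real_dual V)"
      by (simp add: tensor_map_def)
    fix l assume l: "l \<in> real_dual V"
    have l': "(\<lambda>v\<in>car V'. l (?f' v)) \<in> real_dual V'" by (rule real_dual_comp[OF V(2) f'D(1) l])
    have "(\<lambda>v\<in>car V. (\<lambda>v\<in>car V'. l (?f' v)) (f v)) = l"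
      by (rule extensionalityI[of _ "car V"]) (use l in \<open>auto simp: real_dual_iff fD(2,4)\<close>)
    then show "tensor_map V' V ?f' ?g' (tensor_map V V' f g t) l = t l"
      using l l' gD(4)[OF tensors_car[OF W(1) t l]] by (simp add: tensor_map_def)
  qed
  have r: "tensor_map V V' f g (tensor_map V' V ?f' ?g' t) = t" if t: "t \<in> tensors V' W'" for t
  proof (rule extensionalityI[OF _ tensors_ext[OF t]])
    show "tensor_map V V' f g (tensor_map V' V ?f' ?g' t) \<in> extensional (real_dual V')"
      by (simp add: tensor_map_def)
    fix l assume l: "l \<in> real_dual V'"
    have l': "(\<lambda>v\<in>car V. l (f v)) \<in> real_dual V" by (rule real_dual_comp[OF V(1) fD(1) l])
    have "(\<lambda>v\<in>car V'. (\<lambda>v\<in>car V. l (f v)) (?f' v)) = l"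
      by (rule extensionalityI[of _ "car V'"]) (use l in \<open>auto simp: real_dual_iff fD(3,5)\<close>)
    then show "tensor_map V V' f g (tensor_map V' V ?f' ?g' t) l = t l"
      using l l' gD(5)[OF tensors_car[OF W(2) t l]] by (simp add: tensor_map_def)
  qed
  have bij: "bij_betw (tensor_map V V' f g) (tensors V W) (tensors V' W')"
    by (rule bij_betw_byWitness[where f' = "tensor_map V' V ?f' ?g'"])
      (use l r tensor_map_tensors[OF V(1) W(1) fD(1) gD(1)] tensor_map_tensors[OF V(2) W(2) f'D(1) g'D(1)] in auto)
  have "tensor_map V V' f g (\<lambda>l\<in>real_dual V. vadd W (s l) (t l)) =
      (\<lambda>l\<in>real_dual V'. vadd W' (tensor_map V V' f g s l) (tensor_map V V' f g t l))"
    if "s \<in> tensors V W" "t \<in> tensors V W" for s t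
    unfolding tensor_map_def
    by (intro restrict_ext)
      (use real_dual_comp[OF V(1) fD(1)] tensors_car[OF W(1) that(1)] tensors_car[OF W(1) that(2)]
        lin_mapD(2)[OF gD(1)] in simp)
  moreover have "tensor_map V V' f g (\<lambda>l\<in>real_dual V. vscale W c (t l)) =
      (\<lambda>l\<in>real_dual V'. vscale W' c (tensor_map V V' f g t l))" if "t \<in> tensors V W" for c t
    unfolding tensor_map_def
    by (intro restrict_ext)
      (use real_dual_comp[OF V(1) fD(1)] tensors_car[OF W(1) that] lin_mapD(3)[OF gD(1)] in simp)
  ultimately show "lin_iso (tensor_prod V W) (tensor_prod V' W') (tensor_map V V' f g)"
    unfolding lin_iso_def lin_map_def car using bij tensor_map_tensors[OF V(1) W(1) fD(1) gD(1)]
    by (auto simp: tensor_prod_def maps_vspace_simps)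
  show "inv_into (car (tensor_prod V W)) (tensor_map V V' f g) t' = tensor_map V' V ?f' ?g' t'"
    if t': "t' \<in> car (tensor_prod V' W')" for t'
    unfolding car
    by (rule inv_into_f_eq)
      (use bij t' r tensor_map_tensors[OF V(2) W(2) f'D(1) g'D(1)] in \<open>auto simp: bij_betw_def car\<close>)
qed

context atlas
begin

text \<open>At a functional \<open>l\<close> the transition map evaluates the constant tensor at the
  pullback of \<open>l\<close> along the transition map of \<open>E\<close> and then applies that of
  \<open>F\<close>.\<close>

lemma tensor_vector_bundle:
  fixes E :: "(real, 'm, 'e, 'f) vbundle" and F :: "('k::real_or_complex, 'm, 'e1, 'f1) vbundle"
  assumes E: "vector_bundle A E" and F: "vector_bundle A F"
  shows "vector_bundle A (tensor_bundle E F)"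
proof -
  note ED = vector_bundleD[OF E] and FD = vector_bundleD[OF F]
  let ?T = "tensor_bundle E F"
  have T: "model ?T = tensor_prod (model E) (model F)" "fib ?T x = tensor_prod (fib E x) (fib F x)" for x
    by (simp_all add: tensor_bundle_def)
  have trivT: "(U, \<psi>) \<in> triv ?T \<longleftrightarrow> (\<exists>U1 \<psi>1 U2 \<psi>2. (U1, \<psi>1) \<in> triv E \<and> (U2, \<psi>2) \<in> triv F \<and> U = U1 \<inter> U2 \<and>
      \<psi> = (\<lambda>x. tensor_map (fib E x) (model E) (\<psi>1 x) (\<psi>2 x)))" for U \<psi>
    unfolding tensor_bundle_def by auto
  obtain r :: nat and \<epsilon> e where e: "\<And>i. i < r ==> \<epsilon> i \<in> real_dual (model E)" "\<And>i. i < r ==> e i \<in> car (model E)"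
    "\<And>i j. i < r ==> j < r ==> \<epsilon> i (e j) = (if i = j then 1 else 0)"
    "\<And>l v. real_functional (model E) l ==> v \<in> car (model E) ==> l v = (\<Sum>i<r. \<epsilon> i v * l (e i))"
    "separating (model E) (\<epsilon> ` {..<r})"
    by (rule ex_real_basis[OF ED(1)]) (rule that; assumption)
  have iso: "lin_iso (fib ?T x) (model ?T) (tensor_map (fib E x) (model E) (\<psi>1 x) (\<psi>2 x))"
    "t \<in> car (model ?T) ==> inv_into (car (fib ?T x)) (tensor_map (fib E x) (model E) (\<psi>1 x) (\<psi>2 x)) t =
      tensor_map (model E) (fib E x) (inv_into (car (fib E x)) (\<psi>1 x)) (inv_into (car (fib F x)) (\<psi>2 x)) t"
    if "(U1, \<psi>1) \<in> triv E" "(U2, \<psi>2) \<in> triv F" "x \<in> U1" "x \<in> U2" for U1 \<psi>1 U2 \<psi>2 x t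
    unfolding T
    by (rule lin_iso_tensor_map[OF ED(3,2) FD(3,2) ED(5)[OF that(1,3)] FD(5)[OF that(2,4)]]; assumption)+
  show ?thesis
  proof (rule vector_bundleI)
    show "fin_dim_vspace (model ?T)" unfolding T by (rule fin_dim_tensor_prod[OF ED(1) FD(1)])
    show "is_vspace (fib ?T x)" for x unfolding T tensor_prod_def
      by (rule is_vspace_maps[OF map_subspace_tensors[OF ED(3) FD(3)]])
    show "open U" if "(U, \<psi>) \<in> triv ?T" for U \<psi> using that ED(4) FD(4) unfolding trivT by auto
    show "lin_iso (fib ?T x) (model ?T) (\<psi> x)" if "(U, \<psi>) \<in> triv ?T" "x \<in> U" for U \<psi> x
      using that iso(1) unfolding trivT by auto
    show "\<exists>U \<psi>. (U, \<psi>) \<in> triv ?T \<and> x \<in> U" for x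
    proof -
      obtain U1 \<psi>1 where "(U1, \<psi>1) \<in> triv E" "x \<in> U1" by (rule ex_triv[OF E])
      moreover obtain U2 \<psi>2 where "(U2, \<psi>2) \<in> triv F" "x \<in> U2" by (rule ex_triv[OF F])
      ultimately show ?thesis unfolding trivT by blast
    qed
    fix U \<psi> U' \<psi>' t assume tr: "(U, \<psi>) \<in> triv ?T" "(U', \<psi>') \<in> triv ?T" and t: "t \<in> car (model ?T)"
    obtain U1 \<psi>1 U2 \<psi>2 where 1: "(U1, \<psi>1) \<in> triv E" "(U2, \<psi>2) \<in> triv F" "U = U1 \<inter> U2"
      "\<psi> = (\<lambda>x. tensor_map (fib E x) (model E) (\<psi>1 x) (\<psi>2 x))" using tr(1) unfolding trivT by blast
    obtain U1' \<psi>1' U2' \<psi>2' where 2: "(U1', \<psi>1') \<in> triv E" "(U2', \<psi>2') \<in> triv F" "U' = U1' \<inter> U2'"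
      "\<psi>' = (\<lambda>x. tensor_map (fib E x) (model E) (\<psi>1' x) (\<psi>2' x))" using tr(2) unfolding trivT by blast
    let ?N = "U \<inter> U'"
    have N: "open ?N" using ED(4)[OF 1(1)] FD(4)[OF 1(2)] ED(4)[OF 2(1)] FD(4)[OF 2(2)] unfolding 1(3) 2(3) by auto
    have tt: "t \<in> tensors (model E) (model F)" using t unfolding T tensor_prod_def maps_vspace_simps by blast
    let ?c = "\<lambda>x. \<psi>' x (inv_into (car (fib ?T x)) (\<psi> x) t)"
    let ?H = "\<lambda>x v. \<psi>1' x (inv_into (car (fib E x)) (\<psi>1 x) v)"
    have Hlin: "lin_map (model E) (model E) (?H x)" if "x \<in> ?N" for x
      by (rule lin_isoD(1)[OF transition_lin_iso[OF E 1(1) 2(1)]]) (use that 1 2 in auto)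
    have Klin: "lin_map (model F) (model F) (\<lambda>v. \<psi>2' x (inv_into (car (fib F x)) (\<psi>2 x) v))" if "x \<in> ?N" for x
      by (rule lin_isoD(1)[OF transition_lin_iso[OF F 1(2) 2(2)]]) (use that 1 2 in auto)
    have carT: "?c x \<in> extensional (real_dual (model E)) \<inter> tensors (model E) (model F)" if x: "x \<in> ?N" for x
    proof -
      have xU: "x \<in> U1" "x \<in> U2" "x \<in> U1'" "x \<in> U2'" using x 1(3) 2(3) by auto
      have "?c x \<in> car (model ?T)" unfolding 1(4) 2(4)
        by (rule lin_isoD(2)[OF iso(1)[OF 2(1,2) xU(3,4)] lin_isoD(3)[OF iso(1)[OF 1(1,2) xU(1,2)] t]])
      then show ?thesis unfolding T tensor_prod_def maps_vspace_simps .
    qed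
    have val: "?c x l = \<psi>2' x (inv_into (car (fib F x)) (\<psi>2 x) (t (\<lambda>v\<in>car (model E). l (?H x v))))"
      if x: "x \<in> ?N" and l: "l \<in> real_dual (model E)" for x l
    proof -
      have xU: "x \<in> U1" "x \<in> U2" "x \<in> U1'" "x \<in> U2'" using x 1(3) 2(3) by auto
      have l': "(\<lambda>v\<in>car (fib E x). l (\<psi>1' x v)) \<in> real_dual (fib E x)"
        by (rule real_dual_comp[OF ED(3) lin_isoD(1)[OF ED(5)[OF 2(1) xU(3)]] l])
      have "(\<lambda>v\<in>car (model E). (\<lambda>v\<in>car (fib E x). l (\<psi>1' x v)) (inv_into (car (fib E x)) (\<psi>1 x) v)) =
          (\<lambda>v\<in>car (model E). l (?H x v))"
        by (intro restrict_ext) (simp add: lin_isoD(3)[OF ED(5)[OF 1(1) xU(1)]])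
      moreover have "inv_into (car (fib ?T x)) (\<psi> x) t =
          tensor_map (model E) (fib E x) (inv_into (car (fib E x)) (\<psi>1 x)) (inv_into (car (fib F x)) (\<psi>2 x)) t"
        unfolding 1(4) by (rule iso(2)[OF 1(1,2) xU(1,2) t])
      ultimately show ?thesis unfolding 2(4) using l l' by (simp add: tensor_map_def)
    qed
    show "smooth_vec_fun A ?N (model ?T) ?c"
      unfolding T(1) tensor_prod_def
    proof (rule smooth_vec_fun_maps[OF map_subspace_tensors[OF ED(2) FD(2)] FD(1), where T = "\<epsilon> ` {..<r}"])
      show "f = g" if fg: "f \<in> extensional (real_dual (model E)) \<inter> tensors (model E) (model F)"
        "g \<in> extensional (real_dual (model E)) \<inter> tensors (model E) (model F)"
        and eq: "\<And>s. s \<in> \<epsilon> ` {..<r} ==> f s = g s" for f g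
        by (rule tensor_eqI[OF FD(1) _ _ e(1,4) eq]) (use fg in auto)
      fix l assume "l \<in> \<epsilon> ` {..<r}"
      then have l: "l \<in> real_dual (model E)" using e(1) by auto
      have lx: "(\<lambda>v\<in>car (model E). l (?H x v)) \<in> real_dual (model E)" if "x \<in> ?N" for x
        by (rule real_dual_comp[OF ED(2) Hlin[OF that] l])
      \<comment> \<open>The tensor is fixed while its argument moves with \<open>x\<close>.
        Expanding the argument in the dual basis moves the dependence on \<open>x\<close> into
        smooth real coefficients.\<close>
      have a: "smooth_vec_fun A ?N (model F) (\<lambda>x. t (\<lambda>v\<in>car (model E). l (?H x v)))"
      proof (rule smooth_vec_funI)
        show "t (\<lambda>v\<in>car (model E). l (?H x v)) \<in> car (model F)" if "x \<in> ?N" for x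
          by (rule tensors_car[OF FD(2) tt lx[OF that]])
        fix h assume h: "real_functional (model F) h"
        show "smooth_fun A ?N (\<lambda>x. h (t (\<lambda>v\<in>car (model E). l (?H x v))))"
        proof (rule smooth_fun_cong[OF N])
          have "smooth_fun A ?N (\<lambda>x. l (?H x (e i)))" if "i < r" for i
            by (rule smooth_vec_fun_functional[OF ED(2) N smooth_vec_fun_subset[OF ED(6)[OF 1(1) 2(1) e(2)[OF that]]]])
              (use 1(3) 2(3) l in \<open>auto simp: real_dual_iff\<close>)
          then show "smooth_fun A ?N (\<lambda>x. \<Sum>i<r. l (?H x (e i)) * h (t (\<epsilon> i)))"
            by (intro smooth_fun_sum smooth_fun_mult smooth_fun_const N) auto
          show "(\<Sum>i<r. l (?H x (e i)) * h (t (\<epsilon> i))) = h (t (\<lambda>v\<in>car (model E). l (?H x v)))" if x: "x \<in> ?N" for x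
          proof -
            have "real_functional (model E) (\<lambda>v\<in>car (model E). l (?H x v))"
              using lx[OF x] by (simp add: real_dual_iff)
            note eq = tensor_expand[OF FD(2) tt lx[OF x] h e(1) e(4)[OF this]]
            show ?thesis by (subst eq) (auto intro!: sum.cong simp: e(2))
          qed
        qed
      qed
      have "smooth_vec_fun A ?N (model F)
          (\<lambda>x. \<psi>2' x (inv_into (car (fib F x)) (\<psi>2 x) (t (\<lambda>v\<in>car (model E). l (?H x v)))))"
        by (rule smooth_vec_fun_apply[OF FD(1) N Klin FD(2) _ a])
          (assumption, rule smooth_vec_fun_subset[OF FD(6)[OF 1(2) 2(2)]], use 1(3) 2(3) in auto)
      then show "smooth_vec_fun A ?N (model F) (\<lambda>x. ?c x l)"
        by (rule smooth_vec_fun_cong[OF N, rotated]) (simp only: val l)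
    qed (use N carT e(1) in auto)
  qed
qed

subsection \<open>The tangent bundle\<close>

lemma smooth_functions_iff: "f \<in> smooth_functions A \<longleftrightarrow> smooth_fun A UNIV f"
  by (simp add: smooth_functions_def)

lemma smooth_functions_closed:
  "f \<in> smooth_functions A ==> g \<in> smooth_functions A ==> (\<lambda>y. f y + g y) \<in> smooth_functions A"
  "f \<in> smooth_functions A ==> g \<in> smooth_functions A ==> (\<lambda>y. f y * g y) \<in> smooth_functions A"
  "(\<lambda>y. r) \<in> smooth_functions A"
  "f \<in> smooth_functions A ==> (\<lambda>y. r * f y) \<in> smooth_functions A"
  unfolding smooth_functions_iff
  by (intro smooth_fun_add smooth_fun_mult smooth_fun_const open_UNIV; assumption)+

lemma tangent_map_subspace:
  "map_subspace (smooth_functions A) (type_vspace (*\<^sub>R))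
     {v. (\<forall>f\<in>smooth_functions A. \<forall>g\<in>smooth_functions A. v (\<lambda>y. f y + g y) = v f + v g) \<and>
         (\<forall>r. \<forall>f\<in>smooth_functions A. v (\<lambda>y. r * f y) = r * v f) \<and>
         (\<forall>f\<in>smooth_functions A. \<forall>g\<in>smooth_functions A.
            v (\<lambda>y. f y * g y) = v f * g x + f x * v g)}"
proof -
  have "is_vspace (type_vspace (*\<^sub>R) :: (real, real) vspace)"
    unfolding is_vspace_def type_vspace_def
    by (auto simp: algebra_simps intro: exI[of _ "- v" for v :: real])
  then show ?thesis
    unfolding map_subspace_def
    by (auto simp: type_vspace_def smooth_functions_closed algebra_simps)
qed

lemma chart_deriv_coord_derivation:
  "f \<in> smooth_functions A ==> coord_derivation A U \<phi> x a f = chart_deriv U \<phi> f x a"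
  by (simp add: coord_derivation_def chart_deriv_def comp_def)

lemma tangent_vectorD:
  assumes "v \<in> car (tangent_space A x)" "smooth_fun A UNIV f" "smooth_fun A UNIV g"
  shows "v (\<lambda>y. f y + g y) = v f + v g" "v (\<lambda>y. r * f y) = r * v f"
    "v (\<lambda>y. f y * g y) = v f * g x + f x * v g"
  using assms unfolding tangent_space_def maps_vspace_simps by (auto simp: smooth_functions_iff)

text \<open>Derivations at \<open>x\<close> kill products of two functions vanishing at
  \<open>x\<close>, so Hadamard's lemma writes them as directional derivatives; the coordinate
  functions recover the direction.\<close>

lemma lin_iso_coord_derivation:
  assumes c: "(U, \<phi>) \<in> A" and x: "x \<in> U"
  shows "lin_iso (type_vspace (*\<^sub>R)) (tangent_space A x) (coord_derivation A U \<phi> x)"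
proof -
  let ?S = "smooth_functions A" and ?d = "coord_derivation A U \<phi> x"
  have xU: "x \<in> U \<inter> UNIV" using x by simp
  have lin: "linear (chart_deriv U \<phi> f x)" if "f \<in> ?S" for f
    by (rule chart_deriv_linear[OF c open_UNIV _ xU]) (use that in \<open>simp add: smooth_functions_iff\<close>)
  have ext: "?d a \<in> extensional ?S" for a by (simp add: coord_derivation_def)
  have car: "?d a \<in> car (tangent_space A x)" for a
    unfolding tangent_space_def maps_vspace_simps
  proof (intro IntI ext CollectI conjI ballI allI)
    fix f g r assume f: "f \<in> ?S"
    note f' = f[unfolded smooth_functions_iff]
    have "chart_deriv U \<phi> (\<lambda>y. r * f y) x a = r * chart_deriv U \<phi> f x a"
      using chart_deriv_mult[OF c open_UNIV smooth_fun_const[OF open_UNIV, of r] f' xU]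
      by (simp add: chart_deriv_const)
    then show "?d a (\<lambda>y. r * f y) = r * ?d a f"
      using f by (simp add: chart_deriv_coord_derivation smooth_functions_closed)
    assume g: "g \<in> ?S"
    note g' = g[unfolded smooth_functions_iff]
    show "?d a (\<lambda>y. f y + g y) = ?d a f + ?d a g"
      using f g chart_deriv_add[OF c open_UNIV f' g' xU]
      by (simp add: chart_deriv_coord_derivation smooth_functions_closed)
    show "?d a (\<lambda>y. f y * g y) = ?d a f * g x + f x * ?d a g"
      using f g chart_deriv_mult[OF c open_UNIV f' g' xU]
      by (simp add: chart_deriv_coord_derivation smooth_functions_closed)
  qed
  obtain y V where y: "\<And>b. smooth_fun A UNIV (y b)" "open V" "x \<in> V" "V \<subseteq> U"
    "\<And>b z. z \<in> V ==> y b z = (\<phi> z - \<phi> x) \<bullet> b"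
    by (rule ex_global_coordinates[OF c x]) (rule that; assumption)
  have dy: "?d a (y b) = a \<bullet> b" for a b
  proof -
    have "chart_deriv U \<phi> (\<lambda>z. (\<phi> z - \<phi> x) \<bullet> b) x = chart_deriv U \<phi> (y b) x"
      by (rule chart_deriv_cong[OF c y(2) smooth_fun_subset[OF y(1)] _ y(5)]) (use x y(3) in auto)
    from fun_cong[OF this, of a] show ?thesis
      using chart_deriv_coordinate[OF c x, of "\<phi> x" b a] y(1)
      by (simp add: chart_deriv_coord_derivation smooth_functions_iff)
  qed
  have surj: "?d (\<Sum>b\<in>onb. v (y b) *\<^sub>R b) = v" if v: "v \<in> car (tangent_space A x)" for v
  proof (rule extensionalityI[OF ext])
    show "v \<in> extensional ?S" using v by (simp add: tangent_space_def maps_vspace_simps)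
    fix f assume f: "f \<in> ?S"
    note f' = f[unfolded smooth_functions_iff]
    \<comment> \<open>Constants are killed because 1 = 1 * 1 gives v(1) = 2 v(1).\<close>
    have 1: "v (\<lambda>_. 1) = 0"
      using tangent_vectorD(3)[OF v smooth_fun_const[OF open_UNIV, of 1] smooth_fun_const[OF open_UNIV, of 1]]
      by simp
    have "v f = f x * v (\<lambda>_. 1) + (\<Sum>b\<in>onb. chart_deriv U \<phi> f x b * v (y b))"
      by (rule first_order_functional[OF _ _ _ c x y f'])
        (use tangent_vectorD[OF v] in \<open>auto simp: tangent_vectorD(3)[OF v]\<close>)
    also have "\<dots> = chart_deriv U \<phi> f x (\<Sum>b\<in>onb. v (y b) *\<^sub>R b)"
      using lin[OF f] 1 by (simp add: linear_sum linear_scale mult.commute)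
    finally show "?d (\<Sum>b\<in>onb. v (y b) *\<^sub>R b) f = v f"
      using f by (simp add: chart_deriv_coord_derivation)
  qed
  have inj: "a = a'" if "?d a = ?d a'" for a a'
  proof -
    have "(\<Sum>b\<in>onb. (a \<bullet> b) *\<^sub>R b) = (\<Sum>b\<in>onb. (a' \<bullet> b) *\<^sub>R b)"
      unfolding dy[symmetric] that by simp
    then show ?thesis by (simp only: onb(3))
  qed
  have "lin_map (type_vspace (*\<^sub>R)) (tangent_space A x) ?d"
    unfolding lin_map_def
  proof (intro conjI ballI allI)
    show "?d \<in> car (type_vspace (*\<^sub>R)) \<rightarrow> car (tangent_space A x)" using car by blast
    show "?d (vadd (type_vspace (*\<^sub>R)) a a') = vadd (tangent_space A x) (?d a) (?d a')" for a a'
      unfolding tangent_space_def maps_vspace_simps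
      by (rule extensionalityI[OF ext restrict_extensional])
        (use lin in \<open>simp add: type_vspace_def chart_deriv_coord_derivation linear_add\<close>)
    show "?d (vscale (type_vspace (*\<^sub>R)) r a) = vscale (tangent_space A x) r (?d a)" for r a
      unfolding tangent_space_def maps_vspace_simps
      by (rule extensionalityI[OF ext restrict_extensional])
        (use lin in \<open>simp add: type_vspace_def chart_deriv_coord_derivation linear_scale\<close>)
  qed
  moreover have "bij_betw ?d UNIV (car (tangent_space A x))"
    unfolding bij_betw_def
  proof
    show "inj ?d" using inj by (rule injI)
    show "range ?d = car (tangent_space A x)"
      using car surj by (metis (no_types, lifting) image_subset_iff rangeI subsetI subset_antisym)
  qed
  ultimately show ?thesis unfolding lin_iso_def by (simp add: type_vspace_def)
qed

lemma is_vspace_model_space: "is_vspace (type_vspace (*\<^sub>R) :: (real, 'a) vspace)"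
proof -
  have "\<exists>w. v + w = 0" for v :: 'a by (rule exI[of _ "- v"]) simp
  then show ?thesis unfolding is_vspace_def type_vspace_def by (auto simp: algebra_simps)
qed

lemma separating_onb: "separating (type_vspace (*\<^sub>R)) ((\<lambda>b v. v \<bullet> b) ` (onb :: 'a set))"
  unfolding separating_def
proof (intro ballI impI)
  fix u v :: 'a assume "\<forall>f\<in>(\<lambda>b v. v \<bullet> b) ` onb. f u = f v"
  then have "(\<Sum>b\<in>onb. (u \<bullet> b) *\<^sub>R b) = (\<Sum>b\<in>onb. (v \<bullet> b) *\<^sub>R b)" by (intro sum.cong) auto
  then show "u = v" by (simp only: onb(3))
qed

lemma fin_dim_model_space: "fin_dim_vspace (type_vspace (*\<^sub>R) :: (real, 'a) vspace)"
proof (rule fin_dim_vspaceI[OF is_vspace_model_space])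
  show "finite ((\<lambda>b v. v \<bullet> b) ` (onb :: 'a set))" by (simp add: onb(1))
  show "functional (type_vspace (*\<^sub>R)) f" if "f \<in> (\<lambda>b v. v \<bullet> b) ` (onb :: 'a set)" for f
    using that unfolding functional_def type_vspace_def by (auto simp: inner_add_left)
qed (rule separating_onb)

lemma tangent_vector_bundle: "vector_bundle A (tangent_bundle A)"
proof -
  let ?T = "tangent_bundle A"
  have T: "model ?T = type_vspace (*\<^sub>R)" "fib ?T x = tangent_space A x" for x
    by (simp_all add: tangent_bundle_def)
  have trivT: "(U, \<psi>) \<in> triv ?T \<longleftrightarrow> (\<exists>\<phi>. (U, \<phi>) \<in> A \<and> \<psi> = (\<lambda>x. inv_into UNIV (coord_derivation A U \<phi> x)))" for U \<psi>
    unfolding tangent_bundle_def by auto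
  have carM: "car (type_vspace (*\<^sub>R)) = (UNIV :: 'a set)" by (simp add: type_vspace_def)
  have iso: "lin_iso (tangent_space A x) (type_vspace (*\<^sub>R)) (inv_into UNIV (coord_derivation A U \<phi> x))"
    if "(U, \<phi>) \<in> A" "x \<in> U" for U \<phi> x
    using lin_iso_inv[OF is_vspace_model_space lin_iso_coord_derivation[OF that]] unfolding carM .
  show ?thesis
  proof (rule vector_bundleI)
    show "fin_dim_vspace (model ?T)" unfolding T by (rule fin_dim_model_space)
    show "is_vspace (fib ?T x)" for x
      unfolding T tangent_space_def by (rule is_vspace_maps[OF tangent_map_subspace])
    show "open U" if "(U, \<psi>) \<in> triv ?T" for U \<psi> using that chart(1) unfolding trivT by blast
    show "lin_iso (fib ?T x) (model ?T) (\<psi> x)" if "(U, \<psi>) \<in> triv ?T" "x \<in> U" for U \<psi> x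
      using that iso unfolding trivT T by blast
    show "\<exists>U \<psi>. (U, \<psi>) \<in> triv ?T \<and> x \<in> U" for x
    proof -
      obtain U \<phi> where "(U, \<phi>) \<in> A" "x \<in> U" by (rule ex_chart)
      then show ?thesis unfolding trivT by blast
    qed
    fix U \<psi> U' \<psi>' a assume tr: "(U, \<psi>) \<in> triv ?T" "(U', \<psi>') \<in> triv ?T"
    obtain \<phi> where c: "(U, \<phi>) \<in> A" "\<psi> = (\<lambda>x. inv_into UNIV (coord_derivation A U \<phi> x))"
      using tr(1) unfolding trivT by blast
    obtain \<phi>' where c': "(U', \<phi>') \<in> A" "\<psi>' = (\<lambda>x. inv_into UNIV (coord_derivation A U' \<phi>' x))"
      using tr(2) unfolding trivT by blast
    let ?N = "U \<inter> U'"
    have N: "open ?N" using chart(1) c(1) c'(1) by blast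
    let ?c = "\<lambda>x. \<psi>' x (inv_into (car (fib ?T x)) (\<psi> x) a)"
    \<comment> \<open>The transition map is characterized by producing the same derivation from both
      charts. Applied to the coordinates of the second chart, this equation exhibits its components
      as chart derivatives.\<close>
    have cd: "coord_derivation A U' \<phi>' x (?c x) = coord_derivation A U \<phi> x a" if x: "x \<in> ?N" for x
    proof -
      have xU: "x \<in> U" "x \<in> U'" using x by auto
      note D = lin_isoD[OF lin_iso_coord_derivation[OF c(1) xU(1)], unfolded carM]
      note D' = lin_isoD[OF lin_iso_coord_derivation[OF c'(1) xU(2)], unfolded carM]
      have "inv_into (car (tangent_space A x)) (\<psi> x) a = coord_derivation A U \<phi> x a"
      proof (rule inv_into_f_eq)
        show "inj_on (\<psi> x) (car (tangent_space A x))"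
          unfolding c(2) by (rule lin_isoD(8)[OF iso[OF c(1) xU(1)]])
        show "coord_derivation A U \<phi> x a \<in> car (tangent_space A x)" using D(2) by blast
        show "\<psi> x (coord_derivation A U \<phi> x a) = a" unfolding c(2) using D(4) by blast
      qed
      then show ?thesis unfolding T c'(2) using D'(5) D(2) by simp
    qed
    show "smooth_vec_fun A ?N (model ?T) ?c"
      unfolding T
    proof (rule smooth_vec_fun_separating[OF is_vspace_model_space _ separating_onb _ N])
      show "finite ((\<lambda>b v. v \<bullet> b) ` (onb :: 'a set))" by (simp add: onb(1))
      show "real_functional (type_vspace (*\<^sub>R)) f" if "f \<in> (\<lambda>b v. v \<bullet> b) ` (onb :: 'a set)" for f
        using that unfolding real_functional_iff type_vspace_def by (auto simp: inner_add_left)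
      fix f assume "f \<in> (\<lambda>b v. v \<bullet> b) ` (onb :: 'a set)"
      then obtain b where b: "f = (\<lambda>v. v \<bullet> b)" by blast
      show "smooth_fun A ?N (\<lambda>x. f (\<psi>' x (inv_into (car (tangent_space A x)) (\<psi> x) a)))"
      \<comment> \<open>The globally extended coordinates agree with the chart only near the point
        at which they were built.\<close>
      proof (rule smooth_fun_local[OF N])
        fix x0 assume x0: "x0 \<in> ?N"
        then have x0U: "x0 \<in> U'" by blast
        obtain y V where y: "\<And>b. smooth_fun A UNIV (y b)" "open V" "x0 \<in> V" "V \<subseteq> U'"
          "\<And>b z. z \<in> V ==> y b z = (\<phi>' z - \<phi>' x0) \<bullet> b"
          by (rule ex_global_coordinates[OF c'(1) x0U]) (rule that; assumption)
        have VN: "open (V \<inter> ?N)" using y(2) N by blast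
        have "smooth_fun A (V \<inter> ?N) (\<lambda>x. chart_deriv U \<phi> (y b) x a)"
          by (rule smooth_fun_chart_deriv[OF c(1) VN _ smooth_fun_subset[OF y(1)]]) auto
        then have "smooth_fun A (V \<inter> ?N) (\<lambda>x. f (\<psi>' x (inv_into (car (tangent_space A x)) (\<psi> x) a)))"
        proof (rule smooth_fun_cong[OF VN, rotated])
          fix x assume x: "x \<in> V \<inter> ?N"
          have yS: "y b \<in> smooth_functions A" using y(1) by (simp add: smooth_functions_iff)
          have "chart_deriv U' \<phi>' (\<lambda>z. (\<phi>' z - \<phi>' x0) \<bullet> b) x = chart_deriv U' \<phi>' (y b) x"
            by (rule chart_deriv_cong[OF c'(1) y(2) smooth_fun_subset[OF y(1)] _ y(5)]) (use x in auto)
          then have "chart_deriv U' \<phi>' (y b) x v = v \<bullet> b" for v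
            using chart_deriv_coordinate[OF c'(1), of x "\<phi>' x0" b v] x by simp
          moreover have "chart_deriv U' \<phi>' (y b) x (?c x) = chart_deriv U \<phi> (y b) x a"
            using fun_cong[OF cd, of x "y b"] x by (simp add: chart_deriv_coord_derivation[OF yS])
          ultimately show "chart_deriv U \<phi> (y b) x a = f (\<psi>' x (inv_into (car (tangent_space A x)) (\<psi> x) a))"
            unfolding T b by simp
        qed
        then show "\<exists>W. open W \<and> x0 \<in> W \<and>
            smooth_fun A (W \<inter> ?N) (\<lambda>x. f (\<psi>' x (inv_into (car (tangent_space A x)) (\<psi> x) a)))"
          using y(2,3) by blast
      qed
    qed (simp add: carM)
  qed
qed

end

section \<open>Sections of a bundle of Lie algebras\<close>

locale lie_bundle = atlas A + lie_algebra scl brk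
  for A :: "('m::t2_space, 'a::fin_dim_inner) atlas"
    and scl :: "'k::real_or_complex \<Rightarrow> 'g::ab_group_add \<Rightarrow> 'g"
    and brk :: "'g \<Rightarrow> 'g \<Rightarrow> 'g" +
  fixes L :: "('k, 'm, 'e, 'g) vbundle"
    and brL :: "'m \<Rightarrow> 'e \<Rightarrow> 'e \<Rightarrow> 'e"
  assumes fin_dim: "\<exists>B. finite_dimensional_vector_space scl B"
    and lie_algebra_bundle: "lie_algebra_bundle A scl brk L brL"
begin

abbreviation "\<kk> \<equiv> type_vspace scl"
abbreviation "\<Gamma> \<equiv> car (sections A L)"
abbreviation "rscl r u \<equiv> scl (of_real r) u"

lemma L_bundle: "vector_bundle A L" and model_L: "model L = \<kk>"
  and brL_car: "u \<in> car (fib L x) ==> v \<in> car (fib L x) ==> brL x u v \<in> car (fib L x)"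
  using lie_algebra_bundle unfolding lie_algebra_bundle_def by blast+

lemma triv_bracket:
  assumes "(U, \<psi>) \<in> triv L" "x \<in> U" "u \<in> car (fib L x)" "v \<in> car (fib L x)"
  shows "\<psi> x (brL x u v) = brk (\<psi> x u) (\<psi> x v)"
  using lie_algebra_bundle assms unfolding lie_algebra_bundle_def by fastforce

lemma kk_simps [simp]: "car \<kk> = UNIV" "vadd \<kk> u v = u + v" "vzero \<kk> = 0" "vscale \<kk> c v = scl c v"
  by (simp_all add: type_vspace_def)

lemma fin_dim_kk: "fin_dim_vspace \<kk>" and is_vspace_kk: "is_vspace \<kk>"
  using vector_bundleD(1,2)[OF L_bundle] unfolding model_L by blast+

lemma is_vspace_fib: "is_vspace (fib L x)"
  by (rule vector_bundleD(3)[OF L_bundle])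

lemma triv_open: "(U, \<psi>) \<in> triv L ==> open U"
  by (rule vector_bundleD(4)[OF L_bundle])

lemma triv_iso: "(U, \<psi>) \<in> triv L ==> x \<in> U ==> lin_iso (fib L x) \<kk> (\<psi> x)"
  using vector_bundleD(5)[OF L_bundle] unfolding model_L .

lemma triv_inv:
  assumes "(U, \<psi>) \<in> triv L" "x \<in> U"
  shows "inv_into (car (fib L x)) (\<psi> x) w \<in> car (fib L x)" "\<psi> x (inv_into (car (fib L x)) (\<psi> x) w) = w"
    "v \<in> car (fib L x) ==> inv_into (car (fib L x)) (\<psi> x) (\<psi> x v) = v"
    "u \<in> car (fib L x) ==> v \<in> car (fib L x) ==> \<psi> x u = \<psi> x v \<longleftrightarrow> u = v"
  using lin_isoD[OF triv_iso[OF assms]] by simp_all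

lemma triv_linear:
  assumes "(U, \<psi>) \<in> triv L" "x \<in> U"
  shows "u \<in> car (fib L x) ==> v \<in> car (fib L x) ==> \<psi> x (vadd (fib L x) u v) = \<psi> x u + \<psi> x v"
    "v \<in> car (fib L x) ==> \<psi> x (vscale (fib L x) c v) = scl c (\<psi> x v)"
    "\<psi> x (vzero (fib L x)) = 0"
  using lin_mapD[OF lin_isoD(1)[OF triv_iso[OF assms]]]
    lin_map_zero[OF is_vspace_fib is_vspace_kk lin_isoD(1)[OF triv_iso[OF assms]]] by simp_all

lemma fin_dim_fib: "fin_dim_vspace (fib L x)"
proof -
  obtain U \<psi> where "(U, \<psi>) \<in> triv L" "x \<in> U" by (rule ex_triv[OF L_bundle])
  then show ?thesis using lin_iso_fin_dim[OF is_vspace_fib fin_dim_kk triv_iso] by blast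
qed

lemma fib_eqI:
  assumes "u \<in> car (fib L x)" "v \<in> car (fib L x)"
    "\<And>U \<psi>. (U, \<psi>) \<in> triv L ==> x \<in> U ==> \<psi> x u = \<psi> x v"
  shows "u = v"
proof -
  obtain U \<psi> where "(U, \<psi>) \<in> triv L" "x \<in> U" by (rule ex_triv[OF L_bundle])
  then show ?thesis using assms triv_inv(4) by blast
qed

lemma real_functional_kk:
  "real_functional \<kk> l \<longleftrightarrow> (\<forall>u v. l (u + v) = l u + l v) \<and> (\<forall>r u. l (rscl r u) = r * l u)"
  unfolding real_functional_iff by simp

lemma real_functional_sum:
  assumes "real_functional \<kk> l"
  shows "l (\<Sum>i\<in>I. f i) = (\<Sum>i\<in>I. l (f i))"
proof -
  have l: "l (u + v) = l u + l v" for u v using assms unfolding real_functional_kk by blast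
  have "l 0 = 0" using l[of 0 0] by simp
  then show ?thesis by (induction I rule: infinite_finite_induct) (auto simp: l)
qed

subsection \<open>A real basis of the fiber\<close>

definition real_basis :: "nat \<Rightarrow> (nat \<Rightarrow> 'g \<Rightarrow> real) \<Rightarrow> (nat \<Rightarrow> 'g) \<Rightarrow> bool" where
  "real_basis r \<epsilon> e \<longleftrightarrow> (\<forall>i<r. real_functional \<kk> (\<epsilon> i)) \<and>
    (\<forall>i<r. \<forall>j<r. \<epsilon> i (e j) = (if i = j then 1 else 0)) \<and>
    (\<forall>l v. real_functional \<kk> l \<longrightarrow> l v = (\<Sum>i<r. \<epsilon> i v * l (e i))) \<and>
    (\<forall>u v. (\<forall>i<r. \<epsilon> i u = \<epsilon> i v) \<longrightarrow> u = v)"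

lemma ex_real_basis_kk: "\<exists>p. real_basis (fst p) (fst (snd p)) (snd (snd p))"
proof -
  obtain r :: nat and \<epsilon> e where e: "\<And>i. i < r ==> \<epsilon> i \<in> real_dual \<kk>" "\<And>i. i < r ==> e i \<in> car \<kk>"
    "\<And>i j. i < r ==> j < r ==> \<epsilon> i (e j) = (if i = j then 1 else 0)"
    "\<And>l v. real_functional \<kk> l ==> v \<in> car \<kk> ==> l v = (\<Sum>i<r. \<epsilon> i v * l (e i))"
    "separating \<kk> (\<epsilon> ` {..<r})"
    by (rule ex_real_basis[OF fin_dim_kk]) (rule that; assumption)
  have "u = v" if "\<forall>i<r. \<epsilon> i u = \<epsilon> i v" for u v
    using e(5) that unfolding separating_def by auto
  then have "real_basis r \<epsilon> e"
    using e(1,3,4) unfolding real_basis_def real_dual_iff by auto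
  then show ?thesis by (intro exI[of _ "(r, \<epsilon>, e)"]) simp
qed

text \<open>Dimension, functionals and vectors depend on each other, so they are chosen together as
  one triple.\<close>

definition basis_data :: "nat \<times> (nat \<Rightarrow> 'g \<Rightarrow> real) \<times> (nat \<Rightarrow> 'g)" where
  "basis_data = (SOME p. real_basis (fst p) (fst (snd p)) (snd (snd p)))"

definition rdim :: nat where "rdim = fst basis_data"
definition \<epsilon> :: "nat \<Rightarrow> 'g \<Rightarrow> real" where "\<epsilon> = fst (snd basis_data)"
definition e :: "nat \<Rightarrow> 'g" where "e = snd (snd basis_data)"

lemma real_basis: "real_basis rdim \<epsilon> e"
  unfolding rdim_def \<epsilon>_def e_def basis_data_def by (rule someI_ex[OF ex_real_basis_kk])

lemma \<epsilon>_functional: "i < rdim ==> real_functional \<kk> (\<epsilon> i)"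
  and \<epsilon>_e: "i < rdim ==> j < rdim ==> \<epsilon> i (e j) = (if i = j then 1 else 0)"
  and functional_expand: "real_functional \<kk> l ==> l v = (\<Sum>i<rdim. \<epsilon> i v * l (e i))"
  and \<epsilon>_eqI: "(\<And>i. i < rdim ==> \<epsilon> i u = \<epsilon> i v) ==> u = v"
  using real_basis unfolding real_basis_def by blast+

lemma \<epsilon>_linear: "i < rdim ==> \<epsilon> i (u + v) = \<epsilon> i u + \<epsilon> i v" "i < rdim ==> \<epsilon> i (rscl r u) = r * \<epsilon> i u"
  "i < rdim ==> \<epsilon> i 0 = 0"
proof -
  show *: "\<epsilon> i (u + v) = \<epsilon> i u + \<epsilon> i v" if "i < rdim" for u v
    using \<epsilon>_functional[OF that] unfolding real_functional_kk by blast
  show "\<epsilon> i (rscl r u) = r * \<epsilon> i u" if "i < rdim"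
    using \<epsilon>_functional[OF that] unfolding real_functional_kk by blast
  show "i < rdim ==> \<epsilon> i 0 = 0" using *[of 0 0] by simp
qed

lemma real_functional_eqI:
  assumes "\<And>l. real_functional \<kk> l ==> l u = l v"
  shows "u = v"
  by (rule \<epsilon>_eqI) (rule assms[OF \<epsilon>_functional])

lemma expand: "u = (\<Sum>i<rdim. rscl (\<epsilon> i u) (e i))"
proof (rule real_functional_eqI)
  fix l assume l: "real_functional \<kk> l"
  then have "l (rscl r v) = r * l v" for r v unfolding real_functional_kk by blast
  then show "l u = l (\<Sum>i<rdim. rscl (\<epsilon> i u) (e i))"
    using functional_expand[OF l, of u] by (simp add: real_functional_sum[OF l])
qed

lemma smooth_vec_fun_\<epsilon>:
  assumes "open W"
  shows "smooth_vec_fun A W \<kk> g \<longleftrightarrow> (\<forall>i<rdim. smooth_fun A W (\<lambda>x. \<epsilon> i (g x)))"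
proof
  assume "smooth_vec_fun A W \<kk> g"
  then show "\<forall>i<rdim. smooth_fun A W (\<lambda>x. \<epsilon> i (g x))"
    using smooth_vec_fun_functional[OF is_vspace_kk assms _ \<epsilon>_functional] by blast
next
  assume g: "\<forall>i<rdim. smooth_fun A W (\<lambda>x. \<epsilon> i (g x))"
  show "smooth_vec_fun A W \<kk> g"
    by (rule smooth_vec_fun_separating[OF is_vspace_kk, where F = "\<epsilon> ` {..<rdim}"])
      (use g \<epsilon>_functional assms \<epsilon>_eqI in \<open>auto simp: separating_def\<close>)
qed

lemma smooth_kk_functional:
  "open W ==> smooth_vec_fun A W \<kk> g ==> real_functional \<kk> l ==> smooth_fun A W (\<lambda>x. l (g x))"
  by (rule smooth_vec_fun_functional[OF is_vspace_kk])

lemma smooth_kk_add: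
  assumes "open W" "smooth_vec_fun A W \<kk> g" "smooth_vec_fun A W \<kk> h"
  shows "smooth_vec_fun A W \<kk> (\<lambda>x. g x + h x)"
  using assms(2,3) unfolding smooth_vec_fun_\<epsilon>[OF assms(1)]
  by (auto simp: \<epsilon>_linear intro!: smooth_fun_add[OF assms(1)])

lemma smooth_kk_rscl:
  assumes "open W" "smooth_fun A W f" "smooth_vec_fun A W \<kk> g"
  shows "smooth_vec_fun A W \<kk> (\<lambda>x. rscl (f x) (g x))"
  using assms(3) unfolding smooth_vec_fun_\<epsilon>[OF assms(1)]
  by (auto simp: \<epsilon>_linear intro!: smooth_fun_mult[OF assms(1,2)])

lemma smooth_kk_scl:
  assumes "open W" "smooth_vec_fun A W \<kk> g"
  shows "smooth_vec_fun A W \<kk> (\<lambda>x. scl c (g x))"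
  by (rule smooth_vec_fun_lin_map[OF is_vspace_kk assms])
    (auto simp: lin_map_def scale_right_distrib scale_left_commute)

lemma smooth_kk_sum:
  assumes "open W" "\<And>i. i \<in> I ==> smooth_vec_fun A W \<kk> (g i)"
  shows "smooth_vec_fun A W \<kk> (\<lambda>x. \<Sum>i\<in>I. g i x)"
  using assms(2)
  by (induction I rule: infinite_finite_induct)
    (auto intro!: smooth_kk_add smooth_vec_fun_const assms(1))

lemma brk_linear:
  "lin_map \<kk> \<kk> (brk u)" "lin_map \<kk> \<kk> (\<lambda>u. brk u v)"
  unfolding lin_map_def
  by (auto simp: bracket_add_left bracket_add_right bracket_scale_left bracket_scale_right)

lemma smooth_kk_brk:
  assumes W: "open W" and g: "smooth_vec_fun A W \<kk> g" and h: "smooth_vec_fun A W \<kk> h"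
  shows "smooth_vec_fun A W \<kk> (\<lambda>x. brk (g x) (h x))"
  by (rule smooth_vec_fun_apply[OF fin_dim_kk W _ is_vspace_kk _ h, where H = "\<lambda>x. brk (g x)"])
    (use brk_linear(1) smooth_vec_fun_lin_map[OF is_vspace_kk W g brk_linear(2)] in auto)

lemma brk_0 [simp]: "brk 0 v = 0" "brk u 0 = 0"
  using bracket_add_left[of 0 0 v] bracket_add_right[of u 0 0] by simp_all

subsection \<open>Sections\<close>

lemma section_car: "X \<in> \<Gamma> ==> X x \<in> car (fib L x)"
  by (simp add: sections_def)

lemma section_smooth: "X \<in> \<Gamma> ==> (U, \<psi>) \<in> triv L ==> N \<subseteq> U ==> smooth_vec_fun A N \<kk> (\<lambda>x. \<psi> x (X x))"
  by (rule smooth_vec_fun_subset[of U]) (auto simp: sections_def model_L)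

text \<open>Smooth transition maps carry smoothness from one trivialization near each point to all
  of them.\<close>

lemma sectionI:
  assumes car: "\<And>x. X x \<in> car (fib L x)"
    and loc: "\<And>x. \<exists>U \<psi> N. (U, \<psi>) \<in> triv L \<and> open N \<and> x \<in> N \<and> N \<subseteq> U \<and> smooth_vec_fun A N \<kk> (\<lambda>x. \<psi> x (X x))"
  shows "X \<in> \<Gamma>"
proof -
  have "smooth_vec_fun A U \<kk> (\<lambda>x. \<psi> x (X x))" if t: "(U, \<psi>) \<in> triv L" for U \<psi>
  proof (rule smooth_vec_fun_local[OF triv_open[OF t]])
    fix x assume x: "x \<in> U"
    obtain U' \<psi>' N where N: "(U', \<psi>') \<in> triv L" "open N" "x \<in> N" "N \<subseteq> U'"
      "smooth_vec_fun A N \<kk> (\<lambda>x. \<psi>' x (X x))" using loc by blast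
    have "smooth_vec_fun A (N \<inter> U) (model L) (\<lambda>x. \<psi> x (X x))"
      by (rule triv_change[OF L_bundle N(1) t]) (use N car triv_open[OF t] smooth_vec_fun_subset[OF N(5)] in \<open>auto simp: model_L\<close>)
    then show "\<exists>N. open N \<and> x \<in> N \<and> smooth_vec_fun A (N \<inter> U) \<kk> (\<lambda>x. \<psi> x (X x))"
      using N by (auto simp: model_L)
  qed
  then show ?thesis using car by (auto simp: sections_def model_L)
qed

lemma section_local:
  assumes "\<And>x. \<exists>N Y. open N \<and> x \<in> N \<and> Y \<in> \<Gamma> \<and> (\<forall>y\<in>N. X y = Y y)"
  shows "X \<in> \<Gamma>"
proof (rule sectionI)
  fix x
  obtain N Y where N: "open N" "x \<in> N" "Y \<in> \<Gamma>" "\<forall>y\<in>N. X y = Y y" using assms by blast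
  show "X x \<in> car (fib L x)" using N section_car by simp
  obtain U \<psi> where t: "(U, \<psi>) \<in> triv L" "x \<in> U" by (rule ex_triv[OF L_bundle])
  have o: "open (U \<inter> N)" using triv_open[OF t(1)] N(1) by blast
  have "smooth_vec_fun A (U \<inter> N) \<kk> (\<lambda>x. \<psi> x (X x))"
    by (rule smooth_vec_fun_cong[OF o _ section_smooth[OF N(3) t(1)]]) (use N(4) in auto)
  then show "\<exists>U \<psi> N. (U, \<psi>) \<in> triv L \<and> open N \<and> x \<in> N \<and> N \<subseteq> U \<and> smooth_vec_fun A N \<kk> (\<lambda>x. \<psi> x (X x))"
    using t N(2) o by blast
qed

lemma sectionI_op:
  assumes car: "\<And>x. X x \<in> car (fib L x)"
    and "\<And>U \<psi>. (U, \<psi>) \<in> triv L ==> smooth_vec_fun A U \<kk> (\<lambda>x. \<psi> x (X x))"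
  shows "X \<in> \<Gamma>"
  using assms by (auto simp: sections_def model_L)

section \<open>Operations on sections and local frames\<close>

lemma sections_simps:
  "vadd (sections A L) X Y = (\<lambda>x. vadd (fib L x) (X x) (Y x))"
  "vzero (sections A L) = (\<lambda>x. vzero (fib L x))"
  "vscale (sections A L) c X = (\<lambda>x. vscale (fib L x) c (X x))"
  by (simp_all add: sections_def)

text \<open>The functions are real-valued also when \<K> is complex, in accordance with the real
  tangent bundle.\<close>

definition fmul :: "('m \<Rightarrow> real) \<Rightarrow> ('m \<Rightarrow> 'e) \<Rightarrow> 'm \<Rightarrow> 'e" where
  "fmul f X = (\<lambda>x. vscale (fib L x) (of_real (f x)) (X x))"

lemma section_add: "X \<in> \<Gamma> ==> Y \<in> \<Gamma> ==> vadd (sections A L) X Y \<in> \<Gamma>"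
proof (rule sectionI_op)
  assume X: "X \<in> \<Gamma>" and Y: "Y \<in> \<Gamma>"
  show "vadd (sections A L) X Y x \<in> car (fib L x)" for x
    unfolding sections_simps by (intro is_vspaceD(2)[OF is_vspace_fib] section_car X Y)
  show "smooth_vec_fun A U \<kk> (\<lambda>x. \<psi> x (vadd (sections A L) X Y x))" if t: "(U, \<psi>) \<in> triv L" for U \<psi>
    by (rule smooth_vec_fun_cong[OF triv_open[OF t] _ smooth_kk_add[OF triv_open[OF t]
            section_smooth[OF X t] section_smooth[OF Y t]]])
      (auto simp: sections_simps triv_linear[OF t] section_car X Y)
qed

lemma section_scale: "X \<in> \<Gamma> ==> vscale (sections A L) c X \<in> \<Gamma>"
proof (rule sectionI_op)
  assume X: "X \<in> \<Gamma>"
  show "vscale (sections A L) c X x \<in> car (fib L x)" for x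
    unfolding sections_simps by (intro is_vspaceD(3)[OF is_vspace_fib] section_car X)
  show "smooth_vec_fun A U \<kk> (\<lambda>x. \<psi> x (vscale (sections A L) c X x))" if t: "(U, \<psi>) \<in> triv L" for U \<psi>
    by (rule smooth_vec_fun_cong[OF triv_open[OF t] _ smooth_kk_scl[OF triv_open[OF t] section_smooth[OF X t]]])
      (auto simp: sections_simps triv_linear[OF t] section_car X)
qed

lemma section_fmul: "smooth_fun A UNIV f ==> X \<in> \<Gamma> ==> fmul f X \<in> \<Gamma>"
proof (rule sectionI_op)
  assume f: "smooth_fun A UNIV f" and X: "X \<in> \<Gamma>"
  show "fmul f X x \<in> car (fib L x)" for x
    unfolding fmul_def by (intro is_vspaceD(3)[OF is_vspace_fib] section_car X)
  show "smooth_vec_fun A U \<kk> (\<lambda>x. \<psi> x (fmul f X x))" if t: "(U, \<psi>) \<in> triv L" for U \<psi>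
    by (rule smooth_vec_fun_cong[OF triv_open[OF t] _ smooth_kk_rscl[OF triv_open[OF t]
            smooth_fun_subset[OF f] section_smooth[OF X t]]])
      (auto simp: fmul_def triv_linear[OF t] section_car X)
qed

lemma section_bracket_closed: "X \<in> \<Gamma> ==> Y \<in> \<Gamma> ==> section_bracket brL X Y \<in> \<Gamma>"
proof (rule sectionI_op)
  assume X: "X \<in> \<Gamma>" and Y: "Y \<in> \<Gamma>"
  show "section_bracket brL X Y x \<in> car (fib L x)" for x
    unfolding section_bracket_def by (intro brL_car section_car X Y)
  show "smooth_vec_fun A U \<kk> (\<lambda>x. \<psi> x (section_bracket brL X Y x))" if t: "(U, \<psi>) \<in> triv L" for U \<psi>
    by (rule smooth_vec_fun_cong[OF triv_open[OF t] _ smooth_kk_brk[OF triv_open[OF t]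
            section_smooth[OF X t] section_smooth[OF Y t]]])
      (auto simp: section_bracket_def triv_bracket[OF t] section_car X Y)
qed

lemma triv_fmul: "(U, \<psi>) \<in> triv L ==> x \<in> U ==> X \<in> \<Gamma> ==> \<psi> x (fmul f X x) = rscl (f x) (\<psi> x (X x))"
  by (simp add: fmul_def triv_linear section_car)

lemma triv_section_bracket:
  "(U, \<psi>) \<in> triv L ==> x \<in> U ==> X \<in> \<Gamma> ==> Y \<in> \<Gamma> ==>
    \<psi> x (section_bracket brL X Y x) = brk (\<psi> x (X x)) (\<psi> x (Y x))"
  by (simp add: section_bracket_def triv_bracket section_car)

lemma section_zero: "vzero (sections A L) \<in> \<Gamma>"
proof (rule sectionI_op)
  show "vzero (sections A L) x \<in> car (fib L x)" for x
    unfolding sections_simps by (rule is_vspaceD(1)[OF is_vspace_fib])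
  show "smooth_vec_fun A U \<kk> (\<lambda>x. \<psi> x (vzero (sections A L) x))" if t: "(U, \<psi>) \<in> triv L" for U \<psi>
    by (rule smooth_vec_fun_cong[OF triv_open[OF t] _ smooth_vec_fun_const[OF triv_open[OF t], of 0]])
      (auto simp: sections_simps triv_linear[OF t])
qed

lemma section_extend:
  assumes t: "(U, \<psi>) \<in> triv L" and N: "open N" "N \<subseteq> U"
    and \<beta>: "smooth_fun A UNIV \<beta>" "\<And>y. y \<notin> C ==> \<beta> y = 0" and C: "closed C" "C \<subseteq> N"
    and g: "smooth_vec_fun A N \<kk> g"
  shows "(\<lambda>y. if y \<in> N then inv_into (car (fib L y)) (\<psi> y) (rscl (\<beta> y) (g y)) else vzero (fib L y)) \<in> \<Gamma>"
    (is "?X \<in> \<Gamma>")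
proof (rule sectionI)
  \<comment> \<open>The trivialization sends zero to zero, so the two branches agree where
    \<open>\<beta>\<close> has vanished; this makes the section smooth across the boundary of
    \<open>N\<close>.\<close>
  have X0: "?X y = vzero (fib L y)" if "y \<notin> C" for y
  proof (cases "y \<in> N")
    case True
    then have y: "y \<in> U" using N by blast
    have "inv_into (car (fib L y)) (\<psi> y) 0 = vzero (fib L y)"
      using triv_inv(3)[OF t y is_vspaceD(1)[OF is_vspace_fib]] triv_linear(3)[OF t y] by simp
    then show ?thesis using \<beta>(2)[OF that] by simp
  qed simp
  show "?X x \<in> car (fib L x)" for x
    using triv_inv(1)[OF t] N is_vspaceD(1)[OF is_vspace_fib] by auto
  fix x
  show "\<exists>U \<psi> N. (U, \<psi>) \<in> triv L \<and> open N \<and> x \<in> N \<and> N \<subseteq> U \<and> smooth_vec_fun A N \<kk> (\<lambda>x. \<psi> x (?X x))"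
  proof (cases "x \<in> N")
    case True
    have "smooth_vec_fun A N \<kk> (\<lambda>x. \<psi> x (?X x))"
      by (rule smooth_vec_fun_cong[OF N(1) _ smooth_kk_rscl[OF N(1) smooth_fun_subset[OF \<beta>(1)] g]])
        (use triv_inv(2)[OF t] N(2) in auto)
    then show ?thesis using t N True by blast
  next
    case False
    obtain U' \<psi>' where t': "(U', \<psi>') \<in> triv L" "x \<in> U'" by (rule ex_triv[OF L_bundle])
    have o: "open (U' \<inter> - C)" using triv_open[OF t'(1)] C(1) by auto
    have "smooth_vec_fun A (U' \<inter> - C) \<kk> (\<lambda>x. \<psi>' x (?X x))"
      by (rule smooth_vec_fun_cong[OF o _ smooth_vec_fun_const[OF o, of 0]])
        (use triv_linear(3)[OF t'(1)] in \<open>auto simp: X0 simp del: if_image_distrib\<close>)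
    moreover have "x \<in> U' \<inter> - C" using t'(2) False C(2) by blast
    ultimately show ?thesis using t'(1) o by blast
  qed
qed

text \<open>Constant local sections, cut off to become global. They carry a vector \<open>u\<close>
  of \<kk> to arguments on which x-derivations can be evaluated.\<close>

lemma ex_local_frame:
  assumes t: "(U, \<psi>) \<in> triv L" and x: "x \<in> U" "x \<in> N" and N: "open N"
  obtains E V where "open V" "x \<in> V" "V \<subseteq> U" "V \<subseteq> N" "\<And>u. E u \<in> \<Gamma>" "\<And>u y. y \<in> V ==> \<psi> y (E u y) = u"
proof -
  have o: "open (U \<inter> N)" "x \<in> U \<inter> N" using triv_open[OF t] N x by auto
  obtain \<beta> V C where \<beta>: "smooth_fun A UNIV \<beta>" "open V" "x \<in> V" "V \<subseteq> C" "closed C" "C \<subseteq> U \<inter> N"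
    "\<And>y. y \<in> V ==> \<beta> y = 1" "\<And>y. y \<notin> C ==> \<beta> y = 0"
    by (rule ex_bump[OF o]) (rule that; assumption)
  let ?E = "\<lambda>u y. if y \<in> U \<inter> N then inv_into (car (fib L y)) (\<psi> y) (rscl (\<beta> y) u) else vzero (fib L y)"
  show ?thesis
  proof (rule that[of V ?E])
    show "?E u \<in> \<Gamma>" for u
      by (rule section_extend[OF t o(1) _ \<beta>(1,8,5,6) smooth_vec_fun_const[OF o(1)]]) auto
    show "\<psi> y (?E u y) = u" if y: "y \<in> V" for u y
    proof -
      have "y \<in> U \<inter> N" "\<beta> y = 1" using y \<beta>(4,6,7) by auto
      then show ?thesis using triv_inv(2)[OF t] by simp
    qed
  qed (use \<beta>(2-6) in auto)
qed

lemma ex_section_through: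
  assumes "v \<in> car (fib L x)"
  obtains X where "X \<in> \<Gamma>" "X x = v"
proof -
  obtain U \<psi> where t: "(U, \<psi>) \<in> triv L" "x \<in> U" by (rule ex_triv[OF L_bundle])
  obtain E V where E: "open V" "x \<in> V" "V \<subseteq> U" "V \<subseteq> UNIV" "\<And>u. E u \<in> \<Gamma>" "\<And>u y. y \<in> V ==> \<psi> y (E u y) = u"
    by (rule ex_local_frame[OF t UNIV_I open_UNIV]) (rule that; assumption)
  have "\<psi> x (E (\<psi> x v) x) = \<psi> x v" by (rule E(6)[OF E(2)])
  then have "E (\<psi> x v) x = v" using triv_inv(4)[OF t section_car[OF E(5)] assms] by simp
  then show ?thesis using that E(5) by blast
qed

subsection \<open>Derivations at a point vanish on products of two functions vanishing there\<close>

lemma x_derivationD: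
  assumes "\<delta> \<in> car (x_derivations A L brL x)"
  shows "X \<in> \<Gamma> ==> \<delta> X \<in> car (fib L x)"
    "X \<in> \<Gamma> ==> Y \<in> \<Gamma> ==> \<delta> (vadd (sections A L) X Y) = vadd (fib L x) (\<delta> X) (\<delta> Y)"
    "X \<in> \<Gamma> ==> \<delta> (vscale (sections A L) c X) = vscale (fib L x) c (\<delta> X)"
    "X \<in> \<Gamma> ==> Y \<in> \<Gamma> ==> \<delta> (section_bracket brL X Y) = vadd (fib L x) (brL x (\<delta> X) (Y x)) (brL x (X x) (\<delta> Y))"
    "\<delta> \<in> extensional \<Gamma>"
  using assms unfolding x_derivations_def maps_vspace_simps by (auto dest: lin_mapD)

lemma fmul_add:
  "X \<in> \<Gamma> ==> Y \<in> \<Gamma> ==> fmul f (vadd (sections A L) X Y) = vadd (sections A L) (fmul f X) (fmul f Y)"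
  unfolding fmul_def sections_simps using is_vspaceD(8)[OF is_vspace_fib section_car section_car] by blast

lemma section_eqI:
  assumes "X \<in> \<Gamma>" "Y \<in> \<Gamma>" "\<And>x U \<psi>. (U, \<psi>) \<in> triv L ==> x \<in> U ==> \<psi> x (X x) = \<psi> x (Y x)"
  shows "X = Y"
  by (rule ext) (rule fib_eqI[OF section_car[OF assms(1)] section_car[OF assms(2)] assms(3)])

lemma fmul_bracket:
  assumes "X \<in> \<Gamma>" "Y \<in> \<Gamma>" "smooth_fun A UNIV f" "smooth_fun A UNIV g"
  shows "fmul (\<lambda>y. f y * g y) (section_bracket brL X Y) = section_bracket brL (fmul f X) (fmul g Y)"
  by (rule section_eqI)
    (use assms in \<open>simp_all add: section_fmul section_bracket_closed smooth_fun_mult triv_fmul triv_section_bracket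
      bracket_scale_left bracket_scale_right\<close>)

text \<open>Finite sums of brackets. Scalars and functions can be absorbed into one factor of a
  bracket.\<close>

inductive_set bracket_span :: "('m \<Rightarrow> 'e) set" where
  bracket: "X \<in> \<Gamma> ==> Y \<in> \<Gamma> ==> section_bracket brL X Y \<in> bracket_span"
| add: "X \<in> bracket_span ==> Y \<in> bracket_span ==> vadd (sections A L) X Y \<in> bracket_span"

lemma bracket_span_sections: "X \<in> bracket_span ==> X \<in> \<Gamma>"
  by (induction rule: bracket_span.induct) (auto intro: section_bracket_closed section_add)

lemma brL_zero:
  assumes "u \<in> car (fib L x)"
  shows "brL x (vzero (fib L x)) u = vzero (fib L x)" "brL x u (vzero (fib L x)) = vzero (fib L x)"
proof -
  note z = is_vspaceD(1)[OF is_vspace_fib, of x]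
  show "brL x (vzero (fib L x)) u = vzero (fib L x)"
    by (rule fib_eqI[OF brL_car[OF z assms] z]) (simp add: triv_bracket[OF _ _ z assms] triv_linear(3))
  show "brL x u (vzero (fib L x)) = vzero (fib L x)"
    by (rule fib_eqI[OF brL_car[OF assms z] z]) (simp add: triv_bracket[OF _ _ assms z] triv_linear(3))
qed

lemma fmul_at_zero: "X \<in> \<Gamma> ==> f x = 0 ==> fmul f X x = vzero (fib L x)"
  by (simp add: fmul_def vscale_0[OF is_vspace_fib section_car])

text \<open>Each of the two terms of the product rule contains the value at \<open>x\<close> of one
  factor, which is zero.\<close>

lemma x_derivation_bracket_vanish:
  assumes \<delta>: "\<delta> \<in> car (x_derivations A L brL x)"
    and fg: "smooth_fun A UNIV f" "smooth_fun A UNIV g" "f x = 0" "g x = 0"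
    and X: "X \<in> \<Gamma>" "Y \<in> \<Gamma>"
  shows "\<delta> (section_bracket brL (fmul f X) (fmul g Y)) = vzero (fib L x)"
  using x_derivationD(4)[OF \<delta> section_fmul[OF fg(1) X(1)] section_fmul[OF fg(2) X(2)]]
    x_derivationD(1)[OF \<delta> section_fmul[OF fg(1) X(1)]] x_derivationD(1)[OF \<delta> section_fmul[OF fg(2) X(2)]]
  by (simp add: fmul_at_zero X fg brL_zero is_vspaceD(1,6)[OF is_vspace_fib])

lemma x_derivation_vanish_centerfree:
  assumes \<delta>: "\<delta> \<in> car (x_derivations A L brL x)" and cf: "centerfree"
    and fg: "smooth_fun A UNIV f" "smooth_fun A UNIV g" "f x = 0" "g x = 0" and X: "X \<in> \<Gamma>"
  shows "\<delta> (fmul (\<lambda>y. f y * g y) X) = vzero (fib L x)"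
proof -
  obtain U \<psi> where t: "(U, \<psi>) \<in> triv L" "x \<in> U" by (rule ex_triv[OF L_bundle])
  let ?fg = "\<lambda>y. f y * g y"
  have sfg: "smooth_fun A UNIV ?fg" by (rule smooth_fun_mult[OF open_UNIV fg(1,2)])
  have FX: "fmul ?fg X \<in> \<Gamma>" by (rule section_fmul[OF sfg X])
  let ?d = "\<delta> (fmul ?fg X)"
  have d: "?d \<in> car (fib L x)" by (rule x_derivationD(1)[OF \<delta> FX])
  have "brk (\<psi> x ?d) w = 0" for w
  proof -
    obtain Y where Y: "Y \<in> \<Gamma>" "Y x = inv_into (car (fib L x)) (\<psi> x) w"
      by (rule ex_section_through[OF triv_inv(1)[OF t]])
    have dY: "\<delta> Y \<in> car (fib L x)" by (rule x_derivationD(1)[OF \<delta> Y(1)])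
    have "section_bracket brL (fmul ?fg X) Y = section_bracket brL (fmul f X) (fmul g Y)"
      by (rule section_eqI)
        (use X Y(1) fg FX in \<open>simp_all add: section_fmul section_bracket_closed triv_fmul triv_section_bracket
          bracket_scale_left bracket_scale_right\<close>)
    then have "\<delta> (section_bracket brL (fmul ?fg X) Y) = vzero (fib L x)"
      using x_derivation_bracket_vanish[OF \<delta> fg X Y(1)] by simp
    then have "vadd (fib L x) (brL x ?d (Y x)) (brL x (fmul ?fg X x) (\<delta> Y)) = vzero (fib L x)"
      using x_derivationD(4)[OF \<delta> FX Y(1)] by simp
    moreover have "fmul ?fg X x = vzero (fib L x)" by (rule fmul_at_zero[OF X]) (simp add: fg)
    ultimately have "vadd (fib L x) (brL x ?d (Y x)) (vzero (fib L x)) = vzero (fib L x)"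
      using brL_zero(1)[OF dY] by simp
    from arg_cong[OF this, of "\<psi> x"] show ?thesis
      using d section_car[OF Y(1), of x]
      by (simp add: triv_linear[OF t] triv_bracket[OF t] brL_car is_vspaceD(1)[OF is_vspace_fib] Y(2) triv_inv[OF t])
  qed
  then have "\<psi> x ?d = 0" using cf unfolding centerfree_def by blast
  then show ?thesis
    using triv_inv(4)[OF t d is_vspaceD(1)[OF is_vspace_fib]] triv_linear(3)[OF t] by simp
qed

lemma x_derivation_vanish_span:
  assumes \<delta>: "\<delta> \<in> car (x_derivations A L brL x)"
    and fg: "smooth_fun A UNIV f" "smooth_fun A UNIV g" "f x = 0" "g x = 0" and X: "X \<in> bracket_span"
  shows "\<delta> (fmul (\<lambda>y. f y * g y) X) = vzero (fib L x)"
  using X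
proof (induction rule: bracket_span.induct)
  case (bracket X Y)
  then show ?case
    using fmul_bracket[OF bracket fg(1,2)] x_derivation_bracket_vanish[OF \<delta> fg bracket] by simp
next
  case (add X Y)
  note s = add(1,2)[THEN bracket_span_sections]
  note s' = s[THEN section_fmul[OF smooth_fun_mult[OF open_UNIV fg(1,2)]]]
  show ?case
    unfolding fmul_add[OF s] x_derivationD(2)[OF \<delta> s'] add(3,4)
    by (rule is_vspaceD(6)[OF is_vspace_fib is_vspaceD(1)[OF is_vspace_fib]])
qed

end

section \<open>Derivations and centroids of the fibers\<close>

lemma vadd_shuffle:
  assumes V: "is_vspace V" and "a \<in> car V" "b \<in> car V" "c \<in> car V" "d \<in> car V"
  shows "vadd V (vadd V a b) (vadd V c d) = vadd V (vadd V a c) (vadd V b d)"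
proof -
  note D = is_vspaceD[OF V]
  have "vadd V (vadd V a b) (vadd V c d) = vadd V a (vadd V (vadd V b c) d)"
    using assms D(2,4) by metis
  also have "vadd V b c = vadd V c b" using assms D(5) by blast
  also have "vadd V a (vadd V (vadd V c b) d) = vadd V (vadd V a c) (vadd V b d)"
    using assms D(2,4) by metis
  finally show ?thesis .
qed

lemma vadd_zero:
  assumes "is_vspace V"
  shows "vadd V (vzero V) (vzero V) = vzero V"
  by (rule is_vspaceD(6)[OF assms is_vspaceD(1)[OF assms]])

definition bilinear_on :: "('k, 'v) vspace \<Rightarrow> ('v \<Rightarrow> 'v \<Rightarrow> 'v) \<Rightarrow> bool" where
  "bilinear_on V br \<longleftrightarrow> (\<forall>u\<in>car V. lin_map V V (br u) \<and> lin_map V V (\<lambda>v. br v u))"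

lemma bilinear_onD:
  assumes "bilinear_on V br"
  shows "u \<in> car V ==> v \<in> car V ==> br u v \<in> car V"
    "u \<in> car V ==> v \<in> car V ==> w \<in> car V ==> br u (vadd V v w) = vadd V (br u v) (br u w)"
    "u \<in> car V ==> v \<in> car V ==> w \<in> car V ==> br (vadd V v w) u = vadd V (br v u) (br w u)"
    "u \<in> car V ==> v \<in> car V ==> br u (vscale V c v) = vscale V c (br u v)"
    "u \<in> car V ==> v \<in> car V ==> br (vscale V c v) u = vscale V c (br v u)"
proof -
  have l: "lin_map V V (br u)" "lin_map V V (\<lambda>v. br v u)" if "u \<in> car V" for u
    using assms that unfolding bilinear_on_def by auto
  show "br u v \<in> car V" if "u \<in> car V" "v \<in> car V" by (rule lin_mapD(1)[OF l(1)[OF that(1)] that(2)])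
  show "br u (vadd V v w) = vadd V (br u v) (br u w)" if "u \<in> car V" "v \<in> car V" "w \<in> car V"
    by (rule lin_mapD(2)[OF l(1)[OF that(1)] that(2,3)])
  show "br (vadd V v w) u = vadd V (br v u) (br w u)" if "u \<in> car V" "v \<in> car V" "w \<in> car V"
    by (rule lin_mapD(2)[OF l(2)[OF that(1)] that(2,3)])
  show "br u (vscale V c v) = vscale V c (br u v)" if "u \<in> car V" "v \<in> car V"
    by (rule lin_mapD(3)[OF l(1)[OF that(1)] that(2)])
  show "br (vscale V c v) u = vscale V c (br v u)" if "u \<in> car V" "v \<in> car V"
    by (rule lin_mapD(3)[OF l(2)[OF that(1)] that(2)])
qed

lemma bilinear_on_zero:
  assumes V: "is_vspace V" and br: "bilinear_on V br" and u: "u \<in> car V"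
  shows "br u (vzero V) = vzero V" "br (vzero V) u = vzero V"
proof -
  have l: "lin_map V V (br u)" "lin_map V V (\<lambda>v. br v u)"
    using br u unfolding bilinear_on_def by auto
  show "br u (vzero V) = vzero V" "br (vzero V) u = vzero V"
    by (rule lin_map_zero[OF V V l(1)], rule lin_map_zero[OF V V l(2)])
qed

lemma lin_map_cong:
  assumes "\<And>u v. u \<in> car V ==> v \<in> car V ==> vadd V u v \<in> car V" "\<And>c v. v \<in> car V ==> vscale V c v \<in> car V"
    and "\<And>v. v \<in> car V ==> f v = g v"
  shows "lin_map V W f \<longleftrightarrow> lin_map V W g"
  using assms unfolding lin_map_def by (auto simp: Pi_iff)

lemma lin_map_subspace:
  assumes V: "\<And>u v. u \<in> car V ==> v \<in> car V ==> vadd V u v \<in> car V" "\<And>c v. v \<in> car V ==> vscale V c v \<in> car V"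
    and W: "is_vspace W"
  shows "map_subspace (car V) W {f. lin_map V W f}"
proof -
  note D = is_vspaceD[OF W]
  have "lin_map V W (\<lambda>s\<in>car V. vzero W)"
    using V D(1) vadd_zero[OF W] vscale_zero[OF W] unfolding lin_map_def by auto
  moreover have "lin_map V W (\<lambda>s\<in>car V. vadd W (f s) (g s))" if "lin_map V W f" "lin_map V W g" for f g
    using that V D(2) lin_mapD[OF that(1)] lin_mapD[OF that(2)] vadd_shuffle[OF W] D(8)
    by (simp add: lin_map_def Pi_iff)
  moreover have "lin_map V W (\<lambda>s\<in>car V. vscale W c (f s))" if "lin_map V W f" for c f
    using that V D(3) lin_mapD[OF that] D(8) vscale_commute[OF W]
    by (simp add: lin_map_def Pi_iff)
  ultimately show ?thesis
    unfolding map_subspace_def using W by (auto simp: lin_map_def Pi_iff)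
qed

text \<open>Derivations along a map \<open>\<rho>\<close>; derivations of an algebra and derivations at a point are the cases
  \<open>\<rho> = id\<close> and \<open>\<rho> = ev\<^sub>x\<close>.\<close>

lemma derivation_subspace:
  assumes V: "\<And>u v. u \<in> car V ==> v \<in> car V ==> vadd V u v \<in> car V" "\<And>c v. v \<in> car V ==> vscale V c v \<in> car V"
    and br: "\<And>u v. u \<in> car V ==> v \<in> car V ==> br u v \<in> car V"
    and W: "is_vspace W" "bilinear_on W br'" and \<rho>: "\<And>v. v \<in> car V ==> \<rho> v \<in> car W"
  shows "map_subspace (car V) W {\<delta>. lin_map V W \<delta> \<and>
     (\<forall>u\<in>car V. \<forall>v\<in>car V. \<delta> (br u v) = vadd W (br' (\<delta> u) (\<rho> v)) (br' (\<rho> u) (\<delta> v)))}" (is "map_subspace _ _ ?F")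
proof -
  note D = is_vspaceD[OF W(1)] and B = bilinear_onD[OF W(2)]
  note lin = lin_map_subspace[of V W, OF V W(1), simplified map_subspace_def, simplified]
  have "(\<lambda>s\<in>car V. vzero W) \<in> ?F"
    using lin br \<rho> D(1) bilinear_on_zero[OF W] vadd_zero[OF W(1)] by simp
  moreover have "(\<lambda>s\<in>car V. vadd W (f s) (g s)) \<in> ?F"
    if f: "f \<in> extensional (car V)" "f \<in> ?F" and g: "g \<in> extensional (car V)" "g \<in> ?F" for f g
  proof -
    have "vadd W (f (br u v)) (g (br u v)) =
        vadd W (br' (vadd W (f u) (g u)) (\<rho> v)) (br' (\<rho> u) (vadd W (f v) (g v)))"
      if uv: "u \<in> car V" "v \<in> car V" for u v
    proof -
      have "lin_map V W f" "lin_map V W g" using f(2) g(2) by auto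
      then have c: "f u \<in> car W" "f v \<in> car W" "g u \<in> car W" "g v \<in> car W"
        using uv by (auto dest: lin_mapD(1))
      have "vadd W (f (br u v)) (g (br u v)) = vadd W (vadd W (br' (f u) (\<rho> v)) (br' (\<rho> u) (f v)))
          (vadd W (br' (g u) (\<rho> v)) (br' (\<rho> u) (g v)))"
        using f(2) g(2) uv by simp
      also have "\<dots> = vadd W (vadd W (br' (f u) (\<rho> v)) (br' (g u) (\<rho> v))) (vadd W (br' (\<rho> u) (f v)) (br' (\<rho> u) (g v)))"
        by (rule vadd_shuffle[OF W(1)]) (use B(1) c \<rho> uv in auto)
      finally show ?thesis using B(2,3) c \<rho> uv by simp
    qed
    then show ?thesis using lin f g br by simp
  qed
  moreover have "(\<lambda>s\<in>car V. vscale W c (f s)) \<in> ?F"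
    if f: "f \<in> extensional (car V)" "f \<in> ?F" for c f
  proof -
    have "vscale W c (f (br u v)) = vadd W (br' (vscale W c (f u)) (\<rho> v)) (br' (\<rho> u) (vscale W c (f v)))"
      if uv: "u \<in> car V" "v \<in> car V" for u v
    proof -
      have "lin_map V W f" using f(2) by auto
      then have c: "f u \<in> car W" "f v \<in> car W" using uv by (auto dest: lin_mapD(1))
      have "vscale W c (f (br u v)) = vscale W c (vadd W (br' (f u) (\<rho> v)) (br' (\<rho> u) (f v)))"
        using f(2) uv by simp
      then show ?thesis using B c \<rho> uv D(8) by simp
    qed
    then show ?thesis using lin f br by simp
  qed
  ultimately show ?thesis
    unfolding map_subspace_def using W(1) by (auto simp: lin_map_def Pi_iff)
qed

abbreviation derivation_set :: "('k, 'v) vspace \<Rightarrow> ('v \<Rightarrow> 'v \<Rightarrow> 'v) \<Rightarrow> ('v \<Rightarrow> 'v) set" where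
  "derivation_set V br \<equiv> {D. lin_map V V D \<and>
     (\<forall>u\<in>car V. \<forall>v\<in>car V. D (br u v) = vadd V (br (D u) v) (br u (D v)))}"

abbreviation centroid_set :: "('k, 'v) vspace \<Rightarrow> ('v \<Rightarrow> 'v \<Rightarrow> 'v) \<Rightarrow> ('v \<Rightarrow> 'v) set" where
  "centroid_set V br \<equiv> {f. lin_map V V f \<and> (\<forall>u\<in>car V. \<forall>v\<in>car V. f (br u v) = br u (f v))}"

lemma derivation_set_subspace:
  assumes "is_vspace V" "bilinear_on V br"
  shows "map_subspace (car V) V (derivation_set V br)"
  by (rule derivation_subspace[where \<rho> = "\<lambda>v. v"])
    (use assms is_vspaceD(2,3)[OF assms(1)] bilinear_onD(1)[OF assms(2)] in auto)

lemma centroid_set_subspace: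
  assumes V: "is_vspace V" and br: "bilinear_on V br"
  shows "map_subspace (car V) V (centroid_set V br)"
proof -
  note D = is_vspaceD[OF V] and B = bilinear_onD[OF br]
  note lin = lin_map_subspace[of V V, OF D(2,3) V, simplified map_subspace_def, simplified]
  have "(\<lambda>s\<in>car V. vzero V) \<in> centroid_set V br"
    using lin B(1) bilinear_on_zero(1)[OF V br] by simp
  moreover have "(\<lambda>s\<in>car V. vadd V (f s) (g s)) \<in> centroid_set V br"
    if f: "f \<in> extensional (car V)" "f \<in> centroid_set V br"
      and g: "g \<in> extensional (car V)" "g \<in> centroid_set V br" for f g
    using f g lin B(1,2) lin_mapD(1)[of V V f] lin_mapD(1)[of V V g] by simp
  moreover have "(\<lambda>s\<in>car V. vscale V c (f s)) \<in> centroid_set V br"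
    if f: "f \<in> extensional (car V)" "f \<in> centroid_set V br" for c f
    using f lin B(1,4) lin_mapD(1)[of V V f] by simp
  ultimately show ?thesis
    unfolding map_subspace_def using V by (auto simp: lin_map_def Pi_iff)
qed

lemma lin_map_conj_map:
  assumes V: "is_vspace V" and W: "is_vspace W" and \<psi>: "lin_iso V W \<psi>" and D: "lin_map V V D"
  shows "lin_map W W (conj_map V W \<psi> D)"
proof -
  have "lin_map W W (\<lambda>w. \<psi> (D (inv_into (car V) \<psi> w)))"
    by (intro lin_map_comp[OF lin_map_comp[OF lin_isoD(1)[OF lin_iso_inv[OF V \<psi>]] D] lin_isoD(1)[OF \<psi>]])
  then show ?thesis
    using lin_map_cong[OF is_vspaceD(2,3)[OF W], of "conj_map V W \<psi> D" "\<lambda>w. \<psi> (D (inv_into (car V) \<psi> w))"]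
    by (simp add: conj_map_def)
qed

lemma conj_map_derivation:
  assumes V: "is_vspace V" and W: "is_vspace W" and \<psi>: "lin_iso V W \<psi>"
    and hom: "\<And>u v. u \<in> car V ==> v \<in> car V ==> \<psi> (br u v) = br' (\<psi> u) (\<psi> v)"
    and br: "bilinear_on V br" and br': "bilinear_on W br'"
  shows "D \<in> derivation_set V br ==> conj_map V W \<psi> D \<in> derivation_set W br'"
    "D \<in> centroid_set V br ==> conj_map V W \<psi> D \<in> centroid_set W br'"
proof -
  note \<psi>D = lin_isoD[OF \<psi>]
  let ?i = "inv_into (car V) \<psi>"
  have inv: "?i (br' u v) = br (?i u) (?i v)" if "u \<in> car W" "v \<in> car W" for u v
    using hom[OF \<psi>D(3)[OF that(1)] \<psi>D(3)[OF that(2)]] \<psi>D(4)[OF bilinear_onD(1)[OF br \<psi>D(3)[OF that(1)] \<psi>D(3)[OF that(2)]]]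
    by (simp add: \<psi>D(5) that)
  show "conj_map V W \<psi> D \<in> derivation_set W br'" if D: "D \<in> derivation_set V br"
  proof -
    have lin: "lin_map V V D" using D by blast
    have "conj_map V W \<psi> D (br' u v) = vadd W (br' (conj_map V W \<psi> D u) v) (br' u (conj_map V W \<psi> D v))"
      if uv: "u \<in> car W" "v \<in> car W" for u v
    proof -
      note c = \<psi>D(3)[OF uv(1)] \<psi>D(3)[OF uv(2)]
      have Dc: "D (?i u) \<in> car V" "D (?i v) \<in> car V" using lin_mapD(1)[OF lin] c by auto
      have "D (br (?i u) (?i v)) = vadd V (br (D (?i u)) (?i v)) (br (?i u) (D (?i v)))" using D c by blast
      note Dbr = this
      have "\<psi> (vadd V (br (D (?i u)) (?i v)) (br (?i u) (D (?i v)))) =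
          vadd W (br' (\<psi> (D (?i u))) v) (br' u (\<psi> (D (?i v))))"
        using lin_mapD(2)[OF \<psi>D(1) bilinear_onD(1)[OF br Dc(1) c(2)] bilinear_onD(1)[OF br c(1) Dc(2)]]
          hom[OF Dc(1) c(2)] hom[OF c(1) Dc(2)] by (simp add: \<psi>D(5) uv)
      then show ?thesis
        using Dbr uv bilinear_onD(1)[OF br' uv] by (simp add: conj_map_def inv)
    qed
    then show ?thesis using lin_map_conj_map[OF V W \<psi> lin] by blast
  qed
  show "conj_map V W \<psi> D \<in> centroid_set W br'" if D: "D \<in> centroid_set V br"
  proof -
    have lin: "lin_map V V D" using D by blast
    have "conj_map V W \<psi> D (br' u v) = br' u (conj_map V W \<psi> D v)" if uv: "u \<in> car W" "v \<in> car W" for u v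
    proof -
      note c = \<psi>D(3)[OF uv(1)] \<psi>D(3)[OF uv(2)]
      have "D (?i v) \<in> car V" using lin_mapD(1)[OF lin] c by blast
      moreover have "D (br (?i u) (?i v)) = br (?i u) (D (?i v))" using D c by blast
      ultimately show ?thesis
        using hom[OF c(1)] uv bilinear_onD(1)[OF br' uv] by (simp add: conj_map_def inv \<psi>D(5))
    qed
    then show ?thesis using lin_map_conj_map[OF V W \<psi> lin] by blast
  qed
qed

context lie_bundle
begin

lemma bilinear_kk: "bilinear_on \<kk> brk"
  unfolding bilinear_on_def using brk_linear by blast

lemma triv_inv_bracket:
  assumes t: "(U, \<psi>) \<in> triv L" "x \<in> U"
  shows "inv_into (car (fib L x)) (\<psi> x) (brk u v) =
    brL x (inv_into (car (fib L x)) (\<psi> x) u) (inv_into (car (fib L x)) (\<psi> x) v)"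
  using triv_inv(3)[OF t brL_car[OF triv_inv(1)[OF t, of u] triv_inv(1)[OF t, of v]]]
    triv_bracket[OF t triv_inv(1)[OF t, of u] triv_inv(1)[OF t, of v]] triv_inv(2)[OF t] by simp

text \<open>The bracket of a fiber is given only as an operation preserved by the trivializations;
  its bilinearity is transported from \<kk>.\<close>

lemma bilinear_fib: "bilinear_on (fib L x) (brL x)"
proof -
  obtain U \<psi> where t: "(U, \<psi>) \<in> triv L" "x \<in> U" by (rule ex_triv[OF L_bundle])
  note D = is_vspaceD(2,3)[OF is_vspace_fib, of _ x]
  have eq: "u = v" if "u \<in> car (fib L x)" "v \<in> car (fib L x)" "\<psi> x u = \<psi> x v" for u v
    using triv_inv(4)[OF t that(1,2)] that(3) by blast
  show ?thesis
    unfolding bilinear_on_def lin_map_def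
    by (intro ballI conjI allI funcsetI)
      (auto intro!: eq simp: D brL_car triv_bracket[OF t] triv_linear[OF t]
        bracket_add_left bracket_add_right bracket_scale_left bracket_scale_right)
qed

lemma triv_conj:
  assumes t: "(U, \<psi>) \<in> triv L" "x \<in> U"
  shows "D \<in> derivation_set (fib L x) (brL x) ==> conj_map (fib L x) \<kk> (\<psi> x) D \<in> derivation_set \<kk> brk"
    "D \<in> centroid_set (fib L x) (brL x) ==> conj_map (fib L x) \<kk> (\<psi> x) D \<in> centroid_set \<kk> brk"
    "D' \<in> derivation_set \<kk> brk ==> conj_map \<kk> (fib L x) (inv_into (car (fib L x)) (\<psi> x)) D' \<in> derivation_set (fib L x) (brL x)"
    "D' \<in> centroid_set \<kk> brk ==> conj_map \<kk> (fib L x) (inv_into (car (fib L x)) (\<psi> x)) D' \<in> centroid_set (fib L x) (brL x)"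
  by (rule conj_map_derivation[OF is_vspace_fib is_vspace_kk triv_iso[OF t] triv_bracket[OF t] bilinear_fib bilinear_kk]
      conj_map_derivation[OF is_vspace_kk is_vspace_fib lin_iso_inv[OF is_vspace_fib triv_iso[OF t]]
        triv_inv_bracket[OF t] bilinear_kk bilinear_fib]; assumption)+

lemmas Der_fib_subspace = derivation_set_subspace[OF is_vspace_fib bilinear_fib]
lemmas Cent_fib_subspace = centroid_set_subspace[OF is_vspace_fib bilinear_fib]
lemmas Der_kk_subspace = derivation_set_subspace[OF is_vspace_kk bilinear_kk]
lemmas Cent_kk_subspace = centroid_set_subspace[OF is_vspace_kk bilinear_kk]

lemma Der_vector_bundle: "vector_bundle A (Der_bundle brk L brL)"
  by (rule conj_vector_bundle[OF L_bundle Der_fib_subspace, where G = "derivation_set \<kk> brk"])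
    (use Der_kk_subspace triv_conj in \<open>auto simp: Der_bundle_def derivations_def model_L simp del: kk_simps\<close>)

lemma Cent_vector_bundle: "vector_bundle A (Cent_bundle brk L brL)"
  by (rule conj_vector_bundle[OF L_bundle Cent_fib_subspace, where G = "centroid_set \<kk> brk"])
    (use Cent_kk_subspace triv_conj in \<open>auto simp: Cent_bundle_def centroid_def model_L simp del: kk_simps\<close>)

lemma Der_conj_iso:
  assumes t: "(U, \<psi>) \<in> triv L" "x \<in> U"
  shows "lin_iso (derivations (fib L x) (brL x)) (derivations \<kk> brk) (conj_map (fib L x) \<kk> (\<psi> x))"
    "D \<in> car (derivations \<kk> brk) ==>
      inv_into (car (derivations (fib L x) (brL x))) (conj_map (fib L x) \<kk> (\<psi> x)) D =
        (\<lambda>v\<in>car (fib L x). inv_into (car (fib L x)) (\<psi> x) (D (\<psi> x v)))"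
  unfolding derivations_def
  by (rule lin_iso_conj_map[OF is_vspace_fib triv_iso[OF t] Der_fib_subspace Der_kk_subspace
        triv_conj(1)[OF t] triv_conj(3)[OF t]]; assumption)+

lemma Cent_conj_iso:
  assumes t: "(U, \<psi>) \<in> triv L" "x \<in> U"
  shows "lin_iso (centroid (fib L x) (brL x)) (centroid \<kk> brk) (conj_map (fib L x) \<kk> (\<psi> x))"
    "D \<in> car (centroid \<kk> brk) ==>
      inv_into (car (centroid (fib L x) (brL x))) (conj_map (fib L x) \<kk> (\<psi> x)) D =
        (\<lambda>v\<in>car (fib L x). inv_into (car (fib L x)) (\<psi> x) (D (\<psi> x v)))"
  unfolding centroid_def
  by (rule lin_iso_conj_map[OF is_vspace_fib triv_iso[OF t] Cent_fib_subspace Cent_kk_subspace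
        triv_conj(2)[OF t] triv_conj(4)[OF t]]; assumption)+

lemma x_derivations_subspace:
  "map_subspace \<Gamma> (fib L x) {\<delta>. lin_map (sections A L) (fib L x) \<delta> \<and>
     (\<forall>X\<in>\<Gamma>. \<forall>Y\<in>\<Gamma>. \<delta> (section_bracket brL X Y) = vadd (fib L x) (brL x (\<delta> X) (Y x)) (brL x (X x) (\<delta> Y)))}"
  by (rule derivation_subspace[where \<rho> = "\<lambda>X. X x"])
    (use section_add section_scale section_bracket_closed is_vspace_fib bilinear_fib section_car in auto)

lemma is_vspace_x_derivations: "is_vspace (x_derivations A L brL x)"
  unfolding x_derivations_def by (rule is_vspace_maps[OF x_derivations_subspace])

lemma endomorphism_eq_on_basis:
  assumes "lin_map \<kk> \<kk> f" "lin_map \<kk> \<kk> g" "\<And>s. s \<in> e ` {..<rdim} ==> f s = g s"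
  shows "f = g"
  by (rule endomorphism_eqI[OF fin_dim_kk _ _ _ _ _ _ fin_dim_kk assms(3), where \<epsilon> = \<epsilon> and r = rdim])
    (use assms functional_expand in auto)

end

section \<open>First-order operators in charts\<close>

context lie_bundle
begin

text \<open>Assembled from the derivatives of the real coordinates, as \<kk> carries no norm.
  \<open>partial_derivative_eq_pd\<close> identifies it with the derivative in the definition of the
  order.\<close>

definition pd :: "'m set \<Rightarrow> ('m \<Rightarrow> 'a) \<Rightarrow> ('m \<Rightarrow> 'e \<Rightarrow> 'g) \<Rightarrow> ('m \<Rightarrow> 'e) \<Rightarrow> 'm \<Rightarrow> 'a \<Rightarrow> 'g" where
  "pd U \<phi> \<psi> X x v = (\<Sum>i<rdim. rscl (chart_deriv U \<phi> (\<lambda>y. \<epsilon> i (\<psi> y (X y))) x v) (e i))"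

lemma section_functional_smooth:
  "(U', \<psi>) \<in> triv L ==> X \<in> \<Gamma> ==> real_functional \<kk> l ==> smooth_fun A U' (\<lambda>y. l (\<psi> y (X y)))"
  by (rule smooth_kk_functional[OF triv_open section_smooth]) auto

lemma real_functional_kkD:
  "real_functional \<kk> l ==> l (u + v) = l u + l v" "real_functional \<kk> l ==> l (rscl r u) = r * l u"
  unfolding real_functional_kk by blast+

lemma real_functional_kk_comp: "lin_map \<kk> \<kk> f ==> real_functional \<kk> l ==> real_functional \<kk> (\<lambda>v. l (f v))"
  by (rule real_functional_comp)

lemma lin_map_scl: "lin_map \<kk> \<kk> (scl c)"
  by (auto simp: lin_map_def scale_right_distrib scale_left_commute)

text \<open>Makes \<open>pd\<close> independent of the chosen basis. Through it, each rule for
  \<open>pd\<close> reduces to the rule for real functions.\<close>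

lemma pd_functional:
  assumes c: "(U, \<phi>) \<in> A" and t: "(U', \<psi>) \<in> triv L" and x: "x \<in> U \<inter> U'" and X: "X \<in> \<Gamma>"
    and l: "real_functional \<kk> l"
  shows "l (pd U \<phi> \<psi> X x v) = chart_deriv U \<phi> (\<lambda>y. l (\<psi> y (X y))) x v"
proof -
  note o = triv_open[OF t]
  have s: "smooth_fun A U' (\<lambda>y. \<epsilon> i (\<psi> y (X y)))" if "i < rdim" for i
    by (rule section_functional_smooth[OF t X \<epsilon>_functional[OF that]])
  have "(\<lambda>y. l (\<psi> y (X y))) = (\<lambda>y. \<Sum>i<rdim. \<epsilon> i (\<psi> y (X y)) * l (e i))"
    by (rule ext) (rule functional_expand[OF l])
  then have "chart_deriv U \<phi> (\<lambda>y. l (\<psi> y (X y))) x v =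
      (\<Sum>i<rdim. chart_deriv U \<phi> (\<lambda>y. \<epsilon> i (\<psi> y (X y)) * l (e i)) x v)"
    using chart_deriv_sum[OF c o _ x, of "{..<rdim}" "\<lambda>i y. \<epsilon> i (\<psi> y (X y)) * l (e i)" v]
      smooth_fun_mult[OF o s smooth_fun_const[OF o]] by simp
  also have "\<dots> = (\<Sum>i<rdim. chart_deriv U \<phi> (\<lambda>y. \<epsilon> i (\<psi> y (X y))) x v * l (e i))"
    using chart_deriv_mult[OF c o s smooth_fun_const[OF o] x]
    by (intro sum.cong refl) (simp add: chart_deriv_const)
  also have "\<dots> = l (pd U \<phi> \<psi> X x v)"
    unfolding pd_def by (simp add: real_functional_sum[OF l] real_functional_kkD[OF l])
  finally show ?thesis by simp
qed

lemma pd_eqI: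
  assumes "(U, \<phi>) \<in> A" "(U', \<psi>) \<in> triv L" "x \<in> U \<inter> U'" "X \<in> \<Gamma>"
    and "\<And>l. real_functional \<kk> l ==> chart_deriv U \<phi> (\<lambda>y. l (\<psi> y (X y))) x v = l w"
  shows "pd U \<phi> \<psi> X x v = w"
  by (rule real_functional_eqI) (simp only: pd_functional[OF assms(1-4)] assms(5))

lemma pd_local_functional:
  assumes c: "(U, \<phi>) \<in> A" and V: "open V" "x \<in> V" "x \<in> U"
    and s: "smooth_fun A V f" and eq: "\<And>y. y \<in> V ==> g y = f y"
  shows "chart_deriv U \<phi> g x v = chart_deriv U \<phi> f x v"
  using chart_deriv_cong[OF c V(1) s, of x g] V eq by auto

lemma pd_add:
  assumes c: "(U, \<phi>) \<in> A" and t: "(U', \<psi>) \<in> triv L" and x: "x \<in> U \<inter> U'" and X: "X \<in> \<Gamma>" "Y \<in> \<Gamma>"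
  shows "pd U \<phi> \<psi> (vadd (sections A L) X Y) x v = pd U \<phi> \<psi> X x v + pd U \<phi> \<psi> Y x v"
proof (rule pd_eqI[OF c t x section_add[OF X]])
  fix l assume l: "real_functional \<kk> l"
  note o = triv_open[OF t] and s = section_functional_smooth[OF t X(1) l] section_functional_smooth[OF t X(2) l]
  have "chart_deriv U \<phi> (\<lambda>y. l (\<psi> y (vadd (sections A L) X Y y))) x v =
      chart_deriv U \<phi> (\<lambda>y. l (\<psi> y (X y)) + l (\<psi> y (Y y))) x v"
    by (rule pd_local_functional[OF c o _ _ smooth_fun_add[OF o s]])
      (use x X in \<open>auto simp: sections_simps triv_linear[OF t] section_car real_functional_kkD[OF l]\<close>)
  also have "\<dots> = l (pd U \<phi> \<psi> X x v + pd U \<phi> \<psi> Y x v)"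
    by (simp add: chart_deriv_add[OF c o s x] real_functional_kkD[OF l] pd_functional[OF c t x _ l] X)
  finally show "chart_deriv U \<phi> (\<lambda>y. l (\<psi> y (vadd (sections A L) X Y y))) x v = l (pd U \<phi> \<psi> X x v + pd U \<phi> \<psi> Y x v)" .
qed

lemma pd_scale:
  assumes c: "(U, \<phi>) \<in> A" and t: "(U', \<psi>) \<in> triv L" and x: "x \<in> U \<inter> U'" and X: "X \<in> \<Gamma>"
  shows "pd U \<phi> \<psi> (vscale (sections A L) k X) x v = scl k (pd U \<phi> \<psi> X x v)"
proof (rule pd_eqI[OF c t x section_scale[OF X]])
  fix l assume "real_functional \<kk> l"
  then have l: "real_functional \<kk> (\<lambda>v. l (scl k v))" by (rule real_functional_kk_comp[OF lin_map_scl])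
  have "chart_deriv U \<phi> (\<lambda>y. l (\<psi> y (vscale (sections A L) k X y))) x v =
      chart_deriv U \<phi> (\<lambda>y. l (scl k (\<psi> y (X y)))) x v"
    by (rule pd_local_functional[OF c triv_open[OF t] _ _ section_functional_smooth[OF t X l]])
      (use x X in \<open>auto simp: sections_simps triv_linear[OF t] section_car\<close>)
  then show "chart_deriv U \<phi> (\<lambda>y. l (\<psi> y (vscale (sections A L) k X y))) x v = l (scl k (pd U \<phi> \<psi> X x v))"
    by (simp add: pd_functional[OF c t x X l])
qed

lemma pd_fmul:
  assumes c: "(U, \<phi>) \<in> A" and t: "(U', \<psi>) \<in> triv L" and x: "x \<in> U \<inter> U'" and X: "X \<in> \<Gamma>"
    and f: "smooth_fun A UNIV f"
  shows "pd U \<phi> \<psi> (fmul f X) x v = rscl (f x) (pd U \<phi> \<psi> X x v) + rscl (chart_deriv U \<phi> f x v) (\<psi> x (X x))"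
proof (rule pd_eqI[OF c t x section_fmul[OF f X]])
  fix l assume l: "real_functional \<kk> l"
  note o = triv_open[OF t] and s = section_functional_smooth[OF t X l]
  note f' = smooth_fun_subset[OF f, of U', simplified]
  have "chart_deriv U \<phi> (\<lambda>y. l (\<psi> y (fmul f X y))) x v = chart_deriv U \<phi> (\<lambda>y. f y * l (\<psi> y (X y))) x v"
    by (rule pd_local_functional[OF c o _ _ smooth_fun_mult[OF o f' s]])
      (use x X in \<open>auto simp: triv_fmul[OF t] real_functional_kkD[OF l]\<close>)
  then show "chart_deriv U \<phi> (\<lambda>y. l (\<psi> y (fmul f X y))) x v =
      l (rscl (f x) (pd U \<phi> \<psi> X x v) + rscl (chart_deriv U \<phi> f x v) (\<psi> x (X x)))"
    by (simp add: chart_deriv_mult[OF c o f' s x] real_functional_kkD[OF l] pd_functional[OF c t x X l])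
qed

lemma pd_bracket:
  assumes c: "(U, \<phi>) \<in> A" and t: "(U', \<psi>) \<in> triv L" and x: "x \<in> U \<inter> U'" and X: "X \<in> \<Gamma>" "Y \<in> \<Gamma>"
  shows "pd U \<phi> \<psi> (section_bracket brL X Y) x v =
    brk (pd U \<phi> \<psi> X x v) (\<psi> x (Y x)) + brk (\<psi> x (X x)) (pd U \<phi> \<psi> Y x v)"
proof (rule pd_eqI[OF c t x section_bracket_closed[OF X]])
  fix l assume l: "real_functional \<kk> l"
  note o = triv_open[OF t]
  have li: "real_functional \<kk> (\<lambda>w. l (brk (e i) w))" for i by (rule real_functional_kk_comp[OF brk_linear(1) l])
  have lw: "real_functional \<kk> (\<lambda>u. l (brk u w))" for w by (rule real_functional_kk_comp[OF brk_linear(2) l])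
  \<comment> \<open>Expanding the left factor in the real basis turns the bracket into a sum of
    products of real functions, to which the ordinary product rule applies.\<close>
  have ex: "l (brk u w) = (\<Sum>i<rdim. \<epsilon> i u * l (brk (e i) w))" for u w by (rule functional_expand[OF lw])
  have s1: "smooth_fun A U' (\<lambda>y. \<epsilon> i (\<psi> y (X y)))" if "i < rdim" for i
    by (rule section_functional_smooth[OF t X(1) \<epsilon>_functional[OF that]])
  have s2: "smooth_fun A U' (\<lambda>y. l (brk (e i) (\<psi> y (Y y))))" for i
    by (rule section_functional_smooth[OF t X(2) li])
  have s: "smooth_fun A U' (\<lambda>y. \<epsilon> i (\<psi> y (X y)) * l (brk (e i) (\<psi> y (Y y))))" if "i < rdim" for i
    by (rule smooth_fun_mult[OF o s1[OF that] s2])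
  have "chart_deriv U \<phi> (\<lambda>y. l (\<psi> y (section_bracket brL X Y y))) x v =
      chart_deriv U \<phi> (\<lambda>y. \<Sum>i<rdim. \<epsilon> i (\<psi> y (X y)) * l (brk (e i) (\<psi> y (Y y)))) x v"
    by (rule pd_local_functional[OF c o _ _ smooth_fun_sum[OF o s]])
      (use x X in \<open>auto simp: triv_section_bracket[OF t] ex[symmetric]\<close>)
  also have "\<dots> = (\<Sum>i<rdim. chart_deriv U \<phi> (\<lambda>y. \<epsilon> i (\<psi> y (X y)) * l (brk (e i) (\<psi> y (Y y)))) x v)"
    by (rule chart_deriv_sum[OF c o s x]) simp
  also have "\<dots> = (\<Sum>i<rdim. \<epsilon> i (\<psi> x (X x)) * l (brk (e i) (pd U \<phi> \<psi> Y x v)) +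
      \<epsilon> i (pd U \<phi> \<psi> X x v) * l (brk (e i) (\<psi> x (Y x))))"
    by (intro sum.cong refl)
      (simp add: chart_deriv_mult[OF c o s1 s2 x] pd_functional[OF c t x X(1) \<epsilon>_functional]
        pd_functional[OF c t x X(2) li])
  also have "\<dots> = l (brk (pd U \<phi> \<psi> X x v) (\<psi> x (Y x)) + brk (\<psi> x (X x)) (pd U \<phi> \<psi> Y x v))"
    by (simp add: sum.distrib ex[symmetric] real_functional_kkD[OF l])
  finally show "chart_deriv U \<phi> (\<lambda>y. l (\<psi> y (section_bracket brL X Y y))) x v =
      l (brk (pd U \<phi> \<psi> X x v) (\<psi> x (Y x)) + brk (\<psi> x (X x)) (pd U \<phi> \<psi> Y x v))" .
qed

lemma pd_locally_const:
  assumes c: "(U, \<phi>) \<in> A" and t: "(U', \<psi>) \<in> triv L" and x: "x \<in> U \<inter> U'" and X: "X \<in> \<Gamma>"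
    and V: "open V" "x \<in> V" "\<And>y. y \<in> V ==> \<psi> y (X y) = u"
  shows "pd U \<phi> \<psi> X x v = 0"
proof (rule pd_eqI[OF c t x X])
  fix l assume l: "real_functional \<kk> l"
  have "chart_deriv U \<phi> (\<lambda>y. l (\<psi> y (X y))) x v = chart_deriv U \<phi> (\<lambda>y. l u) x v"
    by (rule pd_local_functional[OF c V(1,2) _ smooth_fun_const[OF V(1)]]) (use x V in auto)
  moreover have "l 0 = 0" using real_functional_kkD(1)[OF l, of 0 0] by simp
  ultimately show "chart_deriv U \<phi> (\<lambda>y. l (\<psi> y (X y))) x v = l 0" by (simp add: chart_deriv_const)
qed

text \<open>Used to pass from partial derivatives along \<open>onb\<close> to those along an
  arbitrary basis.\<close>

lemma pd_linear:
  assumes c: "(U, \<phi>) \<in> A" and t: "(U', \<psi>) \<in> triv L" and x: "x \<in> U \<inter> U'" and X: "X \<in> \<Gamma>"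
  shows "pd U \<phi> \<psi> X x (\<Sum>i\<in>I. r i *\<^sub>R v i) = (\<Sum>i\<in>I. rscl (r i) (pd U \<phi> \<psi> X x (v i)))"
proof (rule pd_eqI[OF c t x X])
  fix l assume l: "real_functional \<kk> l"
  have "linear (chart_deriv U \<phi> (\<lambda>y. l (\<psi> y (X y))) x)"
    by (rule chart_deriv_linear[OF c triv_open[OF t] section_functional_smooth[OF t X l] x])
  then show "chart_deriv U \<phi> (\<lambda>y. l (\<psi> y (X y))) x (\<Sum>i\<in>I. r i *\<^sub>R v i) =
      l (\<Sum>i\<in>I. rscl (r i) (pd U \<phi> \<psi> X x (v i)))"
    by (simp add: linear_sum linear_scale real_functional_sum[OF l] real_functional_kkD[OF l] pd_functional[OF c t x X l])
qed

lemma pd_smooth: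
  assumes c: "(U, \<phi>) \<in> A" and t: "(U', \<psi>) \<in> triv L" and X: "X \<in> \<Gamma>"
  shows "smooth_vec_fun A (U \<inter> U') \<kk> (\<lambda>x. pd U \<phi> \<psi> X x v)"
proof -
  have o: "open (U \<inter> U')" using chart(1)[OF c] triv_open[OF t] by blast
  show ?thesis
    unfolding pd_def
    by (intro smooth_kk_sum smooth_kk_rscl o smooth_vec_fun_const smooth_fun_chart_deriv[OF c o]
        smooth_fun_subset[OF section_functional_smooth[OF t X \<epsilon>_functional]]) auto
qed

text \<open>Real functionals separate points of \<kk>, so the vector described by \<open>THE\<close>
  is unique.\<close>

lemma partial_derivative_eq_pd:
  assumes c: "(U, \<phi>) \<in> A" and t: "(U', \<psi>) \<in> triv L" and x: "x \<in> U \<inter> U'" and X: "X \<in> \<Gamma>"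
  shows "partial_derivative (model L) (local_form U \<phi> \<psi> X) (\<phi> x) v = pd U \<phi> \<psi> X x v"
proof -
  have rd: "l \<in> real_dual \<kk> \<longleftrightarrow> real_functional \<kk> l" for l by (simp add: real_dual_iff extensional_def)
  have d: "((\<lambda>s. l (local_form U \<phi> \<psi> X (\<phi> x + s *\<^sub>R v))) has_real_derivative l (pd U \<phi> \<psi> X x v)) (at 0)"
    if l: "real_functional \<kk> l" for l
  proof -
    let ?f = "\<lambda>p. l (local_form U \<phi> \<psi> X p)" and ?D = "chart_deriv U \<phi> (\<lambda>y. l (\<psi> y (X y))) x"
    have fd: "(?f has_derivative ?D) (at (\<phi> x))"
      using smooth_fun_has_derivative[OF c triv_open[OF t] section_functional_smooth[OF t X l] x]
      by (simp add: local_form_def)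
    have "((\<lambda>s. ?f (\<phi> x + s *\<^sub>R v)) has_derivative (\<lambda>s. ?D (s *\<^sub>R v))) (at 0)"
      by (rule has_derivative_compose[where f = "\<lambda>s. \<phi> x + s *\<^sub>R v" and g = ?f])
        (use fd in \<open>auto intro!: derivative_eq_intros\<close>)
    moreover have "?D (s *\<^sub>R v) = l (pd U \<phi> \<psi> X x v) * s" for s
      using linear_scale[OF has_derivative_linear[OF fd]] by (simp add: pd_functional[OF c t x X l] mult.commute)
    ultimately show ?thesis unfolding has_field_derivative_def by simp
  qed
  show ?thesis
    unfolding partial_derivative_def model_L rd Ball_def kk_simps
  proof (rule the_equality)
    show "pd U \<phi> \<psi> X x v \<in> UNIV \<and> (\<forall>l. real_functional \<kk> l \<longrightarrow>
        ((\<lambda>t. l (local_form U \<phi> \<psi> X (\<phi> x + t *\<^sub>R v))) has_real_derivative l (pd U \<phi> \<psi> X x v)) (at 0))"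
      using d by blast
    fix w assume w: "w \<in> UNIV \<and> (\<forall>l. real_functional \<kk> l \<longrightarrow>
        ((\<lambda>t. l (local_form U \<phi> \<psi> X (\<phi> x + t *\<^sub>R v))) has_real_derivative l w) (at 0))"
    show "w = pd U \<phi> \<psi> X x v"
      by (rule real_functional_eqI) (use w d DERIV_unique in blast)
  qed
qed

subsection \<open>Coefficient space of first-order operators\<close>

text \<open>\<open>None\<close> stands for the term of order 0 and \<open>Some b\<close> for the
  partial derivative in direction \<open>b\<close>.\<close>

definition indices :: "'a option set" where "indices = insert None (Some ` onb)"
definition endos :: "('k, 'g \<Rightarrow> 'g) vspace" where "endos = maps_vspace (car \<kk>) \<kk> {f. lin_map \<kk> \<kk> f}"
definition coeff_set :: "('a option \<Rightarrow> 'g \<Rightarrow> 'g) set" where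
  "coeff_set = {F. F None \<in> derivation_set \<kk> brk \<and> (\<forall>b\<in>onb. F (Some b) \<in> centroid_set \<kk> brk)}"
text \<open>One copy of Der(\<kk>) and one copy of Cent(\<kk>) for each element of
  \<open>onb\<close>: the common model of all spaces of x-derivations.\<close>

definition coeffs :: "('k, 'a option \<Rightarrow> 'g \<Rightarrow> 'g) vspace" where
  "coeffs = maps_vspace indices endos coeff_set"

lemma endos_simps:
  "car endos = {f. lin_map \<kk> \<kk> f}" "vadd endos f g = (\<lambda>u. f u + g u)" "vzero endos = (\<lambda>u. 0)"
  "vscale endos c f = (\<lambda>u. scl c (f u))"
  unfolding endos_def maps_vspace_simps by (simp_all add: restrict_UNIV extensional_UNIV)

lemma endos_subspace: "map_subspace (car \<kk>) \<kk> {f. lin_map \<kk> \<kk> f}"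
  by (rule lin_map_subspace[OF _ _ is_vspace_kk]) simp_all

lemma fin_dim_endos: "fin_dim_vspace endos"
  unfolding endos_def
  by (rule fin_dim_maps[OF endos_subspace fin_dim_kk, where T = "e ` {..<rdim}"])
    (use endomorphism_eq_on_basis in auto)

lemma coeffs_subspace: "map_subspace indices endos coeff_set"
proof -
  have "is_vspace endos" using fin_dim_endos unfolding fin_dim_vspace_def by blast
  moreover note D = Der_kk_subspace[unfolded map_subspace_def] and C = Cent_kk_subspace[unfolded map_subspace_def]
  ultimately show ?thesis
    unfolding map_subspace_def coeff_set_def endos_simps
    by (auto simp: indices_def restrict_UNIV extensional_UNIV)
qed

lemma finite_indices: "finite indices"
  unfolding indices_def by (simp add: onb(1))

lemma fin_dim_coeffs: "fin_dim_vspace coeffs"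
  unfolding coeffs_def
  by (rule fin_dim_maps[OF coeffs_subspace fin_dim_endos finite_indices order.refl])
    (auto intro: extensionalityI)

lemma is_vspace_coeffs: "is_vspace coeffs"
  using fin_dim_coeffs unfolding fin_dim_vspace_def by blast

lemma coeffsD:
  assumes "F \<in> car coeffs"
  shows "F \<in> extensional indices" "lin_map \<kk> \<kk> (F None)" "F None (brk u v) = brk (F None u) v + brk u (F None v)"
    "b \<in> onb ==> lin_map \<kk> \<kk> (F (Some b))" "b \<in> onb ==> F (Some b) (brk u v) = brk u (F (Some b) v)"
  using assms unfolding coeffs_def maps_vspace_simps coeff_set_def by auto

lemma brk_anticommute: "brk u v = - brk v u"
proof -
  have "brk (u + v) (u + v) = brk u v + brk v u"
    by (simp only: bracket_add_left bracket_add_right) (simp add: bracket_self add.commute)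
  then have "brk u v + brk v u = 0" using bracket_self[of "u + v"] by simp
  then show ?thesis by (simp add: eq_neg_iff_add_eq_0)
qed

lemma lin_map_kkD:
  assumes "lin_map \<kk> \<kk> f"
  shows "f (u + v) = f u + f v" "f (scl c u) = scl c (f u)" "f 0 = 0" "f (- u) = - f u"
    "f (\<Sum>i\<in>I. h i) = (\<Sum>i\<in>I. f (h i))"
proof -
  show a: "f (u + v) = f u + f v" for u v using lin_mapD(2)[OF assms, of u v] by simp
  show "f (scl c u) = scl c (f u)" using lin_mapD(3)[OF assms, of u c] by simp
  show z: "f 0 = 0" using a[of 0 0] by simp
  show "f (- u) = - f u" using a[of u "- u"] z by (simp add: eq_neg_iff_add_eq_0 add.commute)
  show "f (\<Sum>i\<in>I. h i) = (\<Sum>i\<in>I. f (h i))" by (induction I rule: infinite_finite_induct) (auto simp: a z)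
qed

text \<open>Anticommutativity moves the defining property of the centroid to the left
  factor.\<close>

lemma coeffs_centroid_left:
  assumes "F \<in> car coeffs" "b \<in> onb"
  shows "F (Some b) (brk u v) = brk (F (Some b) u) v"
  using coeffsD(5)[OF assms, of v u] lin_map_kkD(4)[OF coeffsD(4)[OF assms], of "brk v u"]
    brk_anticommute[of u v] brk_anticommute[of "F (Some b) u" v] by simp

lemma smooth_coeffs:
  assumes N: "open N" and g: "\<And>x. x \<in> N ==> g x \<in> car coeffs"
    and s: "\<And>i u. i \<in> indices ==> smooth_vec_fun A N \<kk> (\<lambda>x. g x i u)"
  shows "smooth_vec_fun A N coeffs g"
  unfolding coeffs_def
proof (rule smooth_vec_fun_maps[OF coeffs_subspace fin_dim_endos finite_indices order.refl _ N])
  show "g x \<in> extensional indices \<inter> coeff_set" if "x \<in> N" for x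
    using g[OF that] by (simp add: coeffs_def maps_vspace_simps)
  fix i assume i: "i \<in> indices"
  show "smooth_vec_fun A N endos (\<lambda>x. g x i)"
    unfolding endos_def
  proof (rule smooth_vec_fun_maps[OF endos_subspace fin_dim_kk, where T = "e ` {..<rdim}"])
    show "g x i \<in> extensional (car \<kk>) \<inter> {f. lin_map \<kk> \<kk> f}" if "x \<in> N" for x
      using coeffsD(2,4)[OF g[OF that]] i by (auto simp: indices_def extensional_UNIV)
  qed (use N s i endomorphism_eq_on_basis in auto)
qed (auto intro: extensionalityI)

lemma smooth_coeffs_eval:
  assumes N: "open N" and g: "smooth_vec_fun A N coeffs g" and i: "i \<in> indices"
  shows "smooth_vec_fun A N \<kk> (\<lambda>x. g x i u)"
proof -
  have "smooth_vec_fun A N endos (\<lambda>x. g x i)"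
    by (rule smooth_vec_fun_eval[OF coeffs_subspace N g[unfolded coeffs_def] i])
  then show ?thesis
    unfolding endos_def by (rule smooth_vec_fun_eval[OF endos_subspace N]) simp
qed

text \<open>The operator at \<open>x\<close> with prescribed coefficients in the charts. Its inverse
  in \<open>F\<close> will trivialize the bundle of derivations.\<close>

definition Phi :: "'m set \<Rightarrow> ('m \<Rightarrow> 'a) \<Rightarrow> ('m \<Rightarrow> 'e \<Rightarrow> 'g) \<Rightarrow> 'm \<Rightarrow> ('a option \<Rightarrow> 'g \<Rightarrow> 'g) \<Rightarrow> ('m \<Rightarrow> 'e) \<Rightarrow> 'e" where
  "Phi U \<phi> \<psi> x F = (\<lambda>X\<in>\<Gamma>. inv_into (car (fib L x)) (\<psi> x)
     (F None (\<psi> x (X x)) + (\<Sum>b\<in>onb. F (Some b) (pd U \<phi> \<psi> X x b))))"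

lemma triv_Phi:
  assumes t: "(U', \<psi>) \<in> triv L" "x \<in> U'" and X: "X \<in> \<Gamma>"
  shows "\<psi> x (Phi U \<phi> \<psi> x F X) = F None (\<psi> x (X x)) + (\<Sum>b\<in>onb. F (Some b) (pd U \<phi> \<psi> X x b))"
    "Phi U \<phi> \<psi> x F X \<in> car (fib L x)"
  using X by (simp_all add: Phi_def triv_inv[OF t])

lemma brk_sum: "brk (\<Sum>i\<in>I. f i) v = (\<Sum>i\<in>I. brk (f i) v)" "brk v (\<Sum>i\<in>I. f i) = (\<Sum>i\<in>I. brk v (f i))"
  using lin_map_kkD(5)[OF brk_linear(2)] lin_map_kkD(5)[OF brk_linear(1)] by blast+

text \<open>A partial derivative of a bracket is a sum of two brackets, and a centroid element can
  be drawn into whichever factor has been differentiated. The term of order 0 is a derivation by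
  itself.\<close>

lemma Phi_derivation:
  assumes c: "(U, \<phi>) \<in> A" and t: "(U', \<psi>) \<in> triv L" and x: "x \<in> U \<inter> U'" and F: "F \<in> car coeffs"
  shows "Phi U \<phi> \<psi> x F \<in> car (x_derivations A L brL x)"
proof -
  have xU: "x \<in> U'" using x by blast
  note T = triv_Phi[OF t xU] and FD = coeffsD[OF F]
  note n = lin_map_kkD[OF FD(2)] and s = lin_map_kkD[OF FD(4)]
  have eq: "u = v" if "u \<in> car (fib L x)" "v \<in> car (fib L x)" "\<psi> x u = \<psi> x v" for u v
    using triv_inv(4)[OF t xU that(1,2)] that(3) by blast
  note D = is_vspaceD(2,3)[OF is_vspace_fib, of _ x]
  have add: "Phi U \<phi> \<psi> x F (vadd (sections A L) X Y) = vadd (fib L x) (Phi U \<phi> \<psi> x F X) (Phi U \<phi> \<psi> x F Y)"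
    if X: "X \<in> \<Gamma>" "Y \<in> \<Gamma>" for X Y
  proof (rule eq)
    show "\<psi> x (Phi U \<phi> \<psi> x F (vadd (sections A L) X Y)) = \<psi> x (vadd (fib L x) (Phi U \<phi> \<psi> x F X) (Phi U \<phi> \<psi> x F Y))"
      using X section_add[OF X] section_car[OF X(1)] section_car[OF X(2)]
      by (simp add: T triv_linear[OF t xU] pd_add[OF c t x X] n s sum.distrib)
        (simp add: sections_simps triv_linear[OF t xU] n)
  qed (use X section_add[OF X] in \<open>auto intro!: D simp: T\<close>)
  have scale: "Phi U \<phi> \<psi> x F (vscale (sections A L) k X) = vscale (fib L x) k (Phi U \<phi> \<psi> x F X)"
    if X: "X \<in> \<Gamma>" for X k
  proof (rule eq)
    show "\<psi> x (Phi U \<phi> \<psi> x F (vscale (sections A L) k X)) = \<psi> x (vscale (fib L x) k (Phi U \<phi> \<psi> x F X))"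
      using X section_scale[OF X] section_car[OF X]
      by (simp add: T triv_linear[OF t xU] pd_scale[OF c t x X] s scale_right_distrib scale_sum_right)
        (simp add: sections_simps triv_linear[OF t xU] n)
  qed (use X section_scale[OF X] in \<open>auto intro!: D simp: T\<close>)
  have br: "Phi U \<phi> \<psi> x F (section_bracket brL X Y) =
      vadd (fib L x) (brL x (Phi U \<phi> \<psi> x F X) (Y x)) (brL x (X x) (Phi U \<phi> \<psi> x F Y))"
    if X: "X \<in> \<Gamma>" "Y \<in> \<Gamma>" for X Y
  proof (rule eq)
    have "F (Some b) (pd U \<phi> \<psi> (section_bracket brL X Y) x b) =
        brk (F (Some b) (pd U \<phi> \<psi> X x b)) (\<psi> x (Y x)) + brk (\<psi> x (X x)) (F (Some b) (pd U \<phi> \<psi> Y x b))"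
      if b: "b \<in> onb" for b
      by (simp only: pd_bracket[OF c t x X] s(1)[OF b]
          coeffs_centroid_left[OF F b, of "pd U \<phi> \<psi> X x b"] FD(5)[OF b, of "\<psi> x (X x)"])
    then show "\<psi> x (Phi U \<phi> \<psi> x F (section_bracket brL X Y)) =
        \<psi> x (vadd (fib L x) (brL x (Phi U \<phi> \<psi> x F X) (Y x)) (brL x (X x) (Phi U \<phi> \<psi> x F Y)))"
      using X section_bracket_closed[OF X] section_car[OF X(1)] section_car[OF X(2)]
      by (simp add: T triv_linear[OF t xU] triv_bracket[OF t xU] brL_car triv_section_bracket[OF t xU] FD(3)
          bracket_add_left bracket_add_right brk_sum sum.distrib)
  qed (use X section_bracket_closed[OF X] section_car in \<open>auto intro!: D brL_car simp: T\<close>)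
  have "Phi U \<phi> \<psi> x F \<in> extensional \<Gamma>" by (simp add: Phi_def)
  then show ?thesis
    unfolding x_derivations_def maps_vspace_simps using add scale br T(2) by (auto simp: lin_map_def)
qed

lemma ex_frame:
  assumes c: "(U, \<phi>) \<in> A" and t: "(U', \<psi>) \<in> triv L" and x: "x \<in> U \<inter> U'" "x \<in> N" and N: "open N"
  obtains E y V where "open V" "x \<in> V" "V \<subseteq> U \<inter> U'" "V \<subseteq> N" "\<And>u. E u \<in> \<Gamma>" "\<And>u z. z \<in> V ==> \<psi> z (E u z) = u"
    "\<And>b. smooth_fun A UNIV (y b)" "\<And>b z. z \<in> V ==> y b z = (\<phi> z - \<phi> x) \<bullet> b"
proof -
  have xU: "x \<in> U" "x \<in> U'" using x by auto
  obtain E V where E: "open V" "x \<in> V" "V \<subseteq> U'" "V \<subseteq> N" "\<And>u. E u \<in> \<Gamma>" "\<And>u y. y \<in> V ==> \<psi> y (E u y) = u"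
    by (rule ex_local_frame[OF t xU(2) x(2) N]) (rule that; assumption)
  obtain y V' where y: "\<And>b. smooth_fun A UNIV (y b)" "open V'" "x \<in> V'" "V' \<subseteq> U"
    "\<And>b z. z \<in> V' ==> y b z = (\<phi> z - \<phi> x) \<bullet> b"
    by (rule ex_global_coordinates[OF c xU(1)]) (rule that; assumption)
  show ?thesis
    by (rule that[of "V \<inter> V'" E y]) (use E y in auto)
qed

text \<open>The test sections: a locally constant one has no derivatives, and its multiple by the
  coordinate \<open>y b\<close> isolates the direction \<open>b\<close>.\<close>

lemma frame_pd:
  assumes c: "(U, \<phi>) \<in> A" and t: "(U', \<psi>) \<in> triv L"
    and E: "open V" "V \<subseteq> U \<inter> U'" "\<And>u. E u \<in> \<Gamma>" "\<And>u z. z \<in> V ==> \<psi> z (E u z) = u"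
    and y: "\<And>b. smooth_fun A UNIV (y b)" "\<And>b z. z \<in> V ==> y b z = (\<phi> z - p) \<bullet> b" and z: "z \<in> V"
  shows "pd U \<phi> \<psi> (E u) z v = 0" "pd U \<phi> \<psi> (fmul (y b) (E u)) z v = rscl (v \<bullet> b) u"
proof -
  have zU: "z \<in> U \<inter> U'" using z E(2) by blast
  show p0: "pd U \<phi> \<psi> (E u) z v = 0"
    by (rule pd_locally_const[OF c t zU E(3) E(1) z E(4)])
  have "chart_deriv U \<phi> (\<lambda>w. (\<phi> w - p) \<bullet> b) z = chart_deriv U \<phi> (y b) z"
    by (rule chart_deriv_cong[OF c E(1) smooth_fun_subset[OF y(1)] _ y(2)]) (use z zU in auto)
  then have "chart_deriv U \<phi> (y b) z v = v \<bullet> b"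
    using chart_deriv_coordinate[OF c, of z p b v] zU by simp
  then show "pd U \<phi> \<psi> (fmul (y b) (E u)) z v = rscl (v \<bullet> b) u"
    by (simp add: pd_fmul[OF c t zU E(3) y(1)] p0 E(4)[OF z])
qed

text \<open>The coordinates are centered at \<open>p\<close>, which may differ from
  \<open>\<phi> z\<close>; hence the term with \<open>y b z\<close>. Keeping one frame while
  \<open>z\<close> moves is what shows the coefficients to be smooth.\<close>

lemma frame_Phi:
  assumes c: "(U, \<phi>) \<in> A" and t: "(U', \<psi>) \<in> triv L"
    and E: "open V" "V \<subseteq> U \<inter> U'" "\<And>u. E u \<in> \<Gamma>" "\<And>u z. z \<in> V ==> \<psi> z (E u z) = u"
    and y: "\<And>b. smooth_fun A UNIV (y b)" "\<And>b z. z \<in> V ==> y b z = (\<phi> z - p) \<bullet> b" and z: "z \<in> V"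
    and F: "F \<in> car coeffs"
  shows "\<psi> z (Phi U \<phi> \<psi> z F (E u)) = F None u"
    "b \<in> onb ==> \<psi> z (Phi U \<phi> \<psi> z F (fmul (y b) (E u))) = rscl (y b z) (F None u) + F (Some b) u"
proof -
  have zU: "z \<in> U'" using z E(2) by blast
  note pd = frame_pd[OF c t E y z] and FD = coeffsD[OF F]
  show "\<psi> z (Phi U \<phi> \<psi> z F (E u)) = F None u"
    unfolding triv_Phi(1)[OF t zU E(3)]
    by (simp add: pd E(4)[OF z] lin_map_kkD(3)[OF FD(4)])
  assume b: "b \<in> onb"
  have "(\<Sum>b'\<in>onb. F (Some b') (rscl (b' \<bullet> b) u)) = (\<Sum>b'\<in>onb. if b' = b then F (Some b) u else 0)"
    by (intro sum.cong refl) (auto simp: onb(2)[OF _ b] lin_map_kkD(3)[OF FD(4)])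
  then have "(\<Sum>b'\<in>onb. F (Some b') (rscl (b' \<bullet> b) u)) = F (Some b) u"
    using b by (simp add: onb(1))
  then show "\<psi> z (Phi U \<phi> \<psi> z F (fmul (y b) (E u))) = rscl (y b z) (F None u) + F (Some b) u"
    unfolding triv_Phi(1)[OF t zU section_fmul[OF y(1) E(3)]]
    by (simp add: pd triv_fmul[OF t zU E(3)] E(4)[OF z] lin_map_kkD(2)[OF FD(2)])
qed

end

section \<open>Derivations at a point are first-order operators\<close>

text \<open>Isolates the one consequence of perfectness or centerfreeness on which the rest is
  built, so that both cases continue together.\<close>

locale vanishing_lie_bundle = lie_bundle A scl brk L brL
  for A :: "('m::t2_space, 'a::fin_dim_inner) atlas"
    and scl :: "'k::real_or_complex \<Rightarrow> 'g::ab_group_add \<Rightarrow> 'g"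
    and brk :: "'g \<Rightarrow> 'g \<Rightarrow> 'g"
    and L :: "('k, 'm, 'e, 'g) vbundle"
    and brL :: "'m \<Rightarrow> 'e \<Rightarrow> 'e \<Rightarrow> 'e" +
  assumes vanish: "\<delta> \<in> car (x_derivations A L brL x) ==> smooth_fun A UNIV f ==> smooth_fun A UNIV g ==>
    f x = 0 ==> g x = 0 ==> X \<in> \<Gamma> ==> \<delta> (fmul (\<lambda>y. f y * g y) X) = vzero (fib L x)"
begin

text \<open>The difference of the sections vanishes near \<open>x\<close>, so it equals
  \<open>g * g\<close> times itself for a cutoff \<open>g\<close> that vanishes at
  \<open>x\<close>.\<close>

lemma x_derivation_local:
  assumes \<delta>: "\<delta> \<in> car (x_derivations A L brL x)" and X: "X \<in> \<Gamma>" "Y \<in> \<Gamma>"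
    and V: "open V" "x \<in> V" "\<And>y. y \<in> V ==> X y = Y y"
  shows "\<delta> X = \<delta> Y"
proof -
  let ?m = "vscale (sections A L) (- 1) Y"
  define Z where "Z = vadd (sections A L) X ?m"
  have m: "?m \<in> \<Gamma>" by (rule section_scale[OF X(2)])
  have Z: "Z \<in> \<Gamma>" unfolding Z_def by (rule section_add[OF X(1) m])
  obtain g where g: "smooth_fun A UNIV g" "g x = 0" "\<And>y. y \<notin> V ==> g y = 1"
    by (rule ex_cutoff[OF V(1,2)]) (rule that; assumption)
  have "fmul (\<lambda>y. g y * g y) Z = Z"
  proof (rule section_eqI[OF section_fmul[OF smooth_fun_mult[OF open_UNIV g(1,1)] Z] Z])
    fix y U \<psi> assume t: "(U, \<psi>) \<in> triv L" "y \<in> U"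
    have "\<psi> y (Z y) = 0" if "y \<in> V"
      using V(3)[OF that] section_car[OF X(2), of y] section_car[OF m, of y]
      by (simp add: Z_def sections_simps triv_linear[OF t])
    then show "\<psi> y (fmul (\<lambda>y. g y * g y) Z y) = \<psi> y (Z y)"
      using g(3)[of y] by (cases "y \<in> V") (simp_all add: triv_fmul[OF t Z])
  qed
  then have "\<delta> Z = vzero (fib L x)" using vanish[OF \<delta> g(1,1,2,2) Z] by simp
  then have eq: "vadd (fib L x) (\<delta> X) (vscale (fib L x) (- 1) (\<delta> Y)) = vzero (fib L x)"
    unfolding Z_def x_derivationD(2)[OF \<delta> X(1) m] x_derivationD(3)[OF \<delta> X(2)] .
  show ?thesis
  proof (rule fib_eqI[OF x_derivationD(1)[OF \<delta> X(1)] x_derivationD(1)[OF \<delta> X(2)]])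
    fix U \<psi> assume t: "(U, \<psi>) \<in> triv L" "x \<in> U"
    from arg_cong[OF eq, of "\<psi> x"] show "\<psi> x (\<delta> X) = \<psi> x (\<delta> Y)"
      using x_derivationD(1)[OF \<delta> X(1)] x_derivationD(1)[OF \<delta> X(2)] is_vspaceD(3)[OF is_vspace_fib]
      by (simp add: triv_linear[OF t])
  qed
qed

lemma section_eq_of_triv:
  assumes "(U, \<psi>) \<in> triv L" "y \<in> U" "X \<in> \<Gamma>" "Y \<in> \<Gamma>" "\<psi> y (X y) = \<psi> y (Y y)"
  shows "X y = Y y"
  using triv_inv(4)[OF assms(1,2) section_car[OF assms(3)] section_car[OF assms(4)]] assms(5) by blast

text \<open>Near \<open>x\<close> a section is a combination of the constant sections
  \<open>E (e i)\<close> with real coefficient functions. For fixed \<open>i\<close>, applying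
  \<open>\<delta>\<close> to \<open>f\<close> times \<open>E (e i)\<close> gives a functional of
  \<open>f\<close> of the kind treated by \<open>first_order_functional\<close>.\<close>

lemma x_derivation_frame_expand:
  assumes c: "(U, \<phi>) \<in> A" and t: "(U', \<psi>) \<in> triv L" and x: "x \<in> U \<inter> U'"
    and \<delta>: "\<delta> \<in> car (x_derivations A L brL x)"
    and E: "open V" "x \<in> V" "V \<subseteq> U \<inter> U'" "\<And>u. E u \<in> \<Gamma>" "\<And>u z. z \<in> V ==> \<psi> z (E u z) = u"
    and y: "\<And>b. smooth_fun A UNIV (y b)" "\<And>b z. z \<in> V ==> y b z = (\<phi> z - \<phi> x) \<bullet> b"
    and X: "X \<in> \<Gamma>" and l: "real_functional \<kk> l"
  shows "l (\<psi> x (\<delta> X)) = (\<Sum>i<rdim. \<epsilon> i (\<psi> x (X x)) * l (\<psi> x (\<delta> (E (e i)))) +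
      (\<Sum>b\<in>onb. chart_deriv U \<phi> (\<lambda>z. \<epsilon> i (\<psi> z (X z))) x b * l (\<psi> x (\<delta> (fmul (y b) (E (e i)))))))"
proof -
  have xU: "x \<in> U" "x \<in> U'" using x by auto
  note o = triv_open[OF t] and \<delta>D = x_derivationD[OF \<delta>] and tl = triv_linear[OF t xU(2)]
  define \<theta> where "\<theta> i f = l (\<psi> x (\<delta> (fmul f (E (e i)))))" for i f
  have fc: "fmul f (E u) \<in> \<Gamma>" if "smooth_fun A UNIV f" for f u by (rule section_fmul[OF that E(4)])
  have \<theta>: "\<theta> i f = f x * \<theta> i (\<lambda>_. 1) + (\<Sum>b\<in>onb. chart_deriv U \<phi> f x b * \<theta> i (y b))"
    if f: "smooth_fun A UNIV f" for i f
  proof (rule first_order_functional[OF _ _ _ c xU(1) y(1) E(1,2) _ y(2) f])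
    show "V \<subseteq> U" using E(3) by blast
    fix f g :: "'m \<Rightarrow> real" assume f: "smooth_fun A UNIV f"
    show "\<theta> i (\<lambda>y. r * f y) = r * \<theta> i f" for r
    proof -
      have "fmul (\<lambda>y. r * f y) (E (e i)) = vscale (sections A L) (of_real r) (fmul f (E (e i)))"
        unfolding fmul_def sections_simps using is_vspaceD(10)[OF is_vspace_fib section_car[OF E(4)]] by simp
      then show ?thesis
        unfolding \<theta>_def by (simp add: \<delta>D(3)[OF fc[OF f]] tl \<delta>D(1)[OF fc[OF f]] real_functional_kkD[OF l])
    qed
    assume g: "smooth_fun A UNIV g"
    show "\<theta> i (\<lambda>y. f y + g y) = \<theta> i f + \<theta> i g"
    proof -
      have "fmul (\<lambda>y. f y + g y) (E (e i)) = vadd (sections A L) (fmul f (E (e i))) (fmul g (E (e i)))"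
        unfolding fmul_def sections_simps using is_vspaceD(9)[OF is_vspace_fib section_car[OF E(4)]] by simp
      then show ?thesis
        unfolding \<theta>_def
        by (simp add: \<delta>D(2)[OF fc[OF f] fc[OF g]] tl \<delta>D(1)[OF fc[OF f]] \<delta>D(1)[OF fc[OF g]] real_functional_kkD[OF l])
    qed
    assume "f x = 0" "g x = 0"
    then have "\<delta> (fmul (\<lambda>y. f y * g y) (E (e i))) = vzero (fib L x)" by (intro vanish[OF \<delta> f g] E(4))
    then show "\<theta> i (\<lambda>y. f y * g y) = 0"
      unfolding \<theta>_def using real_functional_kkD(1)[OF l, of 0 0] by (simp add: tl)
  qed
  have s: "smooth_fun A U' (\<lambda>z. \<epsilon> i (\<psi> z (X z)))" if "i < rdim" for i
    by (rule section_functional_smooth[OF t X \<epsilon>_functional[OF that]])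
  \<comment> \<open>The coefficient functions of \<open>X\<close> exist only over \<open>U'\<close>;
    \<open>\<delta>\<close> needs global functions with the same germs at \<open>x\<close>.\<close>
  have "\<exists>f W. smooth_fun A UNIV f \<and> open W \<and> x \<in> W \<and> W \<subseteq> U' \<and> (\<forall>z\<in>W. f z = \<epsilon> i (\<psi> z (X z)))"
    if i: "i < rdim" for i
  proof -
    obtain f W where "smooth_fun A UNIV f" "open W" "x \<in> W" "W \<subseteq> U'" "\<And>z. z \<in> W ==> f z = \<epsilon> i (\<psi> z (X z))"
      by (rule smooth_fun_extend[OF o xU(2) s[OF i]]) (rule that; assumption)
    then show ?thesis by blast
  qed
  then obtain f W where f: "\<And>i. i < rdim ==> smooth_fun A UNIV (f i)" "\<And>i. i < rdim ==> open (W i)"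
    "\<And>i. i < rdim ==> x \<in> W i" "\<And>i z. i < rdim ==> z \<in> W i ==> f i z = \<epsilon> i (\<psi> z (X z))"
    by metis
  define N where "N = V \<inter> (\<Inter>i<rdim. W i)"
  have N: "open N" "x \<in> N" "N \<subseteq> V" unfolding N_def using E(1,2) f(2,3) by auto
  have fN: "f i z = \<epsilon> i (\<psi> z (X z))" if "i < rdim" "z \<in> N" for i z
    using f(4)[OF that(1)] that unfolding N_def by auto
  \<comment> \<open>The combination is built term by term, adding one summand and using additivity
    of \<open>\<delta>\<close> at each stage.\<close>
  have "\<exists>S\<in>\<Gamma>. (\<forall>z\<in>N. \<psi> z (S z) = (\<Sum>i<n. rscl (f i z) (e i))) \<and> l (\<psi> x (\<delta> S)) = (\<Sum>i<n. \<theta> i (f i))"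
    if "n \<le> rdim" for n
    using that
  proof (induction n)
    case 0
    have "\<delta> (vscale (sections A L) 0 (vzero (sections A L))) = vscale (fib L x) 0 (\<delta> (vzero (sections A L)))"
      by (rule \<delta>D(3)[OF section_zero])
    moreover have "vscale (sections A L) 0 (vzero (sections A L)) = vzero (sections A L)"
      unfolding sections_simps using vscale_zero[OF is_vspace_fib] by simp
    ultimately have "\<delta> (vzero (sections A L)) = vzero (fib L x)"
      using vscale_0[OF is_vspace_fib \<delta>D(1)[OF section_zero]] by simp
    moreover have "\<psi> z (vzero (sections A L) z) = 0" if "z \<in> N" for z
      using triv_linear(3)[OF t, of z] that N(3) E(3) by (auto simp: sections_simps)
    ultimately show ?case
      using section_zero real_functional_kkD(1)[OF l, of 0 0] by (intro bexI[OF _ section_zero]) (auto simp: tl)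
  next
    case (Suc n)
    then obtain S where S: "S \<in> \<Gamma>" "\<forall>z\<in>N. \<psi> z (S z) = (\<Sum>i<n. rscl (f i z) (e i))"
      "l (\<psi> x (\<delta> S)) = (\<Sum>i<n. \<theta> i (f i))" by auto
    have n: "n < rdim" using Suc by simp
    let ?T = "fmul (f n) (E (e n))"
    have T: "?T \<in> \<Gamma>" by (rule fc[OF f(1)[OF n]])
    have "\<psi> z (vadd (sections A L) S ?T z) = (\<Sum>i<Suc n. rscl (f i z) (e i))" if z: "z \<in> N" for z
    proof -
      have zU: "z \<in> U'" "z \<in> V" using z N(3) E(3) by auto
      show ?thesis
        using S(2) z section_car[OF S(1), of z] section_car[OF T, of z]
        by (simp add: sections_simps triv_linear[OF t zU(1)] triv_fmul[OF t zU(1) E(4)] E(5)[OF zU(2)])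
    qed
    moreover have "l (\<psi> x (\<delta> (vadd (sections A L) S ?T))) = (\<Sum>i<Suc n. \<theta> i (f i))"
      using S(3) \<delta>D(1)[OF S(1)] \<delta>D(1)[OF T]
      by (simp add: \<delta>D(2)[OF S(1) T] tl real_functional_kkD[OF l] \<theta>_def)
    ultimately show ?case by (intro bexI[OF _ section_add[OF S(1) T]]) blast
  qed
  from this[OF order.refl] obtain S where S: "S \<in> \<Gamma>" "\<forall>z\<in>N. \<psi> z (S z) = (\<Sum>i<rdim. rscl (f i z) (e i))"
    "l (\<psi> x (\<delta> S)) = (\<Sum>i<rdim. \<theta> i (f i))" by blast
  have "X z = S z" if z: "z \<in> N" for z
  proof (rule section_eq_of_triv[OF t _ X S(1)])
    show "z \<in> U'" using z N(3) E(3) by blast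
    have "\<psi> z (S z) = (\<Sum>i<rdim. rscl (\<epsilon> i (\<psi> z (X z))) (e i))" using S(2) z fN by simp
    then show "\<psi> z (X z) = \<psi> z (S z)" using expand[of "\<psi> z (X z)"] by simp
  qed
  then have "\<delta> X = \<delta> S" by (rule x_derivation_local[OF \<delta> X S(1) N(1,2)])
  moreover have "\<theta> i (f i) = \<epsilon> i (\<psi> x (X x)) * l (\<psi> x (\<delta> (E (e i)))) +
      (\<Sum>b\<in>onb. chart_deriv U \<phi> (\<lambda>z. \<epsilon> i (\<psi> z (X z))) x b * l (\<psi> x (\<delta> (fmul (y b) (E (e i))))))" if i: "i < rdim" for i
  proof -
    have "fmul (\<lambda>_. 1) (E (e i)) = E (e i)"
      unfolding fmul_def using is_vspaceD(11)[OF is_vspace_fib section_car[OF E(4)]] by simp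
    moreover have "chart_deriv U \<phi> (\<lambda>z. \<epsilon> i (\<psi> z (X z))) x v = chart_deriv U \<phi> (f i) x v" for v
      by (rule pd_local_functional[OF c N(1,2) xU(1) smooth_fun_subset[OF f(1)[OF i]]]) (use fN[OF i] in auto)
    ultimately show ?thesis
      using \<theta>[OF f(1)[OF i], of i] fN[OF i N(2)] unfolding \<theta>_def by simp
  qed
  ultimately show ?thesis using S(3) by simp
qed

lemma Phi_surj:
  assumes c: "(U, \<phi>) \<in> A" and t: "(U', \<psi>) \<in> triv L" and x: "x \<in> U \<inter> U'"
    and \<delta>: "\<delta> \<in> car (x_derivations A L brL x)"
  shows "\<exists>F\<in>car coeffs. Phi U \<phi> \<psi> x F = \<delta>"
proof -
  have xU: "x \<in> U" "x \<in> U'" using x by auto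
  note \<delta>D = x_derivationD[OF \<delta>] and tl = triv_linear[OF t xU(2)]
  obtain E y V where E: "open V" "x \<in> V" "V \<subseteq> U \<inter> U'" "V \<subseteq> UNIV" "\<And>u. E u \<in> \<Gamma>" "\<And>u z. z \<in> V ==> \<psi> z (E u z) = u"
    and y: "\<And>b. smooth_fun A UNIV (y b)" "\<And>b z. z \<in> V ==> y b z = (\<phi> z - \<phi> x) \<bullet> b"
    by (rule ex_frame[OF c t x UNIV_I open_UNIV]) (rule that; assumption)
  have VU: "z \<in> U'" if "z \<in> V" for z using that E(3) by blast
  have yx: "y b x = 0" for b using y(2)[OF E(2)] by simp
  have fE: "fmul (y b) (E u) \<in> \<Gamma>" for b u by (rule section_fmul[OF y(1) E(5)])
  \<comment> \<open>The frame respects sums, multiples and brackets only on \<open>V\<close>.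
    Locality turns such identities on \<open>V\<close> into identities between values of
    \<open>\<delta>\<close>.\<close>
  have loc: "\<delta> X = \<delta> Y" if "X \<in> \<Gamma>" "Y \<in> \<Gamma>" "\<And>z. z \<in> V ==> \<psi> z (X z) = \<psi> z (Y z)" for X Y
    by (rule x_derivation_local[OF \<delta> that(1,2) E(1,2)]) (rule section_eq_of_triv[OF t VU that(1,2) that(3)])
  \<comment> \<open>The coefficients are the values of \<open>\<delta>\<close> on constant sections
    and on their multiples by the coordinates centered at \<open>x\<close>.\<close>
  define F where "F = (\<lambda>i\<in>indices. \<lambda>u. \<psi> x (\<delta> (case i of None \<Rightarrow> E u | Some b \<Rightarrow> fmul (y b) (E u))))"
  have FN: "F None u = \<psi> x (\<delta> (E u))" for u by (simp add: F_def indices_def)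
  have FS: "F (Some b) u = \<psi> x (\<delta> (fmul (y b) (E u)))" if "b \<in> onb" for b u using that by (simp add: F_def indices_def)
  note ev = sections_simps triv_linear[OF t VU] section_car E(5,6) fE triv_fmul[OF t VU]
    triv_section_bracket[OF t VU] section_add section_scale section_bracket_closed
  have "lin_map \<kk> \<kk> (F None)"
    unfolding lin_map_def kk_simps
  proof (intro conjI ballI allI)
    show "F None (u + v) = F None u + F None v" for u v
    proof -
      have "\<delta> (E (u + v)) = \<delta> (vadd (sections A L) (E u) (E v))"
        by (rule loc[OF E(5) section_add[OF E(5,5)]]) (simp add: ev)
      then show ?thesis by (simp add: FN \<delta>D(2)[OF E(5,5)] tl \<delta>D(1)[OF E(5)])
    qed
    show "F None (scl k v) = scl k (F None v)" for k v
    proof -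
      have "\<delta> (E (scl k v)) = \<delta> (vscale (sections A L) k (E v))"
        by (rule loc[OF E(5) section_scale[OF E(5)]]) (simp add: ev)
      then show ?thesis by (simp add: FN \<delta>D(3)[OF E(5)] tl \<delta>D(1)[OF E(5)])
    qed
  qed simp
  moreover have "F None (brk u v) = brk (F None u) v + brk u (F None v)" for u v
  proof -
    have "\<delta> (E (brk u v)) = \<delta> (section_bracket brL (E u) (E v))"
      by (rule loc[OF E(5) section_bracket_closed[OF E(5,5)]]) (simp add: ev)
    then show ?thesis
      by (simp add: FN \<delta>D(4)[OF E(5,5)] tl \<delta>D(1)[OF E(5)] brL_car section_car[OF E(5)] triv_bracket[OF t xU(2)] E(6)[OF E(2)])
  qed
  moreover have "lin_map \<kk> \<kk> (F (Some b))" if b: "b \<in> onb" for b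
    unfolding lin_map_def kk_simps
  proof (intro conjI ballI allI)
    show "F (Some b) (u + v) = F (Some b) u + F (Some b) v" for u v
    proof -
      have "\<delta> (fmul (y b) (E (u + v))) = \<delta> (vadd (sections A L) (fmul (y b) (E u)) (fmul (y b) (E v)))"
        by (rule loc[OF fE section_add[OF fE fE]])
          (simp add: ev scale_right_distrib section_car[OF fE])
      then show ?thesis by (simp add: FS[OF b] \<delta>D(2)[OF fE fE] tl \<delta>D(1)[OF fE])
    qed
    show "F (Some b) (scl k v) = scl k (F (Some b) v)" for k v
    proof -
      have "\<delta> (fmul (y b) (E (scl k v))) = \<delta> (vscale (sections A L) k (fmul (y b) (E v)))"
        by (rule loc[OF fE section_scale[OF fE]])
          (simp add: ev scale_left_commute section_car[OF fE])
      then show ?thesis by (simp add: FS[OF b] \<delta>D(3)[OF fE] tl \<delta>D(1)[OF fE])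
    qed
  qed simp
  \<comment> \<open>Putting the factor \<open>y b\<close> on the second entry of the bracket leaves
    one term of the product rule: the other one contains the value of that entry at
    \<open>x\<close>, which is zero.\<close>
  moreover have "F (Some b) (brk u v) = brk u (F (Some b) v)" if b: "b \<in> onb" for b u v
  proof -
    have "\<delta> (fmul (y b) (E (brk u v))) = \<delta> (section_bracket brL (E u) (fmul (y b) (E v)))"
      by (rule loc[OF fE section_bracket_closed[OF E(5) fE]]) (simp add: ev bracket_scale_right)
    moreover have "fmul (y b) (E v) x = vzero (fib L x)" by (rule fmul_at_zero[where f = "y b" and x = x, OF E(5) yx])
    ultimately show ?thesis
      by (simp add: FS[OF b] \<delta>D(4)[OF E(5) fE] tl \<delta>D(1)[OF E(5)] \<delta>D(1)[OF fE] brL_car section_car[OF E(5)]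
          triv_bracket[OF t xU(2)] E(6)[OF E(2)] brL_zero is_vspaceD(1)[OF is_vspace_fib])
  qed
  moreover have "F \<in> extensional indices" by (simp add: F_def)
  ultimately have F: "F \<in> car coeffs" unfolding coeffs_def maps_vspace_simps coeff_set_def by simp
  have "Phi U \<phi> \<psi> x F X = \<delta> X" if X: "X \<in> \<Gamma>" for X
  proof -
    have "\<psi> x (Phi U \<phi> \<psi> x F X) = \<psi> x (\<delta> X)"
    proof (rule real_functional_eqI)
      fix l assume l: "real_functional \<kk> l"
      note lF = real_functional_kk_comp[OF coeffsD(2)[OF F] l] real_functional_kk_comp[OF coeffsD(4)[OF F] l]
      have "l (\<psi> x (Phi U \<phi> \<psi> x F X)) = l (F None (\<psi> x (X x))) + (\<Sum>b\<in>onb. l (F (Some b) (pd U \<phi> \<psi> X x b)))"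
        by (simp add: triv_Phi(1)[OF t xU(2) X] real_functional_kkD[OF l] real_functional_sum[OF l])
      also have "l (F None (\<psi> x (X x))) = (\<Sum>i<rdim. \<epsilon> i (\<psi> x (X x)) * l (F None (e i)))"
        by (rule functional_expand[OF lF(1)])
      also have "(\<Sum>b\<in>onb. l (F (Some b) (pd U \<phi> \<psi> X x b))) =
          (\<Sum>b\<in>onb. \<Sum>i<rdim. \<epsilon> i (pd U \<phi> \<psi> X x b) * l (F (Some b) (e i)))"
        by (intro sum.cong refl functional_expand[OF lF(2)])
      also have "\<dots> = (\<Sum>i<rdim. \<Sum>b\<in>onb. \<epsilon> i (pd U \<phi> \<psi> X x b) * l (F (Some b) (e i)))"
        by (rule sum.swap)
      also have "(\<Sum>i<rdim. \<epsilon> i (\<psi> x (X x)) * l (F None (e i))) +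
          (\<Sum>i<rdim. \<Sum>b\<in>onb. \<epsilon> i (pd U \<phi> \<psi> X x b) * l (F (Some b) (e i))) =
        (\<Sum>i<rdim. \<epsilon> i (\<psi> x (X x)) * l (\<psi> x (\<delta> (E (e i)))) +
          (\<Sum>b\<in>onb. chart_deriv U \<phi> (\<lambda>z. \<epsilon> i (\<psi> z (X z))) x b * l (\<psi> x (\<delta> (fmul (y b) (E (e i)))))))"
        by (simp add: sum.distrib FN FS pd_functional[OF c t x X \<epsilon>_functional])
      also have "\<dots> = l (\<psi> x (\<delta> X))"
        by (rule x_derivation_frame_expand[OF c t x \<delta> E(1,2,3,5) _ y(1) _ X l, symmetric])
          ((rule E(6) y(2))?; assumption)+
      finally show "l (\<psi> x (Phi U \<phi> \<psi> x F X)) = l (\<psi> x (\<delta> X))" .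
    qed
    then show ?thesis using triv_inv(4)[OF t xU(2) triv_Phi(2)[OF t xU(2) X] \<delta>D(1)[OF X]] by blast
  qed
  then have "Phi U \<phi> \<psi> x F = \<delta>"
    by (intro extensionalityI[of _ \<Gamma>]) (use \<delta>D(5) in \<open>auto simp: Phi_def\<close>)
  then show ?thesis using F by blast
qed

text \<open>Injectivity comes from the test sections: constant ones return \<open>F None\<close>,
  and since \<open>y b x = 0\<close> their multiples by \<open>y b\<close> return
  \<open>F (Some b)\<close>.\<close>

lemma Phi_iso:
  assumes c: "(U, \<phi>) \<in> A" and t: "(U', \<psi>) \<in> triv L" and x: "x \<in> U \<inter> U'"
  shows "lin_iso coeffs (x_derivations A L brL x) (Phi U \<phi> \<psi> x)"
proof -
  have xU: "x \<in> U" "x \<in> U'" using x by auto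
  note tl = triv_linear[OF t xU(2)] and T = triv_Phi[OF t xU(2)]
  have ext: "Phi U \<phi> \<psi> x F \<in> extensional \<Gamma>" for F by (simp add: Phi_def)
  obtain E y V where E: "open V" "x \<in> V" "V \<subseteq> U \<inter> U'" "V \<subseteq> UNIV" "\<And>u. E u \<in> \<Gamma>" "\<And>u z. z \<in> V ==> \<psi> z (E u z) = u"
    and y: "\<And>b. smooth_fun A UNIV (y b)" "\<And>b z. z \<in> V ==> y b z = (\<phi> z - \<phi> x) \<bullet> b"
    by (rule ex_frame[OF c t x UNIV_I open_UNIV]) (rule that; assumption)
  have "lin_map coeffs (x_derivations A L brL x) (Phi U \<phi> \<psi> x)"
    unfolding lin_map_def
  proof (intro conjI ballI allI funcsetI)
    show "Phi U \<phi> \<psi> x F \<in> car (x_derivations A L brL x)" if "F \<in> car coeffs" for F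
      by (rule Phi_derivation[OF c t x that])
    fix F assume F: "F \<in> car coeffs"
    have co: "vadd coeffs F G i u = F i u + G i u" "vscale coeffs k F i u = scl k (F i u)" if "i \<in> indices" for G i u k
      using that by (simp_all add: coeffs_def maps_vspace_simps endos_simps)
    have ind: "None \<in> indices" "b \<in> onb ==> Some b \<in> indices" for b by (auto simp: indices_def)
    show "Phi U \<phi> \<psi> x (vscale coeffs k F) = vscale (x_derivations A L brL x) k (Phi U \<phi> \<psi> x F)" for k
    proof (rule extensionalityI[OF ext])
      show "vscale (x_derivations A L brL x) k (Phi U \<phi> \<psi> x F) \<in> extensional \<Gamma>"
        by (simp add: x_derivations_def maps_vspace_simps)
      fix X assume X: "X \<in> \<Gamma>"
      have "\<psi> x (Phi U \<phi> \<psi> x (vscale coeffs k F) X) = \<psi> x (vscale (fib L x) k (Phi U \<phi> \<psi> x F X))"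
        using X by (simp add: T tl co ind scale_right_distrib scale_sum_right)
      then show "Phi U \<phi> \<psi> x (vscale coeffs k F) X = vscale (x_derivations A L brL x) k (Phi U \<phi> \<psi> x F) X"
        using triv_inv(4)[OF t xU(2) T(2)[OF X] is_vspaceD(3)[OF is_vspace_fib T(2)[OF X]]] X
        by (simp add: x_derivations_def maps_vspace_simps)
    qed
    fix G assume G: "G \<in> car coeffs"
    show "Phi U \<phi> \<psi> x (vadd coeffs F G) = vadd (x_derivations A L brL x) (Phi U \<phi> \<psi> x F) (Phi U \<phi> \<psi> x G)"
    proof (rule extensionalityI[OF ext])
      show "vadd (x_derivations A L brL x) (Phi U \<phi> \<psi> x F) (Phi U \<phi> \<psi> x G) \<in> extensional \<Gamma>"
        by (simp add: x_derivations_def maps_vspace_simps)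
      fix X assume X: "X \<in> \<Gamma>"
      have "\<psi> x (Phi U \<phi> \<psi> x (vadd coeffs F G) X) = \<psi> x (vadd (fib L x) (Phi U \<phi> \<psi> x F X) (Phi U \<phi> \<psi> x G X))"
        using X by (simp add: T tl co ind sum.distrib)
      then show "Phi U \<phi> \<psi> x (vadd coeffs F G) X = vadd (x_derivations A L brL x) (Phi U \<phi> \<psi> x F) (Phi U \<phi> \<psi> x G) X"
        using triv_inv(4)[OF t xU(2) T(2)[OF X] is_vspaceD(2)[OF is_vspace_fib T(2)[OF X] T(2)[OF X]]] X
        by (simp add: x_derivations_def maps_vspace_simps)
    qed
  qed
  moreover have "inj_on (Phi U \<phi> \<psi> x) (car coeffs)"
  proof (rule inj_onI)
    fix F G assume FG: "F \<in> car coeffs" "G \<in> car coeffs" "Phi U \<phi> \<psi> x F = Phi U \<phi> \<psi> x G"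
    have fr: "\<psi> x (Phi U \<phi> \<psi> x H (E u)) = H None u"
      "b \<in> onb ==> \<psi> x (Phi U \<phi> \<psi> x H (fmul (y b) (E u))) = rscl (y b x) (H None u) + H (Some b) u"
      if "H \<in> car coeffs" for H b u
      by (rule frame_Phi[OF c t E(1,3,5) _ y(1) _ E(2) that]; (rule E(6) y(2))?; assumption)+
    have yx: "y b x = 0" for b using y(2)[OF E(2)] by simp
    show "F = G"
    proof (rule extensionalityI[OF coeffsD(1)[OF FG(1)] coeffsD(1)[OF FG(2)]])
      fix i assume i: "i \<in> indices"
      show "F i = G i"
      proof
        fix u
        show "F i u = G i u"
        proof (cases i)
          case None
          then show ?thesis using fr(1)[OF FG(1), of u] fr(1)[OF FG(2), of u] FG(3) by simp
        next
          case (Some b)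
          then have "b \<in> onb" using i by (auto simp: indices_def)
          then show ?thesis using fr(2)[OF FG(1), of b u] fr(2)[OF FG(2), of b u] FG(3) Some by (simp add: yx)
        qed
      qed
    qed
  qed
  moreover have "Phi U \<phi> \<psi> x ` car coeffs = car (x_derivations A L brL x)"
    using Phi_surj[OF c t x] Phi_derivation[OF c t x] by (auto 4 3)
  ultimately show ?thesis unfolding lin_iso_def bij_betw_def by blast
qed

lemma linear_scl_iff: "Vector_Spaces.linear scl scl f \<longleftrightarrow> lin_map \<kk> \<kk> f"
  unfolding Vector_Spaces.linear_def module_hom_def module_hom_axioms_def lin_map_def
  using vector_space_axioms module_axioms by auto

lemma x_derivation_order_at_most_one:
  assumes \<delta>: "\<delta> \<in> car (x_derivations A L brL x)"
  shows "order_at_most_one A scl L x \<delta>"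
proof -
  have "\<exists>a b. Vector_Spaces.linear scl scl a \<and> (\<forall>c\<in>C. Vector_Spaces.linear scl scl (b c)) \<and>
      (\<forall>X\<in>\<Gamma>. \<psi> x (\<delta> X) = a (local_form U \<phi> \<psi> X (\<phi> x)) +
        (\<Sum>c\<in>C. b c (partial_derivative (model L) (local_form U \<phi> \<psi> X) (\<phi> x) c)))"
    if c: "(U, \<phi>) \<in> A" and t: "(U', \<psi>) \<in> triv L" and x: "x \<in> U \<inter> U'"
      and C: "finite C" "Real_Vector_Spaces.independent C" "Real_Vector_Spaces.span C = UNIV"
    for U \<phi> U' \<psi> and C :: "'a set"
  proof -
    have xU: "x \<in> U" "x \<in> U'" using x by auto
    obtain F where F: "F \<in> car coeffs" "Phi U \<phi> \<psi> x F = \<delta>" using Phi_surj[OF c t x \<delta>] by blast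
    note FD = coeffsD[OF F(1)]
    \<comment> \<open>The order condition refers to an arbitrary basis \<open>C\<close>, the
      coefficients to \<open>onb\<close>. Writing each element of \<open>onb\<close> in the basis
      \<open>C\<close> converts one into the other.\<close>
    define b where "b c w = (\<Sum>d\<in>onb. rscl (Real_Vector_Spaces.representation C d c) (F (Some d) w))" for c w
    have "lin_map \<kk> \<kk> (b c)" for c
      unfolding b_def lin_map_def
      by (auto simp: lin_map_kkD(1,2)[OF FD(4)] scale_right_distrib sum.distrib scale_sum_right mult.commute)
    moreover have "\<psi> x (\<delta> X) = F None (local_form U \<phi> \<psi> X (\<phi> x)) +
        (\<Sum>c\<in>C. b c (partial_derivative (model L) (local_form U \<phi> \<psi> X) (\<phi> x) c))" if X: "X \<in> \<Gamma>" for X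
    proof -
      have "pd U \<phi> \<psi> X x d = (\<Sum>c\<in>C. rscl (Real_Vector_Spaces.representation C d c) (pd U \<phi> \<psi> X x c))" for d
      proof -
        have "d = (\<Sum>c\<in>C. Real_Vector_Spaces.representation C d c *\<^sub>R c)"
          by (rule real_vector.sum_representation_eq[symmetric]) (use C in auto)
        then show ?thesis
          using pd_linear[OF c t x X, of "Real_Vector_Spaces.representation C d" "\<lambda>c. c" C] by simp
      qed
      then have "(\<Sum>d\<in>onb. F (Some d) (pd U \<phi> \<psi> X x d)) =
          (\<Sum>d\<in>onb. F (Some d) (\<Sum>c\<in>C. rscl (Real_Vector_Spaces.representation C d c) (pd U \<phi> \<psi> X x c)))" by metis
      also have "\<dots> = (\<Sum>d\<in>onb. \<Sum>c\<in>C. rscl (Real_Vector_Spaces.representation C d c) (F (Some d) (pd U \<phi> \<psi> X x c)))"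
        by (intro sum.cong refl) (simp add: lin_map_kkD(2,5)[OF FD(4)])
      also have "\<dots> = (\<Sum>c\<in>C. b c (pd U \<phi> \<psi> X x c))" unfolding b_def by (rule sum.swap)
      finally show ?thesis
        using triv_Phi(1)[OF t xU(2) X, of U \<phi> F] F(2)
        by (simp add: partial_derivative_eq_pd[OF c t x X] local_form_def chart(6)[OF c xU(1)])
    qed
    ultimately show ?thesis using FD(2) unfolding linear_scl_iff by blast
  qed
  then show ?thesis unfolding order_at_most_one_def by (auto simp: split_beta)
qed

end

section \<open>The bundle of derivations at points\<close>

lemma fin_dim_coord_space: "fin_dim_vspace (coord_space n)"
proof -
  have "lin_iso (coord_space n) (coord_space n) (\<lambda>v. v)"
    unfolding lin_iso_def lin_map_def using bij_betw_id[unfolded id_def] by auto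
  then show ?thesis unfolding fin_dim_vspace_def using is_vspace_coord_space by blast
qed

context vanishing_lie_bundle
begin

text \<open>The typical fiber is a coordinate space, so the trivializations pass from coefficients
  to coordinates by one isomorphism \<open>J\<close>, the same for all charts.\<close>

definition derivation_bundle ::
    "nat \<Rightarrow> (('a option \<Rightarrow> 'g \<Rightarrow> 'g) \<Rightarrow> nat \<Rightarrow> 'k) \<Rightarrow> ('k, 'm, ('m \<Rightarrow> 'e) \<Rightarrow> 'e, nat \<Rightarrow> 'k) vbundle" where
  "derivation_bundle n J = \<lparr>model = coord_space n, fib = x_derivations A L brL,
     triv = {(U \<inter> U', \<lambda>x d. J (inv_into (car coeffs) (Phi U \<phi> \<psi> x) d)) | U \<phi> U' \<psi>. (U, \<phi>) \<in> A \<and> (U', \<psi>) \<in> triv L}\<rparr>"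

lemma derivation_bundle_simps:
  "model (derivation_bundle n J) = coord_space n" "fib (derivation_bundle n J) = x_derivations A L brL"
  "(W, \<Psi>) \<in> triv (derivation_bundle n J) \<longleftrightarrow> (\<exists>U \<phi> U' \<psi>. (U, \<phi>) \<in> A \<and> (U', \<psi>) \<in> triv L \<and> W = U \<inter> U' \<and>
     \<Psi> = (\<lambda>x d. J (inv_into (car coeffs) (Phi U \<phi> \<psi> x) d)))"
  by (auto simp: derivation_bundle_def)

lemma smooth_coefficients_apply:
  assumes c: "(U, \<phi>) \<in> A" and t: "(U', \<psi>) \<in> triv L" and N: "open N" "N \<subseteq> U \<inter> U'"
    and g: "smooth_vec_fun A N coeffs g" and X: "X \<in> \<Gamma>"
  shows "smooth_vec_fun A N \<kk> (\<lambda>x. \<psi> x (Phi U \<phi> \<psi> x (g x) X))"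
proof (rule smooth_vec_fun_cong[OF N(1)])
  have lin: "lin_map \<kk> \<kk> (g x None)" "b \<in> onb ==> lin_map \<kk> \<kk> (g x (Some b))" if "x \<in> N" for x b
    using coeffsD(2,4)[OF smooth_vec_fun_car[OF g that]] by auto
  have ind: "None \<in> indices" "b \<in> onb ==> Some b \<in> indices" for b by (auto simp: indices_def)
  have NU: "N \<subseteq> U'" using N(2) by blast
  have 1: "smooth_vec_fun A N \<kk> (\<lambda>x. g x None (\<psi> x (X x)))"
    by (rule smooth_vec_fun_apply[OF fin_dim_kk N(1) lin(1) is_vspace_kk smooth_coeffs_eval[OF N(1) g ind(1)]
          section_smooth[OF X t NU]])
  have 2: "smooth_vec_fun A N \<kk> (\<lambda>x. g x (Some b) (pd U \<phi> \<psi> X x b))" if b: "b \<in> onb" for b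
    by (rule smooth_vec_fun_apply[OF fin_dim_kk N(1) lin(2)[OF _ b] is_vspace_kk smooth_coeffs_eval[OF N(1) g ind(2)[OF b]]
          smooth_vec_fun_subset[OF pd_smooth[OF c t X] N(2)]])
  show "smooth_vec_fun A N \<kk> (\<lambda>x. g x None (\<psi> x (X x)) + (\<Sum>b\<in>onb. g x (Some b) (pd U \<phi> \<psi> X x b)))"
    by (rule smooth_kk_add[OF N(1) 1 smooth_kk_sum[OF N(1) 2]])
  show "g x None (\<psi> x (X x)) + (\<Sum>b\<in>onb. g x (Some b) (pd U \<phi> \<psi> X x b)) = \<psi> x (Phi U \<phi> \<psi> x (g x) X)"
    if "x \<in> N" for x
    using triv_Phi(1)[OF t _ X, of x] that NU by auto
qed

text \<open>The coefficients of a derivation are recovered from its values on sections that are constant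
  or linear in a chart.\<close>

lemma smooth_coefficients:
  assumes c: "(U, \<phi>) \<in> A" and t: "(U', \<psi>) \<in> triv L" and N: "open N" "N \<subseteq> U \<inter> U'"
    and d: "\<And>x. x \<in> N ==> d x \<in> car (x_derivations A L brL x)"
    and s: "\<And>X. X \<in> \<Gamma> ==> smooth_vec_fun A N \<kk> (\<lambda>x. \<psi> x (d x X))"
  shows "smooth_vec_fun A N coeffs (\<lambda>x. inv_into (car coeffs) (Phi U \<phi> \<psi> x) (d x))"
proof (rule smooth_coeffs[OF N(1)])
  define F where "F x = inv_into (car coeffs) (Phi U \<phi> \<psi> x) (d x)" for x
  have F: "F x \<in> car coeffs" "Phi U \<phi> \<psi> x (F x) = d x" if "x \<in> N" for x
    unfolding F_def using lin_isoD(3,5)[OF Phi_iso[OF c t] d[OF that]] that N(2) by auto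
  show "inv_into (car coeffs) (Phi U \<phi> \<psi> x) (d x) \<in> car coeffs" if "x \<in> N" for x
    using F(1)[OF that] by (simp add: F_def)
  fix i u assume i: "i \<in> indices"
  have "smooth_vec_fun A N \<kk> (\<lambda>x. F x i u)"
  proof (rule smooth_vec_fun_local[OF N(1)])
    fix x0 assume x0: "x0 \<in> N"
    then have x0U: "x0 \<in> U \<inter> U'" using N(2) by blast
    obtain E y V where E: "open V" "x0 \<in> V" "V \<subseteq> U \<inter> U'" "V \<subseteq> N" "\<And>u. E u \<in> \<Gamma>" "\<And>u z. z \<in> V ==> \<psi> z (E u z) = u"
      and y: "\<And>b. smooth_fun A UNIV (y b)" "\<And>b z. z \<in> V ==> y b z = (\<phi> z - \<phi> x0) \<bullet> b"
      by (rule ex_frame[OF c t x0U x0 N(1)]) (rule that; assumption)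
    have fr: "\<psi> z (d z (E u)) = F z None u"
      "b \<in> onb ==> \<psi> z (d z (fmul (y b) (E u))) = rscl (y b z) (F z None u) + F z (Some b) u"
      if "z \<in> V" for z b
    proof -
      have zN: "z \<in> N" using that E(4) by blast
      show "\<psi> z (d z (E u)) = F z None u"
        unfolding F(2)[OF zN, symmetric]
        by (rule frame_Phi(1)[OF c t E(1,3,5) _ y(1) _ that F(1)[OF zN]]; (rule E(6) y(2))?; assumption)
      show "\<psi> z (d z (fmul (y b) (E u))) = rscl (y b z) (F z None u) + F z (Some b) u" if "b \<in> onb"
        unfolding F(2)[OF zN, symmetric]
        by (rule frame_Phi(2)[OF c t E(1,3,5) _ y(1) _ \<open>z \<in> V\<close> F(1)[OF zN] that]; (rule E(6) y(2))?; assumption)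
    qed
    have sE: "smooth_vec_fun A V \<kk> (\<lambda>x. \<psi> x (d x X))" if "X \<in> \<Gamma>" for X
      by (rule smooth_vec_fun_subset[OF s[OF that] E(4)])
    have "smooth_vec_fun A V \<kk> (\<lambda>x. F x i u)"
    proof (cases i)
      case None
      then show ?thesis
        using smooth_vec_fun_cong[OF E(1) _ sE[OF E(5)[of u]], of "\<lambda>x. F x None u"] fr(1) by simp
    next
      case (Some b)
      then have b: "b \<in> onb" using i by (auto simp: indices_def)
      have o: "smooth_vec_fun A V \<kk> (\<lambda>x. \<psi> x (d x (fmul (y b) (E u))) + rscl (- 1 * y b x) (\<psi> x (d x (E u))))"
        by (intro smooth_kk_add smooth_kk_rscl smooth_fun_mult smooth_fun_const E(1) sE E(5)
            section_fmul[OF y(1)] smooth_fun_subset[OF y(1)]) simp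
      show ?thesis unfolding Some
        by (rule smooth_vec_fun_cong[OF E(1) _ o]) (simp add: fr b)
    qed
    moreover have "V \<inter> N = V" using E(4) by blast
    ultimately show "\<exists>W. open W \<and> x0 \<in> W \<and> smooth_vec_fun A (W \<inter> N) \<kk> (\<lambda>x. F x i u)"
      using E(1,2) by (intro exI[of _ V]) simp
  qed
  then show "smooth_vec_fun A N \<kk> (\<lambda>x. inv_into (car coeffs) (Phi U \<phi> \<psi> x) (d x) i u)"
    by (simp add: F_def)
qed

section \<open>Smooth families of derivations and the bundle structure\<close>

context
  fixes n J
  assumes J: "lin_iso coeffs (coord_space n) J"
begin

lemma derivation_triv_iso:
  assumes "(U, \<phi>) \<in> A" "(U', \<psi>) \<in> triv L" "x \<in> U \<inter> U'"
  shows "lin_iso (x_derivations A L brL x) (coord_space n) (\<lambda>d. J (inv_into (car coeffs) (Phi U \<phi> \<psi> x) d))"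
    "v \<in> car (coord_space n) ==> inv_into (car (x_derivations A L brL x))
      (\<lambda>d. J (inv_into (car coeffs) (Phi U \<phi> \<psi> x) d)) v = Phi U \<phi> \<psi> x (inv_into (car coeffs) J v)"
proof -
  show iso: "lin_iso (x_derivations A L brL x) (coord_space n) (\<lambda>d. J (inv_into (car coeffs) (Phi U \<phi> \<psi> x) d))"
    by (rule lin_iso_comp[OF lin_iso_inv[OF is_vspace_coeffs Phi_iso[OF assms]] J])
  assume v: "v \<in> car (coord_space n)"
  note P = lin_isoD[OF Phi_iso[OF assms]]
  show "inv_into (car (x_derivations A L brL x)) (\<lambda>d. J (inv_into (car coeffs) (Phi U \<phi> \<psi> x) d)) v =
      Phi U \<phi> \<psi> x (inv_into (car coeffs) J v)"
    by (rule inv_into_f_eq[OF lin_isoD(8)[OF iso]])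
      (simp_all add: P(2,4) lin_isoD(3,5)[OF J] v)
qed

text \<open>Together with \<open>derivation_family_smooth\<close> this makes smoothness in a
  trivialization equivalent to smoothness of the values on all sections. That criterion does not
  mention the chart, and so smooth transition maps come out of it.\<close>

lemma smooth_derivation_family:
  assumes W: "(W, \<Psi>) \<in> triv (derivation_bundle n J)" and t: "(U', \<psi>) \<in> triv L" and N: "open N" "N \<subseteq> W" "N \<subseteq> U'"
    and d: "\<And>x. x \<in> N ==> d x \<in> car (x_derivations A L brL x)"
    and s: "\<And>X. X \<in> \<Gamma> ==> smooth_vec_fun A N \<kk> (\<lambda>x. \<psi> x (d x X))"
  shows "smooth_vec_fun A N (coord_space n) (\<lambda>x. \<Psi> x (d x))"
proof -
  obtain U \<phi> U1 \<psi>1 where c: "(U, \<phi>) \<in> A" and t1: "(U1, \<psi>1) \<in> triv L" and W': "W = U \<inter> U1"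
    and \<Psi>: "\<Psi> = (\<lambda>x d. J (inv_into (car coeffs) (Phi U \<phi> \<psi>1 x) d))"
    using W unfolding derivation_bundle_simps by blast
  have "smooth_vec_fun A N \<kk> (\<lambda>x. \<psi>1 x (d x X))" if X: "X \<in> \<Gamma>" for X
    by (rule triv_change[OF L_bundle t t1 N(1), unfolded model_L])
      (use N W' s[OF X] x_derivationD(1)[OF d X] in auto)
  then have "smooth_vec_fun A N coeffs (\<lambda>x. inv_into (car coeffs) (Phi U \<phi> \<psi>1 x) (d x))"
    by (intro smooth_coefficients[OF c t1 N(1) _ d]) (use N(2) W' in auto)
  then show ?thesis
    unfolding \<Psi> by (rule smooth_vec_fun_lin_map[OF is_vspace_coeffs N(1) _ lin_isoD(1)[OF J]])
qed

lemma derivation_family_smooth: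
  assumes c: "(U, \<phi>) \<in> A" and t: "(U', \<psi>) \<in> triv L" and N: "open N" "N \<subseteq> U \<inter> U'"
    and d: "\<And>x. x \<in> N ==> d x \<in> car (x_derivations A L brL x)"
    and s: "smooth_vec_fun A N (coord_space n) (\<lambda>x. J (inv_into (car coeffs) (Phi U \<phi> \<psi> x) (d x)))"
    and X: "X \<in> \<Gamma>"
  shows "smooth_vec_fun A N \<kk> (\<lambda>x. \<psi> x (d x X))"
proof (rule smooth_vec_fun_cong[OF N(1)])
  have P: "inv_into (car coeffs) (Phi U \<phi> \<psi> x) (d x) \<in> car coeffs"
    "Phi U \<phi> \<psi> x (inv_into (car coeffs) (Phi U \<phi> \<psi> x) (d x)) = d x" if "x \<in> N" for x
    using lin_isoD(3,5)[OF Phi_iso[OF c t] d[OF that]] that N(2) by auto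
  have "smooth_vec_fun A N coeffs (\<lambda>x. inv_into (car coeffs) J (J (inv_into (car coeffs) (Phi U \<phi> \<psi> x) (d x))))"
    by (rule smooth_vec_fun_lin_map[OF is_vspace_coord_space N(1) s lin_isoD(1)[OF lin_iso_inv[OF is_vspace_coeffs J]]])
  then have "smooth_vec_fun A N coeffs (\<lambda>x. inv_into (car coeffs) (Phi U \<phi> \<psi> x) (d x))"
    by (rule smooth_vec_fun_cong[OF N(1), rotated]) (simp add: lin_isoD(4)[OF J] P(1))
  then show "smooth_vec_fun A N \<kk> (\<lambda>x. \<psi> x (Phi U \<phi> \<psi> x (inv_into (car coeffs) (Phi U \<phi> \<psi> x) (d x)) X))"
    by (rule smooth_coefficients_apply[OF c t N _ X])
  show "\<psi> x (Phi U \<phi> \<psi> x (inv_into (car coeffs) (Phi U \<phi> \<psi> x) (d x)) X) = \<psi> x (d x X)" if "x \<in> N" for x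
    by (simp only: P(2)[OF that])
qed

lemma derivation_vector_bundle: "vector_bundle A (derivation_bundle n J)"
proof (rule vector_bundleI, unfold derivation_bundle_simps(1,2))
  show "fin_dim_vspace (coord_space n :: ('k, nat \<Rightarrow> 'k) vspace)" by (rule fin_dim_coord_space)
  show "is_vspace (x_derivations A L brL x)" for x by (rule is_vspace_x_derivations)
  show "open W" if "(W, \<Psi>) \<in> triv (derivation_bundle n J)" for W \<Psi>
    using that chart(1) triv_open unfolding derivation_bundle_simps by blast
  show "lin_iso (x_derivations A L brL x) (coord_space n) (\<Psi> x)"
    if "(W, \<Psi>) \<in> triv (derivation_bundle n J)" "x \<in> W" for W \<Psi> x
    using that derivation_triv_iso(1) unfolding derivation_bundle_simps by blast
  show "\<exists>W \<Psi>. (W, \<Psi>) \<in> triv (derivation_bundle n J) \<and> x \<in> W" for x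
  proof -
    obtain U \<phi> where "(U, \<phi>) \<in> A" "x \<in> U" by (rule ex_chart)
    moreover obtain U' \<psi> where "(U', \<psi>) \<in> triv L" "x \<in> U'" by (rule ex_triv[OF L_bundle])
    ultimately show ?thesis unfolding derivation_bundle_simps by blast
  qed
  fix W \<Psi> W' \<Psi>' and v :: "nat \<Rightarrow> 'k" assume W: "(W, \<Psi>) \<in> triv (derivation_bundle n J)" and W': "(W', \<Psi>') \<in> triv (derivation_bundle n J)"
    and v: "v \<in> car (coord_space n)"
  obtain U \<phi> U1 \<psi> where c: "(U, \<phi>) \<in> A" and t: "(U1, \<psi>) \<in> triv L" and WU: "W = U \<inter> U1"
    and \<Psi>: "\<Psi> = (\<lambda>x d. J (inv_into (car coeffs) (Phi U \<phi> \<psi> x) d))"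
    using W unfolding derivation_bundle_simps by blast
  have oW: "open (W \<inter> W')"
    using W W' chart(1) triv_open unfolding derivation_bundle_simps by blast
  let ?d = "\<lambda>x. inv_into (car (x_derivations A L brL x)) (\<Psi> x) v"
  have iso: "lin_iso (x_derivations A L brL x) (coord_space n) (\<Psi> x)" if "x \<in> W" for x
    unfolding \<Psi> by (rule derivation_triv_iso(1)[OF c t]) (use that WU in blast)
  have d: "?d x \<in> car (x_derivations A L brL x)" "\<Psi> x (?d x) = v" if "x \<in> W" for x
    using lin_isoD(3,5)[OF iso[OF that] v] by auto
  have "smooth_vec_fun A (W \<inter> W') (coord_space n) (\<lambda>x. \<Psi> x (?d x))"
    by (rule smooth_vec_fun_cong[OF oW _ smooth_vec_fun_const[OF oW v]]) (simp add: d(2))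
  \<comment> \<open>A constant coordinate vector in the first trivialization yields a family with
    smooth values on sections; from these the second trivialization reads off smooth
    coordinates.\<close>
  then have s: "smooth_vec_fun A (W \<inter> W') \<kk> (\<lambda>x. \<psi> x (?d x X))" if "X \<in> \<Gamma>" for X
    by (intro derivation_family_smooth[OF c t oW _ _ _ that]) (use WU d(1) \<Psi> in auto)
  show "smooth_vec_fun A (W \<inter> W') (coord_space n) (\<lambda>x. \<Psi>' x (?d x))"
    by (rule smooth_derivation_family[OF W' t oW _ _ _ s]) (use WU d(1) in auto)
qed

lemma derivation_bundle_sections:
  "d \<in> car (sections A (derivation_bundle n J)) \<longleftrightarrow>
     (\<forall>x. d x \<in> car (x_derivations A L brL x)) \<and> (\<forall>X\<in>\<Gamma>. (\<lambda>x. d x X) \<in> \<Gamma>)"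
proof
  assume "d \<in> car (sections A (derivation_bundle n J))"
  then have d: "\<And>x. d x \<in> car (x_derivations A L brL x)"
    and s: "\<And>W \<Psi>. (W, \<Psi>) \<in> triv (derivation_bundle n J) ==> smooth_vec_fun A W (coord_space n) (\<lambda>x. \<Psi> x (d x))"
    by (auto simp: sections_def derivation_bundle_simps(1,2))
  have "(\<lambda>x. d x X) \<in> \<Gamma>" if X: "X \<in> \<Gamma>" for X
  proof (rule sectionI)
    show "d x X \<in> car (fib L x)" for x by (rule x_derivationD(1)[OF d X])
    fix x
    obtain U \<phi> where c: "(U, \<phi>) \<in> A" "x \<in> U" by (rule ex_chart)
    obtain U' \<psi> where t: "(U', \<psi>) \<in> triv L" "x \<in> U'" by (rule ex_triv[OF L_bundle])
    have o: "open (U \<inter> U')" using chart(1)[OF c(1)] triv_open[OF t(1)] by blast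
    have "smooth_vec_fun A (U \<inter> U') \<kk> (\<lambda>x. \<psi> x (d x X))"
      by (rule derivation_family_smooth[OF c(1) t(1) o order.refl d _ X], rule s)
        (use c t in \<open>unfold derivation_bundle_simps, blast\<close>)
    then show "\<exists>U \<psi> N. (U, \<psi>) \<in> triv L \<and> open N \<and> x \<in> N \<and> N \<subseteq> U \<and> smooth_vec_fun A N \<kk> (\<lambda>x. \<psi> x (d x X))"
      using t c(2) o by (intro exI[of _ U'] exI[of _ \<psi>] exI[of _ "U \<inter> U'"]) auto
  qed
  then show "(\<forall>x. d x \<in> car (x_derivations A L brL x)) \<and> (\<forall>X\<in>\<Gamma>. (\<lambda>x. d x X) \<in> \<Gamma>)" using d by blast
next
  assume *: "(\<forall>x. d x \<in> car (x_derivations A L brL x)) \<and> (\<forall>X\<in>\<Gamma>. (\<lambda>x. d x X) \<in> \<Gamma>)"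
  have "smooth_vec_fun A W (coord_space n) (\<lambda>x. \<Psi> x (d x))" if W: "(W, \<Psi>) \<in> triv (derivation_bundle n J)" for W \<Psi>
  proof -
    obtain U \<phi> U1 \<psi> where c: "(U, \<phi>) \<in> A" and t: "(U1, \<psi>) \<in> triv L" and WU: "W = U \<inter> U1"
      using W unfolding derivation_bundle_simps by blast
    have o: "open W" using chart(1)[OF c] triv_open[OF t] WU by blast
    show ?thesis
      by (rule smooth_derivation_family[OF W t o order.refl])
        (use * WU section_smooth[OF _ t, of _ W] in auto)
  qed
  then show "d \<in> car (sections A (derivation_bundle n J))"
    using * by (auto simp: sections_def derivation_bundle_simps(1,2))
qed

text \<open>By \<open>derivation_bundle_sections\<close> a section is a family of x-derivations
  whose values on each section of \<open>L\<close> form a section again. Exchanging the two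
  arguments turns such a family into a derivation.\<close>

lemma eval_derivation_iso:
  "lin_iso (derivations (sections A L) (section_bracket brL)) (sections A (derivation_bundle n J)) (eval_derivation A L)"
proof -
  let ?D = "derivations (sections A L) (section_bracket brL)" and ?S = "sections A (derivation_bundle n J)"
  have Dcar: "D \<in> car ?D \<longleftrightarrow> D \<in> extensional \<Gamma> \<and> lin_map (sections A L) (sections A L) D \<and>
      (\<forall>X\<in>\<Gamma>. \<forall>Y\<in>\<Gamma>. D (section_bracket brL X Y) =
        vadd (sections A L) (section_bracket brL (D X) Y) (section_bracket brL X (D Y)))" for D
    unfolding derivations_def maps_vspace_simps by auto
  have into: "eval_derivation A L D \<in> car ?S" if D: "D \<in> car ?D" for D
    unfolding derivation_bundle_sections
  proof (intro conjI allI ballI)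
    have lin: "lin_map (sections A L) (sections A L) D" using D Dcar by blast
    show "eval_derivation A L D x \<in> car (x_derivations A L brL x)" for x
      unfolding x_derivations_def maps_vspace_simps eval_derivation_def
    proof (intro IntI CollectI conjI ballI restrict_extensional)
      show "lin_map (sections A L) (fib L x) (\<lambda>X\<in>\<Gamma>. D X x)"
        unfolding lin_map_def
        using lin_mapD[OF lin] section_add section_scale section_car
        by (auto simp: sections_simps(1,3)[THEN fun_cong])
      fix X Y assume X: "X \<in> \<Gamma>" "Y \<in> \<Gamma>"
      have "D (section_bracket brL X Y) =
        vadd (sections A L) (section_bracket brL (D X) Y) (section_bracket brL X (D Y))" using D Dcar X by blast
      then show "(\<lambda>X\<in>\<Gamma>. D X x) (section_bracket brL X Y) =
          vadd (fib L x) (brL x ((\<lambda>X\<in>\<Gamma>. D X x) X) (Y x)) (brL x (X x) ((\<lambda>X\<in>\<Gamma>. D X x) Y))"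
        using X section_bracket_closed[OF X] by (simp add: sections_simps section_bracket_def)
    qed
    show "(\<lambda>x. eval_derivation A L D x X) \<in> \<Gamma>" if "X \<in> \<Gamma>" for X
      using that lin_mapD(1)[OF lin that] by (simp add: eval_derivation_def)
  qed
  have onto: "\<exists>D\<in>car ?D. eval_derivation A L D = d" if "d \<in> car ?S" for d
  proof
    have d: "\<And>x. d x \<in> car (x_derivations A L brL x)" and dG: "\<And>X. X \<in> \<Gamma> ==> (\<lambda>x. d x X) \<in> \<Gamma>"
      using that unfolding derivation_bundle_sections by blast+
    note dD = x_derivationD[OF d]
    let ?D' = "\<lambda>X\<in>\<Gamma>. \<lambda>x. d x X"
    have "lin_map (sections A L) (sections A L) ?D'"
      unfolding lin_map_def
    proof (intro conjI ballI allI funcsetI)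
      show "?D' X \<in> \<Gamma>" if "X \<in> \<Gamma>" for X using dG that by simp
      show "?D' (vadd (sections A L) X Y) = vadd (sections A L) (?D' X) (?D' Y)" if "X \<in> \<Gamma>" "Y \<in> \<Gamma>" for X Y
        using that section_add[OF that] dD(2)[OF that] by (simp add: sections_simps(1)[of "\<lambda>x. d x X"])
      show "?D' (vscale (sections A L) k X) = vscale (sections A L) k (?D' X)" if "X \<in> \<Gamma>" for k X
        using that section_scale[OF that] dD(3)[OF that] by (simp add: sections_simps(3)[of _ "\<lambda>x. d x X"])
    qed
    moreover have "?D' (section_bracket brL X Y) =
        vadd (sections A L) (section_bracket brL (?D' X) Y) (section_bracket brL X (?D' Y))"
      if "X \<in> \<Gamma>" "Y \<in> \<Gamma>" for X Y
      using that section_bracket_closed[OF that] dD(4)[OF that]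
      by (simp add: sections_simps(1) section_bracket_def[of _ "\<lambda>x. d x X"] section_bracket_def[of _ X "\<lambda>x. d x Y"])
    ultimately show "?D' \<in> car ?D" unfolding Dcar by simp
    show "eval_derivation A L ?D' = d"
    proof
      fix x show "eval_derivation A L ?D' x = d x"
        unfolding eval_derivation_def
        by (rule extensionalityI[OF _ dD(5)]) auto
    qed
  qed
  have "inj_on (eval_derivation A L) (car ?D)"
  proof (rule inj_onI)
    fix D D' assume DD: "D \<in> car ?D" "D' \<in> car ?D" "eval_derivation A L D = eval_derivation A L D'"
    show "D = D'"
    proof (rule extensionalityI)
      show "D \<in> extensional \<Gamma>" "D' \<in> extensional \<Gamma>" using DD Dcar by blast+
      fix X assume X: "X \<in> \<Gamma>"
      show "D X = D' X"
      proof
        fix x show "D X x = D' X x"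
          using fun_cong[OF fun_cong[OF DD(3), of x], of X] X by (simp add: eval_derivation_def)
      qed
    qed
  qed
  moreover have "lin_map ?D ?S (eval_derivation A L)"
    unfolding lin_map_def
  proof (intro conjI ballI allI funcsetI)
    show "eval_derivation A L D \<in> car ?S" if "D \<in> car ?D" for D by (rule into[OF that])
    show "eval_derivation A L (vadd ?D D D') = vadd ?S (eval_derivation A L D) (eval_derivation A L D')" for D D'
      by (intro ext) (simp add: eval_derivation_def derivations_def maps_vspace_simps sections_def
          derivation_bundle_simps(2) x_derivations_def restrict_def)
    show "eval_derivation A L (vscale ?D k D) = vscale ?S k (eval_derivation A L D)" for k D
      by (intro ext) (simp add: eval_derivation_def derivations_def maps_vspace_simps sections_def
          derivation_bundle_simps(2) x_derivations_def restrict_def)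
  qed
  moreover have "eval_derivation A L ` car ?D = car ?S"
    using into onto by (auto 4 3)
  ultimately show ?thesis unfolding lin_iso_def bij_betw_def by blast
qed

end

end

section \<open>The symbol sequence\<close>

context vanishing_lie_bundle
begin

abbreviation (input) model_tangent :: "(real, 'a) vspace" where "model_tangent \<equiv> type_vspace (*\<^sub>R)"
abbreviation (input) model_tensor :: "('k, ('a \<Rightarrow> real) \<Rightarrow> 'g \<Rightarrow> 'g) vspace" where
  "model_tensor \<equiv> tensor_prod model_tangent (centroid \<kk> brk)"
abbreviation (input) fib_tensor :: "'m \<Rightarrow> ('k, ((('m \<Rightarrow> real) \<Rightarrow> real) \<Rightarrow> real) \<Rightarrow> 'e \<Rightarrow> 'e) vspace" where
  "fib_tensor x \<equiv> tensor_prod (tangent_space A x) (centroid (fib L x) (brL x))"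

text \<open>The sum over \<open>onb\<close> of the tensors of \<open>b\<close> and
  \<open>F (Some b)\<close>, written out in the realization of tensors as maps on the dual
  space.\<close>

definition principal_part :: "('a option \<Rightarrow> 'g \<Rightarrow> 'g) \<Rightarrow> ('a \<Rightarrow> real) \<Rightarrow> 'g \<Rightarrow> 'g" where
  "principal_part F = (\<lambda>l\<in>real_dual model_tangent. \<lambda>u. \<Sum>b\<in>onb. rscl (l b) (F (Some b) u))"

lemma real_dual_model_tangent: "l \<in> real_dual model_tangent \<longleftrightarrow> linear l"
  unfolding real_dual_def type_vspace_def by (auto simp: linear_iff extensional_UNIV)

lemma centroid_kk_simps:
  "car (centroid \<kk> brk) = {f. lin_map \<kk> \<kk> f \<and> (\<forall>u v. f (brk u v) = brk u (f v))}"
  "vadd (centroid \<kk> brk) f g = (\<lambda>u. f u + g u)" "vzero (centroid \<kk> brk) = (\<lambda>u. 0)"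
  "vscale (centroid \<kk> brk) c f = (\<lambda>u. scl c (f u))"
  unfolding centroid_def maps_vspace_simps by (simp_all add: restrict_UNIV extensional_UNIV)

lemma is_vspace_centroid: "is_vspace (centroid \<kk> brk)" "is_vspace (centroid (fib L x) (brL x))"
  unfolding centroid_def by (rule is_vspace_maps[OF Cent_kk_subspace], rule is_vspace_maps[OF Cent_fib_subspace])

lemma evaluation_functional: "real_functional \<kk> l ==> real_functional (centroid \<kk> brk) (\<lambda>f. l (f u))"
  unfolding centroid_def by (rule maps_real_functional[OF _ Cent_kk_subspace]) simp_all

lemma tensor_car: "car (tensor_prod V W) = tensors V W"
  unfolding tensor_prod_def maps_vspace_simps using tensors_ext by blast

lemma coeffs_Some: "F \<in> car coeffs ==> b \<in> onb ==> F (Some b) \<in> car (centroid \<kk> brk)"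
  unfolding centroid_kk_simps using coeffsD(4,5) by blast

lemma functional_sum_rscl:
  "real_functional \<kk> h ==> h (\<Sum>i\<in>I. rscl (r i) (w i)) = (\<Sum>i\<in>I. r i * h (w i))"
proof -
  assume h: "real_functional \<kk> h"
  have "h 0 = 0" using real_functional_kkD(1)[OF h, of 0 0] by simp
  then show ?thesis
    by (induction I rule: infinite_finite_induct) (simp_all add: real_functional_kkD[OF h])
qed

text \<open>Membership in \<open>tensors\<close> needs an actual sum of pure tensors. The one from
  \<open>ex_tensor_sum\<close> has the same values under all functionals, hence is the same
  map.\<close>

lemma principal_part_tensors:
  assumes F: "F \<in> car coeffs"
  shows "principal_part F \<in> tensors model_tangent (centroid \<kk> brk)"
proof -
  have "\<exists>t\<in>tensors model_tangent (centroid \<kk> brk). \<forall>l\<in>real_dual model_tangent. \<forall>h.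
      real_functional (centroid \<kk> brk) h \<longrightarrow> h (t l) = (\<Sum>b\<in>onb. l b * h (F (Some b)))"
    by (rule ex_tensor_sum[OF is_vspace_model_space is_vspace_centroid(1) onb(1)])
      (simp_all add: type_vspace_def coeffs_Some[OF F, unfolded type_vspace_def])
  then obtain t where t: "t \<in> tensors model_tangent (centroid \<kk> brk)"
    "\<And>l h. l \<in> real_dual model_tangent ==> real_functional (centroid \<kk> brk) h ==> h (t l) = (\<Sum>b\<in>onb. l b * h (F (Some b)))"
    by blast
  have "principal_part F = t"
  proof (rule extensionalityI[OF _ tensors_ext[OF t(1)]])
    show "principal_part F \<in> extensional (real_dual model_tangent)" by (simp add: principal_part_def)
    fix l :: "'a \<Rightarrow> real" assume l: "l \<in> real_dual model_tangent"
    show "principal_part F l = t l"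
    proof (rule ext, rule real_functional_eqI)
      fix u h assume h: "real_functional \<kk> h"
      show "h (principal_part F l u) = h (t l u)"
        using t(2)[OF l evaluation_functional[OF h]] l by (simp add: principal_part_def functional_sum_rscl[OF h])
    qed
  qed
  then show ?thesis using t(1) by simp
qed

lemma principal_part_lin_map: "lin_map coeffs model_tensor principal_part"
  unfolding lin_map_def
proof (intro conjI ballI allI funcsetI)
  fix F G c assume F: "F \<in> car coeffs"
  show "principal_part F \<in> car model_tensor" unfolding tensor_car by (rule principal_part_tensors[OF F])
  show "principal_part (vscale coeffs c F) = vscale model_tensor c (principal_part F)"
    unfolding coeffs_def tensor_prod_def maps_vspace_simps endos_simps centroid_kk_simps
    by (rule extensionalityI[of _ "real_dual model_tangent"])
      (simp_all add: principal_part_def indices_def scale_sum_right mult.commute[of c])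
next
  fix F G assume "F \<in> car coeffs" "G \<in> car coeffs"
  show "principal_part (vadd coeffs F G) = vadd model_tensor (principal_part F) (principal_part G)"
    unfolding coeffs_def tensor_prod_def maps_vspace_simps endos_simps centroid_kk_simps
    by (rule extensionalityI[of _ "real_dual model_tangent"])
      (simp_all add: principal_part_def indices_def scale_right_distrib sum.distrib)
qed

lemma inner_real_dual: "(\<lambda>v. v \<bullet> b) \<in> real_dual model_tangent"
  unfolding real_dual_model_tangent by (simp add: linear_iff inner_add_left)

lemma principal_part_apply: "b \<in> onb ==> principal_part F (\<lambda>v. v \<bullet> b) = (\<lambda>u. F (Some b) u)"
proof -
  assume b: "b \<in> onb"
  have "(\<Sum>c\<in>onb. rscl (c \<bullet> b) (F (Some c) u)) = (\<Sum>c\<in>onb. if c = b then F (Some c) u else 0)" for u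
    by (rule sum.cong) (simp_all add: onb(2)[OF _ b])
  then show ?thesis
    by (intro ext) (simp add: principal_part_def inner_real_dual onb(1) b)
qed

lemma principal_part_eq_zero:
  assumes F: "F \<in> car coeffs"
  shows "principal_part F = vzero model_tensor \<longleftrightarrow> (\<forall>b\<in>onb. F (Some b) = (\<lambda>u. 0))"
proof
  assume z: "principal_part F = vzero model_tensor"
  show "\<forall>b\<in>onb. F (Some b) = (\<lambda>u. 0)"
  proof
    fix b :: 'a assume b: "b \<in> onb"
    show "F (Some b) = (\<lambda>u. 0)"
      using principal_part_apply[OF b, of F] inner_real_dual[of b]
      unfolding z tensor_prod_def maps_vspace_simps centroid_kk_simps by simp
  qed
next
  assume "\<forall>b\<in>onb. F (Some b) = (\<lambda>u. 0)"
  then show "principal_part F = vzero model_tensor"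
    unfolding tensor_prod_def maps_vspace_simps centroid_kk_simps
    by (simp add: principal_part_def)
qed

lemma principal_part_surj:
  assumes t: "t \<in> tensors model_tangent (centroid \<kk> brk)"
  shows "\<exists>F\<in>car coeffs. principal_part F = t"
proof -
  \<comment> \<open>The components of a tensor are its values at the functionals dual to
    \<open>onb\<close>; the coefficient of order 0 is free and taken to be 0.\<close>
  define F where "F = (\<lambda>i\<in>indices. case i of None \<Rightarrow> (\<lambda>u. 0) | Some b \<Rightarrow> t (\<lambda>v. v \<bullet> b))"
  have c: "t l \<in> car (centroid \<kk> brk)" if "l \<in> real_dual model_tangent" for l
    by (rule tensors_car[OF is_vspace_centroid(1) t that])
  have F0: "F None = (\<lambda>u. 0)" by (simp add: F_def indices_def)
  have FS: "F (Some b) = t (\<lambda>v. v \<bullet> b)" if "b \<in> onb" for b using that by (simp add: F_def indices_def)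
  have "lin_map \<kk> \<kk> (\<lambda>u. 0)" unfolding lin_map_def by simp
  moreover have "brk 0 v = 0" "brk v 0 = 0" for v
    using lin_map_kkD(3)[OF brk_linear(1)] lin_map_kkD(3)[OF brk_linear(2)] by blast+
  ultimately have F: "F \<in> car coeffs"
    unfolding coeffs_def maps_vspace_simps coeff_set_def
    using c[OF inner_real_dual] F0 FS by (auto simp: F_def[THEN arg_cong[where f = "\<lambda>f. f \<in> extensional indices"]] centroid_kk_simps)
  obtain r :: nat and \<beta> where \<beta>: "bij_betw \<beta> {..<r} (onb :: 'a set)"
    using ex_bij_betw_nat_finite[OF onb(1)] atLeast0LessThan by metis
  have "principal_part F = t"
  proof (rule extensionalityI[OF _ tensors_ext[OF t]])
    show "principal_part F \<in> extensional (real_dual model_tangent)" by (simp add: principal_part_def)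
    fix l :: "'a \<Rightarrow> real" assume l: "l \<in> real_dual model_tangent"
    then have lin: "linear l" by (simp add: real_dual_model_tangent)
    show "principal_part F l = t l"
    proof (rule ext, rule real_functional_eqI)
      fix u h assume h: "real_functional \<kk> h"
      have e: "l v = (\<Sum>i<r. (v \<bullet> \<beta> i) * l (\<beta> i))" for v
        using linear_onb[OF lin, of v] sum.reindex_bij_betw[OF \<beta>, of "\<lambda>b. (v \<bullet> b) * l b"] by simp
      have "h (t l u) = (\<Sum>i<r. l (\<beta> i) * h (t (\<lambda>v. v \<bullet> \<beta> i) u))"
        by (rule tensor_expand[OF is_vspace_centroid(1) t l evaluation_functional[OF h] inner_real_dual]) (rule e)
      also have "\<dots> = (\<Sum>b\<in>onb. l b * h (t (\<lambda>v. v \<bullet> b) u))"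
        by (rule sum.reindex_bij_betw[OF \<beta>])
      also have "\<dots> = h (principal_part F l u)"
        using l FS by (simp add: principal_part_def functional_sum_rscl[OF h])
      finally show "h (principal_part F l u) = h (t l u)" by simp
    qed
  qed
  then show ?thesis using F by blast
qed

text \<open>A functional \<open>l\<close> on the tangent space is the differential of a function \<open>f\<close> vanishing at \<open>x\<close>;
  the symbol of \<open>\<delta>\<close> at \<open>l\<close> maps \<open>X\<^sub>x\<close> to \<open>\<delta>(f X)\<close>.\<close>

definition symbol :: "'m \<Rightarrow> (('m \<Rightarrow> 'e) \<Rightarrow> 'e) \<Rightarrow> ((('m \<Rightarrow> real) \<Rightarrow> real) \<Rightarrow> real) \<Rightarrow> 'e \<Rightarrow> 'e" where
  "symbol x \<delta> = (\<lambda>l\<in>real_dual (tangent_space A x). \<lambda>u\<in>car (fib L x).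
     \<delta> (fmul (SOME f. smooth_fun A UNIV f \<and> f x = 0 \<and> (\<forall>v\<in>car (tangent_space A x). l v = v f))
       (SOME X. X \<in> \<Gamma> \<and> X x = u)))"

text \<open>In coordinates centered at \<open>x\<close> take the linear function whose coefficients
  are the values of \<open>l\<close> on the coordinate derivations.\<close>

lemma ex_differential:
  assumes l: "l \<in> real_dual (tangent_space A x)"
  shows "\<exists>f. smooth_fun A UNIV f \<and> f x = 0 \<and> (\<forall>v\<in>car (tangent_space A x). l v = v f)"
proof -
  obtain U \<phi> where c: "(U, \<phi>) \<in> A" "x \<in> U" by (rule ex_chart)
  let ?d = "coord_derivation A U \<phi> x"
  note iso = lin_iso_coord_derivation[OF c]
  obtain y V where y: "\<And>b. smooth_fun A UNIV (y b)" "open V" "x \<in> V" "V \<subseteq> U"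
    "\<And>b z. z \<in> V ==> y b z = (\<phi> z - \<phi> x) \<bullet> b"
    by (rule ex_global_coordinates[OF c]) (rule that; assumption)
  define f where "f z = (\<Sum>b\<in>onb. l (?d b) * y b z)" for z
  have sf: "smooth_fun A UNIV f"
    unfolding f_def by (intro smooth_fun_sum smooth_fun_mult smooth_fun_const open_UNIV y(1))
  have d: "chart_deriv U \<phi> f x a = (\<Sum>b\<in>onb. l (?d b) * (a \<bullet> b))" for a
  proof -
    have sV: "smooth_fun A V (y b)" for b by (rule smooth_fun_subset[OF y(1)]) simp
    have "chart_deriv U \<phi> (y b) x a = a \<bullet> b" for b
      using fun_cong[OF chart_deriv_cong[OF c(1) y(2) sV, where x = x and g = "\<lambda>z. (\<phi> z - \<phi> x) \<bullet> b" and b1 = b], of a]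
        chart_deriv_coordinate[OF c] y(3,5) c(2) by simp
    moreover have "chart_deriv U \<phi> f x a = (\<Sum>b\<in>onb. chart_deriv U \<phi> (\<lambda>z. l (?d b) * y b z) x a)"
      unfolding f_def
      by (rule chart_deriv_sum[OF c(1) open_UNIV smooth_fun_mult[OF open_UNIV smooth_fun_const[OF open_UNIV] y(1)]])
        (use c in simp)
    moreover have "chart_deriv U \<phi> (\<lambda>z. r * y b z) x a = r * chart_deriv U \<phi> (y b) x a" for r b
      using chart_deriv_mult[OF c(1) open_UNIV smooth_fun_const[OF open_UNIV] y(1), of x r b a] c(2)
      by (simp add: chart_deriv_const)
    ultimately show ?thesis by simp
  qed
  have "real_functional model_tangent (\<lambda>a. l (?d a))"
    using real_functional_comp[OF lin_isoD(1)[OF iso]] l unfolding real_dual_iff by blast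
  then have "linear (\<lambda>a. l (?d a))"
    unfolding real_functional_iff by (simp add: linear_iff type_vspace_def)
  note ld = linear_onb[OF this]
  have "l v = v f" if v: "v \<in> car (tangent_space A x)" for v
  proof -
    obtain a where a: "v = ?d a" using lin_isoD(7)[OF iso] v by (auto simp: type_vspace_def)
    show ?thesis
      using ld[of a] d[of a] chart_deriv_coord_derivation[of f U \<phi> x a] sf unfolding a
      by (simp add: smooth_functions_iff mult.commute)
  qed
  moreover have "f x = 0" unfolding f_def using y(5)[OF y(3)] by simp
  ultimately show ?thesis using sf by blast
qed

text \<open>At a zero of \<open>f\<close> the product rule leaves only the differential of
  \<open>f\<close>, which is prescribed by \<open>l\<close>, and the value of \<open>X\<close> at
  \<open>x\<close>. So the choices made in \<open>symbol\<close> do not matter, and in matching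
  trivializations the symbol becomes \<open>principal_part\<close>.\<close>

lemma symbol_Phi:
  assumes c: "(U, \<phi>) \<in> A" and t: "(U', \<psi>) \<in> triv L" and x: "x \<in> U \<inter> U'" and F: "F \<in> car coeffs"
  shows "symbol x (Phi U \<phi> \<psi> x F) = inv_into (car (fib_tensor x))
    (tensor_map (tangent_space A x) model_tangent (inv_into UNIV (coord_derivation A U \<phi> x))
      (conj_map (fib L x) \<kk> (\<psi> x))) (principal_part F)"
proof -
  have xU: "x \<in> U" "x \<in> U'" using x by auto
  let ?d = "coord_derivation A U \<phi> x" and ?T = "tangent_space A x" and ?i = "inv_into (car (fib L x)) (\<psi> x)"
  note iso = lin_iso_coord_derivation[OF c xU(1)]
  have carM: "car model_tangent = UNIV" by (simp add: type_vspace_def)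
  have vT: "is_vspace ?T" using vector_bundleD(3)[OF tangent_vector_bundle, of x] by (simp add: tangent_bundle_def)
  have iso': "lin_iso ?T model_tangent (inv_into UNIV ?d)"
    using lin_iso_inv[OF is_vspace_model_space iso] unfolding carM .
  have inv: "inv_into (car ?T) (inv_into UNIV ?d) a = ?d a" for a
    by (rule inv_into_f_eq[OF lin_isoD(8)[OF iso']])
      (use lin_isoD(2,4)[OF iso] in \<open>simp_all add: carM\<close>)
  have R: "inv_into (car (fib_tensor x))
    (tensor_map ?T model_tangent (inv_into UNIV ?d) (conj_map (fib L x) \<kk> (\<psi> x))) (principal_part F) =
      tensor_map model_tangent ?T (inv_into (car ?T) (inv_into UNIV ?d))
        (inv_into (car (centroid (fib L x) (brL x))) (conj_map (fib L x) \<kk> (\<psi> x))) (principal_part F)"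
    by (rule lin_iso_tensor_map(2)[OF vT is_vspace_model_space is_vspace_centroid(2,1) iso' Cent_conj_iso(1)[OF t xU(2)]])
      (simp add: tensor_car principal_part_tensors[OF F])
  show ?thesis
    unfolding R
  proof (rule extensionalityI[of _ "real_dual ?T"])
    show "symbol x (Phi U \<phi> \<psi> x F) \<in> extensional (real_dual ?T)" by (simp add: symbol_def)
    show "tensor_map model_tangent ?T (inv_into (car ?T) (inv_into UNIV ?d))
        (inv_into (car (centroid (fib L x) (brL x))) (conj_map (fib L x) \<kk> (\<psi> x))) (principal_part F) \<in> extensional (real_dual ?T)"
      by (simp add: tensor_map_def)
    fix l assume l: "l \<in> real_dual ?T"
    define f where "f = (SOME f. smooth_fun A UNIV f \<and> f x = 0 \<and> (\<forall>v\<in>car ?T. l v = v f))"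
    have f: "smooth_fun A UNIV f" "f x = 0" "\<And>v. v \<in> car ?T ==> l v = v f"
      using someI_ex[OF ex_differential[OF l]] unfolding f_def by blast+
    have lb: "chart_deriv U \<phi> f x b = l (?d b)" for b
      using f(3)[OF lin_isoD(2)[OF iso]] chart_deriv_coord_derivation[of f U \<phi> x b] f(1)
      by (simp add: carM smooth_functions_iff)
    have lin: "(\<lambda>a\<in>car model_tangent. l (?d a)) \<in> real_dual model_tangent"
      by (rule real_dual_comp[OF is_vspace_model_space lin_isoD(1)[OF iso] l])
    have lin': "(\<lambda>a. l (?d a)) \<in> real_dual model_tangent" using lin by (simp add: carM restrict_UNIV)
    have P: "principal_part F (\<lambda>a. l (?d a)) \<in> car (centroid \<kk> brk)"
      by (rule tensors_car[OF is_vspace_centroid(1) principal_part_tensors[OF F] lin'])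
    have "symbol x (Phi U \<phi> \<psi> x F) l = (\<lambda>u\<in>car (fib L x). ?i (\<Sum>b\<in>onb. rscl (l (?d b)) (F (Some b) (\<psi> x u))))"
    proof (rule extensionalityI[of _ "car (fib L x)"])
      fix u assume u: "u \<in> car (fib L x)"
      define X where "X = (SOME X. X \<in> \<Gamma> \<and> X x = u)"
      have "\<exists>X. X \<in> \<Gamma> \<and> X x = u" by (rule ex_section_through[OF u]) blast
      from someI_ex[OF this] have X: "X \<in> \<Gamma>" "X x = u" unfolding X_def by blast+
      have "symbol x (Phi U \<phi> \<psi> x F) l u = Phi U \<phi> \<psi> x F (fmul f X)"
        using l u by (simp add: symbol_def f_def X_def)
      also have "\<dots> = ?i (F None (\<psi> x (fmul f X x)) + (\<Sum>b\<in>onb. F (Some b) (pd U \<phi> \<psi> (fmul f X) x b)))"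
        by (simp add: Phi_def section_fmul[OF f(1) X(1)])
      also have "\<dots> = ?i (\<Sum>b\<in>onb. rscl (l (?d b)) (F (Some b) (\<psi> x u)))"
        using lin_map_kkD(2)[OF coeffsD(4)[OF F]]
        by (simp add: triv_fmul[OF t xU(2) X(1)] f(2) lin_map_kkD(3)[OF coeffsD(2)[OF F]]
          pd_fmul[OF c t x X(1) f(1)] lb X(2))
      finally show "symbol x (Phi U \<phi> \<psi> x F) l u =
        (\<lambda>u\<in>car (fib L x). ?i (\<Sum>b\<in>onb. rscl (l (?d b)) (F (Some b) (\<psi> x u)))) u" using u by simp
    qed (use l in \<open>simp_all add: symbol_def\<close>)
    moreover have "tensor_map model_tangent ?T (inv_into (car ?T) (inv_into UNIV ?d))
        (inv_into (car (centroid (fib L x) (brL x))) (conj_map (fib L x) \<kk> (\<psi> x))) (principal_part F) l =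
        (\<lambda>u\<in>car (fib L x). ?i (\<Sum>b\<in>onb. rscl (l (?d b)) (F (Some b) (\<psi> x u))))"
      using l lin' Cent_conj_iso(2)[OF t xU(2) P] by (simp add: tensor_map_def inv carM restrict_UNIV principal_part_def)
    ultimately show "symbol x (Phi U \<phi> \<psi> x F) l = tensor_map model_tangent ?T (inv_into (car ?T) (inv_into UNIV ?d))
        (inv_into (car (centroid (fib L x) (brL x))) (conj_map (fib L x) \<kk> (\<psi> x))) (principal_part F) l" by simp
  qed
qed

abbreviation (input) "TCent \<equiv> tensor_bundle (tangent_bundle A) (Cent_bundle brk L brL)"

lemma TCent_simps: "fib TCent x = fib_tensor x" "model TCent = model_tensor"
  by (simp_all add: tensor_bundle_def tangent_bundle_def Cent_bundle_def model_L)

lemma TCent_vector_bundle: "vector_bundle A TCent"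
  by (rule tensor_vector_bundle[OF tangent_vector_bundle Cent_vector_bundle])

lemma TCent_triv:
  assumes "(U, \<phi>) \<in> A" "(U', \<psi>) \<in> triv L"
  shows "(U \<inter> U', \<lambda>x. tensor_map (tangent_space A x) model_tangent (inv_into UNIV (coord_derivation A U \<phi> x))
      (conj_map (fib L x) \<kk> (\<psi> x))) \<in> triv TCent"
proof -
  have 1: "(U, \<lambda>x. inv_into UNIV (coord_derivation A U \<phi> x)) \<in> triv (tangent_bundle A)"
    using assms(1) unfolding tangent_bundle_def by force
  have 2: "(U', \<lambda>x. conj_map (fib L x) \<kk> (\<psi> x)) \<in> triv (Cent_bundle brk L brL)"
    using assms(2) unfolding Cent_bundle_def conj_triv_def by (force simp: model_L)
  have "(U \<inter> U', \<lambda>x. tensor_map (fib (tangent_bundle A) x) (model (tangent_bundle A))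
      (inv_into UNIV (coord_derivation A U \<phi> x)) (conj_map (fib L x) \<kk> (\<psi> x))) \<in> triv TCent"
    unfolding tensor_bundle_def vbundle.simps
    by (rule CollectI, rule exI, rule exI, rule exI, rule exI, rule conjI[OF refl conjI[OF 1 2]])
  then show ?thesis by (simp add: tangent_bundle_def)
qed

lemma is_vspace_tensors: "is_vspace (fib_tensor x)" "is_vspace model_tensor"
  by (rule vector_bundleD(3,2)[OF TCent_vector_bundle, unfolded TCent_simps])+

lemma symbol_kernel:
  assumes c: "(U, \<phi>) \<in> A" and t: "(U', \<psi>) \<in> triv L" and x: "x \<in> U \<inter> U'" and F: "F \<in> car coeffs"
  shows "symbol x (Phi U \<phi> \<psi> x F) = vzero (fib_tensor x) \<longleftrightarrow> (\<forall>b\<in>onb. F (Some b) = (\<lambda>u. 0))"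
proof -
  note iso = lin_iso_inv[OF is_vspace_tensors(1) vector_bundleD(5)[OF TCent_vector_bundle TCent_triv[OF c t] x, unfolded TCent_simps]]
  show ?thesis
    unfolding symbol_Phi[OF c t x F] principal_part_eq_zero[OF F, symmetric]
      lin_map_zero[OF is_vspace_tensors(2,1) lin_isoD(1)[OF iso], symmetric]
    by (rule lin_isoD(6)[OF iso lin_mapD(1)[OF principal_part_lin_map F] is_vspaceD(1)[OF is_vspace_tensors(2)]])
qed

lemma symbol_lin_map: "lin_map (x_derivations A L brL x) (fib_tensor x) (symbol x)" (is ?lin)
  and symbol_surj: "symbol x ` car (x_derivations A L brL x) = car (fib_tensor x)" (is ?surj)
proof -
  obtain U \<phi> where c: "(U, \<phi>) \<in> A" "x \<in> U" by (rule ex_chart)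
  obtain U' \<psi> where t: "(U', \<psi>) \<in> triv L" "x \<in> U'" by (rule ex_triv[OF L_bundle])
  have x: "x \<in> U \<inter> U'" using c t by blast
  note c = c(1) and t = t(1)
  let ?B = "tensor_map (tangent_space A x) model_tangent (inv_into UNIV (coord_derivation A U \<phi> x))
    (conj_map (fib L x) \<kk> (\<psi> x))"
  let ?I = "inv_into (car (fib_tensor x)) ?B"
  note iso = vector_bundleD(5)[OF TCent_vector_bundle TCent_triv[OF c t] x, unfolded TCent_simps]
  note inv = lin_isoD(1)[OF lin_iso_inv[OF is_vspace_tensors(1) iso]]
  have eq: "symbol x \<delta> = ?I (principal_part (inv_into (car coeffs) (Phi U \<phi> \<psi> x) \<delta>))"
    if "\<delta> \<in> car (x_derivations A L brL x)" for \<delta>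
    using symbol_Phi[OF c t x lin_isoD(3)[OF Phi_iso[OF c t x] that]] lin_isoD(5)[OF Phi_iso[OF c t x] that] by simp
  have 1: "lin_map (x_derivations A L brL x) (fib_tensor x)
      (\<lambda>\<delta>. ?I (principal_part (inv_into (car coeffs) (Phi U \<phi> \<psi> x) \<delta>)))"
    by (rule lin_map_comp[OF lin_map_comp[OF lin_isoD(1)[OF lin_iso_inv[OF is_vspace_coeffs Phi_iso[OF c t x]]]
            principal_part_lin_map] inv])
  show ?lin
    by (rule iffD2[OF lin_map_cong 1]; (rule is_vspaceD(2,3)[OF is_vspace_x_derivations] eq)?; assumption)
  show ?surj
  proof (intro equalityI subsetI)
    fix s assume "s \<in> car (fib_tensor x)"
    then have s: "?B s \<in> tensors model_tangent (centroid \<kk> brk)" "?I (?B s) = s"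
      using lin_isoD(2,4)[OF iso] by (auto simp: tensor_car)
    obtain F where F: "F \<in> car coeffs" "principal_part F = ?B s" using principal_part_surj[OF s(1)] by blast
    have "symbol x (Phi U \<phi> \<psi> x F) = s" using symbol_Phi[OF c t x F(1)] F(2) s(2) by simp
    then show "s \<in> symbol x ` car (x_derivations A L brL x)" using Phi_derivation[OF c t x F(1)] by blast
  qed (use lin_mapD(1)[OF 1] eq in auto)
qed

lemma der_inclusion_lin_map:
  "lin_map (derivations (fib L x) (brL x)) (x_derivations A L brL x) (der_inclusion A L x)"
  unfolding lin_map_def
proof (intro conjI ballI allI funcsetI)
  fix D c assume "D \<in> car (derivations (fib L x) (brL x))"
  then have D: "lin_map (fib L x) (fib L x) D"
    "\<And>u v. u \<in> car (fib L x) ==> v \<in> car (fib L x) ==> D (brL x u v) = vadd (fib L x) (brL x (D u) v) (brL x u (D v))"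
    unfolding derivations_def maps_vspace_simps by blast+
  show "der_inclusion A L x D \<in> car (x_derivations A L brL x)"
    unfolding x_derivations_def maps_vspace_simps der_inclusion_def
  proof (intro IntI CollectI conjI ballI restrict_extensional)
    show "lin_map (sections A L) (fib L x) (\<lambda>X\<in>\<Gamma>. D (X x))"
      unfolding lin_map_def
      using lin_mapD[OF D(1)] section_add section_scale section_car by (auto simp: sections_simps)
    fix X Y assume X: "X \<in> \<Gamma>" "Y \<in> \<Gamma>"
    show "(\<lambda>X\<in>\<Gamma>. D (X x)) (section_bracket brL X Y) =
        vadd (fib L x) (brL x ((\<lambda>X\<in>\<Gamma>. D (X x)) X) (Y x)) (brL x (X x) ((\<lambda>X\<in>\<Gamma>. D (X x)) Y))"
      using X section_bracket_closed[OF X] D(2)[OF section_car[OF X(1)] section_car[OF X(2)]]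
      by (simp add: section_bracket_def)
  qed
next
  show "der_inclusion A L x (vadd (derivations (fib L x) (brL x)) D D') =
      vadd (x_derivations A L brL x) (der_inclusion A L x D) (der_inclusion A L x D')" for D D'
    unfolding der_inclusion_def derivations_def x_derivations_def maps_vspace_simps
    by (rule restrict_ext) (simp add: section_car)
  show "der_inclusion A L x (vscale (derivations (fib L x) (brL x)) k D) =
      vscale (x_derivations A L brL x) k (der_inclusion A L x D)" for k D
    unfolding der_inclusion_def derivations_def x_derivations_def maps_vspace_simps
    by (rule restrict_ext) (simp add: section_car)
qed

lemma der_inclusion_inj: "inj_on (der_inclusion A L x) (car (derivations (fib L x) (brL x)))"
proof (rule inj_onI)
  fix D D' assume D: "D \<in> car (derivations (fib L x) (brL x))" "D' \<in> car (derivations (fib L x) (brL x))"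
    and eq: "der_inclusion A L x D = der_inclusion A L x D'"
  show "D = D'"
  proof (rule extensionalityI)
    show "D \<in> extensional (car (fib L x))" "D' \<in> extensional (car (fib L x))"
      using D unfolding derivations_def maps_vspace_simps by blast+
    fix u assume "u \<in> car (fib L x)"
    then obtain X where "X \<in> \<Gamma>" "X x = u" by (rule ex_section_through)
    then show "D u = D' u" using fun_cong[OF eq, of X] by (simp add: der_inclusion_def)
  qed
qed

text \<open>A vanishing symbol leaves only the coefficient \<open>F None\<close>, a derivation of
  \<kk>. Conjugated back to the fiber, it is the derivation to which \<open>der_inclusion\<close> is
  applied.\<close>

lemma symbol_exact:
  "der_inclusion A L x ` car (derivations (fib L x) (brL x)) =
    {\<delta> \<in> car (x_derivations A L brL x). symbol x \<delta> = vzero (fib_tensor x)}"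
proof (intro equalityI subsetI)
  obtain U \<phi> where c: "(U, \<phi>) \<in> A" "x \<in> U" by (rule ex_chart)
  obtain U' \<psi> where t: "(U', \<psi>) \<in> triv L" "x \<in> U'" by (rule ex_triv[OF L_bundle])
  have x: "x \<in> U \<inter> U'" using c t by blast
  note c = c(1)
  note iso = Der_conj_iso(1)[OF t]
  have bz: "lin_map \<kk> \<kk> (\<lambda>u. 0)" "brk v 0 = 0" for v
    using lin_map_kkD(3)[OF brk_linear(1)] by (auto simp: lin_map_def)
  {
    fix \<delta> assume "\<delta> \<in> der_inclusion A L x ` car (derivations (fib L x) (brL x))"
    then obtain D where D: "D \<in> car (derivations (fib L x) (brL x))" and \<delta>: "\<delta> = der_inclusion A L x D" by blast
    let ?D = "conj_map (fib L x) \<kk> (\<psi> x) D"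
    define F where "F = (\<lambda>i\<in>indices. case i of None \<Rightarrow> ?D | Some b \<Rightarrow> (\<lambda>u. 0))"
    have F0: "F None = ?D" and FS: "\<And>b. b \<in> onb ==> F (Some b) = (\<lambda>u. 0)" by (simp_all add: F_def indices_def)
    have "?D \<in> derivation_set \<kk> brk"
      using lin_isoD(2)[OF iso D] unfolding derivations_def maps_vspace_simps by blast
    moreover have "F \<in> extensional indices" by (simp add: F_def)
    ultimately have F: "F \<in> car coeffs"
      unfolding coeffs_def maps_vspace_simps coeff_set_def using F0 FS bz by (auto simp: conj_map_def)
    have "\<delta> = Phi U \<phi> \<psi> x F"
      unfolding \<delta> der_inclusion_def Phi_def
    proof (rule restrict_ext)
      fix X assume X: "X \<in> \<Gamma>"
      have "D (X x) \<in> car (fib L x)"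
        using D section_car[OF X] unfolding derivations_def maps_vspace_simps by (auto dest: lin_mapD(1))
      then show "D (X x) = inv_into (car (fib L x)) (\<psi> x) (F None (\<psi> x (X x)) + (\<Sum>b\<in>onb. F (Some b) (pd U \<phi> \<psi> X x b)))"
        by (simp add: F0 FS conj_map_def triv_inv(3)[OF t] section_car[OF X])
    qed
    then show "\<delta> \<in> {\<delta> \<in> car (x_derivations A L brL x). symbol x \<delta> = vzero (fib_tensor x)}"
      using symbol_kernel[OF c t(1) x F] FS Phi_derivation[OF c t(1) x F] by blast
  next
    fix \<delta> assume "\<delta> \<in> {\<delta> \<in> car (x_derivations A L brL x). symbol x \<delta> = vzero (fib_tensor x)}"
    then have \<delta>: "\<delta> \<in> car (x_derivations A L brL x)" "symbol x \<delta> = vzero (fib_tensor x)" by auto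
    obtain F where F: "F \<in> car coeffs" "Phi U \<phi> \<psi> x F = \<delta>" using Phi_surj[OF c t(1) x \<delta>(1)] by blast
    have FS: "F (Some b) = (\<lambda>u. 0)" if "b \<in> onb" for b
      using symbol_kernel[OF c t(1) x F(1)] F(2) \<delta>(2) that by blast
    have F0: "F None \<in> car (derivations \<kk> brk)"
      using coeffsD(2,3)[OF F(1)] unfolding derivations_def maps_vspace_simps by (simp add: extensional_UNIV)
    let ?D = "inv_into (car (derivations (fib L x) (brL x))) (conj_map (fib L x) \<kk> (\<psi> x)) (F None)"
    have "der_inclusion A L x ?D = \<delta>"
      unfolding F(2)[symmetric] Phi_def der_inclusion_def
      by (rule restrict_ext) (simp add: Der_conj_iso(2)[OF t F0] section_car FS)
    then show "\<delta> \<in> der_inclusion A L x ` car (derivations (fib L x) (brL x))"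
      using lin_isoD(3)[OF iso F0] by blast
  }
qed

section \<open>Smoothness of the maps and the exact sequence\<close>

context
  fixes n J
  assumes J: "lin_iso coeffs (coord_space n) J"
begin

text \<open>In the trivialization built from the same charts, constant coefficients have a constant
  principal part. Any other trivialization of the target adds a transition map, which is
  smooth.\<close>

lemma symbol_smooth: "smooth_bundle_map A (derivation_bundle n J) TCent symbol"
  unfolding smooth_bundle_map_def TCent_simps derivation_bundle_simps(1,2)
proof (intro conjI allI ballI, rule symbol_lin_map, clarify)
  fix W \<Psi> V \<Theta> and v :: "nat \<Rightarrow> 'k" assume W: "(W, \<Psi>) \<in> triv (derivation_bundle n J)" and V: "(V, \<Theta>) \<in> triv TCent"
    and v: "v \<in> car (coord_space n)"
  obtain U \<phi> U1 \<psi> where c: "(U, \<phi>) \<in> A" and t: "(U1, \<psi>) \<in> triv L" and WU: "W = U \<inter> U1"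
    and \<Psi>: "\<Psi> = (\<lambda>x d. J (inv_into (car coeffs) (Phi U \<phi> \<psi> x) d))"
    using W unfolding derivation_bundle_simps by blast
  have F: "inv_into (car coeffs) J v \<in> car coeffs" by (rule lin_isoD(3)[OF J v])
  let ?s = "\<lambda>x. inv_into (car (fib_tensor x))
    (tensor_map (tangent_space A x) model_tangent (inv_into UNIV (coord_derivation A U \<phi> x))
      (conj_map (fib L x) \<kk> (\<psi> x))) (principal_part (inv_into (car coeffs) J v))"
  have s: "smooth_vec_fun A (W \<inter> V) model_tensor (\<lambda>x. \<Theta> x (?s x))"
    unfolding WU
    by (rule vector_bundleD(6)[OF TCent_vector_bundle TCent_triv[OF c t] V, unfolded TCent_simps])
      (rule lin_mapD(1)[OF principal_part_lin_map F])
  have eq: "symbol x (inv_into (car (x_derivations A L brL x)) (\<Psi> x) v) = ?s x" if "x \<in> W" for x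
    using symbol_Phi[OF c t _ F, of x] derivation_triv_iso(2)[OF J c t, of x v] v that unfolding WU \<Psi> by simp
  have o: "open (W \<inter> V)"
    using chart(1)[OF c] triv_open[OF t] vector_bundleD(4)[OF TCent_vector_bundle V] WU by auto
  show "smooth_vec_fun A (W \<inter> V) model_tensor
      (\<lambda>x. \<Theta> x (symbol x (inv_into (car (x_derivations A L brL x)) (\<Psi> x) v)))"
    by (rule smooth_vec_fun_cong[OF o _ s]) (simp only: IntD1 eq)
qed

text \<open>By the criterion on values it is enough that a constant derivation \<open>D\<close> of
  \<kk>, applied to the local form of a section, gives a smooth map.\<close>

lemma der_inclusion_smooth:
  "smooth_bundle_map A (Der_bundle brk L brL) (derivation_bundle n J) (der_inclusion A L)"
proof -
  have E: "fib (Der_bundle brk L brL) x = derivations (fib L x) (brL x)" "model (Der_bundle brk L brL) = derivations \<kk> brk"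
    "triv (Der_bundle brk L brL) = conj_triv L" for x
    by (simp_all add: Der_bundle_def model_L)
  show ?thesis
    unfolding smooth_bundle_map_def E derivation_bundle_simps(1,2)
  proof (intro conjI allI ballI, rule der_inclusion_lin_map, clarify)
    fix V \<Theta> W \<Psi> D assume V: "(V, \<Theta>) \<in> conj_triv L" and W: "(W, \<Psi>) \<in> triv (derivation_bundle n J)"
      and D: "D \<in> car (derivations \<kk> brk)"
    obtain \<psi> where t: "(V, \<psi>) \<in> triv L" and \<Theta>: "\<Theta> = (\<lambda>x. conj_map (fib L x) \<kk> (\<psi> x))"
      using V unfolding conj_triv_def model_L by auto
    let ?D = "\<lambda>x. inv_into (car (derivations (fib L x) (brL x))) (\<Theta> x) D"
    have D': "?D x \<in> car (derivations (fib L x) (brL x))" if "x \<in> V" for x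
      unfolding \<Theta> by (rule lin_isoD(3)[OF Der_conj_iso(1)[OF t that] D])
    have lin: "lin_map \<kk> \<kk> D" using D unfolding derivations_def maps_vspace_simps by blast
    have o: "open (V \<inter> W)"
      using triv_open[OF t] vector_bundleD(4)[OF derivation_vector_bundle[OF J] W] by blast
    show "smooth_vec_fun A (V \<inter> W) (coord_space n) (\<lambda>x. \<Psi> x (der_inclusion A L x (?D x)))"
    proof (rule smooth_derivation_family[OF J W t o])
      show "der_inclusion A L x (?D x) \<in> car (x_derivations A L brL x)" if "x \<in> V \<inter> W" for x
        by (rule lin_mapD(1)[OF der_inclusion_lin_map D']) (use that in blast)
      fix X assume X: "X \<in> \<Gamma>"
      have "smooth_vec_fun A (V \<inter> W) \<kk> (\<lambda>x. D (\<psi> x (X x)))"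
        by (rule smooth_vec_fun_lin_map[OF is_vspace_kk o section_smooth[OF X t] lin]) blast
      then show "smooth_vec_fun A (V \<inter> W) \<kk> (\<lambda>x. \<psi> x (der_inclusion A L x (?D x) X))"
      proof (rule smooth_vec_fun_cong[OF o, rotated])
        fix x assume x: "x \<in> V \<inter> W"
        then have xV: "x \<in> V" by blast
        show "D (\<psi> x (X x)) = \<psi> x (der_inclusion A L x (?D x) X)"
          unfolding \<Theta> Der_conj_iso(2)[OF t xV D] der_inclusion_def
          using X by (simp add: section_car[OF X] triv_inv(2)[OF t xV])
      qed
    qed auto
  qed
qed

lemma symbol_short_exact_sequence:
  "short_exact_sequence A (Der_bundle brk L brL) (derivation_bundle n J) TCent (der_inclusion A L) symbol"
proof -
  have E: "fib (Der_bundle brk L brL) x = derivations (fib L x) (brL x)" for x by (simp add: Der_bundle_def)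
  show ?thesis
    unfolding short_exact_sequence_def E TCent_simps derivation_bundle_simps(2)
    by (intro conjI allI Der_vector_bundle derivation_vector_bundle[OF J] TCent_vector_bundle der_inclusion_smooth
        symbol_smooth der_inclusion_inj symbol_exact symbol_surj)
qed

end

end

section \<open>Extension over compact exhaustions\<close>

context atlas
begin

text \<open>A compact set meets only finitely many members of a locally finite cover by relatively
  compact open sets, so the union \<open>nxt K\<close> of their closures is compact and contains
  \<open>K\<close> in its interior. Iterating \<open>nxt\<close> from one point exhausts a nonempty
  set that is open and closed, hence everything by connectedness.\<close>

lemma ex_exhaustion:
  assumes conn: "connected (UNIV :: 'm set)" and para: "paracompact_type TYPE('m)"
  obtains C :: "nat \<Rightarrow> 'm set" where "\<And>m. compact (C m)" "\<And>m. C m \<subseteq> interior (C (Suc m))" "(\<Union>m. C m) = UNIV"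
proof -
  define \<C> :: "'m set set" where "\<C> = {V. open V \<and> compact (closure V)}"
  have "x \<in> \<Union> \<C>" for x
  proof -
    obtain U \<phi> where c: "(U, \<phi>) \<in> A" "x \<in> U" by (rule ex_chart)
    obtain r where r: "r > 0" and sub: "cball (\<phi> x) (2 * r) \<subseteq> \<phi> ` (U \<inter> UNIV)"
      by (rule ex_chart_ball[OF c UNIV_I open_UNIV])
    have sub': "cball (\<phi> x) r \<subseteq> \<phi> ` (U \<inter> UNIV)" using sub r by (auto simp: subset_iff)
    note b = chart_ball[OF c(1) sub']
    let ?V = "inv_into U \<phi> ` ball (\<phi> x) r" and ?K = "inv_into U \<phi> ` cball (\<phi> x) r"
    have "closure ?V \<subseteq> ?K" by (rule closure_minimal[OF image_mono[OF ball_subset_cball] b(2)])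
    then have "compact (closure ?V)" using compact_Int_closed[OF b(1) closed_closure, of ?V] by (simp add: Int_absorb1)
    then have "?V \<in> \<C>" unfolding \<C>_def using b(3) by blast
    then show ?thesis using b(7)[OF c(2) r] by blast
  qed
  then have "(\<forall>V\<in>\<C>. open V) \<and> \<Union> \<C> = UNIV" unfolding \<C>_def by blast
  then obtain \<D> where \<D>: "\<And>D. D \<in> \<D> ==> open D" "\<And>D. D \<in> \<D> ==> \<exists>V\<in>\<C>. D \<subseteq> V" "\<Union> \<D> = UNIV"
    "locally_finite_in euclidean \<D>"
    using para unfolding paracompact_type_def by metis
  have cD: "compact (closure D)" if D: "D \<in> \<D>" for D
  proof -
    obtain V where V: "compact (closure V)" "D \<subseteq> V" using \<D>(2)[OF D] unfolding \<C>_def by blast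
    show ?thesis
      using compact_Int_closed[OF V(1) closed_closure, of D] closure_mono[OF V(2)] by (simp add: Int_absorb1)
  qed
  have fin: "finite {D \<in> \<D>. D \<inter> K \<noteq> {}}" if K: "compact K" for K
  proof -
    have "\<forall>x. \<exists>V. open V \<and> x \<in> V \<and> finite {D \<in> \<D>. D \<inter> V \<noteq> {}}"
      using \<D>(4) unfolding locally_finite_in_def by simp
    then obtain V where V: "\<And>x. open (V x)" "\<And>x. x \<in> V x" "\<And>x. finite {D \<in> \<D>. D \<inter> V x \<noteq> {}}" by metis
    obtain T where T: "finite T" "K \<subseteq> (\<Union>x\<in>T. V x)"
      by (rule compactE_image[OF K, of K V]) (use V(1,2) in auto)
    have "{D \<in> \<D>. D \<inter> K \<noteq> {}} \<subseteq> (\<Union>x\<in>T. {D \<in> \<D>. D \<inter> V x \<noteq> {}})" using T(2) by blast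
    then show ?thesis using finite_subset T(1) V(3) by blast
  qed
  define nxt where "nxt K = \<Union> (closure ` {D \<in> \<D>. D \<inter> K \<noteq> {}})" for K
  have nxt: "compact (nxt K)" "K \<subseteq> interior (nxt K)" if K: "compact K" for K
  proof -
    show "compact (nxt K)" unfolding nxt_def
      by (rule compact_Union[OF finite_imageI[OF fin[OF K]]]) (elim imageE, simp add: cD)
    show "K \<subseteq> interior (nxt K)"
    proof
      fix y assume y: "y \<in> K"
      have "y \<in> \<Union> \<D>" by (simp add: \<D>(3))
      then obtain D where D: "D \<in> \<D>" "y \<in> D" by (rule UnionE)
      then have "closure D \<subseteq> nxt K" unfolding nxt_def using y by blast
      then have "D \<subseteq> nxt K" using closure_subset by (rule order.trans[rotated])
      then show "y \<in> interior (nxt K)" by (rule interiorI[OF \<D>(1)[OF D(1)] D(2)])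
    qed
  qed
  \<comment> \<open>The value \<open>undefined\<close> serves as an arbitrary starting point of the
    manifold.\<close>
  define C where "C m = (nxt ^^ m) {undefined}" for m
  have CS: "C (Suc m) = nxt (C m)" for m by (simp add: C_def)
  have cC: "compact (C m)" for m by (induction m) (simp add: C_def, simp only: CS nxt(1))
  define S where "S = (\<Union>m. C m)"
  have int: "C m \<subseteq> interior (C (Suc m))" for m unfolding CS by (rule nxt(2)[OF cC])
  have sub: "interior (C m) \<subseteq> S" for m
    by (rule order.trans[OF interior_subset]) (auto simp: S_def)
  have "open S"
  proof (rule open_subopen[THEN iffD2], rule ballI)
    fix y assume "y \<in> S"
    then obtain m where "y \<in> C m" by (auto simp: S_def)
    then show "\<exists>T. open T \<and> y \<in> T \<and> T \<subseteq> S"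
      by (intro exI[of _ "interior (C (Suc m))"] conjI open_interior sub subsetD[OF int])
  qed
  \<comment> \<open>A member of the cover that meets some \<open>C m\<close> lies in
    \<open>C (Suc m)\<close>. So a member around a point outside \<open>S\<close> misses
    \<open>S\<close> altogether.\<close>
  moreover have "closed S"
    unfolding closed_def
  proof (rule open_subopen[THEN iffD2], rule ballI)
    fix y assume y: "y \<in> - S"
    have "y \<in> \<Union> \<D>" by (simp add: \<D>(3))
    then obtain D where D: "D \<in> \<D>" "y \<in> D" by (rule UnionE)
    have "D \<inter> C m = {}" for m
    proof (rule ccontr)
      assume "D \<inter> C m \<noteq> {}"
      then have "closure D \<subseteq> C (Suc m)" unfolding CS nxt_def using D(1) by blast
      then have "y \<in> C (Suc m)" using D(2) closure_subset[of D] by (simp add: subset_iff)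
      then have "y \<in> S" by (auto simp: S_def)
      then show False using y by simp
    qed
    then have "D \<subseteq> - S" by (auto simp: S_def)
    then show "\<exists>T. open T \<and> y \<in> T \<and> T \<subseteq> - S"
      by (intro exI[of _ D] conjI \<D>(1) D)
  qed
  moreover have "undefined \<in> C 0" by (simp add: C_def)
  then have "S \<noteq> {}" by (auto simp: S_def)
  ultimately have "S = UNIV" using conn unfolding connected_clopen by auto
  then show ?thesis by (intro that[of C] cC int) (simp add: S_def)
qed

text \<open>Repairs \<open>s\<close> on one compact shell after another. Each step keeps what is
  good already and changes \<open>s\<close> only inside a prescribed neighborhood, so the values on
  each \<open>B m\<close> stop changing; the limit is locally one of the approximations, which
  \<open>loc\<close> accepts.\<close>

lemma exhaustion_principle:
  fixes good :: "'m \<Rightarrow> 'd \<Rightarrow> bool" and \<S> :: "('m \<Rightarrow> 'd) set"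
  assumes conn: "connected (UNIV :: 'm set)" and para: "paracompact_type TYPE('m)"
    and loc: "\<And>s. (\<And>x. \<exists>V t. open V \<and> x \<in> V \<and> t \<in> \<S> \<and> (\<forall>y\<in>V. s y = t y)) ==> s \<in> \<S>"
    and step: "\<And>x N. open N ==> x \<in> N ==> \<exists>W K. open W \<and> x \<in> W \<and> W \<subseteq> K \<and> compact K \<and>
      (\<forall>C s. compact C \<longrightarrow> s \<in> \<S> \<longrightarrow> (\<forall>y\<in>C. good y (s y)) \<longrightarrow>
        (\<exists>s'\<in>\<S>. (\<forall>y\<in>C \<union> K. good y (s' y)) \<and> (\<forall>y. y \<notin> N \<longrightarrow> s' y = s y)))"
    and s0: "s0 \<in> \<S>"
  shows "\<exists>s\<in>\<S>. \<forall>x. good x (s x)"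
proof -
  obtain C :: "nat \<Rightarrow> 'm set" where C: "\<And>m. compact (C m)" "\<And>m. C m \<subseteq> interior (C (Suc m))" "(\<Union>m. C m) = UNIV"
    by (rule ex_exhaustion[OF conn para]) (rule that; assumption)
  \<comment> \<open>Shifted by two: \<open>B 0\<close> and \<open>B 1\<close> are empty, so
    \<open>s0\<close> is a valid start without being good anywhere, and two levels of the exhaustion
    can be referred to at each stage.\<close>
  define B where "B m = (if m < 2 then {} else C (m - 2))" for m
  have B: "compact (B m)" "B m \<subseteq> interior (B (Suc m))" "\<exists>m. x \<in> B m" for m x
  proof -
    show "compact (B m)" unfolding B_def using C(1) by simp
    show "B m \<subseteq> interior (B (Suc m))"
    proof (cases "m < 2")
      case False
      then have "Suc m - 2 = Suc (m - 2)" by simp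
      then show ?thesis unfolding B_def using C(2)[of "m - 2"] False by simp
    qed (simp add: B_def)
    obtain k where "x \<in> C k" using C(3) by blast
    then show "\<exists>m. x \<in> B m" by (intro exI[of _ "k + 2"]) (simp add: B_def)
  qed
  have mono: "B m \<subseteq> B k" if "m \<le> k" for m k
    by (rule lift_Suc_mono_le[of B, OF _ that]) (use B(2) interior_subset in blast)
  have "\<exists>s'. (s' \<in> \<S> \<and> (\<forall>y\<in>B (Suc (Suc m)). good y (s' y))) \<and> (\<forall>y\<in>B m. s' y = s y)"
    if s: "s \<in> \<S> \<and> (\<forall>y\<in>B (Suc m). good y (s y))" for s m
  proof -
    define N where "N = - B m"
    have N: "open N" unfolding N_def using compact_imp_closed[OF B(1)] by auto
    \<comment> \<open>The shell still to be repaired. Since \<open>B m\<close> lies in the interior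
      of \<open>B (Suc m)\<close>, the shell keeps away from \<open>B m\<close>, where
      \<open>s\<close> must not change.\<close>
    define R where "R = B (Suc (Suc m)) - interior (B (Suc m))"
    have R: "compact R" "R \<subseteq> N" unfolding R_def N_def using compact_diff[OF B(1) open_interior] B(2)[of m] by auto
    define E where "E K \<longleftrightarrow> (\<forall>C s. compact C \<longrightarrow> s \<in> \<S> \<longrightarrow> (\<forall>y\<in>C. good y (s y)) \<longrightarrow>
        (\<exists>s'\<in>\<S>. (\<forall>y\<in>C \<union> K. good y (s' y)) \<and> (\<forall>y. y \<notin> N \<longrightarrow> s' y = s y)))" for K
    have "\<forall>x\<in>R. \<exists>W K. open W \<and> x \<in> W \<and> W \<subseteq> K \<and> compact K \<and> E K"
      unfolding E_def by (rule ballI, rule step[OF N], rule subsetD[OF R(2)])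
    then obtain W K where W: "\<And>x. x \<in> R ==> open (W x)" "\<And>x. x \<in> R ==> x \<in> W x" "\<And>x. x \<in> R ==> W x \<subseteq> K x"
      "\<And>x. x \<in> R ==> compact (K x)" and E: "\<And>x. x \<in> R ==> E (K x)"
      by metis
    obtain T where T: "T \<subseteq> R" "finite T" "R \<subseteq> (\<Union>x\<in>T. W x)"
      by (rule compactE_image[OF R(1), of R W]) (use W(1,2) in auto)
    have "\<exists>s'\<in>\<S>. (\<forall>y\<in>B (Suc m) \<union> (\<Union>x\<in>T. K x). good y (s' y)) \<and> (\<forall>y. y \<notin> N \<longrightarrow> s' y = s y)"
      using T(2,1)
    proof (induction T rule: finite_induct)
      case empty
      then show ?case using s by auto
    next
      case (insert x T)
      then obtain s1 where s1: "s1 \<in> \<S>" "\<forall>y\<in>B (Suc m) \<union> (\<Union>x\<in>T. K x). good y (s1 y)" "\<forall>y. y \<notin> N \<longrightarrow> s1 y = s y"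
        by auto
      have "compact (B (Suc m) \<union> (\<Union>x\<in>T. K x))"
        by (intro compact_Un B(1) compact_UN) (use insert W(4) in auto)
      from E[of x, unfolded E_def, rule_format, OF _ this s1(1)] s1(2) insert.prems obtain s' where
        "s' \<in> \<S>" "\<forall>y\<in>B (Suc m) \<union> (\<Union>x\<in>T. K x) \<union> K x. good y (s' y)" "\<forall>y. y \<notin> N \<longrightarrow> s' y = s1 y" by auto
      then show ?case using s1(3) by (intro bexI[of _ s']) auto
    qed
    then obtain s' where s': "s' \<in> \<S>" "\<forall>y\<in>B (Suc m) \<union> (\<Union>x\<in>T. K x). good y (s' y)" "\<forall>y. y \<notin> N \<longrightarrow> s' y = s y"
      by blast
    have "R \<subseteq> (\<Union>x\<in>T. K x)" using T(1,3) W(3) by blast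
    then have "B (Suc (Suc m)) \<subseteq> B (Suc m) \<union> (\<Union>x\<in>T. K x)"
      unfolding R_def using interior_subset[of "B (Suc m)"] by blast
    then show ?thesis using s' unfolding N_def by blast
  qed
  moreover have "\<exists>s. s \<in> \<S> \<and> (\<forall>y\<in>B (Suc 0). good y (s y))" using s0 by (auto simp: B_def)
  ultimately obtain S where S: "\<And>m. S m \<in> \<S> \<and> (\<forall>y\<in>B (Suc m). good y (S m y))" "\<And>m. \<forall>y\<in>B m. S (Suc m) y = S m y"
    using dependent_nat_choice[of "\<lambda>m s. s \<in> \<S> \<and> (\<forall>y\<in>B (Suc m). good y (s y))" "\<lambda>m s s'. \<forall>y\<in>B m. s' y = s y"]
    by blast
  have stable: "S k y = S m y" if y: "y \<in> B m" and k: "m \<le> k" for m k y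
    using k
  proof (induction k rule: dec_induct)
    case (step k)
    then show ?case using S(2)[of k] mono[OF step(1)] y by auto
  qed simp
  \<comment> \<open>On \<open>B m\<close> the sequence is constant from stage \<open>m\<close> on,
    so every stage whose set contains \<open>y\<close> gives the same value.\<close>
  define s where "s y = S (LEAST m. y \<in> B m) y" for y
  have s: "s y = S m y" if "y \<in> B m" for m y
    unfolding s_def using stable[OF LeastI[of "\<lambda>m. y \<in> B m", OF that] Least_le[of "\<lambda>m. y \<in> B m", OF that]] by simp
  have "s \<in> \<S>"
  proof (rule loc)
    fix x
    obtain m where "x \<in> B m" using B(3) by blast
    then have "x \<in> interior (B (Suc m))" using B(2) by blast
    moreover have "\<forall>y\<in>interior (B (Suc m)). s y = S (Suc m) y" using s interior_subset by blast
    ultimately show "\<exists>V t. open V \<and> x \<in> V \<and> t \<in> \<S> \<and> (\<forall>y\<in>V. s y = t y)" using S(1) open_interior by blast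
  qed
  moreover have "good x (s x)" for x
  proof -
    obtain m where m: "x \<in> B m" using B(3) by blast
    then have "x \<in> B (Suc m)" using mono[of m "Suc m"] by auto
    then show ?thesis using S(1)[of m] s[OF m] by simp
  qed
  ultimately show ?thesis by blast
qed

end

section \<open>Matrices of full rank\<close>

text \<open>The vectors \<open>M j\<close> span the space of dimension \<open>r\<close>, expressed
  by duality: no nonzero functional kills them all.\<close>

definition full_rank :: "nat \<Rightarrow> 'j set \<Rightarrow> ('j \<Rightarrow> nat \<Rightarrow> real) \<Rightarrow> bool" where
  "full_rank r J M \<longleftrightarrow> (\<forall>c. (\<forall>j\<in>J. (\<Sum>a<r. c a * M j a) = 0) \<longrightarrow> (\<forall>a<r. c a = 0))"

text \<open>As functionals on \<open>coord_space r\<close> the rows separate points. The dual basis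
  of a minimal separating subfamily inverts the selected rows and is extended by 0 to the
  others.\<close>

lemma full_rank_left_inverse:
  assumes J: "finite J" and M: "full_rank r J M"
  obtains c where "\<And>a b. a < r ==> b < r ==> (\<Sum>j\<in>J. c b j * M j a) = (if a = b then 1 else 0 :: real)"
proof -
  let ?V = "coord_space r :: (real, nat \<Rightarrow> real) vspace"
  define \<Lambda> where "\<Lambda> j v = (\<Sum>a<r. v a * M j a)" for j and v :: "nat \<Rightarrow> real"
  have \<Lambda>: "functional ?V (\<Lambda> j)" for j
    unfolding functional_def coord_space_def \<Lambda>_def
    by (simp add: algebra_simps sum.distrib sum_distrib_left)
  have "separating ?V (\<Lambda> ` J)"
    unfolding separating_def
  proof (intro ballI impI ext)
    fix u v a assume uv: "u \<in> car ?V" "v \<in> car ?V" and eq: "\<forall>f\<in>\<Lambda> ` J. f u = f v"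
    have "\<forall>j\<in>J. (\<Sum>a<r. (u a - v a) * M j a) = 0"
      using eq unfolding \<Lambda>_def by (simp add: left_diff_distrib sum_subtractf)
    then have "\<forall>a<r. u a - v a = 0" using M unfolding full_rank_def by (elim allE[of _ "\<lambda>a. u a - v a"]) simp
    then show "u a = v a" using uv by (cases "a < r") (auto simp: coord_space_def)
  qed
  then obtain G e where G: "G \<subseteq> \<Lambda> ` J" "separating ?V G" "\<And>g. g \<in> G ==> e g \<in> car ?V"
    "\<And>f g. f \<in> G ==> g \<in> G ==> f (e g) = (if f = g then 1 else 0)"
    "\<And>l v. functional ?V l ==> v \<in> car ?V ==> l v = (\<Sum>g\<in>G. g v * l (e g))"
    by (rule ex_dual_basis[OF is_vspace_coord_space[of r] finite_imageI[OF J, of \<Lambda>], rotated])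
      ((use \<Lambda> in blast) | (rule that; assumption))+
  obtain \<iota> where \<iota>: "\<And>g. g \<in> G ==> \<iota> g \<in> J" "\<And>g. g \<in> G ==> g = \<Lambda> (\<iota> g)"
    using G(1) unfolding subset_iff image_iff by metis
  show ?thesis
  proof (rule that)
    fix a b assume ab: "a < r" "b < r"
    define u :: "nat \<Rightarrow> real" where "u i = (if i = a then 1 else 0)" for i
    have u: "u \<in> car ?V" using ab by (auto simp: u_def coord_space_def)
    have "functional ?V (\<lambda>v. v b)" by (simp add: functional_def coord_space_def)
    from G(5)[OF this u] have "(\<Sum>g\<in>G. g u * e g b) = (if a = b then 1 else 0)" by (auto simp: u_def)
    moreover have "g u = M (\<iota> g) a" if "g \<in> G" for g
    proof -
      have "\<Lambda> (\<iota> g) u = M (\<iota> g) a"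
        using ab by (simp add: \<Lambda>_def u_def if_distrib[of "\<lambda>x. x * _"] sum.delta cong: if_cong)
      then show ?thesis using \<iota>(2)[OF that] by simp
    qed
    ultimately have "(\<Sum>g\<in>G. M (\<iota> g) a * e g b) = (if a = b then 1 else 0)" by simp
    \<comment> \<open>The members of \<open>G\<close> point to rows through \<open>\<iota>\<close>.
      The coefficient of row \<open>j\<close> collects those that point to \<open>j\<close> and is 0
      if there are none.\<close>
    moreover have "(\<Sum>j\<in>J. (\<Sum>g\<in>G. if \<iota> g = j then e g b else 0) * M j a) = (\<Sum>g\<in>G. M (\<iota> g) a * e g b)"
    proof -
      have "(\<Sum>j\<in>J. (\<Sum>g\<in>G. if \<iota> g = j then e g b else 0) * M j a) =
          (\<Sum>g\<in>G. \<Sum>j\<in>J. (if \<iota> g = j then e g b else 0) * M j a)"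
        unfolding sum_distrib_right by (rule sum.swap)
      also have "\<dots> = (\<Sum>g\<in>G. e g b * M (\<iota> g) a)"
        using J \<iota>(1) by (intro sum.cong) (simp_all add: if_distrib[of "\<lambda>x. x * _"] cong: if_cong)
      finally show ?thesis by (simp add: mult.commute)
    qed
    ultimately show "(\<Sum>j\<in>J. (\<lambda>b j. \<Sum>g\<in>G. if \<iota> g = j then e g b else 0) b j * M j a) = (if a = b then 1 else 0)"
      by simp
  qed
qed

text \<open>For a relation among the columns of \<open>M'\<close>, a left inverse of
  \<open>M\<close> expresses its coefficients through the difference of the matrices. A small
  \<open>\<eta>\<close> bounds the largest coefficient by half of itself, so it is 0.\<close>

lemma full_rank_perturb:
  assumes J: "finite J" and M: "full_rank r J M"
  obtains \<eta> where "\<eta> > 0" "\<And>M'. \<forall>j\<in>J. \<forall>a<r. \<bar>M' j a - M j a\<bar> \<le> \<eta> ==> full_rank r J M'"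
proof -
  obtain c where c: "\<And>a b. a < r ==> b < r ==> (\<Sum>j\<in>J. c b j * M j a) = (if a = b then 1 else 0 :: real)"
    by (rule full_rank_left_inverse[OF J M]) (rule that; assumption)
  define S where "S = (\<Sum>b<r. \<Sum>j\<in>J. \<bar>c b j\<bar>)"
  have S0: "S \<ge> 0" unfolding S_def by (intro sum_nonneg) simp
  \<comment> \<open>Chosen to get \<open>real r * (S * \<eta>) \<le> 1 / 2\<close>; the added ones
    keep the denominator positive when \<open>r\<close> or \<open>S\<close> is 0.\<close>
  define \<eta> where "\<eta> = 1 / (2 * ((real r + 1) * (S + 1)))"
  have \<eta>: "\<eta> > 0" "real r * (S * \<eta>) \<le> 1 / 2"
  proof -
    have "real r * S \<le> (real r + 1) * (S + 1)" using S0 by (simp add: algebra_simps)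
    moreover have pos: "(real r + 1) * (S + 1) > 0" using S0 by simp
    ultimately show "real r * (S * \<eta>) \<le> 1 / 2" "\<eta> > 0" unfolding \<eta>_def by (simp_all add: field_simps)
  qed
  show ?thesis
  proof (rule that[OF \<eta>(1)])
    fix M' assume M': "\<forall>j\<in>J. \<forall>a<r. \<bar>M' j a - M j a\<bar> \<le> \<eta>"
    show "full_rank r J M'"
      unfolding full_rank_def
    proof (intro allI impI)
      fix l a assume l: "\<forall>j\<in>J. (\<Sum>a<r. l a * M' j a) = 0" and a: "a < r"
      define m where "m = Max ((\<lambda>a. \<bar>l a\<bar>) ` {..<r})"
      have ne: "(\<lambda>a. \<bar>l a\<bar>) ` {..<r} \<noteq> {}" using a by auto
      have m: "\<bar>l b\<bar> \<le> m" if "b < r" for b unfolding m_def using that by (intro Max_ge) auto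
      have "m \<in> (\<lambda>a. \<bar>l a\<bar>) ` {..<r}" unfolding m_def by (rule Max_in) (use ne in auto)
      then obtain b where b: "b < r" "m = \<bar>l b\<bar>" by auto
      have m0: "m \<ge> 0" using b by simp
      have "l b = (\<Sum>a<r. l a * (if a = b then 1 else 0))"
        using b(1) by (simp add: if_distrib[of "\<lambda>x. _ * x"] cong: if_cong)
      also have "\<dots> = (\<Sum>a<r. l a * (\<Sum>j\<in>J. c b j * M j a))" using c b(1) by simp
      also have "\<dots> = (\<Sum>j\<in>J. c b j * (\<Sum>a<r. l a * M j a))"
        unfolding sum_distrib_left by (subst sum.swap) (simp add: mult_ac)
      also have "\<dots> = (\<Sum>j\<in>J. c b j * (\<Sum>a<r. l a * (M j a - M' j a)))"
        using l by (intro sum.cong) (simp_all add: right_diff_distrib sum_subtractf)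
      finally have "\<bar>l b\<bar> \<le> (\<Sum>j\<in>J. \<bar>c b j\<bar> * (real r * (m * \<eta>)))"
      proof -
        assume eq: "l b = (\<Sum>j\<in>J. c b j * (\<Sum>a<r. l a * (M j a - M' j a)))"
        have "\<bar>\<Sum>a<r. l a * (M j a - M' j a)\<bar> \<le> real r * (m * \<eta>)" if j: "j \<in> J" for j
        proof -
          have "\<bar>l a * (M j a - M' j a)\<bar> \<le> m * \<eta>" if "a < r" for a
            unfolding abs_mult using m[OF that] M'[rule_format, OF j that] by (intro mult_mono m0) (auto simp: abs_minus_commute)
          then show ?thesis
            by (intro order.trans[OF sum_abs] order.trans[OF sum_bounded_above[of _ _ "m * \<eta>"]]) auto
        qed
        then show ?thesis
          unfolding eq by (intro order.trans[OF sum_abs] sum_mono) (auto simp: abs_mult intro!: mult_left_mono)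
      qed
      also have "\<dots> \<le> S * (real r * (m * \<eta>))"
        unfolding sum_distrib_right[symmetric]
      proof (rule mult_right_mono)
        show "(\<Sum>j\<in>J. \<bar>c b j\<bar>) \<le> S"
          unfolding S_def by (rule member_le_sum) (use b(1) in \<open>auto intro: sum_nonneg\<close>)
      qed (use m0 \<eta>(1) in simp)
      also have "\<dots> = (real r * (S * \<eta>)) * m" by simp
      also have "\<dots> \<le> 1 / 2 * m" by (rule mult_right_mono[OF \<eta>(2) m0])
      finally have "m \<le> 0" using b(2) by simp
      then show "l a = 0" using m[OF a] by simp
    qed
  qed
qed

section \<open>Continuity of smooth functions and inversion of smooth matrices\<close>

context atlas
begin

lemma smooth_fun_continuous:
  assumes W: "open W" and f: "smooth_fun A W f"
  shows "continuous_on W f"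
  unfolding continuous_on_eq_continuous_at[OF W]
proof
  fix x assume x: "x \<in> W"
  obtain U \<phi> where c: "(U, \<phi>) \<in> A" "x \<in> U" by (rule ex_chart)
  have o: "open (U \<inter> W)" using chart(1)[OF c(1)] W by blast
  have "continuous_on (U \<inter> W) (\<lambda>y. f (inv_into U \<phi> (\<phi> y)))"
    by (rule continuous_on_compose2[OF smooth_on_continuous[OF smooth_funD[OF c(1) f]]])
      (use continuous_on_subset[OF chart(3)[OF c(1)]] in auto)
  then have "continuous_on (U \<inter> W) f"
    by (rule continuous_on_cong[THEN iffD1, rotated 2]) (auto simp: chart(6)[OF c(1)])
  then show "isCont f x" using continuous_on_eq_continuous_at[OF o] x c(2) by blast
qed

lemma smooth_fun_near:
  assumes W: "open W" "x \<in> W" and f: "smooth_fun A W f" and \<eta>: "\<eta> > 0"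
  obtains V where "open V" "x \<in> V" "V \<subseteq> W" "\<And>y. y \<in> V ==> \<bar>f y - f x\<bar> < \<eta>"
proof (rule that)
  show "open (W \<inter> f -` ball (f x) \<eta>)"
    by (rule continuous_open_preimage[OF smooth_fun_continuous[OF W(1) f] W(1) open_ball])
qed (use W(2) \<eta> in \<open>auto simp: dist_real_def abs_minus_commute\<close>)

text \<open>Gaussian elimination: \<open>g\<close> reduces the first \<open>m\<close> columns of \<open>a\<close> to those of the identity.\<close>

lemma smooth_left_inverse:
  fixes r :: nat
  assumes V: "open V" "x \<in> V" and a: "\<And>k i. k < r ==> i < r ==> smooth_fun A V (a k i)"
    and ax: "\<And>k i. k < r ==> i < r ==> a k i x = (if k = i then 1 else 0)"
  obtains W g where "open W" "x \<in> W" "W \<subseteq> V" "\<And>b k. b < r ==> k < r ==> smooth_fun A W (g b k)"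
    "\<And>y b i. y \<in> W ==> b < r ==> i < r ==> (\<Sum>k<r. g b k y * a k i y) = (if b = i then 1 else 0)"
proof -
  \<comment> \<open>The condition at \<open>x\<close> concerns all columns, not only the first
    \<open>m\<close>: it makes the next pivot equal to 1 at \<open>x\<close> and hence nonzero near
    \<open>x\<close>.\<close>
  have "\<exists>W g. open W \<and> x \<in> W \<and> W \<subseteq> V \<and> (\<forall>b<r. \<forall>k<r. smooth_fun A W (g b k)) \<and>
      (\<forall>b<r. \<forall>i<r. (\<Sum>k<r. g b k x * a k i x) = (if b = i then 1 else 0)) \<and>
      (\<forall>y\<in>W. \<forall>b<r. \<forall>i<m. (\<Sum>k<r. g b k y * a k i y) = (if b = i then 1 else 0))" if "m \<le> r" for m
    using that
  proof (induction m)
    case 0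
    have "(\<Sum>k<r. (if b = k then 1 else 0) * a k i x) = (if b = i then 1 else 0)" if "b < r" "i < r" for b i
      using ax[OF that] that(1) by (simp add: if_distrib[of "\<lambda>x. x * _"] cong: if_cong)
    then show ?case
      using V by (intro exI[of _ V] exI[of _ "\<lambda>b k y. if b = k then 1 else 0"]) (auto simp: smooth_fun_const)
  next
    case (Suc m)
    then obtain W g where W: "open W" "x \<in> W" "W \<subseteq> V" and G: "\<forall>b<r. \<forall>k<r. smooth_fun A W (g b k)"
      "\<forall>b<r. \<forall>i<r. (\<Sum>k<r. g b k x * a k i x) = (if b = i then 1 else 0)"
      "\<forall>y\<in>W. \<forall>b<r. \<forall>i<m. (\<Sum>k<r. g b k y * a k i y) = (if b = i then 1 else 0)"
      using Suc_leD[of m r] by blast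
    note g = G(1)[rule_format] and gx = G(2)[rule_format] and gy = G(3)[rule_format]
    have m: "m < r" using Suc.prems by simp
    define B where "B b i y = (\<Sum>k<r. g b k y * a k i y)" for b i y
    have sB: "smooth_fun A W (B b i)" if "b < r" "i < r" for b i
      unfolding B_def using that
      by (intro smooth_fun_sum smooth_fun_mult g W(1) smooth_fun_subset[OF a W(3)]) auto
    obtain W' where W': "open W'" "x \<in> W'" "W' \<subseteq> W" "\<And>y. y \<in> W' ==> \<bar>B m m y - B m m x\<bar> < 1"
      by (rule smooth_fun_near[OF W(1,2) sB[OF m m] zero_less_one]) (rule that; assumption)
    have Bx: "B b i x = (if b = i then 1 else 0)" if "b < r" "i < r" for b i
      unfolding B_def by (rule gx[OF that])
    have By: "B b i y = (if b = i then 1 else 0)" if "y \<in> W'" "b < r" "i < m" for b i y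
      unfolding B_def by (rule gy) (use that W'(3) in auto)
    have p: "B m m y \<noteq> 0" if "y \<in> W'" for y using W'(4)[OF that] Bx[OF m m] by auto
    \<comment> \<open>For \<open>b\<close> different from \<open>m\<close> this clears column
      \<open>m\<close> of row \<open>b\<close>; for \<open>b = m\<close> it divides row
      \<open>m\<close> by the pivot.\<close>
    define q where "q b y = (B b m y - (if b = m then 1 else 0)) / B m m y" for b y
    define h where "h b k y = g b k y - q b y * g m k y" for b k y
    have hB: "(\<Sum>k<r. h b k y * a k i y) = B b i y - q b y * B m i y" for b i y
      unfolding h_def B_def by (simp add: left_diff_distrib sum_subtractf sum_distrib_left mult.assoc)
    have "smooth_fun A W' (h b k)" if "b < r" "k < r" for b k
      unfolding h_def q_def using that m W'(1) p
      by (intro smooth_fun_diff smooth_fun_mult smooth_fun_divide smooth_fun_const W'(1)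
          smooth_fun_subset[OF g W'(3)] smooth_fun_subset[OF sB W'(3)]) auto
    moreover have "(\<Sum>k<r. h b k x * a k i x) = (if b = i then 1 else 0)" if "b < r" "i < r" for b i
      unfolding hB q_def using that m by (simp add: Bx)
    moreover have "(\<Sum>k<r. h b k y * a k i y) = (if b = i then 1 else 0)" if y: "y \<in> W'" "b < r" "i < Suc m" for y b i
    proof (cases "i = m")
      case True
      then show ?thesis unfolding hB q_def using p[OF y(1)] by simp
    next
      case False
      then have "i < m" using y(3) by simp
      then show ?thesis unfolding hB using By[OF y(1)] y(2) m by simp
    qed
    ultimately show ?case using W'(1-3) W(3) by (intro exI[of _ W'] exI[of _ h]) auto
  qed
  from this[OF order.refl] obtain W g where "open W" "x \<in> W" "W \<subseteq> V" "\<forall>b<r. \<forall>k<r. smooth_fun A W (g b k)"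
    "\<forall>y\<in>W. \<forall>b<r. \<forall>i<r. (\<Sum>k<r. g b k y * a k i y) = (if b = i then 1 else 0)" by blast
  then show ?thesis by (intro that[of W g]) auto
qed

end

section \<open>Finitely many sections spanning every fiber\<close>

context atlas
begin

text \<open>Every point has its own radius of harmless perturbations. Half of it absorbs the
  variation of \<open>M\<close> nearby, and a finite subcover of \<open>D\<close> leaves one radius
  for all.\<close>

lemma full_rank_compact:
  fixes M :: "'m \<Rightarrow> 'j \<Rightarrow> nat \<Rightarrow> real"
  assumes D: "compact D" "D \<subseteq> V" and V: "open V" and J: "finite J"
    and s: "\<And>j a. j \<in> J ==> a < r ==> smooth_fun A V (\<lambda>y. M y j a)"
    and M: "\<And>y. y \<in> D ==> full_rank r J (M y)"
  obtains \<eta> where "\<eta> > 0"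
    "\<And>y M'. y \<in> D ==> \<forall>j\<in>J. \<forall>a<r. \<bar>M' j a - M y j a\<bar> \<le> \<eta> ==> full_rank r J M'"
proof -
  define P where "P y \<eta> \<longleftrightarrow> (\<forall>M'. (\<forall>j\<in>J. \<forall>a<r. \<bar>M' j a - M y j a\<bar> \<le> \<eta>) \<longrightarrow> full_rank r J M')" for y \<eta>
  have "\<exists>W \<eta>. open W \<and> x \<in> W \<and> \<eta> > 0 \<and> (\<forall>y\<in>W. P y \<eta>)" if x: "x \<in> D" for x
  proof -
    obtain \<eta> where \<eta>: "\<eta> > 0" "\<And>M'. \<forall>j\<in>J. \<forall>a<r. \<bar>M' j a - M x j a\<bar> \<le> \<eta> ==> full_rank r J M'"
      by (rule full_rank_perturb[OF J M[OF x]]) (rule that; assumption)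
    have xV: "x \<in> V" using x D(2) by blast
    have h: "\<eta> / 2 > 0" using \<eta>(1) by simp
    have "\<forall>p\<in>J \<times> {..<r}. \<exists>W. open W \<and> x \<in> W \<and> (\<forall>y\<in>W. \<bar>M y (fst p) (snd p) - M x (fst p) (snd p)\<bar> < \<eta> / 2)"
    proof
      fix p assume p: "p \<in> J \<times> {..<r}"
      have "smooth_fun A V (\<lambda>y. M y (fst p) (snd p))" by (rule s) (use p in auto)
      from smooth_fun_near[OF V xV this h] obtain W where
        "open W" "x \<in> W" "\<And>y. y \<in> W ==> \<bar>M y (fst p) (snd p) - M x (fst p) (snd p)\<bar> < \<eta> / 2" by metis
      then show "\<exists>W. open W \<and> x \<in> W \<and> (\<forall>y\<in>W. \<bar>M y (fst p) (snd p) - M x (fst p) (snd p)\<bar> < \<eta> / 2)" by blast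
    qed
    from bchoice[OF this] obtain W where W: "\<forall>p\<in>J \<times> {..<r}. open (W p) \<and> x \<in> W p \<and>
        (\<forall>y\<in>W p. \<bar>M y (fst p) (snd p) - M x (fst p) (snd p)\<bar> < \<eta> / 2)" by (rule exE)
    have "P y (\<eta> / 2)" if y: "y \<in> (\<Inter>p\<in>J \<times> {..<r}. W p)" for y
      unfolding P_def
    proof (intro allI impI, rule \<eta>(2), intro ballI allI impI)
      fix M' j a assume M': "\<forall>j\<in>J. \<forall>a<r. \<bar>M' j a - M y j a\<bar> \<le> \<eta> / 2" and j: "j \<in> J" "a < r"
      then have "(j, a) \<in> J \<times> {..<r}" by simp
      then have "\<bar>M y j a - M x j a\<bar> < \<eta> / 2" using bspec[OF W, of "(j, a)"] INT_D[OF y, of "(j, a)"] by simp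
      moreover have "\<bar>M' j a - M y j a\<bar> \<le> \<eta> / 2" using M' j by blast
      ultimately show "\<bar>M' j a - M x j a\<bar> \<le> \<eta>" by linarith
    qed
    moreover have "open (\<Inter>p\<in>J \<times> {..<r}. W p)" using J W by (intro open_INT) auto
    moreover have "x \<in> (\<Inter>p\<in>J \<times> {..<r}. W p)" using W by (intro INT_I) blast
    ultimately show ?thesis using h by blast
  qed
  then obtain W \<eta> where W: "\<And>x. x \<in> D ==> open (W x)" "\<And>x. x \<in> D ==> x \<in> W x" "\<And>x. x \<in> D ==> \<eta> x > (0::real)"
    "\<And>x y. x \<in> D ==> y \<in> W x ==> P y (\<eta> x)" by metis
  obtain T where T: "T \<subseteq> D" "finite T" "D \<subseteq> (\<Union>x\<in>T. W x)"
    by (rule compactE_image[OF D(1), of D W]) (use W(1,2) in auto)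
  define \<eta>' where "\<eta>' = Min (insert 1 (\<eta> ` T))"
  have \<eta>': "\<eta>' > 0" "\<And>x. x \<in> T ==> \<eta>' \<le> \<eta> x"
    unfolding \<eta>'_def using T(1,2) W(3) by (auto simp: subset_iff)
  show ?thesis
  proof (rule that[OF \<eta>'(1)])
    fix y M' assume y: "y \<in> D" and M': "\<forall>j\<in>J. \<forall>a<r. \<bar>M' j a - M y j a\<bar> \<le> \<eta>'"
    obtain x where x: "x \<in> T" "y \<in> W x" using T(3) y by blast
    have "P y (\<eta> x)" using W(4) x T(1) by blast
    moreover have "\<forall>j\<in>J. \<forall>a<r. \<bar>M' j a - M y j a\<bar> \<le> \<eta> x" using M' \<eta>'(2)[OF x(1)] by (meson order.trans)
    ultimately show "full_rank r J M'" unfolding P_def by blast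
  qed
qed

text \<open>The values \<open>(\<Sum>b. c b * f i b z)\<^sub>i\<close> form a Lipschitz image of a bounded set of dimension
  \<open>card onb + r\<close>, which has empty interior in dimension \<open>q\<close>.\<close>

lemma generic_parameters:
  fixes f :: "nat \<Rightarrow> nat \<Rightarrow> 'm \<Rightarrow> real"
  assumes c: "(U, \<phi>) \<in> A" and sub: "cball (\<phi> x) \<rho> \<subseteq> \<phi> ` (U \<inter> V)"
    and f: "\<And>i b. i < q ==> b < r ==> smooth_fun A V (f i b)"
    and q: "card (onb :: 'a set) + r < q" and \<eta>: "\<eta> > 0"
  shows "\<exists>\<tau>. (\<forall>i<q. 0 \<le> \<tau> i \<and> \<tau> i < \<eta>) \<and>
    (\<forall>z\<in>inv_into U \<phi> ` cball (\<phi> x) \<rho>. \<forall>c. (\<forall>b<r. \<bar>c b\<bar> \<le> 1) \<longrightarrow> (\<exists>i<q. (\<Sum>b<r. c b * f i b z) \<noteq> \<tau> i))"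
proof -
  \<comment> \<open>A pair of a chart point and a coefficient vector is encoded as one function on
    \<open>onb <+> {..<r}\<close>, the format of the counting argument.\<close>
  define pt where "pt p = (\<Sum>b\<in>onb. p (Inl b) *\<^sub>R b)" for p :: "'a + nat \<Rightarrow> real"
  define mk where "mk z c d = (case d of Inl b \<Rightarrow> z \<bullet> b | Inr b \<Rightarrow> c b)" for z :: 'a and c :: "nat \<Rightarrow> real" and d
  have mk: "pt (mk z c) = z" "mk z c (Inl b) = z \<bullet> b" "mk z c (Inr j) = c j" for z c b j
    by (simp_all add: pt_def mk_def onb(3))
  define P where "P = {mk z c | z c. z \<in> cball (\<phi> x) \<rho> \<and> (\<forall>b<r. \<bar>c b\<bar> \<le> 1)}"
  define F where "F i b p = f i b (inv_into U \<phi> p)" for i b p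
  define g where "g i p = (\<Sum>b<r. p (Inr b) * F i b (pt p))" for i p
  define D where "D = (onb <+> {..<r} :: ('a + nat) set)"
  have D: "finite D" "card D = card (onb :: 'a set) + r"
    unfolding D_def by (simp_all add: card_Plus onb(1))
  have nb: "norm b = 1" if "b \<in> onb" for b :: 'a using onb(2)[OF that that] by (simp add: norm_eq_sqrt_inner)
  have bd: "\<bar>p d\<bar> \<le> norm (\<phi> x) + \<bar>\<rho>\<bar> + 1" if p: "p \<in> P" and d: "d \<in> D" for p d
  proof -
    obtain z c where z: "p = mk z c" "z \<in> cball (\<phi> x) \<rho>" "\<forall>b<r. \<bar>c b\<bar> \<le> 1" using p unfolding P_def by blast
    have 1: "norm z \<le> norm (\<phi> x) + \<rho>" using z(2) norm_triangle_sub[of z "\<phi> x"] by (simp add: dist_norm norm_minus_commute)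
    have 2: "\<bar>z \<bullet> b\<bar> \<le> norm z" if "b \<in> onb" for b using Cauchy_Schwarz_ineq2[of z b] nb[OF that] by simp
    show ?thesis
    proof (cases d)
      case (Inl b)
      then have "b \<in> onb" using d by (auto simp: D_def)
      from 2[OF this] 1 show ?thesis by (simp add: z(1) mk Inl)
    next
      case (Inr b)
      then have "b < r" using d by (auto simp: D_def)
      then have "\<bar>c b\<bar> \<le> 1" using z(3) by blast
      moreover have "0 \<le> norm (\<phi> x) + \<bar>\<rho>\<bar>" by simp
      ultimately show ?thesis unfolding z(1) Inr mk(3) by linarith
    qed
  qed
  have "\<exists>\<Lambda>\<ge>0. (\<forall>p\<in>cball (\<phi> x) \<rho>. \<bar>F i b p\<bar> \<le> \<Lambda>) \<and>
      (\<forall>p\<in>cball (\<phi> x) \<rho>. \<forall>p'\<in>cball (\<phi> x) \<rho>. \<bar>F i b p - F i b p'\<bar> \<le> \<Lambda> * norm (p - p'))"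
    if "i < q" "b < r" for i b
    unfolding F_def by (rule smooth_on_Lipschitz[OF smooth_funD[OF c f[OF that]] sub])
  then obtain L where L: "\<And>i b. i < q ==> b < r ==> L i b \<ge> 0"
    "\<And>i b p. i < q ==> b < r ==> p \<in> cball (\<phi> x) \<rho> ==> \<bar>F i b p\<bar> \<le> L i b"
    "\<And>i b p p'. i < q ==> b < r ==> p \<in> cball (\<phi> x) \<rho> ==> p' \<in> cball (\<phi> x) \<rho> ==> \<bar>F i b p - F i b p'\<bar> \<le> L i b * norm (p - p')"
    by metis
  define \<Lambda> where "\<Lambda> = (\<Sum>i<q. \<Sum>b<r. L i b)"
  have \<Lambda>: "L i b \<le> \<Lambda>" if "i < q" "b < r" for i b
  proof -
    have "L i b \<le> (\<Sum>b<r. L i b)" by (rule member_le_sum) (use that L(1) in auto)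
    also have "\<dots> \<le> \<Lambda>" unfolding \<Lambda>_def by (rule member_le_sum) (use that L(1) in \<open>auto intro: sum_nonneg\<close>)
    finally show ?thesis .
  qed
  let ?n = "real (card (onb :: 'a set))"
  \<comment> \<open>If all coordinates differ by at most \<open>\<epsilon>\<close>, the chart points
    differ by at most \<open>?n * \<epsilon>\<close>; the additional 1 accounts for the change of
    the coefficient. Each of the \<open>r\<close> summands contributes at most this much times
    \<open>\<Lambda>\<close>.\<close>
  have lip: "\<bar>g i p - g i p'\<bar> \<le> (real r * (\<Lambda> * (?n + 1))) * \<epsilon>"
    if p: "p \<in> P" "p' \<in> P" and i: "i < q" and \<epsilon>: "\<epsilon> > 0" and close: "\<And>d. d \<in> D ==> \<bar>p d - p' d\<bar> \<le> \<epsilon>" for p p' \<epsilon> i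
  proof -
    obtain z c where z: "p = mk z c" "z \<in> cball (\<phi> x) \<rho>" "\<forall>b<r. \<bar>c b\<bar> \<le> 1" using p(1) unfolding P_def by blast
    obtain z' c' where z': "p' = mk z' c'" "z' \<in> cball (\<phi> x) \<rho>" "\<forall>b<r. \<bar>c' b\<bar> \<le> 1" using p(2) unfolding P_def by blast
    have "z - z' = (\<Sum>b\<in>onb. ((z - z') \<bullet> b) *\<^sub>R b)" by (simp add: onb(3))
    then have "norm (z - z') \<le> (\<Sum>b\<in>onb. norm (((z - z') \<bullet> b) *\<^sub>R b))" by (metis norm_sum)
    also have "\<dots> \<le> ?n * \<epsilon>"
    proof (rule sum_bounded_above[THEN order.trans])
      fix b :: 'a assume b: "b \<in> onb"
      then have "\<bar>z \<bullet> b - z' \<bullet> b\<bar> \<le> \<epsilon>" using close[of "Inl b"] by (auto simp: D_def z(1) z'(1) mk)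
      then show "norm (((z - z') \<bullet> b) *\<^sub>R b) \<le> \<epsilon>" using nb[OF b] by (simp add: inner_diff_left)
    qed simp
    finally have nz: "norm (z - z') \<le> ?n * \<epsilon>" .
    have "\<bar>c b * F i b z - c' b * F i b z'\<bar> \<le> \<Lambda> * (?n + 1) * \<epsilon>" if b: "b < r" for b
    proof -
      have L0: "0 \<le> \<Lambda>" using L(1)[OF i b] \<Lambda>[OF i b] by simp
      have "\<bar>c b * F i b z - c' b * F i b z'\<bar> \<le> \<bar>c b\<bar> * \<bar>F i b z - F i b z'\<bar> + \<bar>c b - c' b\<bar> * \<bar>F i b z'\<bar>"
        unfolding abs_mult[symmetric] by (rule order.trans[OF _ abs_triangle_ineq]) (simp add: algebra_simps)
      also have "\<dots> \<le> 1 * (\<Lambda> * (?n * \<epsilon>)) + \<epsilon> * \<Lambda>"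
      proof (intro add_mono mult_mono)
        show "\<bar>c b\<bar> \<le> 1" using z(3) b by blast
        have "L i b * norm (z - z') \<le> \<Lambda> * (?n * \<epsilon>)" by (rule mult_mono[OF \<Lambda>[OF i b] nz L0]) simp
        then show "\<bar>F i b z - F i b z'\<bar> \<le> \<Lambda> * (?n * \<epsilon>)" using L(3)[OF i b z(2) z'(2)] by linarith
        show "\<bar>c b - c' b\<bar> \<le> \<epsilon>" using close[of "Inr b"] b by (auto simp: D_def z(1) z'(1) mk)
        show "\<bar>F i b z'\<bar> \<le> \<Lambda>" using L(2)[OF i b z'(2)] \<Lambda>[OF i b] by linarith
      qed (use \<epsilon> in auto)
      finally show ?thesis by (simp add: algebra_simps)
    qed
    then have "(\<Sum>b<r. \<bar>c b * F i b z - c' b * F i b z'\<bar>) \<le> real r * (\<Lambda> * (?n + 1) * \<epsilon>)"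
      by (intro order.trans[OF sum_bounded_above[of _ _ "\<Lambda> * (?n + 1) * \<epsilon>"]]) auto
    then have "\<bar>\<Sum>b<r. c b * F i b z - c' b * F i b z'\<bar> \<le> real r * (\<Lambda> * (?n + 1) * \<epsilon>)"
      by (rule order.trans[OF sum_abs])
    then show ?thesis by (simp add: g_def z(1) z'(1) mk sum_subtractf mult.assoc)
  qed
  have "\<exists>\<tau>. (\<forall>i\<in>{..<q}. 0 \<le> \<tau> i \<and> \<tau> i < \<eta>) \<and> (\<forall>p\<in>P. \<exists>i\<in>{..<q}. g i p \<noteq> \<tau> i)"
    by (rule Lipschitz_image_avoids[OF D(1) finite_lessThan, where B = "norm (\<phi> x) + \<bar>\<rho>\<bar> + 1"
          and \<Lambda> = "real r * (\<Lambda> * (?n + 1))"])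
      (use D(2) q bd lip \<eta> in auto)
  then obtain \<tau> where \<tau>': "\<forall>i\<in>{..<q}. 0 \<le> \<tau> i \<and> \<tau> i < \<eta>" "\<forall>p\<in>P. \<exists>i\<in>{..<q}. g i p \<noteq> \<tau> i" by blast
  have \<tau>: "\<forall>i<q. 0 \<le> \<tau> i \<and> \<tau> i < \<eta>" "\<And>p. p \<in> P ==> \<exists>i<q. g i p \<noteq> \<tau> i" using \<tau>' by auto
  have "\<exists>i<q. (\<Sum>b<r. c b * f i b z) \<noteq> \<tau> i" if z: "z \<in> inv_into U \<phi> ` cball (\<phi> x) \<rho>" and c: "\<forall>b<r. \<bar>c b\<bar> \<le> 1" for z c
  proof -
    obtain w where w: "w \<in> cball (\<phi> x) \<rho>" "z = inv_into U \<phi> w" using z by blast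
    then have "mk w c \<in> P" unfolding P_def using c by blast
    from \<tau>(2)[OF this] show ?thesis by (simp add: g_def mk F_def w(2))
  qed
  then show ?thesis using \<tau>(1) by blast
qed

end

context lie_bundle
begin

text \<open>Spanning over the reals, stated by duality: it needs no linear combinations of vectors,
  and it can be applied to one argument of a bracket at a time.\<close>

definition spans_at :: "'m \<Rightarrow> 'j set \<Rightarrow> ('j \<Rightarrow> 'e) \<Rightarrow> bool" where
  "spans_at x J S \<longleftrightarrow> (\<forall>l. real_functional (fib L x) l \<longrightarrow> (\<forall>j\<in>J. l (S j) = 0) \<longrightarrow> (\<forall>v\<in>car (fib L x). l v = 0))"

lemma fib_functional_expand:
  assumes t: "(U, \<psi>) \<in> triv L" "x \<in> U" and l: "real_functional (fib L x) l" and v: "v \<in> car (fib L x)"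
  shows "l v = (\<Sum>a<rdim. l (inv_into (car (fib L x)) (\<psi> x) (e a)) * \<epsilon> a (\<psi> x v))"
proof -
  have "real_functional \<kk> (\<lambda>w. l (inv_into (car (fib L x)) (\<psi> x) w))"
    by (rule real_functional_comp[OF lin_isoD(1)[OF lin_iso_inv[OF is_vspace_fib triv_iso[OF t]]] l])
  from functional_expand[OF this, of "\<psi> x v"] show ?thesis by (simp add: triv_inv(3)[OF t v] mult.commute)
qed

lemma spans_at_iff:
  assumes t: "(U, \<psi>) \<in> triv L" "x \<in> U" and S: "\<And>j. j \<in> J ==> S j \<in> car (fib L x)"
  shows "spans_at x J S \<longleftrightarrow> full_rank rdim J (\<lambda>j a. \<epsilon> a (\<psi> x (S j)))"
proof
  assume sp: "spans_at x J S"
  show "full_rank rdim J (\<lambda>j a. \<epsilon> a (\<psi> x (S j)))"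
    unfolding full_rank_def
  proof (intro allI impI)
    fix c b assume c: "\<forall>j\<in>J. (\<Sum>a<rdim. c a * \<epsilon> a (\<psi> x (S j))) = 0" and b: "b < rdim"
    define l where "l v = (\<Sum>a<rdim. c a * \<epsilon> a (\<psi> x v))" for v
    have "real_functional (fib L x) l"
      unfolding real_functional_iff l_def
      by (simp add: triv_linear[OF t] \<epsilon>_linear algebra_simps sum.distrib sum_distrib_left)
    then have "\<forall>v\<in>car (fib L x). l v = 0" using sp c unfolding spans_at_def l_def by blast
    then have "l (inv_into (car (fib L x)) (\<psi> x) (e b)) = 0" using triv_inv(1)[OF t] by blast
    then show "c b = 0" using b by (simp add: l_def triv_inv(2)[OF t] \<epsilon>_e if_distrib[of "\<lambda>x. _ * x"] cong: if_cong)
  qed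
next
  assume fr: "full_rank rdim J (\<lambda>j a. \<epsilon> a (\<psi> x (S j)))"
  show "spans_at x J S"
    unfolding spans_at_def
  proof (intro allI impI ballI)
    fix l v assume l: "real_functional (fib L x) l" and z: "\<forall>j\<in>J. l (S j) = 0" and v: "v \<in> car (fib L x)"
    note ex = fib_functional_expand[OF t l]
    have "\<forall>a<rdim. l (inv_into (car (fib L x)) (\<psi> x) (e a)) = 0"
      using fr z ex[OF S] unfolding full_rank_def by fastforce
    then show "l v = 0" unfolding ex[OF v] by simp
  qed
qed

text \<open>For each basis direction \<open>a\<close> there are \<open>q\<close> sections
  \<open>(a, i)\<close>, and near \<open>x\<close> the \<open>i\<close>-th is shifted by
  \<open>\<tau> a i\<close> times the constant section \<open>e a\<close>. If a nonzero functional
  \<open>l\<close> killed the shifted family at a point, take \<open>a\<close> with the modulus of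
  \<open>l a\<close> maximal. The equations for \<open>(a, i)\<close>, divided by
  \<open>l a\<close>, show the vector \<open>\<tau> a\<close> to be one of the values that
  \<open>generic_parameters\<close> avoids.\<close>

lemma perturbation_step:
  fixes q :: nat
  defines "J \<equiv> {..<rdim} \<times> {..<q}"
  assumes q: "card (onb :: 'a set) + rdim < q" and N: "open N" "x \<in> N"
  shows "\<exists>W K. open W \<and> x \<in> W \<and> W \<subseteq> K \<and> compact K \<and>
    (\<forall>C s. compact C \<longrightarrow> s \<in> {s. \<forall>j. (\<lambda>x. s x j) \<in> \<Gamma>} \<longrightarrow> (\<forall>y\<in>C. spans_at y J (s y)) \<longrightarrow>
      (\<exists>s'\<in>{s. \<forall>j. (\<lambda>x. s x j) \<in> \<Gamma>}. (\<forall>y\<in>C \<union> K. spans_at y J (s' y)) \<and> (\<forall>y. y \<notin> N \<longrightarrow> s' y = s y)))"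
proof -
  have J: "finite J" by (simp add: J_def)
  obtain U' \<psi> where t: "(U', \<psi>) \<in> triv L" "x \<in> U'" by (rule ex_triv[OF L_bundle])
  obtain U \<phi> where c: "(U, \<phi>) \<in> A" "x \<in> U" by (rule ex_chart)
  obtain E V where E: "open V" "x \<in> V" "V \<subseteq> U'" "V \<subseteq> N" "\<And>u. E u \<in> \<Gamma>" "\<And>u y. y \<in> V ==> \<psi> y (E u y) = u"
    by (rule ex_local_frame[OF t N(2,1)]) (rule that; assumption)
  obtain r where r: "r > 0" and sub2: "cball (\<phi> x) (2 * r) \<subseteq> \<phi> ` (U \<inter> V)"
    by (rule ex_chart_ball[OF c E(2,1)])
  have sub: "cball (\<phi> x) r \<subseteq> \<phi> ` (U \<inter> V)" using sub2 r by (auto simp: subset_iff)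
  let ?W = "inv_into U \<phi> ` ball (\<phi> x) r" and ?K = "inv_into U \<phi> ` cball (\<phi> x) r" and ?K2 = "inv_into U \<phi> ` cball (\<phi> x) (2 * r)"
  note k = chart_ball[OF c(1) sub] and k2 = chart_ball[OF c(1) sub2]
  obtain \<beta> where \<beta>: "smooth_fun A UNIV \<beta>" "\<And>y. y \<in> ?K ==> \<beta> y = 1" "\<And>y. y \<notin> ?K2 ==> \<beta> y = 0"
    by (rule chart_bump[OF c(1) r sub2]) (rule that; assumption)
  \<comment> \<open>Between the regions where it is 1 and 0 the bump function is controlled only
    through compactness, which gives the bound \<open>b0\<close>.\<close>
  have "compact (\<beta> ` ?K2)"
    by (rule compact_continuous_image[OF continuous_on_subset[OF smooth_fun_continuous[OF open_UNIV \<beta>(1)]] k2(1)]) simp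
  then obtain b0 where "\<forall>y\<in>?K2. \<bar>\<beta> y\<bar> \<le> b0" using compact_imp_bounded[of "\<beta> ` ?K2"] unfolding bounded_iff by auto
  then obtain b0 where b0: "b0 > 0" "\<And>y. y \<in> ?K2 ==> \<bar>\<beta> y\<bar> \<le> b0"
    by (metis less_max_iff_disj max.coboundedI1 zero_less_one)
  have "\<exists>s'\<in>{s. \<forall>j. (\<lambda>x. s x j) \<in> \<Gamma>}. (\<forall>y\<in>C \<union> ?K. spans_at y J (s' y)) \<and> (\<forall>y. y \<notin> N \<longrightarrow> s' y = s y)"
    if C: "compact C" and sG: "s \<in> {s. \<forall>j. (\<lambda>x. s x j) \<in> \<Gamma>}" and good: "\<forall>y\<in>C. spans_at y J (s y)" for C s
  proof -
    have s: "(\<lambda>x. s x j) \<in> \<Gamma>" for j using sG by blast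
    have sc: "s y j \<in> car (fib L y)" for y j by (rule section_car[OF s])
    define M where "M y j a = \<epsilon> a (\<psi> y (s y j))" for y j a
    have sM: "smooth_fun A V (\<lambda>y. M y j a)" if "a < rdim" for j a
      unfolding M_def
      by (rule smooth_fun_subset[OF section_functional_smooth[OF t(1) s \<epsilon>_functional[OF that]] E(3)])
    have D: "compact (C \<inter> ?K2)" "C \<inter> ?K2 \<subseteq> V" using compact_Int[OF C k2(1)] k2(4) by auto
    have rank: "full_rank rdim J (M y)" if y: "y \<in> C \<inter> ?K2" for y
    proof -
      have yU: "y \<in> U'" using y D(2) E(3) by blast
      have "spans_at y J (s y)" using good y by blast
      then show ?thesis using spans_at_iff[where S = "s y" and J = J, OF t(1) yU sc] unfolding M_def by blast
    qed
    obtain \<eta> where \<eta>: "\<eta> > 0" "\<And>y M'. y \<in> C \<inter> ?K2 ==>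
        \<forall>j\<in>J. \<forall>a<rdim. \<bar>M' j a - M y j a\<bar> \<le> \<eta> ==> full_rank rdim J M'"
      by (rule full_rank_compact[OF D E(1) J sM rank]) ((rule that)?; assumption)+
    \<comment> \<open>Parameters below \<open>\<eta> / b0\<close> shift the matrix by at most
      \<open>\<eta>\<close>, which keeps the rank full on the part of \<open>C\<close> that is
      touched.\<close>
    have \<eta>b: "\<eta> / b0 > 0" using \<eta>(1) b0(1) by simp
    \<comment> \<open>The sections \<open>(a, i)\<close> move in the direction \<open>e a\<close>
      alone, so the condition for \<open>a\<close> involves only the unperturbed matrix, and the
      parameters for different \<open>a\<close> are chosen independently.\<close>
    define Q where "Q a \<tau> \<longleftrightarrow> (\<forall>i<q. 0 \<le> \<tau> i \<and> \<tau> i < \<eta> / b0) \<and>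
      (\<forall>z\<in>?K. \<forall>c. (\<forall>b<rdim. \<bar>c b\<bar> \<le> 1) \<longrightarrow> (\<exists>i<q. (\<Sum>b<rdim. c b * (- 1 * M z (a, i) b)) \<noteq> \<tau> i))" for a \<tau>
    have "\<exists>\<tau>. Q a \<tau>" for a
      unfolding Q_def
      by (rule generic_parameters[OF c(1) sub _ q \<eta>b])
        (intro smooth_fun_mult smooth_fun_const E(1) sM)
    then obtain \<tau> where Q: "\<And>a. Q a (\<tau> a)" by metis
    note \<tau> = Q[unfolded Q_def, THEN conjunct1, rule_format]
    define s' where "s' y j = vadd (fib L y) (s y j) (fmul (\<lambda>y. \<beta> y * \<tau> (fst j) (snd j)) (E (e (fst j))) y)" for y j
    have fE: "fmul (\<lambda>y. \<beta> y * \<tau> (fst j) (snd j)) (E (e (fst j))) \<in> \<Gamma>" for j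
      by (rule section_fmul[OF smooth_fun_mult[OF open_UNIV \<beta>(1) smooth_fun_const[OF open_UNIV]] E(5)])
    have s'G: "(\<lambda>y. s' y j) \<in> \<Gamma>" for j
      using section_add[OF s fE, of j j] by (simp add: sections_simps s'_def)
    have s'c: "s' y j \<in> car (fib L y)" for y j by (rule section_car[OF s'G])
    have eq: "s' y = s y" if "y \<notin> ?K2" for y
    proof
      fix j
      show "s' y j = s y j"
        unfolding s'_def using fmul_at_zero[where f = "\<lambda>y. \<beta> y * \<tau> (fst j) (snd j)" and x = y, OF E(5)] \<beta>(3)[OF that]
          is_vspaceD(5,6)[OF is_vspace_fib] sc is_vspaceD(1)[OF is_vspace_fib] by simp
    qed
    have M': "\<epsilon> a (\<psi> y (s' y j)) = M y j a + (if a = fst j then \<beta> y * \<tau> (fst j) (snd j) else 0)"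
      if y: "y \<in> V" and j: "j \<in> J" and a: "a < rdim" for y j a
    proof -
      have yU: "y \<in> U'" using y E(3) by blast
      have "fst j < rdim" using j by (auto simp: J_def)
      then show ?thesis
        using a by (simp add: s'_def M_def triv_linear[OF t(1) yU] sc section_car[OF fE] triv_fmul[OF t(1) yU E(5)]
            E(6)[OF y] \<epsilon>_linear \<epsilon>_e del: of_real_mult)
    qed
    have "spans_at y J (s' y)" if y: "y \<in> ?K" for y
    proof -
      have yV: "y \<in> V" "y \<in> U'" using y k(4) E(3) by auto
      have "full_rank rdim J (\<lambda>j a. \<epsilon> a (\<psi> y (s' y j)))"
        unfolding full_rank_def
      proof (rule ccontr, clarsimp)
        fix l a0 assume l: "\<forall>j\<in>J. (\<Sum>a<rdim. l a * \<epsilon> a (\<psi> y (s' y j))) = 0" and a0: "a0 < rdim" "l a0 \<noteq> 0"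
        \<comment> \<open>Dividing by a coefficient of largest modulus puts the others into the unit
          cube, the range for which the parameters were chosen.\<close>
        define m where "m = Max ((\<lambda>a. \<bar>l a\<bar>) ` {..<rdim})"
        have mx: "\<bar>l b\<bar> \<le> m" if "b < rdim" for b unfolding m_def using that by (intro Max_ge) auto
        have "m \<in> (\<lambda>a. \<bar>l a\<bar>) ` {..<rdim}" unfolding m_def by (rule Max_in) (use a0(1) in auto)
        then obtain a where a: "a < rdim" "m = \<bar>l a\<bar>" by auto
        have la: "l a \<noteq> 0" using mx[OF a0(1)] a0(2) a(2) by auto
        have "\<forall>b<rdim. \<bar>l b / l a\<bar> \<le> 1" using mx a(2) la by (simp add: abs_divide)
        from Q[of a, unfolded Q_def, THEN conjunct2, THEN bspec, OF y, THEN spec, THEN mp, OF this] obtain i where i: "i < q" "(\<Sum>b<rdim. l b / l a * (- 1 * M y (a, i) b)) \<noteq> \<tau> a i" by blast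
        have j: "(a, i) \<in> J" using a(1) i(1) by (simp add: J_def)
        have "\<epsilon> b (\<psi> y (s' y (a, i))) = M y (a, i) b + (if b = a then \<tau> a i else 0)" if "b < rdim" for b
          by (simp add: M'[OF yV(1) j that] \<beta>(2)[OF y])
        then have "(\<Sum>b<rdim. l b * (M y (a, i) b + (if b = a then \<tau> a i else 0))) = 0"
          using l[rule_format, OF j] by simp
        then have "(\<Sum>b<rdim. l b * M y (a, i) b) + l a * \<tau> a i = 0"
          using a(1) by (simp add: distrib_left sum.distrib if_distrib[of "\<lambda>x. _ * x"] cong: if_cong)
        then have "\<tau> a i * l a = - (\<Sum>b<rdim. l b * M y (a, i) b)"
          unfolding eq_neg_iff_add_eq_0 by (simp add: algebra_simps)
        then have "\<tau> a i = - (\<Sum>b<rdim. l b * M y (a, i) b) / l a"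
          by (rule nonzero_eq_divide_eq[OF la, THEN iffD2])
        also have "\<dots> = (\<Sum>b<rdim. l b / l a * (- 1 * M y (a, i) b))"
          by (simp add: sum_divide_distrib sum_negf)
        finally show False using i(2) by auto
      qed
      then show ?thesis using spans_at_iff[where S = "s' y" and J = J, OF t(1) yV(2) s'c] by blast
    qed
    moreover have "spans_at y J (s' y)" if y: "y \<in> C" for y
    proof (cases "y \<in> ?K2")
      case False
      then show ?thesis using eq good y by simp
    next
      case True
      then have yV: "y \<in> V" "y \<in> U'" using k2(4) E(3) by auto
      have "full_rank rdim J (\<lambda>j a. \<epsilon> a (\<psi> y (s' y j)))"
      proof (rule \<eta>(2)[of y], rule IntI[OF y True], intro ballI allI impI)
        fix j a assume j: "j \<in> J" "a < rdim"
        have \<tau>j: "0 \<le> \<tau> (fst j) (snd j)" "\<tau> (fst j) (snd j) \<le> \<eta> / b0"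
          using \<tau>[of "snd j" "fst j"] j(1) by (auto simp: J_def)
        have "\<bar>\<beta> y * \<tau> (fst j) (snd j)\<bar> \<le> b0 * (\<eta> / b0)"
          unfolding abs_mult using b0 b0(2)[OF True] \<tau>j by (intro mult_mono) auto
        then show "\<bar>\<epsilon> a (\<psi> y (s' y j)) - M y j a\<bar> \<le> \<eta>"
          using b0(1) \<eta>(1) by (simp add: M'[OF yV(1) j])
      qed
      then show ?thesis using spans_at_iff[where S = "s' y" and J = J, OF t(1) yV(2) s'c] by blast
    qed
    moreover have "\<forall>y. y \<notin> N \<longrightarrow> s' y = s y" using eq k2(4) E(4) by blast
    ultimately show ?thesis using s'G by (intro bexI[of _ s']) auto
  qed
  note step = this
  show ?thesis
    by (rule exI[of _ ?W], rule exI[of _ ?K], intro conjI k(1,3) k(7)[OF c(2) r] image_mono ball_subset_cball allI impI)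
      (rule step)
qed

lemma ex_spanning_sections:
  assumes "connected (UNIV :: 'm set)" "paracompact_type TYPE('m)"
  obtains J :: "(nat \<times> nat) set" and Y where "finite J" "\<And>j. Y j \<in> \<Gamma>" "\<And>x. spans_at x J (\<lambda>j. Y j x)"
proof -
  \<comment> \<open>The successor is the least \<open>q\<close> that
    \<open>perturbation_step\<close> admits.\<close>
  let ?J = "{..<rdim} \<times> {..<Suc (card (onb :: 'a set) + rdim)}" and ?S = "{s :: 'm \<Rightarrow> nat \<times> nat \<Rightarrow> 'e. \<forall>j. (\<lambda>x. s x j) \<in> \<Gamma>}"
  have "\<exists>s\<in>?S. \<forall>x. spans_at x ?J (s x)"
  proof (rule exhaustion_principle[OF assms])
    fix s assume loc: "\<And>x. \<exists>V t. open V \<and> x \<in> V \<and> t \<in> ?S \<and> (\<forall>y\<in>V. s y = t y)"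
    show "s \<in> ?S"
    proof (rule CollectI, rule allI, rule section_local)
      fix j x
      from loc[of x] obtain V t where V: "open V \<and> x \<in> V \<and> t \<in> ?S \<and> (\<forall>y\<in>V. s y = t y)" by (elim exE)
      then have "(\<lambda>x. t x j) \<in> \<Gamma>" by blast
      then show "\<exists>N Y. open N \<and> x \<in> N \<and> Y \<in> \<Gamma> \<and> (\<forall>y\<in>N. s y j = Y y)"
        using V by (intro exI[of _ V] exI[of _ "\<lambda>x. t x j"]) simp
    qed
  next
    show "(\<lambda>x j. vzero (fib L x)) \<in> ?S" using section_zero by (simp add: sections_simps)
  qed (rule perturbation_step[OF lessI])
  then obtain s where s: "s \<in> ?S" "\<forall>x. spans_at x ?J (s x)" by (rule bexE)
  show ?thesis
  proof (rule that)
    show "finite ?J" by simp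
    show "(\<lambda>x. s x j) \<in> \<Gamma>" for j using s(1) by blast
    show "spans_at x ?J (\<lambda>j. s x j)" for x using s(2) by blast
  qed
qed

end

section \<open>Sections are sums of brackets if the fiber is perfect\<close>

context lie_bundle
begin

text \<open>Let a functional kill all brackets of the given vectors. Spanning in the first argument,
  then in the second, makes it kill all brackets of the fiber, and perfectness makes it
  zero.\<close>

lemma spans_at_brackets:
  assumes perf: perfect and S: "\<And>j. j \<in> J ==> S j \<in> car (fib L x)" and sp: "spans_at x J S"
  shows "spans_at x (J \<times> J) (\<lambda>k. brL x (S (fst k)) (S (snd k)))"
  unfolding spans_at_def
proof (intro allI impI ballI)
  fix l v assume l: "real_functional (fib L x) l" and z: "\<forall>k\<in>J \<times> J. l (brL x (S (fst k)) (S (snd k))) = 0"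
    and v: "v \<in> car (fib L x)"
  have lin: "lin_map (fib L x) (fib L x) (brL x u)" "lin_map (fib L x) (fib L x) (\<lambda>v. brL x v u)"
    if "u \<in> car (fib L x)" for u
    using bilinear_fib that unfolding bilinear_on_def by blast+
  have 1: "l (brL x u (S j)) = 0" if "u \<in> car (fib L x)" "j \<in> J" for u j
    using sp real_functional_comp[OF lin(2)[OF S[OF that(2)]] l] z that unfolding spans_at_def by auto
  have 2: "l (brL x u w) = 0" if "u \<in> car (fib L x)" "w \<in> car (fib L x)" for u w
    using sp real_functional_comp[OF lin(1)[OF that(1)] l] 1[OF that(1)] that(2) unfolding spans_at_def by auto
  obtain U \<psi> where t: "(U, \<psi>) \<in> triv L" "x \<in> U" by (rule ex_triv[OF L_bundle])
  let ?i = "inv_into (car (fib L x)) (\<psi> x)"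
  have l': "real_functional \<kk> (\<lambda>w. l (?i w))"
    by (rule real_functional_comp[OF lin_isoD(1)[OF lin_iso_inv[OF is_vspace_fib triv_iso[OF t]]] l])
  note l'D = real_functional_kkD[OF l']
  \<comment> \<open>The span is taken over \<K> while \<open>l\<close> is only real-linear, so the
    induction carries all \<K>-multiples of \<open>w\<close>.\<close>
  have "w \<in> span {brk a b | a b. True} ==> \<forall>c. l (?i (scl c w)) = 0" for w
  proof (induction rule: span_induct_alt)
    case base
    show ?case using l'D(1)[of 0 0] by simp
  next
    case (step c w y)
    then obtain a b where w: "w = brk a b" by blast
    have "l (?i (scl d w)) = 0" for d
      unfolding w bracket_scale_left[symmetric] triv_inv_bracket[OF t] by (rule 2[OF triv_inv(1,1)[OF t]])
    then show ?case using step by (simp add: scale_right_distrib l'D(1))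
  qed
  moreover have "\<psi> x v \<in> span {brk a b | a b. True}" using perf unfolding perfect_def by simp
  ultimately have "l (?i (scl 1 (\<psi> x v))) = 0" by blast
  then show "l v = 0" using triv_inv(3)[OF t v] by simp
qed

text \<open>At a point this is an affine condition on \<open>c\<close>, so two solutions can be
  blended by a bump function.\<close>

definition combines :: "('m \<Rightarrow> 'e) \<Rightarrow> 'i set \<Rightarrow> ('i \<Rightarrow> 'm \<Rightarrow> 'e) \<Rightarrow> 'm \<Rightarrow> ('i \<Rightarrow> real) \<Rightarrow> bool" where
  "combines R K w x c \<longleftrightarrow> (\<forall>l. real_functional (fib L x) l \<longrightarrow> l (R x) = (\<Sum>k\<in>K. c k * l (w k x)))"

text \<open>A left inverse \<open>c\<close> of the matrix at \<open>x\<close> is kept constant; its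
  product with the matrix at nearby points is smooth and is the identity at \<open>x\<close>.
  Inverting that square matrix smoothly gives a smooth left inverse near \<open>x\<close>.\<close>

lemma ex_local_combination:
  assumes K: "finite K" and w: "\<And>k. k \<in> K ==> w k \<in> \<Gamma>" and sp: "spans_at x K (\<lambda>k. w k x)" and R: "R \<in> \<Gamma>"
    and N: "open N" "x \<in> N"
  obtains V g where "open V" "x \<in> V" "V \<subseteq> N" "\<And>k. smooth_fun A UNIV (g k)" "\<And>y. y \<in> V ==> combines R K w y (\<lambda>k. g k y)"
proof -
  obtain U \<psi> where t: "(U, \<psi>) \<in> triv L" "x \<in> U" by (rule ex_triv[OF L_bundle])
  define M where "M k a y = \<epsilon> a (\<psi> y (w k y))" for k a y
  have o: "open (U \<inter> N)" "x \<in> U \<inter> N" using triv_open[OF t(1)] N t(2) by auto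
  have sM: "smooth_fun A (U \<inter> N) (M k a)" if "k \<in> K" "a < rdim" for k a
    unfolding M_def by (rule smooth_fun_subset[OF section_functional_smooth[OF t(1) w[OF that(1)] \<epsilon>_functional[OF that(2)]]]) blast
  have wc: "w k x \<in> car (fib L x)" if "k \<in> K" for k by (rule section_car[OF w[OF that]])
  have "full_rank rdim K (\<lambda>k a. M k a x)"
    using spans_at_iff[where S = "\<lambda>k. w k x" and J = K, OF t wc] sp unfolding M_def by blast
  then obtain c where c: "\<And>a b. a < rdim ==> b < rdim ==> (\<Sum>k\<in>K. c b k * M k a x) = (if a = b then 1 else 0)"
    by (rule full_rank_left_inverse[OF K]) (rule that; assumption)
  define a where "a b i y = (\<Sum>k\<in>K. c b k * M k i y)" for b i y
  have sa: "smooth_fun A (U \<inter> N) (a b i)" if "b < rdim" "i < rdim" for b i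
    unfolding a_def by (intro smooth_fun_sum smooth_fun_mult smooth_fun_const o(1) sM that)
  have ax: "a b i x = (if b = i then 1 else 0)" if "b < rdim" "i < rdim" for b i
    unfolding a_def using c[OF that(2,1)] by auto
  obtain W g where W: "open W" "x \<in> W" "W \<subseteq> U \<inter> N" and g: "\<And>b k. b < rdim ==> k < rdim ==> smooth_fun A W (g b k)"
    "\<And>y b i. y \<in> W ==> b < rdim ==> i < rdim ==> (\<Sum>k<rdim. g b k y * a k i y) = (if b = i then 1 else 0)"
    by (rule smooth_left_inverse[OF o sa ax]) ((rule that)?; assumption)+
  have WU: "y \<in> U" if "y \<in> W" for y using that W(3) by blast
  \<comment> \<open>In matrix terms \<open>f\<close> is the coordinate row of \<open>R\<close> times
    \<open>g\<close> times \<open>c\<close>. As \<open>g\<close> inverts \<open>a\<close>, which is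
    \<open>c\<close> times \<open>M\<close>, multiplying by \<open>M\<close> returns the coordinates
    of \<open>R\<close>.\<close>
  define f where "f k y = (\<Sum>b<rdim. \<epsilon> b (\<psi> y (R y)) * (\<Sum>m<rdim. g b m y * c m k))" for k y
  have "W \<subseteq> U" using W(3) by blast
  then have sf: "smooth_fun A W (f k)" for k
    unfolding f_def
    by (intro smooth_fun_sum smooth_fun_mult smooth_fun_const W(1) g(1)
        smooth_fun_subset[OF section_functional_smooth[OF t(1) R \<epsilon>_functional]]) auto
  have coord: "(\<Sum>k\<in>K. f k y * M k i y) = \<epsilon> i (\<psi> y (R y))" if y: "y \<in> W" and i: "i < rdim" for y i
  proof -
    have "(\<Sum>k\<in>K. f k y * M k i y) = (\<Sum>k\<in>K. \<Sum>b<rdim. \<epsilon> b (\<psi> y (R y)) * (\<Sum>m<rdim. g b m y * (c m k * M k i y)))"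
      unfolding f_def by (simp add: sum_distrib_right mult.assoc)
    also have "\<dots> = (\<Sum>b<rdim. \<epsilon> b (\<psi> y (R y)) * (\<Sum>k\<in>K. \<Sum>m<rdim. g b m y * (c m k * M k i y)))"
      unfolding sum_distrib_left by (rule sum.swap)
    also have "\<dots> = (\<Sum>b<rdim. \<epsilon> b (\<psi> y (R y)) * (\<Sum>m<rdim. g b m y * a m i y))"
      unfolding a_def sum_distrib_left by (subst sum.swap) (rule refl)
    also have "\<dots> = (\<Sum>b<rdim. \<epsilon> b (\<psi> y (R y)) * (if b = i then 1 else 0))"
      by (rule sum.cong) (simp_all add: g(2)[OF y _ i])
    also have "\<dots> = \<epsilon> i (\<psi> y (R y))"
      using i by (simp add: if_distrib[of "\<lambda>x. _ * x"] cong: if_cong)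
    finally show ?thesis .
  qed
  have comb: "combines R K w y (\<lambda>k. f k y)" if y: "y \<in> W" for y
    unfolding combines_def
  proof (intro allI impI)
    fix l assume l: "real_functional (fib L y) l"
    note ex = fib_functional_expand[OF t(1) WU[OF y] l]
    let ?l = "\<lambda>i. l (inv_into (car (fib L y)) (\<psi> y) (e i))"
    have "(\<Sum>k\<in>K. f k y * l (w k y)) = (\<Sum>k\<in>K. \<Sum>i<rdim. ?l i * (f k y * M k i y))"
      using ex[OF section_car[OF w]] by (simp add: M_def sum_distrib_left mult.left_commute)
    also have "\<dots> = (\<Sum>i<rdim. ?l i * (\<Sum>k\<in>K. f k y * M k i y))"
      unfolding sum_distrib_left by (rule sum.swap)
    also have "\<dots> = l (R y)" unfolding ex[OF section_car[OF R]] by (simp add: coord[OF y])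
    finally show "l (R y) = (\<Sum>k\<in>K. f k y * l (w k y))" by simp
  qed
  have "\<exists>F V. smooth_fun A UNIV F \<and> open V \<and> x \<in> V \<and> V \<subseteq> W \<and> (\<forall>y\<in>V. F y = f k y)" for k
  proof -
    obtain F V where "smooth_fun A UNIV F" "open V" "x \<in> V" "V \<subseteq> W" "\<And>y. y \<in> V ==> F y = f k y"
      by (rule smooth_fun_extend[OF W(1,2) sf]) (rule that; assumption)
    then show ?thesis by blast
  qed
  then obtain F V where F: "\<And>k. smooth_fun A UNIV (F k)" "\<And>k. open (V k)" "\<And>k. x \<in> V k" "\<And>k. V k \<subseteq> W"
    "\<And>k y. y \<in> V k ==> F k y = f k y" by metis
  show ?thesis
  proof (rule that[of "W \<inter> (\<Inter>k\<in>K. V k)" F])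
    show "open (W \<inter> (\<Inter>k\<in>K. V k))" by (intro open_Int W(1) open_INT[OF K] ballI F(2))
    show "x \<in> W \<inter> (\<Inter>k\<in>K. V k)" using W(2) F(3) by blast
    show "W \<inter> (\<Inter>k\<in>K. V k) \<subseteq> N" using W(3) by blast
    show "smooth_fun A UNIV (F k)" for k by (rule F(1))
    fix y assume "y \<in> W \<inter> (\<Inter>k\<in>K. V k)"
    then have y: "y \<in> W" "\<And>k. k \<in> K ==> y \<in> V k" by auto
    show "combines R K w y (\<lambda>k. F k y)"
      using comb[OF y(1)] F(5)[OF y(2)] unfolding combines_def by simp
  qed
qed

lemma ex_combination:
  assumes M: "connected (UNIV :: 'm set)" "paracompact_type TYPE('m)"
    and K: "finite K" and w: "\<And>k. k \<in> K ==> w k \<in> \<Gamma>" and sp: "\<And>x. spans_at x K (\<lambda>k. w k x)" and R: "R \<in> \<Gamma>"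
  obtains f where "\<And>k. smooth_fun A UNIV (f k)" "\<And>x. combines R K w x (\<lambda>k. f k x)"
proof -
  let ?S = "{f. \<forall>k. smooth_fun A UNIV (\<lambda>x. f x k)}"
  have "\<exists>f\<in>?S. \<forall>x. combines R K w x (f x)"
  proof (rule exhaustion_principle[OF M])
    fix f assume loc: "\<And>x. \<exists>V t. open V \<and> x \<in> V \<and> t \<in> ?S \<and> (\<forall>y\<in>V. f y = t y)"
    show "f \<in> ?S"
    proof (rule CollectI, rule allI, rule smooth_fun_local[OF open_UNIV])
      fix k x
      from loc[of x] obtain V t where V: "open V \<and> x \<in> V \<and> t \<in> ?S \<and> (\<forall>y\<in>V. f y = t y)" by (elim exE)
      have "smooth_fun A V (\<lambda>x. t x k)" by (rule smooth_fun_subset[of UNIV]) (use V in auto)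
      then have "smooth_fun A V (\<lambda>x. f x k)" by (rule smooth_fun_cong[rotated 2]) (use V in auto)
      then show "\<exists>N. open N \<and> x \<in> N \<and> smooth_fun A (N \<inter> UNIV) (\<lambda>x. f x k)" using V by (intro exI[of _ V]) simp
    qed
  next
    show "(\<lambda>x k. 0) \<in> ?S" by (simp add: smooth_fun_const)
  next
    fix x N assume N: "open N" "x \<in> (N :: 'm set)"
    obtain V g where V: "open V" "x \<in> V" "V \<subseteq> N" "\<And>k. smooth_fun A UNIV (g k)"
      "\<And>y. y \<in> V ==> combines R K w y (\<lambda>k. g k y)"
      by (rule ex_local_combination[OF K w sp R N]) ((rule that)?; assumption)+
    obtain U \<phi> where c: "(U, \<phi>) \<in> A" "x \<in> U" by (rule ex_chart)
    obtain r where r: "r > 0" and sub2: "cball (\<phi> x) (2 * r) \<subseteq> \<phi> ` (U \<inter> V)"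
      by (rule ex_chart_ball[OF c V(2,1)])
    have sub: "cball (\<phi> x) r \<subseteq> \<phi> ` (U \<inter> V)" using sub2 r by (auto simp: subset_iff)
    let ?W = "inv_into U \<phi> ` ball (\<phi> x) r" and ?K = "inv_into U \<phi> ` cball (\<phi> x) r" and ?K2 = "inv_into U \<phi> ` cball (\<phi> x) (2 * r)"
    note k = chart_ball[OF c(1) sub] and k2 = chart_ball[OF c(1) sub2]
    obtain \<beta> where \<beta>: "smooth_fun A UNIV \<beta>" "\<And>y. y \<in> ?K ==> \<beta> y = 1" "\<And>y. y \<notin> ?K2 ==> \<beta> y = 0"
      by (rule chart_bump[OF c(1) r sub2]) (rule that; assumption)
    have "\<exists>f'\<in>?S. (\<forall>y\<in>C \<union> ?K. combines R K w y (f' y)) \<and> (\<forall>y. y \<notin> N \<longrightarrow> f' y = f y)"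
      if f: "f \<in> ?S" and good: "\<forall>y\<in>C. combines R K w y (f y)" for C f
    \<comment> \<open>Blends the given coefficients with the local ones. The inner ball gets the
      local ones, the complement of the outer ball keeps the given ones, and in between, at points
      of \<open>C\<close>, both are solutions and so is the blend.\<close>
    proof (intro bexI[of _ "\<lambda>y k. f y k + \<beta> y * (g k y - f y k)"] conjI ballI allI impI)
      show "(\<lambda>y k. f y k + \<beta> y * (g k y - f y k)) \<in> ?S"
        using f by (auto intro!: smooth_fun_add smooth_fun_mult smooth_fun_diff \<beta>(1) V(4))
      have VK: "y \<in> V" if "y \<in> ?K2" for y using that k2(4) by blast
      show "(\<lambda>k. f y k + \<beta> y * (g k y - f y k)) = f y" if "y \<notin> N" for y
      proof -
        have "y \<notin> ?K2" using VK V(3) that by blast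
        then show ?thesis by (simp add: \<beta>(3))
      qed
      fix y assume y: "y \<in> C \<union> ?K"
      show "combines R K w y (\<lambda>k. f y k + \<beta> y * (g k y - f y k))"
      proof (cases "y \<in> ?K")
        case True
        then have "y \<in> V" using k(4) by blast
        then show ?thesis using V(5) \<beta>(2)[OF True] by simp
      next
        case False
        then have fy: "combines R K w y (f y)" using good y by blast
        show ?thesis
        proof (cases "y \<in> ?K2")
          case True
          show ?thesis
            unfolding combines_def
          proof (intro allI impI)
            fix l assume l: "real_functional (fib L y) l"
            have e: "l (R y) = (\<Sum>k\<in>K. f y k * l (w k y))" "l (R y) = (\<Sum>k\<in>K. g k y * l (w k y))"
              using fy V(5)[OF VK[OF True]] l unfolding combines_def by blast+
            have "(\<Sum>k\<in>K. (f y k + \<beta> y * (g k y - f y k)) * l (w k y)) =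
                (\<Sum>k\<in>K. f y k * l (w k y)) + \<beta> y * ((\<Sum>k\<in>K. g k y * l (w k y)) - (\<Sum>k\<in>K. f y k * l (w k y)))"
              by (simp add: algebra_simps sum.distrib sum_subtractf sum_distrib_left)
            then show "l (R y) = (\<Sum>k\<in>K. (f y k + \<beta> y * (g k y - f y k)) * l (w k y))"
              unfolding e(1)[symmetric] e(2)[symmetric] by simp
          qed
        qed (use fy \<beta>(3) in simp)
      qed
    qed
    note step = this
    show "\<exists>W K'. open W \<and> x \<in> W \<and> W \<subseteq> K' \<and> compact K' \<and>
      (\<forall>C s. compact C \<longrightarrow> s \<in> ?S \<longrightarrow> (\<forall>y\<in>C. combines R K w y (s y)) \<longrightarrow>
        (\<exists>s'\<in>?S. (\<forall>y\<in>C \<union> K'. combines R K w y (s' y)) \<and> (\<forall>y. y \<notin> N \<longrightarrow> s' y = s y)))"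
      by (rule exI[of _ ?W], rule exI[of _ ?K], intro conjI k(1,3) k(7)[OF c(2) r] image_mono ball_subset_cball allI impI)
        (rule step)
  qed
  then obtain f where f: "f \<in> ?S" "\<forall>x. combines R K w x (f x)" by (rule bexE)
  show ?thesis by (rule that[of "\<lambda>k x. f x k"]) (use f in auto)
qed

lemma ex_bracket_sum:
  assumes "finite I" and Y: "\<And>j. Y j \<in> \<Gamma>" and f: "\<And>k. smooth_fun A UNIV (f k)"
  shows "\<exists>S\<in>bracket_span. \<forall>x. combines S I (\<lambda>k. section_bracket brL (Y (fst k)) (Y (snd k))) x (\<lambda>k. f k x)"
  using assms(1)
proof (induction I rule: finite_induct)
  case empty
  \<comment> \<open>The empty sum is the zero section, obtained as a bracket of zero sections
    because \<open>bracket_span\<close> is generated by brackets.\<close>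
  let ?z = "vzero (sections A L)"
  have "section_bracket brL ?z ?z x = vzero (fib L x)" for x
    unfolding section_bracket_def sections_simps by (rule brL_zero(1)[OF is_vspaceD(1)[OF is_vspace_fib]])
  moreover have "l (vzero (fib L x)) = 0" if "real_functional (fib L x) l" for l x
    using real_functional_scale[OF that is_vspaceD(1)[OF is_vspace_fib], of 0] vscale_zero[OF is_vspace_fib] by simp
  ultimately show ?case
    unfolding combines_def by (intro bexI[OF _ bracket_span.bracket[OF section_zero section_zero]]) simp
next
  case (insert k I)
  then obtain S where S: "S \<in> bracket_span"
    "\<forall>x. combines S I (\<lambda>k. section_bracket brL (Y (fst k)) (Y (snd k))) x (\<lambda>k. f k x)" by blast
  let ?T = "section_bracket brL (fmul (f k) (Y (fst k))) (Y (snd k))"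
  have T: "?T \<in> bracket_span" by (rule bracket_span.bracket[OF section_fmul[OF f Y] Y])
  have Tx: "?T x = vscale (fib L x) (of_real (f k x)) (section_bracket brL (Y (fst k)) (Y (snd k)) x)" for x
    unfolding section_bracket_def fmul_def
    by (rule bilinear_onD(5)[OF bilinear_fib section_car[OF Y] section_car[OF Y]])
  have "combines (vadd (sections A L) S ?T) (insert k I) (\<lambda>k. section_bracket brL (Y (fst k)) (Y (snd k))) x (\<lambda>k. f k x)" for x
    unfolding combines_def
  proof (intro allI impI)
    fix l assume l: "real_functional (fib L x) l"
    have "l (vadd (sections A L) S ?T x) = l (S x) + l (?T x)"
      unfolding sections_simps
      by (rule real_functional_add[OF l section_car[OF bracket_span_sections[OF S(1)]] section_car[OF bracket_span_sections[OF T]]])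
    moreover have "l (?T x) = f k x * l (section_bracket brL (Y (fst k)) (Y (snd k)) x)"
      unfolding Tx by (rule real_functional_scale[OF l section_car[OF section_bracket_closed[OF Y Y]]])
    moreover have "l (S x) = (\<Sum>k\<in>I. f k x * l (section_bracket brL (Y (fst k)) (Y (snd k)) x))"
      using S(2) l unfolding combines_def by blast
    ultimately show "l (vadd (sections A L) S ?T x) =
        (\<Sum>k\<in>insert k I. f k x * l (section_bracket brL (Y (fst k)) (Y (snd k)) x))"
      using insert(1,2) by simp
  qed
  then show ?case by (intro bexI[OF _ bracket_span.add[OF S(1) T]]) blast
qed

lemma section_in_bracket_span:
  assumes M: "connected (UNIV :: 'm set)" "paracompact_type TYPE('m)" and perf: perfect and R: "R \<in> \<Gamma>"
  shows "R \<in> bracket_span"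
proof -
  obtain J :: "(nat \<times> nat) set" and Y where J: "finite J" and Y: "\<And>j. Y j \<in> \<Gamma>" and sp: "\<And>x. spans_at x J (\<lambda>j. Y j x)"
    by (rule ex_spanning_sections[OF M]) (rule that; assumption)
  let ?w = "\<lambda>k. section_bracket brL (Y (fst k)) (Y (snd k))"
  have "spans_at x (J \<times> J) (\<lambda>k. ?w k x)" for x
    unfolding section_bracket_def
    by (rule spans_at_brackets[where S = "\<lambda>j. Y j x", OF perf section_car[OF Y] sp])
  then obtain f where f: "\<And>k. smooth_fun A UNIV (f k)" "\<And>x. combines R (J \<times> J) ?w x (\<lambda>k. f k x)"
    by (rule ex_combination[where w = ?w, OF M finite_cartesian_product[OF J J] section_bracket_closed[OF Y Y] _ R])
      (rule that; assumption)
  obtain S where S: "S \<in> bracket_span" "\<And>x. combines S (J \<times> J) ?w x (\<lambda>k. f k x)"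
    using ex_bracket_sum[where Y = Y and f = f, OF finite_cartesian_product[OF J J] Y f(1)] by blast
  have "R = S"
  proof
    fix x show "R x = S x"
    proof (rule real_dual_eqI[OF fin_dim_fib section_car[OF R] section_car[OF bracket_span_sections[OF S(1)]]])
      fix l assume "l \<in> real_dual (fib L x)"
      then have "real_functional (fib L x) l" by (simp add: real_dual_iff)
      then show "l (R x) = l (S x)" using f(2)[of x] S(2)[of x] unfolding combines_def by simp
    qed
  qed
  then show ?thesis using S(1) by simp
qed

end

theorem theorem2p76:
  fixes A :: "('m::t2_space, 'a::fin_dim_inner) atlas"
    and scl :: "'k::real_or_complex \<Rightarrow> 'g::ab_group_add \<Rightarrow> 'g"
    and brk :: "'g \<Rightarrow> 'g \<Rightarrow> 'g"
    and L :: "('k, 'm, 'e, 'g) vbundle"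
    and brL :: "'m \<Rightarrow> 'e \<Rightarrow> 'e \<Rightarrow> 'e"
  assumes "smooth_manifold A"
    and "lie_algebra scl brk"
    and "\<exists>B. finite_dimensional_vector_space scl B"
    and "lie_algebra_bundle A scl brk L brL"
    and "lie_algebra.perfect scl brk \<or> lie_algebra.centerfree brk"
  shows "(\<forall>x. \<forall>\<delta>\<in>car (x_derivations A L brL x). order_at_most_one A scl L x \<delta>) \<and>
    (\<exists>(DL :: ('k, 'm, ('m \<Rightarrow> 'e) \<Rightarrow> 'e, nat \<Rightarrow> 'k) vbundle) n.
       fib DL = x_derivations A L brL \<and> model DL = coord_space n \<and> vector_bundle A DL \<and>
       lin_iso (derivations (sections A L) (section_bracket brL)) (sections A DL)
         (eval_derivation A L) \<and>
       (\<exists>\<sigma>. short_exact_sequence A (Der_bundle brk L brL) DL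
              (tensor_bundle (tangent_bundle A) (Cent_bundle brk L brL))
              (der_inclusion A L) \<sigma>))"
proof -
  have M: "smooth_atlas A" "connected (UNIV :: 'm set)" "paracompact_type TYPE('m)"
    using assms(1) unfolding smooth_manifold_def by auto
  interpret lie_bundle A scl brk L brL
    by (intro lie_bundle.intro atlas.intro lie_bundle_axioms.intro M(1) assms(2-4))
  have vanish: "\<delta> (fmul (\<lambda>y. f y * g y) X) = vzero (fib L x)"
    if "\<delta> \<in> car (x_derivations A L brL x)" "smooth_fun A UNIV f" "smooth_fun A UNIV g" "f x = 0" "g x = 0" "X \<in> \<Gamma>"
    for \<delta> f g x X
    using assms(5)
  proof
    assume perfect
    from x_derivation_vanish_span[OF that(1-5) section_in_bracket_span[OF M(2,3) this that(6)]] show ?thesis .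
  next
    assume centerfree
    from x_derivation_vanish_centerfree[OF that(1) this that(2-6)] show ?thesis .
  qed
  interpret vanishing_lie_bundle A scl brk L brL
    by unfold_locales (rule vanish)
  \<comment> \<open>The coefficient space is the same for every point and every chart, so a single
    choice of coordinates on it fixes the typical fiber of the whole bundle.\<close>
  obtain n J where J: "lin_iso coeffs (coord_space n) J"
    using fin_dim_coeffs unfolding fin_dim_vspace_def by blast
  show ?thesis
    by (intro conjI allI ballI x_derivation_order_at_most_one exI[of _ "derivation_bundle n J"] exI[of _ n]
        exI[of _ symbol] derivation_bundle_simps(1,2) derivation_vector_bundle[OF J] eval_derivation_iso[OF J]
        symbol_short_exact_sequence[OF J])
qed

end
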